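(* Let $A$ and $B$ be rings, $\mathcal{C}$ an $A$-coring, and $\Sigma\in{}_B\mathcal{M}^{\mathcal{C}}_{\rm fgp}$. Consider the Morita context $\mathbb{C}=(T,{}^*\mathcal{C},\Sigma,Q,\tau,\mu)$ associated to $\Sigma$ (see context). If $\mathcal{C}$ is Frobenius, then there exists an isomorphism of $(A,B)$-bimodules $J:\Sigma^*\to Q$. The Morita context $\mathbb{C}$ is isomorphic to the Morita context $\widetilde{\mathbb{C}}=(T,{}^*\mathcal{C},\Sigma,\Sigma^*,\tau,\mu)$, where the left ${}^*\mathcal{C}$-action on $\Sigma^*$ and the connecting maps $\mu$ and $\tau$ of $\widetilde{\mathbb{C}}$ are given by $$(g\cdot f)(u)=\theta\bigl(z_{(1)}g(z_{(2)})\otimes_A f(u_{[0]})u_{[1]}\bigr),$$ $$\mu:\Sigma^*\otimes_T\Sigma\to{}^*\mathcal{C},\quad \mu(f\otimes_T u)(c)=\theta(c\otimes_A f(u_{[0]})u_{[1]}),$$ $$\tau:\Sigma\otimes_{{}^*\mathcal{C}}\Sigma^*\to T,\quad \tau(u\otimes f)(v)=u_{[0]}\theta(u_{[1]}\otimes_A f(v_{[0]})v_{[1]}),$$ for $f\in\Sigma^*$, $g\in{}^*\mathcal{C}$, $u,v\in\Sigma$, $c\in\mathcal{C}$, and $(z,\theta)$ a Frobenius system for $\mathcal{C}$. Conversely, if $\mathcal{C}$ is finitely generated and projective as a left $A$-module, the equivalent conditions (i)–(iv) listed in the context are satisfied, and $\Sigma^*$ and $Q$ are isomorphic as $(A,B)$-bimodules,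 then $\mathcal{C}$ is a Frobenius coring.
   Context: An $A$-coring is an $A$-bimodule $\mathcal{C}$ with $A$-bimodule maps $\Delta:\mathcal{C}\to\mathcal{C}\otimes_A\mathcal{C}$, $\Delta(c)=c_{(1)}\otimes_A c_{(2)}$ (coassociative) and $\varepsilon:\mathcal{C}\to A$ (counit). Right $\mathcal{C}$-comodules are right $A$-modules with a right $A$-linear, coassociative, counital coaction $m\mapsto m_{[0]}\otimes_A m_{[1]}$; morphisms are right $A$-linear maps commuting with coactions; category $\mathcal{M}^{\mathcal{C}}$, with $\mathrm{Hom}^{\mathcal{C}}$, $\mathrm{End}^{\mathcal{C}}$; left comodules and ${}^{\mathcal{C}}\mathrm{Hom}$ symmetrically. $\Sigma\in{}_B\mathcal{M}^{\mathcal{C}}_{\rm fgp}$ means: $\Sigma$ is a $(B,A)$-bimodule, finitely generated projective as a right $A$-module, and a right $\mathcal{C}$-comodule with left $B$-linear coaction. $\Sigma^*=\mathrm{Hom}_A(\Sigma,A)$ is an $(A,B)$-bimodule via $(afb)(u)=af(bu)$. ${}^*\mathcal{C}={}_A\mathrm{Hom}(\mathcal{C},A)$ is a ring with $(f\#g)(c)=g(c_{(1)}f(c_{(2)}))$. With dual basis $\sum_i e_i\otimes_A f_i$ of $\Sigma$, $\Sigma^*$ is a left $\mathcal{C}$-comodule via $f\mapsto\sum_i f(e_{i[0]})e_{i[1]}\otimes_A f_i$. The context $\mathbb{C}$: $T=\mathrm{End}^{\mathcal{C}}(\Sigma)$; $Q={}^{\mathcal{C}}\mathrm{Hom}(\mathcal{C},\Sigma^*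 )$ is a $({}^*\mathcal{C},T)$-bimodule via $(f\cdot q)(c)=q(c_{(1)}f(c_{(2)}))$, $(q\cdot t)(c)=q(c)\circ t$; $\Sigma$ is a $(T,{}^*\mathcal{C})$-bimodule via $t\cdot u=t(u)$, $u\cdot f=u_{[0]}f(u_{[1]})$; connecting maps $\mu(q\otimes u)(c)=q(c)(u)$, $\tau(u\otimes q)(v)=u_{[0]}(q(u_{[1]})(v))$. The $(A,B)$-bimodule structure on $Q$ is $(aqb)(c)(u)=q(ca)(bu)$. Isomorphism of Morita contexts: ring and bimodule isomorphisms compatible with all structure. $\mathcal{C}$ is Frobenius if the right adjoint $-\otimes_A\mathcal{C}$ of the forgetful functor $\mathcal{M}^{\mathcal{C}}\to\mathcal{M}_A$ is also a left adjoint of it; equivalently, there is a Frobenius system $(z,\theta)$: $z\in\mathcal{C}$ with $az=za$ for all $a\in A$, and an $A$-bimodule map $\theta:\mathcal{C}\otimes_A\mathcal{C}\to A$ with $c_{(1)}\theta(c_{(2)}\otimes_A d)=\theta(c\otimes_A d_{(1)})d_{(2)}$ and $\theta(z\otimes_A c)=\theta(c\otimes_A z)=\varepsilon(c)$ for all $c,d\in\mathcal{C}$. The conditions (equivalent when $\mathcal{C}$ is finitely generated projective as a left $A$-module): (i) $\mathrm{can}:\Sigma^*\otimes_B\Sigma\to\mathcal{C}$, $g\otimes u\mapsto g(u_{[0]})u_{[1]}$, is an isomorphism and $\Sigma$ is faithfully flat as a left $B$-module; (ii) ${}^*\mathcal{C}\to{}_B\mathrm{End}(\Sigma)^{\mathrm{op}}$,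 $\varphi\mapsto(u\mapsto u_{[0]}\varphi(u_{[1]}))$, is an isomorphism and $\Sigma$ is a left $B$-progenerator; (iii) $l:B\to T$, $l(b)(u)=bu$, is an isomorphism and $\mathbb{C}$ is strict (both connecting maps are isomorphisms); (iv) $-\otimes_B\Sigma:\mathcal{M}_B\to\mathcal{M}^{\mathcal{C}}$ and its right adjoint $\mathrm{Hom}^{\mathcal{C}}(\Sigma,-)$ are inverse equivalences. *)

theory Defs
  imports "HOL-Algebra.Free_Abelian_Groups" "HOL-Algebra.Generated_Groups" "HOL-Algebra.QuotRing"
begin

section \<open>Modules and bimodules over noncommutative rings\<close>

text \<open>
  One record serves left modules, right modules and bimodules: a left module is judged by
  \<open>left_module\<close> alone, so its field \<open>ract\<close> is junk, and symmetrically.  As in the library's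
  \<open>module\<close> record, the fields \<open>mult\<close> and \<open>one\<close> inherited from \<open>ring\<close> carry no meaning.
\<close>

record ('l, 'r, 'm) bimod = "'m ring" +
  lact :: "'l \<Rightarrow> 'm \<Rightarrow> 'm" (infixr \<open>\<rightharpoonup>\<index>\<close> 72)
  ract :: "'m \<Rightarrow> 'r \<Rightarrow> 'm" (infixl \<open>\<leftharpoonup>\<index>\<close> 72)

locale left_module = R: ring R + M: abelian_group M
  for R :: "('l, 'y) ring_scheme" (structure)
    and M :: "('l, 'r, 'm, 'z) bimod_scheme" (structure) +
  assumes lact_closed: "\<lbrakk>r \<in> carrier R; m \<in> carrier M\<rbrakk> \<Longrightarrow> r \<rightharpoonup>\<^bsub>M\<^esub> m \<in> carrier M"
    and lact_add_left: "\<lbrakk>r \<in> carrier R; s \<in> carrier R; m \<in> carrier M\<rbrakk>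
      \<Longrightarrow> (r \<oplus>\<^bsub>R\<^esub> s) \<rightharpoonup>\<^bsub>M\<^esub> m = (r \<rightharpoonup>\<^bsub>M\<^esub> m) \<oplus>\<^bsub>M\<^esub> (s \<rightharpoonup>\<^bsub>M\<^esub> m)"
    and lact_add_right: "\<lbrakk>r \<in> carrier R; m \<in> carrier M; n \<in> carrier M\<rbrakk>
      \<Longrightarrow> r \<rightharpoonup>\<^bsub>M\<^esub> (m \<oplus>\<^bsub>M\<^esub> n) = (r \<rightharpoonup>\<^bsub>M\<^esub> m) \<oplus>\<^bsub>M\<^esub> (r \<rightharpoonup>\<^bsub>M\<^esub> n)"
    and lact_mult: "\<lbrakk>r \<in> carrier R; s \<in> carrier R; m \<in> carrier M\<rbrakk>
      \<Longrightarrow> (r \<otimes>\<^bsub>R\<^esub> s) \<rightharpoonup>\<^bsub>M\<^esub> m = r \<rightharpoonup>\<^bsub>M\<^esub> (s \<rightharpoonup>\<^bsub>M\<^esub> m)"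
    and lact_one: "m \<in> carrier M \<Longrightarrow> \<one>\<^bsub>R\<^esub> \<rightharpoonup>\<^bsub>M\<^esub> m = m"

locale right_module = S: ring R + M: abelian_group M
  for R :: "('r, 'y) ring_scheme" (structure)
    and M :: "('l, 'r, 'm, 'z) bimod_scheme" (structure) +
  assumes ract_closed: "\<lbrakk>m \<in> carrier M; r \<in> carrier R\<rbrakk> \<Longrightarrow> m \<leftharpoonup>\<^bsub>M\<^esub> r \<in> carrier M"
    and ract_add_right: "\<lbrakk>m \<in> carrier M; r \<in> carrier R; s \<in> carrier R\<rbrakk>
      \<Longrightarrow> m \<leftharpoonup>\<^bsub>M\<^esub> (r \<oplus>\<^bsub>R\<^esub> s) = (m \<leftharpoonup>\<^bsub>M\<^esub> r) \<oplus>\<^bsub>M\<^esub> (m \<leftharpoonup>\<^bsub>M\<^esub> s)"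
    and ract_add_left: "\<lbrakk>m \<in> carrier M; n \<in> carrier M; r \<in> carrier R\<rbrakk>
      \<Longrightarrow> (m \<oplus>\<^bsub>M\<^esub> n) \<leftharpoonup>\<^bsub>M\<^esub> r = (m \<leftharpoonup>\<^bsub>M\<^esub> r) \<oplus>\<^bsub>M\<^esub> (n \<leftharpoonup>\<^bsub>M\<^esub> r)"
    and ract_mult: "\<lbrakk>m \<in> carrier M; r \<in> carrier R; s \<in> carrier R\<rbrakk>
      \<Longrightarrow> m \<leftharpoonup>\<^bsub>M\<^esub> (r \<otimes>\<^bsub>R\<^esub> s) = (m \<leftharpoonup>\<^bsub>M\<^esub> r) \<leftharpoonup>\<^bsub>M\<^esub> s"
    and ract_one: "m \<in> carrier M \<Longrightarrow> m \<leftharpoonup>\<^bsub>M\<^esub> \<one>\<^bsub>R\<^esub> = m"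

locale bimodule = left_module R M + right_module S M
  for R :: "('l, 'y1) ring_scheme" and S :: "('r, 'y2) ring_scheme"
    and M :: "('l, 'r, 'm, 'z) bimod_scheme" +
  assumes lact_ract: "\<lbrakk>r \<in> carrier R; m \<in> carrier M; s \<in> carrier S\<rbrakk>
      \<Longrightarrow> (r \<rightharpoonup>\<^bsub>M\<^esub> m) \<leftharpoonup>\<^bsub>M\<^esub> s = r \<rightharpoonup>\<^bsub>M\<^esub> (m \<leftharpoonup>\<^bsub>M\<^esub> s)"

definition left_linear ::
  "('l, 'y) ring_scheme \<Rightarrow> ('l, 'r1, 'm, 'z1) bimod_scheme \<Rightarrow> ('l, 'r2, 'n, 'z2) bimod_scheme
    \<Rightarrow> ('m \<Rightarrow> 'n) \<Rightarrow> bool"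
  where "left_linear R M N f \<longleftrightarrow> f \<in> hom (add_monoid M) (add_monoid N) \<and>
    (\<forall>r\<in>carrier R. \<forall>m\<in>carrier M. f (r \<rightharpoonup>\<^bsub>M\<^esub> m) = r \<rightharpoonup>\<^bsub>N\<^esub> f m)"

definition right_linear ::
  "('r, 'y) ring_scheme \<Rightarrow> ('l1, 'r, 'm, 'z1) bimod_scheme \<Rightarrow> ('l2, 'r, 'n, 'z2) bimod_scheme
    \<Rightarrow> ('m \<Rightarrow> 'n) \<Rightarrow> bool"
  where "right_linear R M N f \<longleftrightarrow> f \<in> hom (add_monoid M) (add_monoid N) \<and>
    (\<forall>m\<in>carrier M. \<forall>r\<in>carrier R. f (m \<leftharpoonup>\<^bsub>M\<^esub> r) = f m \<leftharpoonup>\<^bsub>N\<^esub> r)"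

definition bimod_map ::
  "('l, 'y1) ring_scheme \<Rightarrow> ('r, 'y2) ring_scheme \<Rightarrow> ('l, 'r, 'm, 'z1) bimod_scheme
    \<Rightarrow> ('l, 'r, 'n, 'z2) bimod_scheme \<Rightarrow> ('m \<Rightarrow> 'n) \<Rightarrow> bool"
  where "bimod_map R S M N f \<longleftrightarrow> left_linear R M N f \<and> right_linear S M N f"

definition bimod_iso ::
  "('l, 'y1) ring_scheme \<Rightarrow> ('r, 'y2) ring_scheme \<Rightarrow> ('l, 'r, 'm, 'z1) bimod_scheme
    \<Rightarrow> ('l, 'r, 'n, 'z2) bimod_scheme \<Rightarrow> ('m \<Rightarrow> 'n) \<Rightarrow> bool"
  where "bimod_iso R S M N f \<longleftrightarrow> bimod_map R S M N f \<and> bij_betw f (carrier M) (carrier N)"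

text \<open>
  Maps that are elements of a Hom group are extensional on their domain, so that equality of
  elements is equality of maps.
\<close>

definition left_Hom ::
  "('l, 'y) ring_scheme \<Rightarrow> ('l, 'r1, 'm, 'z1) bimod_scheme \<Rightarrow> ('l, 'r2, 'n, 'z2) bimod_scheme
    \<Rightarrow> ('m \<Rightarrow> 'n) set"
  where "left_Hom R M N = {f \<in> extensional (carrier M). left_linear R M N f}"

definition right_Hom ::
  "('r, 'y) ring_scheme \<Rightarrow> ('l1, 'r, 'm, 'z1) bimod_scheme \<Rightarrow> ('l2, 'r, 'n, 'z2) bimod_scheme
    \<Rightarrow> ('m \<Rightarrow> 'n) set"
  where "right_Hom R M N = {f \<in> extensional (carrier M). right_linear R M N f}"

definition pointwise_add :: "'m set \<Rightarrow> ('n, 'z) ring_scheme \<Rightarrow> ('m \<Rightarrow> 'n) \<Rightarrow> ('m \<Rightarrow> 'n) \<Rightarrow> 'm \<Rightarrow> 'n"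
  where "pointwise_add X N f g = (\<lambda>x\<in>X. f x \<oplus>\<^bsub>N\<^esub> g x)"

definition pointwise_zero :: "'m set \<Rightarrow> ('n, 'z) ring_scheme \<Rightarrow> 'm \<Rightarrow> 'n"
  where "pointwise_zero X N = (\<lambda>x\<in>X. \<zero>\<^bsub>N\<^esub>)"

definition regular :: "('a, 'y) ring_scheme \<Rightarrow> ('a, 'a, 'a) bimod"
  where "regular A = \<lparr>carrier = carrier A, mult = mult A, one = one A, zero = zero A, add = add A,
    lact = mult A, ract = mult A\<rparr>"

definition free_bimod :: "('a, 'y) ring_scheme \<Rightarrow> nat \<Rightarrow> ('a, 'a, nat \<Rightarrow> 'a) bimod"
  where "free_bimod A n = \<lparr>carrier = {..<n} \<rightarrow>\<^sub>E carrier A, mult = undefined, one = undefined,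
    zero = pointwise_zero {..<n} A, add = pointwise_add {..<n} A,
    lact = (\<lambda>a x. \<lambda>i\<in>{..<n}. a \<otimes>\<^bsub>A\<^esub> x i), ract = (\<lambda>x a. \<lambda>i\<in>{..<n}. x i \<otimes>\<^bsub>A\<^esub> a)\<rparr>"

text \<open>Finitely generated projective: a direct summand of some \<open>A\<^sup>n\<close>.\<close>

definition left_fgp :: "('a, 'y) ring_scheme \<Rightarrow> ('a, 'r, 'm, 'z) bimod_scheme \<Rightarrow> bool"
  where "left_fgp A M \<longleftrightarrow> (\<exists>n i p. left_linear A M (free_bimod A n) i \<and>
    left_linear A (free_bimod A n) M p \<and> (\<forall>m\<in>carrier M. p (i m) = m))"

definition right_fgp :: "('a, 'y) ring_scheme \<Rightarrow> ('l, 'a, 'm, 'z) bimod_scheme \<Rightarrow> bool"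
  where "right_fgp A M \<longleftrightarrow> (\<exists>n i p. right_linear A M (free_bimod A n) i \<and>
    right_linear A (free_bimod A n) M p \<and> (\<forall>m\<in>carrier M. p (i m) = m))"

section \<open>Tensor products over noncommutative rings\<close>

definition tensor_relators ::
  "('a, 'y) ring_scheme \<Rightarrow> ('l, 'a, 'm, 'z1) bimod_scheme \<Rightarrow> ('a, 'r, 'n, 'z2) bimod_scheme
    \<Rightarrow> ('m \<times> 'n \<Rightarrow>\<^sub>0 int) set"
  where "tensor_relators A M N =
    {frag_of (m \<oplus>\<^bsub>M\<^esub> m', n) - frag_of (m, n) - frag_of (m', n) | m m' n.
       m \<in> carrier M \<and> m' \<in> carrier M \<and> n \<in> carrier N} \<union>
    {frag_of (m, n \<oplus>\<^bsub>N\<^esub> n') - frag_of (m, n) - frag_of (m, n') | m n n'.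
       m \<in> carrier M \<and> n \<in> carrier N \<and> n' \<in> carrier N} \<union>
    {frag_of (m \<leftharpoonup>\<^bsub>M\<^esub> a, n) - frag_of (m, a \<rightharpoonup>\<^bsub>N\<^esub> n) | m a n.
       m \<in> carrier M \<and> a \<in> carrier A \<and> n \<in> carrier N}"

definition tensor_subgroup ::
  "('a, 'y) ring_scheme \<Rightarrow> ('l, 'a, 'm, 'z1) bimod_scheme \<Rightarrow> ('a, 'r, 'n, 'z2) bimod_scheme
    \<Rightarrow> ('m \<times> 'n \<Rightarrow>\<^sub>0 int) set"
  where "tensor_subgroup A M N =
    generate (free_Abelian_group (carrier M \<times> carrier N)) (tensor_relators A M N)"

definition tensor_quotient ::
  "('a, 'y) ring_scheme \<Rightarrow> ('l, 'a, 'm, 'z1) bimod_scheme \<Rightarrow> ('a, 'r, 'n, 'z2) bimod_scheme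
    \<Rightarrow> ('m \<times> 'n \<Rightarrow>\<^sub>0 int) set monoid"
  where "tensor_quotient A M N =
    free_Abelian_group (carrier M \<times> carrier N) Mod tensor_subgroup A M N"

definition tens ::
  "('a, 'y) ring_scheme \<Rightarrow> ('l, 'a, 'm, 'z1) bimod_scheme \<Rightarrow> ('a, 'r, 'n, 'z2) bimod_scheme
    \<Rightarrow> 'm \<Rightarrow> 'n \<Rightarrow> ('m \<times> 'n \<Rightarrow>\<^sub>0 int) set"
  where "tens A M N m n =
    tensor_subgroup A M N #>\<^bsub>free_Abelian_group (carrier M \<times> carrier N)\<^esub> frag_of (m, n)"

text \<open>The quotient written additively.\<close>

definition tensor_group ::
  "('a, 'y) ring_scheme \<Rightarrow> ('l, 'a, 'm, 'z1) bimod_scheme \<Rightarrow> ('a, 'r, 'n, 'z2) bimod_scheme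
    \<Rightarrow> ('m \<times> 'n \<Rightarrow>\<^sub>0 int) set ring"
  where "tensor_group A M N = \<lparr>carrier = carrier (tensor_quotient A M N),
    mult = undefined, one = undefined,
    zero = one (tensor_quotient A M N), add = mult (tensor_quotient A M N)\<rparr>"

text \<open>
  \<open>tlift G f\<close> is the additive map to \<open>G\<close> induced by \<open>m \<otimes> n \<mapsto> f m n\<close>; it evaluates some
  representative of the coset, and so is independent of the choice whenever \<open>f\<close> is balanced.
  With \<open>X = \<rho> m\<close> for a coaction \<open>\<rho>\<close>, the term \<open>tlift G (\<lambda>n c. t n c) X\<close> is the expression
  written \<open>t m\<^sub>[\<^sub>0\<^sub>] m\<^sub>[\<^sub>1\<^sub>]\<close> in Sweedler notation.
\<close>

definition tlift ::
  "('g, 'z) ring_scheme \<Rightarrow> ('m \<Rightarrow> 'n \<Rightarrow> 'g) \<Rightarrow> ('m \<times> 'n \<Rightarrow>\<^sub>0 int) set \<Rightarrow> 'g"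
  where "tlift G f X = (let w = (SOME w. w \<in> X) in
    \<Oplus>\<^bsub>G\<^esub>p\<in>Poly_Mapping.keys w. [Poly_Mapping.lookup w p] \<cdot>\<^bsub>G\<^esub> f (fst p) (snd p))"

definition tensor ::
  "('a, 'y) ring_scheme \<Rightarrow> ('l, 'a, 'm, 'z1) bimod_scheme \<Rightarrow> ('a, 'r, 'n, 'z2) bimod_scheme
    \<Rightarrow> ('l, 'r, ('m \<times> 'n \<Rightarrow>\<^sub>0 int) set) bimod"
  where "tensor A M N = ring.extend (tensor_group A M N)
    \<lparr>lact = (\<lambda>l. tlift (tensor_group A M N) (\<lambda>m n. tens A M N (l \<rightharpoonup>\<^bsub>M\<^esub> m) n)),
     ract = (\<lambda>X r. tlift (tensor_group A M N) (\<lambda>m n. tens A M N m (n \<leftharpoonup>\<^bsub>N\<^esub> r)) X)\<rparr>"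

text \<open>\<open>f \<otimes> g\<close>, with \<open>M \<otimes>\<^sub>A N\<close> as target.\<close>

definition tmap ::
  "('a, 'y) ring_scheme \<Rightarrow> ('l, 'a, 'm, 'z1) bimod_scheme \<Rightarrow> ('a, 'r, 'n, 'z2) bimod_scheme
    \<Rightarrow> ('m1 \<Rightarrow> 'm) \<Rightarrow> ('n1 \<Rightarrow> 'n) \<Rightarrow> ('m1 \<times> 'n1 \<Rightarrow>\<^sub>0 int) set \<Rightarrow> ('m \<times> 'n \<Rightarrow>\<^sub>0 int) set"
  where "tmap A M N f g = tlift (tensor A M N) (\<lambda>m n. tens A M N (f m) (g n))"

section \<open>Faithful flatness and progenerators\<close>

text \<open>
  HOL cannot quantify over all modules.  Notions that involve a class of modules are relative to
  a type \<open>'u\<close>, the universe, on which the underlying sets of the modules in that class live.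
\<close>

definition exact ::
  "('l1, 'r1, 'x, 'z1) bimod_scheme \<Rightarrow> ('l2, 'r2, 'y, 'z2) bimod_scheme
    \<Rightarrow> ('l3, 'r3, 'z, 'z3) bimod_scheme \<Rightarrow> ('x \<Rightarrow> 'y) \<Rightarrow> ('y \<Rightarrow> 'z) \<Rightarrow> bool"
  where "exact X Y Z f g \<longleftrightarrow> f ` carrier X = {y \<in> carrier Y. g y = \<zero>\<^bsub>Z\<^esub>}"

definition faithfully_flat ::
  "'u itself \<Rightarrow> ('b, 'y) ring_scheme \<Rightarrow> ('b, 'r, 's, 'z) bimod_scheme \<Rightarrow> bool"
  where "faithfully_flat (_ :: 'u itself) B S \<longleftrightarrow> left_module B S \<and>
    (\<forall>(X :: (unit, 'b, 'u) bimod) (Y :: (unit, 'b, 'u) bimod) (Z :: (unit, 'b, 'u) bimod) f g.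
      right_module B X \<and> right_module B Y \<and> right_module B Z \<and>
      right_linear B X Y f \<and> right_linear B Y Z g \<longrightarrow>
      (exact X Y Z f g \<longleftrightarrow>
       exact (tensor B X S) (tensor B Y S) (tensor B Z S)
         (tmap B Y S f (\<lambda>u. u)) (tmap B Z S g (\<lambda>u. u))))"

definition left_generator ::
  "'u itself \<Rightarrow> ('b, 'y) ring_scheme \<Rightarrow> ('b, 'r, 's, 'z) bimod_scheme \<Rightarrow> bool"
  where "left_generator (_ :: 'u itself) B S \<longleftrightarrow>
    (\<forall>X :: ('b, unit, 'u) bimod. left_module B X \<longrightarrow>
      generate (add_monoid X) (\<Union>h\<in>left_Hom B S X. h ` carrier S) = carrier X)"

definition left_progenerator ::
  "'u itself \<Rightarrow> ('b, 'y) ring_scheme \<Rightarrow> ('b, 'r, 's, 'z) bimod_scheme \<Rightarrow> bool"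
  where "left_progenerator U B S \<longleftrightarrow> left_module B S \<and> left_fgp B S \<and> left_generator U B S"

section \<open>Corings and comodules\<close>

record ('a, 'c) coring = "('a, 'a, 'c) bimod" +
  comult :: "'c \<Rightarrow> ('c \<times> 'c \<Rightarrow>\<^sub>0 int) set"
  counit :: "'c \<Rightarrow> 'a"

text \<open>
  The coaction \<open>X \<otimes>\<^sub>R \<rho>\<close> on \<open>X \<otimes>\<^sub>R N\<close>, namely \<open>x \<otimes> n \<mapsto> (x \<otimes> n\<^sub>[\<^sub>0\<^sub>]) \<otimes> n\<^sub>[\<^sub>1\<^sub>]\<close>, with the associativity
  isomorphism built in.
\<close>

definition tensor_coact ::
  "('a, 'y1) ring_scheme \<Rightarrow> ('a, 'c, 'z1) coring_scheme \<Rightarrow> ('r, 'y2) ring_scheme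
    \<Rightarrow> ('l, 'r, 'x, 'z2) bimod_scheme \<Rightarrow> ('r, 'a, 'n, 'z3) bimod_scheme
    \<Rightarrow> ('n \<Rightarrow> ('n \<times> 'c \<Rightarrow>\<^sub>0 int) set)
    \<Rightarrow> ('x \<times> 'n \<Rightarrow>\<^sub>0 int) set \<Rightarrow> (('x \<times> 'n \<Rightarrow>\<^sub>0 int) set \<times> 'c \<Rightarrow>\<^sub>0 int) set"
  where "tensor_coact A C R X N \<rho> = (let W = tensor A (tensor R X N) C in
    tlift W (\<lambda>x n. tlift W (\<lambda>n' c. tens A (tensor R X N) C (tens R X N x n') c) (\<rho> n)))"

locale coring = bimodule A A C
  for A :: "('a, 'y) ring_scheme" and C :: "('a, 'c, 'z) coring_scheme" +
  assumes comult_bimod_map: "bimod_map A A C (tensor A C C) (comult C)"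
    and counit_bimod_map: "bimod_map A A C (regular A) (counit C)"
    and coassoc: "c \<in> carrier C \<Longrightarrow>
      tmap A (tensor A C C) C (comult C) (\<lambda>d. d) (comult C c)
        = tensor_coact A C A C C (comult C) (comult C c)"
    and counit_left: "c \<in> carrier C \<Longrightarrow> tlift C (\<lambda>c' d. counit C c' \<rightharpoonup>\<^bsub>C\<^esub> d) (comult C c) = c"
    and counit_right: "c \<in> carrier C \<Longrightarrow> tlift C (\<lambda>c' d. c' \<leftharpoonup>\<^bsub>C\<^esub> counit C d) (comult C c) = c"

locale right_comodule = C: coring A C + M: right_module A M
  for A :: "('a, 'y) ring_scheme" and C :: "('a, 'c, 'z1) coring_scheme"
    and M :: "('l, 'a, 'm, 'z2) bimod_scheme" and \<rho> :: "'m \<Rightarrow> ('m \<times> 'c \<Rightarrow>\<^sub>0 int) set" +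
  assumes coact_linear: "right_linear A M (tensor A M C) \<rho>"
    and coact_coassoc: "m \<in> carrier M \<Longrightarrow>
      tmap A (tensor A M C) C \<rho> (\<lambda>c. c) (\<rho> m) = tensor_coact A C A M C (comult C) (\<rho> m)"
    and coact_counit: "m \<in> carrier M \<Longrightarrow> tlift M (\<lambda>m' c. m' \<leftharpoonup>\<^bsub>M\<^esub> counit C c) (\<rho> m) = m"

definition comod_Hom ::
  "('a, 'y) ring_scheme \<Rightarrow> ('a, 'c, 'z1) coring_scheme
    \<Rightarrow> ('l1, 'a, 'm, 'z2) bimod_scheme \<Rightarrow> ('m \<Rightarrow> ('m \<times> 'c \<Rightarrow>\<^sub>0 int) set)
    \<Rightarrow> ('l2, 'a, 'n, 'z3) bimod_scheme \<Rightarrow> ('n \<Rightarrow> ('n \<times> 'c \<Rightarrow>\<^sub>0 int) set) \<Rightarrow> ('m \<Rightarrow> 'n) set"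
  where "comod_Hom A C M \<rho> N \<sigma> =
    {f \<in> right_Hom A M N. \<forall>m\<in>carrier M. \<sigma> (f m) = tmap A N C f (\<lambda>c. c) (\<rho> m)}"

text \<open>\<open>\<Sigma> \<in> \<^sub>B\<M>\<^sup>\<C>\<close>, finitely generated projective as a right \<open>A\<close>-module.\<close>

locale fgp_bicomodule = BA: bimodule B A \<Sigma> + right_comodule A C \<Sigma> \<rho>
  for A :: "('a, 'y1) ring_scheme" and B :: "('b, 'y2) ring_scheme"
    and C :: "('a, 'c, 'z1) coring_scheme"
    and \<Sigma> :: "('b, 'a, 's, 'z2) bimod_scheme" and \<rho> :: "'s \<Rightarrow> ('s \<times> 'c \<Rightarrow>\<^sub>0 int) set" +
  assumes fgp: "right_fgp A \<Sigma>"
    and coact_left_linear: "left_linear B \<Sigma> (tensor A \<Sigma> C) \<rho>"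

section \<open>Frobenius corings\<close>

text \<open>
  The functor \<open>- \<otimes>\<^sub>A C : \<M>\<^sub>A \<rightarrow> \<M>\<^sup>C\<close> is left adjoint to the forgetful functor, that is, there are
  bijections \<open>Hom\<^sup>C(M \<otimes>\<^sub>A C, N) \<rightarrow> Hom\<^sub>A(M, N)\<close> natural in both arguments.
\<close>

definition frobenius_coring ::
  "'u itself \<Rightarrow> ('a, 'y) ring_scheme \<Rightarrow> ('a, 'c, 'z) coring_scheme \<Rightarrow> bool"
  where "frobenius_coring (_ :: 'u itself) A C \<longleftrightarrow> coring A C \<and>
    (\<exists>\<Phi> :: (unit, 'a, 'u) bimod \<Rightarrow> (unit, 'a, 'u) bimod \<Rightarrow> ('u \<Rightarrow> ('u \<times> 'c \<Rightarrow>\<^sub>0 int) set)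
            \<Rightarrow> (('u \<times> 'c \<Rightarrow>\<^sub>0 int) set \<Rightarrow> 'u) \<Rightarrow> ('u \<Rightarrow> 'u).
      (\<forall>M N \<sigma>. right_module A M \<and> right_comodule A C N \<sigma> \<longrightarrow>
        bij_betw (\<Phi> M N \<sigma>)
          (comod_Hom A C (tensor A M C) (tensor_coact A C A M C (comult C)) N \<sigma>)
          (right_Hom A M N)) \<and>
      (\<forall>M M' N \<sigma> f. \<forall>h \<in> comod_Hom A C (tensor A M C) (tensor_coact A C A M C (comult C)) N \<sigma>.
        right_module A M \<and> right_module A M' \<and> right_comodule A C N \<sigma> \<and> f \<in> right_Hom A M' M \<longrightarrow>
        \<Phi> M' N \<sigma> (compose (carrier (tensor A M' C)) h (tmap A M C f (\<lambda>c. c)))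
          = compose (carrier M') (\<Phi> M N \<sigma> h) f) \<and>
      (\<forall>M N \<sigma> N' \<sigma>' g. \<forall>h \<in> comod_Hom A C (tensor A M C) (tensor_coact A C A M C (comult C)) N \<sigma>.
        right_module A M \<and> right_comodule A C N \<sigma> \<and> right_comodule A C N' \<sigma>' \<and>
        g \<in> comod_Hom A C N \<sigma> N' \<sigma>' \<longrightarrow>
        \<Phi> M N' \<sigma>' (compose (carrier (tensor A M C)) g h)
          = compose (carrier M) g (\<Phi> M N \<sigma> h)))"

definition frobenius_system ::
  "('a, 'y) ring_scheme \<Rightarrow> ('a, 'c, 'z) coring_scheme \<Rightarrow> 'c
    \<Rightarrow> (('c \<times> 'c \<Rightarrow>\<^sub>0 int) set \<Rightarrow> 'a) \<Rightarrow> bool"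
  where "frobenius_system A C z \<theta> \<longleftrightarrow>
    z \<in> carrier C \<and> (\<forall>a\<in>carrier A. a \<rightharpoonup>\<^bsub>C\<^esub> z = z \<leftharpoonup>\<^bsub>C\<^esub> a) \<and>
    bimod_map A A (tensor A C C) (regular A) \<theta> \<and>
    (\<forall>c\<in>carrier C. \<forall>d\<in>carrier C.
      tlift C (\<lambda>c1 c2. c1 \<leftharpoonup>\<^bsub>C\<^esub> \<theta> (tens A C C c2 d)) (comult C c)
        = tlift C (\<lambda>d1 d2. \<theta> (tens A C C c d1) \<rightharpoonup>\<^bsub>C\<^esub> d2) (comult C d)) \<and>
    (\<forall>c\<in>carrier C. \<theta> (tens A C C z c) = counit C c \<and> \<theta> (tens A C C c z) = counit C c)"

section \<open>Morita contexts\<close>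

text \<open>
  A context between the rings \<open>lring\<close> and \<open>rring\<close>: \<open>pmod\<close> is an \<open>(lring, rring)\<close>-bimodule,
  \<open>qmod\<close> an \<open>(rring, lring)\<close>-bimodule, \<open>tau : pmod \<otimes> qmod \<rightarrow> lring\<close>, \<open>mu : qmod \<otimes> pmod \<rightarrow> rring\<close>.
\<close>

record ('r, 's, 'p, 'q) morita =
  lring :: "'r ring"
  rring :: "'s ring"
  pmod :: "('r, 's, 'p) bimod"
  qmod :: "('s, 'r, 'q) bimod"
  tau :: "('p \<times> 'q \<Rightarrow>\<^sub>0 int) set \<Rightarrow> 'r"
  mu :: "('q \<times> 'p \<Rightarrow>\<^sub>0 int) set \<Rightarrow> 's"

definition tensor_pq :: "('r, 's, 'p, 'q) morita \<Rightarrow> ('r, 'r, ('p \<times> 'q \<Rightarrow>\<^sub>0 int) set) bimod"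
  where "tensor_pq X = tensor (rring X) (pmod X) (qmod X)"

definition tensor_qp :: "('r, 's, 'p, 'q) morita \<Rightarrow> ('s, 's, ('q \<times> 'p \<Rightarrow>\<^sub>0 int) set) bimod"
  where "tensor_qp X = tensor (lring X) (qmod X) (pmod X)"

definition morita_context :: "('r, 's, 'p, 'q) morita \<Rightarrow> bool"
  where "morita_context X \<longleftrightarrow>
    bimodule (lring X) (rring X) (pmod X) \<and> bimodule (rring X) (lring X) (qmod X) \<and>
    bimod_map (lring X) (lring X) (tensor_pq X) (regular (lring X)) (tau X) \<and>
    bimod_map (rring X) (rring X) (tensor_qp X) (regular (rring X)) (mu X) \<and>
    (\<forall>p\<in>carrier (pmod X). \<forall>q\<in>carrier (qmod X). \<forall>p'\<in>carrier (pmod X).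
      tau X (tens (rring X) (pmod X) (qmod X) p q) \<rightharpoonup>\<^bsub>pmod X\<^esub> p'
        = p \<leftharpoonup>\<^bsub>pmod X\<^esub> mu X (tens (lring X) (qmod X) (pmod X) q p')) \<and>
    (\<forall>q\<in>carrier (qmod X). \<forall>p\<in>carrier (pmod X). \<forall>q'\<in>carrier (qmod X).
      mu X (tens (lring X) (qmod X) (pmod X) q p) \<rightharpoonup>\<^bsub>qmod X\<^esub> q'
        = q \<leftharpoonup>\<^bsub>qmod X\<^esub> tau X (tens (rring X) (pmod X) (qmod X) p q'))"

definition strict_context :: "('r, 's, 'p, 'q) morita \<Rightarrow> bool"
  where "strict_context X \<longleftrightarrow>
    bimod_iso (lring X) (lring X) (tensor_pq X) (regular (lring X)) (tau X) \<and>
    bimod_iso (rring X) (rring X) (tensor_qp X) (regular (rring X)) (mu X)"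

definition morita_isomorphic ::
  "('r1, 's1, 'p1, 'q1) morita \<Rightarrow> ('r2, 's2, 'p2, 'q2) morita \<Rightarrow> bool"
  where "morita_isomorphic X Y \<longleftrightarrow> morita_context X \<and> morita_context Y \<and>
    (\<exists>\<alpha> \<beta> \<gamma> \<delta>. \<alpha> \<in> ring_iso (lring X) (lring Y) \<and> \<beta> \<in> ring_iso (rring X) (rring Y) \<and>
      \<gamma> \<in> iso (add_monoid (pmod X)) (add_monoid (pmod Y)) \<and>
      \<delta> \<in> iso (add_monoid (qmod X)) (add_monoid (qmod Y)) \<and>
      (\<forall>r\<in>carrier (lring X). \<forall>p\<in>carrier (pmod X). \<gamma> (r \<rightharpoonup>\<^bsub>pmod X\<^esub> p) = \<alpha> r \<rightharpoonup>\<^bsub>pmod Y\<^esub> \<gamma> p) \<and>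
      (\<forall>p\<in>carrier (pmod X). \<forall>s\<in>carrier (rring X). \<gamma> (p \<leftharpoonup>\<^bsub>pmod X\<^esub> s) = \<gamma> p \<leftharpoonup>\<^bsub>pmod Y\<^esub> \<beta> s) \<and>
      (\<forall>s\<in>carrier (rring X). \<forall>q\<in>carrier (qmod X). \<delta> (s \<rightharpoonup>\<^bsub>qmod X\<^esub> q) = \<beta> s \<rightharpoonup>\<^bsub>qmod Y\<^esub> \<delta> q) \<and>
      (\<forall>q\<in>carrier (qmod X). \<forall>r\<in>carrier (lring X). \<delta> (q \<leftharpoonup>\<^bsub>qmod X\<^esub> r) = \<delta> q \<leftharpoonup>\<^bsub>qmod Y\<^esub> \<alpha> r) \<and>
      (\<forall>x\<in>carrier (tensor_pq X).
        tau Y (tmap (rring Y) (pmod Y) (qmod Y) \<gamma> \<delta> x) = \<alpha> (tau X x)) \<and>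
      (\<forall>x\<in>carrier (tensor_qp X).
        mu Y (tmap (lring Y) (qmod Y) (pmod Y) \<delta> \<gamma> x) = \<beta> (mu X x)))"

section \<open>The Morita context of a comodule\<close>

definition dual :: "('a, 'y) ring_scheme \<Rightarrow> ('b, 'a, 's, 'z) bimod_scheme \<Rightarrow> ('a, 'b, 's \<Rightarrow> 'a) bimod"
  where "dual A \<Sigma> = \<lparr>carrier = right_Hom A \<Sigma> (regular A), mult = undefined, one = undefined,
    zero = pointwise_zero (carrier \<Sigma>) A, add = pointwise_add (carrier \<Sigma>) A,
    lact = (\<lambda>a f. \<lambda>u\<in>carrier \<Sigma>. a \<otimes>\<^bsub>A\<^esub> f u), ract = (\<lambda>f b. \<lambda>u\<in>carrier \<Sigma>. f (b \<rightharpoonup>\<^bsub>\<Sigma>\<^esub> u))\<rparr>"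

definition dual_basis ::
  "('a, 'y) ring_scheme \<Rightarrow> ('b, 'a, 's, 'z) bimod_scheme
    \<Rightarrow> nat \<times> (nat \<Rightarrow> 's) \<times> (nat \<Rightarrow> 's \<Rightarrow> 'a) \<Rightarrow> bool"
  where "dual_basis A \<Sigma> = (\<lambda>(n, e, \<phi>).
    (\<forall>i<n. e i \<in> carrier \<Sigma> \<and> \<phi> i \<in> carrier (dual A \<Sigma>)) \<and>
    (\<forall>u\<in>carrier \<Sigma>. u = (\<Oplus>\<^bsub>\<Sigma>\<^esub>i\<in>{..<n}. e i \<leftharpoonup>\<^bsub>\<Sigma>\<^esub> \<phi> i u)))"

text \<open>\<open>f(u\<^sub>[\<^sub>0\<^sub>]) u\<^sub>[\<^sub>1\<^sub>]\<close>\<close>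

definition slice ::
  "('a, 'c, 'z) coring_scheme \<Rightarrow> ('s \<Rightarrow> ('s \<times> 'c \<Rightarrow>\<^sub>0 int) set) \<Rightarrow> ('s \<Rightarrow> 'a) \<Rightarrow> 's \<Rightarrow> 'c"
  where "slice C \<rho> f u = tlift C (\<lambda>v c. f v \<rightharpoonup>\<^bsub>C\<^esub> c) (\<rho> u)"

text \<open>\<open>f \<mapsto> \<Sum>\<^sub>i f(e\<^sub>i\<^sub>[\<^sub>0\<^sub>]) e\<^sub>i\<^sub>[\<^sub>1\<^sub>] \<otimes> \<phi>\<^sub>i\<close>, independent of the dual basis.\<close>

definition dual_coact ::
  "('a, 'y) ring_scheme \<Rightarrow> ('a, 'c, 'z1) coring_scheme \<Rightarrow> ('b, 'a, 's, 'z2) bimod_scheme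
    \<Rightarrow> ('s \<Rightarrow> ('s \<times> 'c \<Rightarrow>\<^sub>0 int) set) \<Rightarrow> ('s \<Rightarrow> 'a) \<Rightarrow> ('c \<times> ('s \<Rightarrow> 'a) \<Rightarrow>\<^sub>0 int) set"
  where "dual_coact A C \<Sigma> \<rho> f = (case (SOME b. dual_basis A \<Sigma> b) of (n, e, \<phi>) \<Rightarrow>
    \<Oplus>\<^bsub>tensor A C (dual A \<Sigma>)\<^esub>i\<in>{..<n}. tens A C (dual A \<Sigma>) (slice C \<rho> f (e i)) (\<phi> i))"

text \<open>\<open>c\<^sub>(\<^sub>1\<^sub>) f(c\<^sub>(\<^sub>2\<^sub>))\<close>\<close>

definition hit :: "('a, 'c, 'z) coring_scheme \<Rightarrow> 'c \<Rightarrow> ('c \<Rightarrow> 'a) \<Rightarrow> 'c"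
  where "hit C c f = tlift C (\<lambda>c1 c2. c1 \<leftharpoonup>\<^bsub>C\<^esub> f c2) (comult C c)"

text \<open>\<open>u\<^sub>[\<^sub>0\<^sub>] f(u\<^sub>[\<^sub>1\<^sub>])\<close>\<close>

definition coact_eval ::
  "('b, 'a, 's, 'z) bimod_scheme \<Rightarrow> ('s \<Rightarrow> ('s \<times> 'c \<Rightarrow>\<^sub>0 int) set) \<Rightarrow> 's \<Rightarrow> ('c \<Rightarrow> 'a) \<Rightarrow> 's"
  where "coact_eval \<Sigma> \<rho> u f = tlift \<Sigma> (\<lambda>v c. v \<leftharpoonup>\<^bsub>\<Sigma>\<^esub> f c) (\<rho> u)"

text \<open>The left dual ring \<open>\<^sup>*C\<close>.\<close>

definition left_dual_ring ::
  "('a, 'y) ring_scheme \<Rightarrow> ('a, 'c, 'z) coring_scheme \<Rightarrow> ('c \<Rightarrow> 'a) ring"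
  where "left_dual_ring A C = \<lparr>carrier = left_Hom A C (regular A),
    mult = (\<lambda>f g. \<lambda>c\<in>carrier C. g (hit C c f)), one = restrict (counit C) (carrier C),
    zero = pointwise_zero (carrier C) A, add = pointwise_add (carrier C) A\<rparr>"

definition comod_End ::
  "('a, 'y) ring_scheme \<Rightarrow> ('a, 'c, 'z1) coring_scheme \<Rightarrow> ('b, 'a, 's, 'z2) bimod_scheme
    \<Rightarrow> ('s \<Rightarrow> ('s \<times> 'c \<Rightarrow>\<^sub>0 int) set) \<Rightarrow> ('s \<Rightarrow> 's) ring"
  where "comod_End A C \<Sigma> \<rho> = \<lparr>carrier = comod_Hom A C \<Sigma> \<rho> \<Sigma> \<rho>,
    mult = compose (carrier \<Sigma>), one = (\<lambda>u\<in>carrier \<Sigma>. u),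
    zero = pointwise_zero (carrier \<Sigma>) \<Sigma>, add = pointwise_add (carrier \<Sigma>) \<Sigma>\<rparr>"

definition left_End_op ::
  "('b, 'y) ring_scheme \<Rightarrow> ('b, 'a, 's, 'z) bimod_scheme \<Rightarrow> ('s \<Rightarrow> 's) ring"
  where "left_End_op B \<Sigma> = \<lparr>carrier = left_Hom B \<Sigma> \<Sigma>,
    mult = (\<lambda>f g. compose (carrier \<Sigma>) g f), one = (\<lambda>u\<in>carrier \<Sigma>. u),
    zero = pointwise_zero (carrier \<Sigma>) \<Sigma>, add = pointwise_add (carrier \<Sigma>) \<Sigma>\<rparr>"

text \<open>\<open>Q = \<^sup>CHom(C, \<Sigma>\<^sup>*)\<close>\<close>

definition Q_set ::
  "('a, 'y) ring_scheme \<Rightarrow> ('a, 'c, 'z1) coring_scheme \<Rightarrow> ('b, 'a, 's, 'z2) bimod_scheme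
    \<Rightarrow> ('s \<Rightarrow> ('s \<times> 'c \<Rightarrow>\<^sub>0 int) set) \<Rightarrow> ('c \<Rightarrow> 's \<Rightarrow> 'a) set"
  where "Q_set A C \<Sigma> \<rho> = {q \<in> left_Hom A C (dual A \<Sigma>). \<forall>c\<in>carrier C.
    dual_coact A C \<Sigma> \<rho> (q c) = tmap A C (dual A \<Sigma>) (\<lambda>d. d) q (comult C c)}"

definition Q_AB ::
  "('a, 'y) ring_scheme \<Rightarrow> ('a, 'c, 'z1) coring_scheme \<Rightarrow> ('b, 'a, 's, 'z2) bimod_scheme
    \<Rightarrow> ('s \<Rightarrow> ('s \<times> 'c \<Rightarrow>\<^sub>0 int) set) \<Rightarrow> ('a, 'b, 'c \<Rightarrow> 's \<Rightarrow> 'a) bimod"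
  where "Q_AB A C \<Sigma> \<rho> = \<lparr>carrier = Q_set A C \<Sigma> \<rho>, mult = undefined, one = undefined,
    zero = pointwise_zero (carrier C) (dual A \<Sigma>), add = pointwise_add (carrier C) (dual A \<Sigma>),
    lact = (\<lambda>a q. \<lambda>c\<in>carrier C. q (c \<leftharpoonup>\<^bsub>C\<^esub> a)),
    ract = (\<lambda>q b. \<lambda>c\<in>carrier C. \<lambda>u\<in>carrier \<Sigma>. q c (b \<rightharpoonup>\<^bsub>\<Sigma>\<^esub> u))\<rparr>"

definition Q_dualT ::
  "('a, 'y) ring_scheme \<Rightarrow> ('a, 'c, 'z1) coring_scheme \<Rightarrow> ('b, 'a, 's, 'z2) bimod_scheme
    \<Rightarrow> ('s \<Rightarrow> ('s \<times> 'c \<Rightarrow>\<^sub>0 int) set) \<Rightarrow> ('c \<Rightarrow> 'a, 's \<Rightarrow> 's, 'c \<Rightarrow> 's \<Rightarrow> 'a) bimod"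
  where "Q_dualT A C \<Sigma> \<rho> = \<lparr>carrier = Q_set A C \<Sigma> \<rho>, mult = undefined, one = undefined,
    zero = pointwise_zero (carrier C) (dual A \<Sigma>), add = pointwise_add (carrier C) (dual A \<Sigma>),
    lact = (\<lambda>f q. \<lambda>c\<in>carrier C. q (hit C c f)),
    ract = (\<lambda>q t. \<lambda>c\<in>carrier C. compose (carrier \<Sigma>) (q c) t)\<rparr>"

definition Sigma_Tdual ::
  "('b, 'a, 's, 'z) bimod_scheme \<Rightarrow> ('s \<Rightarrow> ('s \<times> 'c \<Rightarrow>\<^sub>0 int) set)
    \<Rightarrow> ('s \<Rightarrow> 's, 'c \<Rightarrow> 'a, 's) bimod"
  where "Sigma_Tdual \<Sigma> \<rho> = \<lparr>carrier = carrier \<Sigma>, mult = undefined, one = undefined,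
    zero = zero \<Sigma>, add = add \<Sigma>, lact = (\<lambda>t u. t u), ract = coact_eval \<Sigma> \<rho>\<rparr>"

definition comodule_context ::
  "('a, 'y) ring_scheme \<Rightarrow> ('a, 'c, 'z1) coring_scheme \<Rightarrow> ('b, 'a, 's, 'z2) bimod_scheme
    \<Rightarrow> ('s \<Rightarrow> ('s \<times> 'c \<Rightarrow>\<^sub>0 int) set) \<Rightarrow> ('s \<Rightarrow> 's, 'c \<Rightarrow> 'a, 's, 'c \<Rightarrow> 's \<Rightarrow> 'a) morita"
  where "comodule_context A C \<Sigma> \<rho> = \<lparr>
    lring = comod_End A C \<Sigma> \<rho>, rring = left_dual_ring A C,
    pmod = Sigma_Tdual \<Sigma> \<rho>, qmod = Q_dualT A C \<Sigma> \<rho>,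
    tau = tlift (comod_End A C \<Sigma> \<rho>)
      (\<lambda>u q. \<lambda>v\<in>carrier \<Sigma>. coact_eval \<Sigma> \<rho> u (\<lambda>c. q c v)),
    mu = tlift (left_dual_ring A C) (\<lambda>q u. \<lambda>c\<in>carrier C. q c u)\<rparr>"

text \<open>The context attached to a Frobenius system; \<open>T\<close> acts on \<open>\<Sigma>\<^sup>*\<close> by composition.\<close>

definition Sigma_star_dualT ::
  "('a, 'y) ring_scheme \<Rightarrow> ('a, 'c, 'z1) coring_scheme \<Rightarrow> ('b, 'a, 's, 'z2) bimod_scheme
    \<Rightarrow> ('s \<Rightarrow> ('s \<times> 'c \<Rightarrow>\<^sub>0 int) set) \<Rightarrow> 'c \<Rightarrow> (('c \<times> 'c \<Rightarrow>\<^sub>0 int) set \<Rightarrow> 'a)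
    \<Rightarrow> ('c \<Rightarrow> 'a, 's \<Rightarrow> 's, 's \<Rightarrow> 'a) bimod"
  where "Sigma_star_dualT A C \<Sigma> \<rho> z \<theta> = \<lparr>carrier = carrier (dual A \<Sigma>),
    mult = undefined, one = undefined, zero = zero (dual A \<Sigma>), add = add (dual A \<Sigma>),
    lact = (\<lambda>g f. \<lambda>u\<in>carrier \<Sigma>. \<theta> (tens A C C (hit C z g) (slice C \<rho> f u))),
    ract = compose (carrier \<Sigma>)\<rparr>"

definition frobenius_context ::
  "('a, 'y) ring_scheme \<Rightarrow> ('a, 'c, 'z1) coring_scheme \<Rightarrow> ('b, 'a, 's, 'z2) bimod_scheme
    \<Rightarrow> ('s \<Rightarrow> ('s \<times> 'c \<Rightarrow>\<^sub>0 int) set) \<Rightarrow> 'c \<Rightarrow> (('c \<times> 'c \<Rightarrow>\<^sub>0 int) set \<Rightarrow> 'a)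
    \<Rightarrow> ('s \<Rightarrow> 's, 'c \<Rightarrow> 'a, 's, 's \<Rightarrow> 'a) morita"
  where "frobenius_context A C \<Sigma> \<rho> z \<theta> = \<lparr>
    lring = comod_End A C \<Sigma> \<rho>, rring = left_dual_ring A C,
    pmod = Sigma_Tdual \<Sigma> \<rho>, qmod = Sigma_star_dualT A C \<Sigma> \<rho> z \<theta>,
    tau = tlift (comod_End A C \<Sigma> \<rho>)
      (\<lambda>u f. \<lambda>v\<in>carrier \<Sigma>. coact_eval \<Sigma> \<rho> u (\<lambda>c. \<theta> (tens A C C c (slice C \<rho> f v)))),
    mu = tlift (left_dual_ring A C)
      (\<lambda>f u. \<lambda>c\<in>carrier C. \<theta> (tens A C C c (slice C \<rho> f u)))\<rparr>"

section \<open>The four equivalent conditions\<close>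

definition can_iso ::
  "'u itself \<Rightarrow> ('a, 'y1) ring_scheme \<Rightarrow> ('b, 'y2) ring_scheme \<Rightarrow> ('a, 'c, 'z1) coring_scheme
    \<Rightarrow> ('b, 'a, 's, 'z2) bimod_scheme \<Rightarrow> ('s \<Rightarrow> ('s \<times> 'c \<Rightarrow>\<^sub>0 int) set) \<Rightarrow> bool"
  where "can_iso U A B C \<Sigma> \<rho> \<longleftrightarrow>
    bimod_iso A A (tensor B (dual A \<Sigma>) \<Sigma>) C (tlift C (slice C \<rho>)) \<and> faithfully_flat U B \<Sigma>"

definition dual_progenerator ::
  "'u itself \<Rightarrow> ('a, 'y1) ring_scheme \<Rightarrow> ('b, 'y2) ring_scheme \<Rightarrow> ('a, 'c, 'z1) coring_scheme
    \<Rightarrow> ('b, 'a, 's, 'z2) bimod_scheme \<Rightarrow> ('s \<Rightarrow> ('s \<times> 'c \<Rightarrow>\<^sub>0 int) set) \<Rightarrow> bool"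
  where "dual_progenerator U A B C \<Sigma> \<rho> \<longleftrightarrow>
    (\<lambda>f. \<lambda>u\<in>carrier \<Sigma>. coact_eval \<Sigma> \<rho> u f) \<in> ring_iso (left_dual_ring A C) (left_End_op B \<Sigma>) \<and>
    left_progenerator U B \<Sigma>"

definition strict_comodule_context ::
  "('a, 'y1) ring_scheme \<Rightarrow> ('b, 'y2) ring_scheme \<Rightarrow> ('a, 'c, 'z1) coring_scheme
    \<Rightarrow> ('b, 'a, 's, 'z2) bimod_scheme \<Rightarrow> ('s \<Rightarrow> ('s \<times> 'c \<Rightarrow>\<^sub>0 int) set) \<Rightarrow> bool"
  where "strict_comodule_context A B C \<Sigma> \<rho> \<longleftrightarrow>
    (\<lambda>b. \<lambda>u\<in>carrier \<Sigma>. b \<rightharpoonup>\<^bsub>\<Sigma>\<^esub> u) \<in> ring_iso B (comod_End A C \<Sigma> \<rho>) \<and>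
    strict_context (comodule_context A C \<Sigma> \<rho>)"

text \<open>The right \<open>B\<close>-module \<open>Hom\<^sup>C(\<Sigma>, M)\<close>, with \<open>(hb)(u) = h(bu)\<close>.\<close>

definition comod_Hom_mod ::
  "('a, 'y) ring_scheme \<Rightarrow> ('a, 'c, 'z1) coring_scheme
    \<Rightarrow> ('b, 'a, 's, 'z2) bimod_scheme \<Rightarrow> ('s \<Rightarrow> ('s \<times> 'c \<Rightarrow>\<^sub>0 int) set)
    \<Rightarrow> ('l, 'a, 'm, 'z3) bimod_scheme \<Rightarrow> ('m \<Rightarrow> ('m \<times> 'c \<Rightarrow>\<^sub>0 int) set)
    \<Rightarrow> (unit, 'b, 's \<Rightarrow> 'm) bimod"
  where "comod_Hom_mod A C \<Sigma> \<rho> M \<sigma> = \<lparr>carrier = comod_Hom A C \<Sigma> \<rho> M \<sigma>,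
    mult = undefined, one = undefined,
    zero = pointwise_zero (carrier \<Sigma>) M, add = pointwise_add (carrier \<Sigma>) M,
    lact = undefined, ract = (\<lambda>h b. \<lambda>u\<in>carrier \<Sigma>. h (b \<rightharpoonup>\<^bsub>\<Sigma>\<^esub> u))\<rparr>"

text \<open>
  The functor \<open>- \<otimes>\<^sub>B \<Sigma> : \<M>\<^sub>B \<rightarrow> \<M>\<^sup>C\<close> and its right adjoint \<open>Hom\<^sup>C(\<Sigma>, -)\<close> are inverse equivalences:
  every component of the unit \<open>x \<mapsto> (u \<mapsto> x \<otimes> u)\<close> and of the counit \<open>h \<otimes> u \<mapsto> h u\<close> of the
  adjunction is an isomorphism.
\<close>

definition inverse_equivalences ::
  "'u itself \<Rightarrow> ('a, 'y1) ring_scheme \<Rightarrow> ('b, 'y2) ring_scheme \<Rightarrow> ('a, 'c, 'z1) coring_scheme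
    \<Rightarrow> ('b, 'a, 's, 'z2) bimod_scheme \<Rightarrow> ('s \<Rightarrow> ('s \<times> 'c \<Rightarrow>\<^sub>0 int) set) \<Rightarrow> bool"
  where "inverse_equivalences (_ :: 'u itself) A B C \<Sigma> \<rho> \<longleftrightarrow>
    (\<forall>X :: (unit, 'b, 'u) bimod. right_module B X \<longrightarrow>
      (let H = comod_Hom_mod A C \<Sigma> \<rho> (tensor B X \<Sigma>) (tensor_coact A C B X \<Sigma> \<rho>);
           \<eta> = (\<lambda>x. \<lambda>u\<in>carrier \<Sigma>. tens B X \<Sigma> x u)
       in right_linear B X H \<eta> \<and> bij_betw \<eta> (carrier X) (carrier H))) \<and>
    (\<forall>(M :: (unit, 'a, 'u) bimod) \<sigma>. right_comodule A C M \<sigma> \<longrightarrow>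
      (let H = comod_Hom_mod A C \<Sigma> \<rho> M \<sigma>; \<kappa> = tlift M (\<lambda>h u. h u)
       in restrict \<kappa> (carrier (tensor B H \<Sigma>))
            \<in> comod_Hom A C (tensor B H \<Sigma>) (tensor_coact A C B H \<Sigma> \<rho>) M \<sigma> \<and>
          bij_betw \<kappa> (carrier (tensor B H \<Sigma>)) (carrier M)))"

end

theory Submission
 imports Defs
begin

text \<open>
 Write \<open>u\<^sub>[\<^sub>0\<^sub>] \<otimes> u\<^sub>[\<^sub>1\<^sub>]\<close> for a coaction.  Everything rests on the elements \<open>f(u\<^sub>[\<^sub>0\<^sub>]) u\<^sub>[\<^sub>1\<^sub>] \<in> C\<close>, for \<open>f \<in> \<Sigma>\<^sup>*\<close> and
 \<open>u \<in> \<Sigma>\<close> (the constant \<open>slice\<close>), and on the fact that \<open>Q\<close> consists of the left linear maps \<open>q : C \<rightarrow> \<Sigma>\<^sup>*\<close> with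
 \<open>q(c)(u\<^sub>[\<^sub>0\<^sub>]) u\<^sub>[\<^sub>1\<^sub>] = c\<^sub>(\<^sub>1\<^sub>) q(c\<^sub>(\<^sub>2\<^sub>))(u)\<close> (lemma \<open>Q_mem_iff\<close>).  Sweedler calculations are done by applying balanced
 maps to tensors: two additive maps on a tensor product that agree on pure tensors are equal.

 From an adjunction to a system.  If \<open>- \<otimes> C\<close> is left adjoint to the forgetful functor, then \<open>C = A \<otimes> C\<close> represents
 the forgetful functor: there is \<open>z \<in> C\<close> such that each element \<open>n\<close> of a comodule \<open>N\<close> is \<open>k(z)\<close> for exactly one comodule map
 \<open>k : C \<rightarrow> N\<close> (\<open>frobenius_coring_universal_element\<close>).  Naturality in \<open>A\<close> makes \<open>z\<close> central.  Let \<open>K\<^sub>d : C \<rightarrow> C\<close> be the comodule map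
 with \<open>K\<^sub>d(z) = d\<close>, and \<open>\<theta>(d \<otimes> c) = \<epsilon>(K\<^sub>d(c))\<close>.  Uniqueness, applied to maps \<open>C \<rightarrow> C\<close> and \<open>C \<rightarrow> C \<otimes> C\<close>, gives all
 identities of a Frobenius system.

 From a system to the contexts.  Given \<open>(z, \<theta>)\<close>, the map \<open>J(f)(c)(u) = \<theta>(c \<otimes> f(u\<^sub>[\<^sub>0\<^sub>]) u\<^sub>[\<^sub>1\<^sub>])\<close> is a bijection \<open>\<Sigma>\<^sup>* \<rightarrow> Q\<close> with inverse
 \<open>q \<mapsto> q(z)\<close>.  The context on \<open>\<Sigma>\<^sup>*\<close> is the one obtained from the context on \<open>Q\<close> by transport along \<open>J\<close>
 (\<open>morita_transport\<close>); that its formulas are the stated ones is a computation with the system.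

 The converse.  Let \<open>J : \<Sigma>\<^sup>* \<rightarrow> Q\<close> be any isomorphism of bimodules.  All that is used of the four conditions is that the unit \<open>\<epsilon>\<close> of
 \<open>\<^sup>*C\<close> is a sum \<open>\<Sum>\<^sub>i q\<^sub>i(-)(u\<^sub>i)\<close> with \<open>q\<^sub>i \<in> Q\<close> and \<open>u\<^sub>i \<in> \<Sigma>\<close>, and that \<open>B\<close> maps onto \<open>T\<close> (\<open>trace_unital\<close>).  Then the elements
 \<open>f(u\<^sub>[\<^sub>0\<^sub>]) u\<^sub>[\<^sub>1\<^sub>]\<close> span \<open>C\<close>, the form \<open>\<theta>(c \<otimes> d) = \<Sum>\<^sub>i J(q\<^sub>i(d))(c)(u\<^sub>i)\<close> satisfies \<open>\<theta>(c \<otimes> f(u\<^sub>[\<^sub>0\<^sub>]) u\<^sub>[\<^sub>1\<^sub>]) = J(f)(c)(u)\<close>, and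
 with \<open>z = \<Sum>\<^sub>i J\<^sup>-\<^sup>1(q\<^sub>i)(u\<^sub>i\<^sub>[\<^sub>0\<^sub>]) u\<^sub>i\<^sub>[\<^sub>1\<^sub>]\<close> it is a Frobenius system (\<open>trace_unital_imp_system\<close>).  For a system, \<open>h \<mapsto> (m \<mapsto> h(m \<otimes> z))\<close> is
 the bijection of the adjunction (\<open>adjunction_bij\<close>).

 It remains to derive both facts from each condition.  For a strict context the first is surjectivity of \<open>\<mu>\<close>.  For the
 progenerator condition, \<open>\<^sup>*C\<close> is the ring of \<open>B\<close>-endomorphisms of \<open>\<Sigma>\<close>, and \<open>\<epsilon>\<close> is the sum of the rank one operators of a dual basis.
 For the other two, \<open>\<^sup>*C\<close> is itself a comodule (here \<open>C\<close> is finitely generated projective), \<open>Hom\<^sup>C(\<Sigma>, \<^sup>*C)\<close> is \<open>Q\<close>, and the counit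
 \<open>Hom\<^sup>C(\<Sigma>, M) \<otimes>\<^sub>B \<Sigma> \<rightarrow> M\<close> is surjective for \<open>M = \<^sup>*C\<close>: by assumption for inverse equivalences, and by faithfully flat descent
 (\<open>counit_descent\<close>) when the canonical map is bijective.
\<close>

text \<open>An index that is a single identifier may be written as a plain subscript.\<close>

syntax "_index" :: "id_position => index"  (\<open>(00\<^sub>_)\<close>)

section \<open>Additive maps and balanced maps\<close>

definition additive :: "('g, 'z1) ring_scheme => ('h, 'z2) ring_scheme => ('g => 'h) => bool"
 where "additive G H f \<longleftrightarrow> f \<in> hom (add_monoid G) (add_monoid H)"

lemmas (in left_module) ab = M.abelian_group_axioms
lemmas (in right_module) ab = M.abelian_group_axioms

lemma additiveI:
 assumes "\<And>x. x \<in> carrier G ==> f x \<in> carrier H"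
  and "\<And>x y. x \<in> carrier G ==> y \<in> carrier G ==> f (x \<oplus>\<^sub>G y) = f x \<oplus>\<^sub>H f y"
 shows "additive G H f"
 using assms by (auto simp: additive_def hom_def)

lemma additive_closed: "additive G H f ==> x \<in> carrier G ==> f x \<in> carrier H" by (auto simp: additive_def hom_def)

lemma additive_add:
 "additive G H f ==> x \<in> carrier G ==> y \<in> carrier G ==> f (x \<oplus>\<^sub>G y) = f x \<oplus>\<^sub>H f y" by (auto simp: additive_def hom_def)

lemma additive_comp: "additive G H f ==> additive H K g ==> additive G K (\<lambda>x. g (f x))"
 by (auto simp: additive_def hom_def Pi_iff)

lemma additive_id: "additive G G (\<lambda>x. x)" by (auto simp: additive_def hom_def)

lemma additive_group_hom:
 assumes "additive G H f" "abelian_group G" "abelian_group H"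
 shows "group_hom (add_monoid G) (add_monoid H) f"
 using assms abelian_group.a_group[of G] abelian_group.a_group[of H]
 by (auto simp: additive_def group_hom_def group_hom_axioms_def)

lemma additive_zero:
 "additive G H f ==> abelian_group G ==> abelian_group H ==> f \<zero>\<^sub>G = \<zero>\<^sub>H"
 using group_hom.hom_one[OF additive_group_hom] by fastforce

lemma additive_minus:
 "additive G H f ==> abelian_group G ==> abelian_group H ==> x \<in> carrier G
  ==> f (\<ominus>\<^sub>G x) = \<ominus>\<^sub>H f x"
 using group_hom.hom_inv[OF additive_group_hom] by (fastforce simp: a_inv_def)

lemma additive_finsum:
 assumes "additive G H f" "abelian_group G" "abelian_group H" "finite I" "\<And>i. i \<in> I ==> x i \<in> carrier G"
 shows "f (\<Oplus>\<^sub>G i\<in>I. x i) = (\<Oplus>\<^sub>H i\<in>I. f (x i))"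
proof -
 interpret G: abelian_group G by fact
 interpret H: abelian_group H by fact
 show ?thesis using assms(4,5)
 proof (induction I rule: finite_induct)
  case empty
  then show ?case by (simp add: additive_zero[OF assms(1-3)])
 next
  case (insert i I)
  have "x \<in> I \<rightarrow> carrier G" "(\<lambda>i. f (x i)) \<in> I \<rightarrow> carrier H"
   using insert by (auto intro: additive_closed[OF assms(1)])
  then show ?case using insert by (simp add: additive_add[OF assms(1)] additive_closed[OF assms(1)])
 qed
qed

lemma additive_finsum_fun:
 assumes G: "abelian_group H" and F: "\<And>i. i \<in> I ==> additive G H (F i)"
 shows "additive G H (\<lambda>x. \<Oplus>\<^sub>H i\<in>I. F i x)"
proof -
 interpret H: abelian_group H by fact
 show ?thesis
 proof (rule additiveI)
  fix x assume "x \<in> carrier G"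
  then show "(\<Oplus>\<^sub>H i\<in>I. F i x) \<in> carrier H" using additive_closed[OF F] by (intro H.finsum_closed) auto
 next
  fix x y assume xy: "x \<in> carrier G" "y \<in> carrier G"
  have "(\<Oplus>\<^sub>H i\<in>I. F i (x \<oplus>\<^sub>G y)) = (\<Oplus>\<^sub>H i\<in>I. F i x \<oplus>\<^sub>H F i y)"
   using xy additive_closed[OF F] by (intro H.finsum_cong') (auto simp: additive_add[OF F])
  also have "\<dots> = (\<Oplus>\<^sub>H i\<in>I. F i x) \<oplus>\<^sub>H (\<Oplus>\<^sub>H i\<in>I. F i y)"
   using xy additive_closed[OF F] by (intro H.finsum_addf) auto
  finally show "(\<Oplus>\<^sub>H i\<in>I. F i (x \<oplus>\<^sub>G y)) = (\<Oplus>\<^sub>H i\<in>I. F i x) \<oplus>\<^sub>H (\<Oplus>\<^sub>H i\<in>I. F i y)" .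
 qed
qed

lemma additive_inj_onI:
 assumes "additive G H f" "abelian_group G" "abelian_group H"
  and "\<And>x. x \<in> carrier G ==> f x = \<zero>\<^sub>H ==> x = \<zero>\<^sub>G"
 shows "inj_on f (carrier G)"
proof (rule inj_onI)
 interpret G: abelian_group G by fact
 interpret H: abelian_group H by fact
 fix x y assume xy: "x \<in> carrier G" "y \<in> carrier G" "f x = f y"
 have "f (x \<oplus>\<^sub>G \<ominus>\<^sub>G y) = \<zero>\<^sub>H"
  using xy by (simp add: additive_add[OF assms(1)] additive_minus[OF assms(1-3)]
    additive_closed[OF assms(1)] H.r_neg)
 then have "x \<oplus>\<^sub>G \<ominus>\<^sub>G y = \<zero>\<^sub>G" using assms(4) xy by simp
 then show "x = y" using xy by (metis G.minus_equality G.minus_minus G.a_inv_closed)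
qed

definition balanced ::
 "('a, 'y) ring_scheme => ('l, 'a, 'm, 'z1) bimod_scheme => ('a, 'r, 'n, 'z2) bimod_scheme
  => ('g, 'z3) ring_scheme => ('m => 'n => 'g) => bool"
 where "balanced A M N G f \<longleftrightarrow>
  (\<forall>m\<in>carrier M. \<forall>n\<in>carrier N. f m n \<in> carrier G) \<and>
  (\<forall>m\<in>carrier M. \<forall>m'\<in>carrier M. \<forall>n\<in>carrier N. f (m \<oplus>\<^sub>M m') n = f m n \<oplus>\<^sub>G f m' n) \<and>
  (\<forall>m\<in>carrier M. \<forall>n\<in>carrier N. \<forall>n'\<in>carrier N. f m (n \<oplus>\<^sub>N n') = f m n \<oplus>\<^sub>G f m n') \<and>
  (\<forall>m\<in>carrier M. \<forall>a\<in>carrier A. \<forall>n\<in>carrier N. f (m \<leftharpoonup>\<^sub>M a) n = f m (a \<rightharpoonup>\<^sub>N n))"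

lemma balancedI:
 assumes "\<And>m n. m \<in> carrier M ==> n \<in> carrier N ==> f m n \<in> carrier G"
  and "\<And>m m' n. m \<in> carrier M ==> m' \<in> carrier M ==> n \<in> carrier N ==> f (m \<oplus>\<^sub>M m') n = f m n \<oplus>\<^sub>G f m' n"
  and "\<And>m n n'. m \<in> carrier M ==> n \<in> carrier N ==> n' \<in> carrier N ==> f m (n \<oplus>\<^sub>N n') = f m n \<oplus>\<^sub>G f m n'"
  and "\<And>m a n. m \<in> carrier M ==> a \<in> carrier A ==> n \<in> carrier N ==> f (m \<leftharpoonup>\<^sub>M a) n = f m (a \<rightharpoonup>\<^sub>N n)"
 shows "balanced A M N G f"
 using assms by (auto simp: balanced_def)

lemma balancedD:
 assumes "balanced A M N G f"
 shows "m \<in> carrier M ==> n \<in> carrier N ==> f m n \<in> carrier G"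
  and "m \<in> carrier M ==> m' \<in> carrier M ==> n \<in> carrier N ==> f (m \<oplus>\<^sub>M m') n = f m n \<oplus>\<^sub>G f m' n"
  and "m \<in> carrier M ==> n \<in> carrier N ==> n' \<in> carrier N ==> f m (n \<oplus>\<^sub>N n') = f m n \<oplus>\<^sub>G f m n'"
  and "m \<in> carrier M ==> a \<in> carrier A ==> n \<in> carrier N ==> f (m \<leftharpoonup>\<^sub>M a) n = f m (a \<rightharpoonup>\<^sub>N n)"
 using assms by (auto simp: balanced_def)

lemma balanced_additive1: "balanced A M N G f ==> n \<in> carrier N ==> additive M G (\<lambda>m. f m n)"
 by (auto simp: balanced_def intro: additiveI)

lemma balanced_additive2: "balanced A M N G f ==> m \<in> carrier M ==> additive N G (\<lambda>n. f m n)"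
 by (auto simp: balanced_def intro: additiveI)

lemma balanced_comp: "balanced A M N G f ==> additive G H F ==> balanced A M N H (\<lambda>m n. F (f m n))"
 by (auto simp: balanced_def additive_closed additive_add)

section \<open>The tensor product and its universal property\<close>

text \<open>
 The defining expression of \<open>tlift\<close> evaluates a formal sum of pairs, so it is the additive extension of a map on pairs.
\<close>

lemma hom_free_Abelian_group_finsum:
 assumes G: "abelian_group G" and h: "h \<in> hom (free_Abelian_group S) (add_monoid G)"
  and w: "Poly_Mapping.keys w \<subseteq> S"
 shows "h w = (\<Oplus>\<^sub>G p\<in>Poly_Mapping.keys w. [Poly_Mapping.lookup w p] \<cdot>\<^sub>G h (frag_of p))"
proof -
 interpret G: abelian_group G by fact
 interpret h: group_hom "free_Abelian_group S" "add_monoid G" h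
  using h G.a_group by (auto simp: group_hom_def group_hom_axioms_def)
 have *: "h (\<Sum>p\<in>K. frag_cmul (k p) (frag_of p)) = (\<Oplus>\<^sub>G p\<in>K. [k p] \<cdot>\<^sub>G h (frag_of p))"
  if "finite K" "K \<subseteq> S" for K and k :: "_ => int"
  using that
 proof (induction K rule: finite_induct)
  case empty
  then show ?case using h.hom_one by simp
 next
  case (insert p K)
  have cl: "h (frag_of q) \<in> carrier G" if "q \<in> S" for q
   using h.hom_closed[of "frag_of q"] that by simp
  have keys: "Poly_Mapping.keys (\<Sum>p\<in>K. frag_cmul (k p) (frag_of p)) \<subseteq> S"
   using insert(4) sum_closed_free_Abelian_group[of K "\<lambda>p. frag_cmul (k p) (frag_of p)" S] by (auto simp: subset_iff)
  have pow: "h (frag_cmul (k p) (frag_of p)) = [k p] \<cdot>\<^sub>G h (frag_of p)"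
   using h.hom_int_pow[of "frag_of p" "k p"] insert(4) by (simp add: add_pow_def)
  have "h (frag_cmul (k p) (frag_of p) + (\<Sum>p\<in>K. frag_cmul (k p) (frag_of p)))
    = h (frag_cmul (k p) (frag_of p)) \<oplus>\<^sub>G h (\<Sum>p\<in>K. frag_cmul (k p) (frag_of p))"
   using h.hom_mult[of "frag_cmul (k p) (frag_of p)" "\<Sum>p\<in>K. frag_cmul (k p) (frag_of p)"] insert(4) keys
    order.trans[OF keys_cmul, of "frag_of p" S "k p"] by simp
  moreover have "(\<lambda>p. [k p] \<cdot>\<^sub>G h (frag_of p)) \<in> K \<rightarrow> carrier G" "[k p] \<cdot>\<^sub>G h (frag_of p) \<in> carrier G"
   using insert(4) cl by (auto simp: G.add.int_pow_closed)
  ultimately show ?case using insert by (simp add: pow)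
 qed
 have "w = (\<Sum>p\<in>Poly_Mapping.keys w. frag_cmul (Poly_Mapping.lookup w p) (frag_of p))"
  using frag_expansion[of w] by (simp add: frag_extend_def)
 then show ?thesis using *[of "Poly_Mapping.keys w" "Poly_Mapping.lookup w"] w by simp
qed

lemma tensor_simps:
 "carrier (tensor A M N) = carrier (tensor_quotient A M N)"
 "add (tensor A M N) = mult (tensor_quotient A M N)"
 "zero (tensor A M N) = one (tensor_quotient A M N)" by (simp_all add: tensor_def tensor_group_def ring.defs)

lemma tlift_cong_group:
 fixes G :: "('g, 'z1) ring_scheme" and H :: "('g, 'z2) ring_scheme"
 assumes "carrier G = carrier H" "add G = add H" "zero G = zero H"
 shows "tlift G = tlift H"
proof -
 have "[k] \<cdot>\<^sub>G x = [k] \<cdot>\<^sub>H x" for k :: int and x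
  using assms by (simp add: add_pow_def int_pow_def nat_pow_def m_inv_def Let_def)
 then show ?thesis
  using assms by (intro ext) (simp add: tlift_def finsum_def finprod_def)
qed

lemma tlift_tensor_group: "tlift (tensor_group A M N) = tlift (tensor A M N)"
 by (intro tlift_cong_group) (simp_all add: tensor_simps tensor_group_def)

lemma tensor_lact: "lact (tensor A M N) l X = tlift (tensor A M N) (\<lambda>m n. tens A M N (l \<rightharpoonup>\<^sub>M m) n) X"
 unfolding tlift_tensor_group[symmetric] by (simp add: tensor_def ring.defs)

lemma tensor_ract: "ract (tensor A M N) X r = tlift (tensor A M N) (\<lambda>m n. tens A M N m (n \<leftharpoonup>\<^sub>N r)) X"
 unfolding tlift_tensor_group[symmetric] by (simp add: tensor_def ring.defs)

locale tensor_pair = M: right_module A M + N: left_module A N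
 for A :: "('a, 'y) ring_scheme" and M :: "('l, 'a, 'm, 'z1) bimod_scheme"
  and N :: "('a, 'r, 'n, 'z2) bimod_scheme"
begin

abbreviation (input) "MN \<equiv> tensor A M N"

abbreviation "FA \<equiv> free_Abelian_group (carrier M \<times> carrier N)"

lemma frag_add_closed: "x \<in> carrier FA ==> y \<in> carrier FA ==> x + y \<in> carrier FA"
 using monoid.m_closed[OF group.is_monoid[OF group_free_Abelian_group], of x _ y] by simp

lemma frag_diff_closed: "x \<in> carrier FA ==> y \<in> carrier FA ==> x - y \<in> carrier FA"
 using frag_add_closed[of x "- y"] by (simp add: keys_minus)

lemma tensor_relators_closed: "tensor_relators A M N \<subseteq> carrier FA"
proof -
 have 2: "frag_of x - frag_of y \<in> carrier FA"
  if "x \<in> carrier M \<times> carrier N" "y \<in> carrier M \<times> carrier N" for x y :: "'m \<times> 'n"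
  using that by (intro frag_diff_closed) simp_all
 have 3: "frag_of x - frag_of y - frag_of z \<in> carrier FA"
  if "x \<in> carrier M \<times> carrier N" "y \<in> carrier M \<times> carrier N" "z \<in> carrier M \<times> carrier N" for x y z
  using that by (intro frag_diff_closed 2) simp_all
 show ?thesis
  unfolding tensor_relators_def by (intro Un_least subsetI; elim CollectE exE conjE; hypsubst; intro 2 3 SigmaI;
    simp add: M.ract_closed N.lact_closed)
qed

lemma normal_tensor_subgroup: "normal (tensor_subgroup A M N) FA"
 unfolding tensor_subgroup_def by (intro comm_group.subgroup_imp_normal group.generate_is_subgroup
   abelian_free_Abelian_group group_free_Abelian_group tensor_relators_closed)

lemma subgroup_tensor_subgroup: "subgroup (tensor_subgroup A M N) FA"
 using normal_tensor_subgroup by (simp add: normal_def)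

lemma ab: "abelian_group MN"
proof -
 interpret Q: comm_group "tensor_quotient A M N"
  unfolding tensor_quotient_def
  by (rule comm_group.abelian_FactGroup[OF abelian_free_Abelian_group subgroup_tensor_subgroup])
 show ?thesis by (rule abelian_groupI) (simp_all add: tensor_simps Q.m_ac)
qed

sublocale T: abelian_group MN by (rule ab)

lemma tens_closed [simp, intro]: "m \<in> carrier M ==> n \<in> carrier N ==> tens A M N m n \<in> carrier MN"
 by (auto simp: tensor_simps tensor_quotient_def FactGroup_def RCOSETS_def tens_def)

lemma tens_relator:
 assumes "x \<in> carrier FA" "y \<in> carrier FA" "x - y \<in> tensor_subgroup A M N"
 shows "tensor_subgroup A M N #>\<^sub>FA x = tensor_subgroup A M N #>\<^sub>FA y"
proof -
 have "x \<in> tensor_subgroup A M N #>\<^sub>FA y"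
  unfolding r_coset_def using assms(3) by (auto intro!: bexI[of _ "x - y"])
 then show ?thesis
  using group.repr_independence[OF group_free_Abelian_group, of x _ "tensor_subgroup A M N" y]
   assms subgroup_tensor_subgroup by auto
qed

lemma coset_add:
 assumes "x \<in> carrier FA" "y \<in> carrier FA"
 shows "tensor_subgroup A M N #>\<^sub>FA (x + y)
  = (tensor_subgroup A M N #>\<^sub>FA x) \<oplus>\<^sub>MN (tensor_subgroup A M N #>\<^sub>FA y)"
 using normal.rcos_sum[OF normal_tensor_subgroup assms] by (simp add: tensor_simps tensor_quotient_def)

lemma relator_mem: "x \<in> tensor_relators A M N ==> x \<in> tensor_subgroup A M N"
 unfolding tensor_subgroup_def by (rule generate.incl)

lemma frag_pair_closed: "m \<in> carrier M ==> n \<in> carrier N ==> frag_of (m, n) \<in> carrier FA" by simp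

lemma frag_pair_closed': "x \<in> carrier M \<times> carrier N ==> frag_of x \<in> carrier FA" by simp

lemma tens_balanced: "balanced A M N MN (tens A M N)"
proof (rule balancedI)
 fix m m' n assume mn: "m \<in> carrier M" "m' \<in> carrier M" "n \<in> carrier N"
 have "frag_of (m \<oplus>\<^sub>M m', n) - frag_of (m, n) - frag_of (m', n) \<in> tensor_relators A M N"
  using mn unfolding tensor_relators_def by blast
 then have "tens A M N (m \<oplus>\<^sub>M m') n = tensor_subgroup A M N #>\<^sub>FA (frag_of (m, n) + frag_of (m', n))"
  unfolding tens_def using mn by (intro tens_relator frag_add_closed frag_pair_closed)
   (simp_all add: diff_diff_add[symmetric] relator_mem)
 then show "tens A M N (m \<oplus>\<^sub>M m') n = tens A M N m n \<oplus>\<^sub>MN tens A M N m' n"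
  using mn by (simp add: tens_def coset_add)
next
 fix m n n' assume mn: "m \<in> carrier M" "n \<in> carrier N" "n' \<in> carrier N"
 have "frag_of (m, n \<oplus>\<^sub>N n') - frag_of (m, n) - frag_of (m, n') \<in> tensor_relators A M N"
  using mn unfolding tensor_relators_def by blast
 then have "tens A M N m (n \<oplus>\<^sub>N n') = tensor_subgroup A M N #>\<^sub>FA (frag_of (m, n) + frag_of (m, n'))"
  unfolding tens_def using mn by (intro tens_relator frag_add_closed frag_pair_closed)
   (simp_all add: diff_diff_add[symmetric] relator_mem)
 then show "tens A M N m (n \<oplus>\<^sub>N n') = tens A M N m n \<oplus>\<^sub>MN tens A M N m n'"
  using mn by (simp add: tens_def coset_add)
next
 fix m a n assume mn: "m \<in> carrier M" "a \<in> carrier A" "n \<in> carrier N"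
 have "frag_of (m \<leftharpoonup>\<^sub>M a, n) - frag_of (m, a \<rightharpoonup>\<^sub>N n) \<in> tensor_relators A M N"
  using mn unfolding tensor_relators_def by blast
 then show "tens A M N (m \<leftharpoonup>\<^sub>M a) n = tens A M N m (a \<rightharpoonup>\<^sub>N n)"
  unfolding tens_def using mn by (intro tens_relator) (auto simp: relator_mem M.ract_closed N.lact_closed)
qed auto

lemmas tens_add1 = balancedD(2)[OF tens_balanced]
 and tens_add2 = balancedD(3)[OF tens_balanced]
 and tens_middle = balancedD(4)[OF tens_balanced]

text \<open>
 Independence of the representative: the additive extension of a balanced map kills all relators, hence the subgroup they
 generate.
\<close>

lemma tlift_coset:
 assumes G: "abelian_group G" and f: "balanced A M N G f"
 obtains h where "h \<in> hom FA (add_monoid G)"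
  and "\<And>m n. m \<in> carrier M ==> n \<in> carrier N ==> h (frag_of (m, n)) = f m n"
  and "\<And>w. w \<in> carrier FA ==> tlift G f (tensor_subgroup A M N #>\<^sub>FA w) = h w"
proof -
 interpret G: abelian_group G by fact
 have "(\<lambda>p. f (fst p) (snd p)) ` (carrier M \<times> carrier N) \<subseteq> carrier (add_monoid G)"
  using f by (auto simp: balanced_def)
 from comm_group.free_Abelian_group_universal[OF G.a_comm_group this]
 obtain h where h: "h \<in> hom FA (add_monoid G)"
  and hf: "\<And>x. x \<in> carrier M \<times> carrier N ==> h (frag_of x) = f (fst x) (snd x)" by blast
 interpret h: group_hom FA "add_monoid G" h
  using h G.a_group by (auto simp: group_hom_def group_hom_axioms_def)
 have sub: "h (x - y) = h x \<ominus>\<^sub>G h y" if "x \<in> carrier FA" "y \<in> carrier FA" for x y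
 proof -
  have "h (x + - y) = h x \<oplus>\<^sub>G h (- y)"
   using h.hom_mult[of x "- y"] that by (simp add: keys_minus)
  moreover have "h (- y) = \<ominus>\<^sub>G h y"
   using h.hom_inv[of y] that by (simp add: a_inv_def)
  ultimately show ?thesis by (simp add: a_minus_def)
 qed
 have fr: "frag_of (m, n) \<in> carrier FA" if "m \<in> carrier M" "n \<in> carrier N" for m n using that by simp
 have fr2: "frag_of x - frag_of y \<in> carrier FA" if "x \<in> carrier M \<times> carrier N" "y \<in> carrier M \<times> carrier N" for x y
  using that by (intro frag_diff_closed) simp_all
 have rel0: "h r = \<zero>\<^sub>G" if r: "r \<in> tensor_relators A M N" for r
 proof -
  have 3: "h (frag_of x - frag_of y - frag_of y') = \<zero>\<^sub>G"
   if "x \<in> carrier M \<times> carrier N" "y \<in> carrier M \<times> carrier N" "y' \<in> carrier M \<times> carrier N"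
    "f (fst x) (snd x) = f (fst y) (snd y) \<oplus>\<^sub>G f (fst y') (snd y')" for x y y'
  proof -
   have c: "f (fst p) (snd p) \<in> carrier G" if "p \<in> carrier M \<times> carrier N" for p
    using that f by (auto simp: balanced_def)
   have "h (frag_of x - frag_of y - frag_of y') = h (frag_of x) \<ominus>\<^sub>G h (frag_of y) \<ominus>\<^sub>G h (frag_of y')"
    using that(1-3) by (simp add: sub fr fr2 frag_pair_closed' del: carrier_free_Abelian_group_iff)
   then show ?thesis
    using that c[OF that(1)] c[OF that(2)] c[OF that(3)] by (simp add: hf G.minus_eq G.a_ac G.r_neg G.r_neg1)
  qed
  have 2: "h (frag_of x - frag_of y) = \<zero>\<^sub>G"
   if "x \<in> carrier M \<times> carrier N" "y \<in> carrier M \<times> carrier N" "f (fst x) (snd x) = f (fst y) (snd y)" for x y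
  proof -
   have c: "f (fst y) (snd y) \<in> carrier G" using that f by (auto simp: balanced_def)
   show ?thesis using that c by (simp add: sub hf G.minus_eq G.r_neg)
  qed
  show ?thesis
   using r f unfolding tensor_relators_def by (auto intro!: 3 2 simp: balanced_def M.ract_closed N.lact_closed)
 qed
 have sub0: "h s = \<zero>\<^sub>G" if "s \<in> tensor_subgroup A M N" for s
 proof -
  have "tensor_relators A M N \<subseteq> kernel FA (add_monoid G) h"
   using tensor_relators_closed rel0 unfolding kernel_def by (auto simp del: carrier_free_Abelian_group_iff)
  then have "tensor_subgroup A M N \<subseteq> kernel FA (add_monoid G) h"
   unfolding tensor_subgroup_def by (intro group.generate_subgroup_incl group_free_Abelian_group h.subgroup_kernel)
  then show ?thesis using that by (auto simp: kernel_def)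
 qed
 have "tlift G f (tensor_subgroup A M N #>\<^sub>FA w) = h w" if w: "w \<in> carrier FA" for w
 proof -
  let ?X = "tensor_subgroup A M N #>\<^sub>FA w"
  have "w \<in> ?X" using group.rcos_self[OF group_free_Abelian_group w subgroup_tensor_subgroup] .
  define w' where "w' = (SOME w. w \<in> ?X)"
  have w'X: "w' \<in> ?X" unfolding w'_def using \<open>w \<in> ?X\<close> by (rule someI)
  then obtain s where s: "s \<in> tensor_subgroup A M N" "w' = s + w" by (auto simp: r_coset_def)
  have sc: "s \<in> carrier FA" using s(1) subgroup.subset[OF subgroup_tensor_subgroup] by blast
  have "h w' = h w"
   using h.hom_mult[of s w] sc w s sub0 h.hom_closed[OF w] by simp
  moreover have w'c: "w' \<in> carrier FA"
   unfolding s(2) by (rule frag_add_closed[OF sc w])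
  moreover have "tlift G f ?X = h w'"
  proof -
   have k: "Poly_Mapping.keys w' \<subseteq> carrier M \<times> carrier N" using w'c by simp
   have "tlift G f ?X = (\<Oplus>\<^sub>G p\<in>Poly_Mapping.keys w'. [Poly_Mapping.lookup w' p] \<cdot>\<^sub>G f (fst p) (snd p))"
    by (simp add: tlift_def w'_def Let_def)
   also have "\<dots> = (\<Oplus>\<^sub>G p\<in>Poly_Mapping.keys w'. [Poly_Mapping.lookup w' p] \<cdot>\<^sub>G h (frag_of p))"
    using k hf f by (intro G.add.finprod_cong') (auto simp: balanced_def G.add.int_pow_closed)
   also have "\<dots> = h w'" using hom_free_Abelian_group_finsum[OF G h k] by simp
   finally show ?thesis .
  qed
  ultimately show ?thesis by simp
 qed
 then show ?thesis by (intro that[OF h]) (simp_all add: hf)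
qed

lemma tensor_cosetE:
 assumes "X \<in> carrier MN"
 obtains w where "w \<in> carrier FA" "X = tensor_subgroup A M N #>\<^sub>FA w"
 using assms by (auto simp: tensor_simps tensor_quotient_def FactGroup_def RCOSETS_def)

lemma tlift_tens [simp]:
 assumes "abelian_group G" "balanced A M N G f" "m \<in> carrier M" "n \<in> carrier N"
 shows "tlift G f (tens A M N m n) = f m n"
proof -
 obtain h where "h (frag_of (m, n)) = f m n"
  "\<And>w. w \<in> carrier FA ==> tlift G f (tensor_subgroup A M N #>\<^sub>FA w) = h w"
  using tlift_coset[OF assms(1,2)] assms(3,4) by metis
 then show ?thesis using assms(3,4) by (simp add: tens_def)
qed

lemma additive_tlift:
 assumes "abelian_group G" "balanced A M N G f"
 shows "additive MN G (tlift G f)"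
proof -
 obtain h where h: "h \<in> hom FA (add_monoid G)"
  "\<And>w. w \<in> carrier FA ==> tlift G f (tensor_subgroup A M N #>\<^sub>FA w) = h w"
  using tlift_coset[OF assms(1,2)] by metis
 show ?thesis
 proof (rule additiveI)
  fix X assume "X \<in> carrier MN"
  then obtain w where "w \<in> carrier FA" "X = tensor_subgroup A M N #>\<^sub>FA w" by (rule tensor_cosetE)
  then show "tlift G f X \<in> carrier G" using h by (auto simp: hom_def)
 next
  fix X Y assume "X \<in> carrier MN" "Y \<in> carrier MN"
  then obtain v w where v: "v \<in> carrier FA" "X = tensor_subgroup A M N #>\<^sub>FA v"
   and w: "w \<in> carrier FA" "Y = tensor_subgroup A M N #>\<^sub>FA w" by (metis tensor_cosetE)
  have vw: "v + w \<in> carrier FA" by (rule frag_add_closed[OF v(1) w(1)])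
  have "h (v + w) = h v \<oplus>\<^sub>G h w" using h(1) v(1) w(1) by (auto simp: hom_def)
  then show "tlift G f (X \<oplus>\<^sub>MN Y) = tlift G f X \<oplus>\<^sub>G tlift G f Y"
   using h(2)[OF v(1)] h(2)[OF w(1)] h(2)[OF vw] v w by (simp add: coset_add[symmetric])
 qed
qed

lemma tensor_induct [consumes 1, case_names zero tens add]:
 assumes X: "X \<in> carrier MN"
  and zero: "P \<zero>\<^sub>MN"
  and tens: "\<And>m n. m \<in> carrier M ==> n \<in> carrier N ==> P (tens A M N m n)"
  and add: "\<And>X Y. X \<in> carrier MN ==> Y \<in> carrier MN ==> P X ==> P Y
   ==> P (X \<oplus>\<^sub>MN Y)"
 shows "P X"
proof -
 let ?c = "\<lambda>w. tensor_subgroup A M N #>\<^sub>FA w"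
 have cl: "?c w \<in> carrier MN" if "w \<in> carrier FA" for w
  using that by (auto simp: tensor_simps tensor_quotient_def FactGroup_def RCOSETS_def)
 have add_c: "additive \<lparr>carrier = carrier FA, mult = undefined, one = undefined, zero = 0, add = (+)\<rparr> MN ?c"
  by (rule additiveI) (use cl coset_add in \<open>auto simp: free_Abelian_group_def\<close>)
 have FA_ab: "abelian_group \<lparr>carrier = carrier FA, mult = undefined, one = undefined, zero = 0, add = (+)\<rparr>"
  using abelian_free_Abelian_group[of "carrier M \<times> carrier N"]
  by (intro comm_group_abelian_groupI) (simp add: free_Abelian_group_def)
 have c0: "?c 0 = \<zero>\<^sub>MN"
  using additive_zero[OF add_c FA_ab ab] by simp
 have neg: "?c (- w) = \<ominus>\<^sub>MN ?c w" if "w \<in> carrier FA" for w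
 proof -
  have "?c (- w) \<oplus>\<^sub>MN ?c w = \<zero>\<^sub>MN"
   using coset_add[of "- w" w] that c0 by (simp add: keys_minus)
  then show ?thesis using T.minus_equality[of "?c (- w)" "?c w"] cl[OF that] cl[of "- w"] that by (simp add: keys_minus)
 qed
 have neg_tens: "\<ominus>\<^sub>MN tens A M N m n = tens A M N (\<ominus>\<^sub>M m) n" if "m \<in> carrier M" "n \<in> carrier N" for m n
  using additive_minus[OF balanced_additive1[OF tens_balanced that(2)] M.ab ab that(1)] by simp
 obtain w where w: "Poly_Mapping.keys w \<subseteq> carrier M \<times> carrier N" "X = ?c w" using X by (rule tensor_cosetE) auto
 have "P (?c w) \<and> P (?c (- w))"
 proof (rule free_Abelian_group_induct[OF w(1)])
  show "P (?c 0) \<and> P (?c (- 0))" using zero c0 by simp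
 next
  fix x y :: "'m \<times> 'n \<Rightarrow>\<^sub>0 int"
  assume xy: "Poly_Mapping.keys x \<subseteq> carrier M \<times> carrier N" "Poly_Mapping.keys y \<subseteq> carrier M \<times> carrier N"
   and P: "P (?c x) \<and> P (?c (- x))" "P (?c y) \<and> P (?c (- y))"
  have e: "?c (x - y) = ?c x \<oplus>\<^sub>MN ?c (- y)" "?c (- (x - y)) = ?c y \<oplus>\<^sub>MN ?c (- x)"
   using coset_add[of x "- y"] coset_add[of y "- x"] xy by (simp_all add: keys_minus)
  show "P (?c (x - y)) \<and> P (?c (- (x - y)))"
   unfolding e using xy P add[OF cl cl] by (simp add: keys_minus)
 next
  fix p assume "p \<in> carrier M \<times> carrier N"
  then obtain m n where p: "p = (m, n)" "m \<in> carrier M" "n \<in> carrier N" by auto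
  then have "?c (- frag_of p) = tens A M N (\<ominus>\<^sub>M m) n"
   using neg[of "frag_of p"] neg_tens by (simp add: tens_def)
  then show "P (?c (frag_of p)) \<and> P (?c (- frag_of p))"
   using p tens[of m n] tens[of "\<ominus>\<^sub>M m" n] by (simp add: tens_def)
 qed
 then show ?thesis using w by simp
qed

text \<open>
 The principle behind all Sweedler calculations below.
\<close>

lemma tensor_eqI:
 assumes "abelian_group G" "additive MN G F" "additive MN G F'"
  and "\<And>m n. m \<in> carrier M ==> n \<in> carrier N ==> F (tens A M N m n) = F' (tens A M N m n)"
  and "X \<in> carrier MN"
 shows "F X = F' X"
 using assms(5)
proof (induction X rule: tensor_induct)
 case zero
 then show ?case using assms(1-3) by (simp add: additive_zero ab)
next
 case (tens m n)
 then show ?case using assms(4) by simp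
next
 case (add X Y)
 then show ?case using assms(2,3) by (simp add: additive_add)
qed

lemma tlift_closed:
 "abelian_group G ==> balanced A M N G f ==> X \<in> carrier MN ==> tlift G f X \<in> carrier G"
 by (rule additive_closed[OF additive_tlift])

lemma tlift_cong:
 assumes "abelian_group G" "balanced A M N G f"
  and "\<And>m n. m \<in> carrier M ==> n \<in> carrier N ==> f m n = g m n"
  and X: "X \<in> carrier MN"
 shows "tlift G f X = tlift G g X"
proof -
 have g: "balanced A M N G g"
  using assms(2,3) by (auto simp: balanced_def M.ract_closed N.lact_closed)
 show ?thesis by (rule tensor_eqI[OF assms(1) additive_tlift[OF assms(1,2)] additive_tlift[OF assms(1) g] _ X])
   (simp add: assms(1,2) g, rule assms(3))
qed

lemma tlift_comp:
 assumes "abelian_group G" "abelian_group H" "balanced A M N G f" "additive G H F"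
  and X: "X \<in> carrier MN"
 shows "F (tlift G f X) = tlift H (\<lambda>m n. F (f m n)) X"
 using assms(1-3) balanced_comp[OF assms(3,4)]
 by (intro tensor_eqI[OF assms(2) additive_comp[OF additive_tlift[OF assms(1,3)] assms(4)]
    additive_tlift[OF assms(2) balanced_comp[OF assms(3,4)]] _ X]) (simp add: assms(2))

lemma tlift_tens_self: "X \<in> carrier MN ==> tlift MN (tens A M N) X = X"
 by (rule tensor_eqI[OF ab additive_tlift[OF ab tens_balanced] additive_id]) (simp_all add: tens_balanced ab)

lemma additive_eq_tlift:
 assumes "abelian_group G" "additive MN G F" "X \<in> carrier MN"
 shows "F X = tlift G (\<lambda>m n. F (tens A M N m n)) X"
 using tlift_comp[OF ab assms(1) tens_balanced assms(2,3)] by (simp add: tlift_tens_self assms(3))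

lemma balanced_add_fun:
 assumes "abelian_group G" "balanced A M N G f" "balanced A M N G g"
 shows "balanced A M N G (\<lambda>m n. f m n \<oplus>\<^sub>G g m n)"
proof -
 interpret G: abelian_group G by fact
 show ?thesis using assms(2,3) by (auto simp: balanced_def G.a_ac)
qed

lemma tlift_add_fun:
 assumes "abelian_group G" "balanced A M N G f" "balanced A M N G g"
  and X: "X \<in> carrier MN"
 shows "tlift G (\<lambda>m n. f m n \<oplus>\<^sub>G g m n) X = tlift G f X \<oplus>\<^sub>G tlift G g X"
proof -
 interpret G: abelian_group G by fact
 have fg: "balanced A M N G (\<lambda>m n. f m n \<oplus>\<^sub>G g m n)" by (rule balanced_add_fun[OF assms(1-3)])
 show ?thesis
 proof (rule tensor_eqI[OF assms(1) additive_tlift[OF assms(1) fg] _ _ X])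
  show "additive MN G (\<lambda>X. tlift G f X \<oplus>\<^sub>G tlift G g X)"
   using assms by (intro additiveI) (auto simp: tlift_closed additive_add[OF additive_tlift] G.a_ac)
 qed (use assms fg in auto)
qed

end

text \<open>
 Fubini for Sweedler sums: two tensors that come from unrelated coactions may be summed in either order.
\<close>

lemma tlift_swap:
 assumes MN: "tensor_pair A M N" and PQ: "tensor_pair R P Q" and G: "abelian_group G"
  and f: "\<And>m n. m \<in> carrier M ==> n \<in> carrier N ==> balanced R P Q G (f m n)"
  and g: "\<And>p q. p \<in> carrier P ==> q \<in> carrier Q ==> balanced A M N G (\<lambda>m n. f m n p q)"
  and X: "X \<in> carrier (tensor A M N)" and Y: "Y \<in> carrier (tensor R P Q)"
 shows "tlift G (\<lambda>m n. tlift G (f m n) Y) X = tlift G (\<lambda>p q. tlift G (\<lambda>m n. f m n p q) X) Y"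
  and "balanced A M N G (\<lambda>m n. tlift G (f m n) Y)"
proof -
 interpret MN: tensor_pair A M N by fact
 interpret PQ: tensor_pair R P Q by fact
 interpret G: abelian_group G by fact
 have bal: "balanced A M N G (\<lambda>m n. tlift G (f m n) Y)" if "Y \<in> carrier (tensor R P Q)" for Y
 proof (rule balancedI)
  fix m m' n assume *: "m \<in> carrier M" "m' \<in> carrier M" "n \<in> carrier N"
  have "tlift G (f (m \<oplus>\<^sub>M m') n) Y = tlift G (\<lambda>p q. f m n p q \<oplus>\<^sub>G f m' n p q) Y"
   using * g by (intro PQ.tlift_cong G f that) (auto simp: balanced_def)
  then show "tlift G (f (m \<oplus>\<^sub>M m') n) Y = tlift G (f m n) Y \<oplus>\<^sub>G tlift G (f m' n) Y"
   using * that by (simp add: PQ.tlift_add_fun G f)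
 next
  fix m n n' assume *: "m \<in> carrier M" "n \<in> carrier N" "n' \<in> carrier N"
  have "tlift G (f m (n \<oplus>\<^sub>N n')) Y = tlift G (\<lambda>p q. f m n p q \<oplus>\<^sub>G f m n' p q) Y"
   using * g by (intro PQ.tlift_cong G f that) (auto simp: balanced_def)
  then show "tlift G (f m (n \<oplus>\<^sub>N n')) Y = tlift G (f m n) Y \<oplus>\<^sub>G tlift G (f m n') Y"
   using * that by (simp add: PQ.tlift_add_fun G f)
 next
  fix m a n assume *: "m \<in> carrier M" "a \<in> carrier A" "n \<in> carrier N"
  show "tlift G (f (m \<leftharpoonup>\<^sub>M a) n) Y = tlift G (f m (a \<rightharpoonup>\<^sub>N n)) Y"
   using * g by (intro PQ.tlift_cong G f that MN.M.ract_closed) (auto simp: balanced_def)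
 qed (auto intro: PQ.tlift_closed G f that)
 then show "balanced A M N G (\<lambda>m n. tlift G (f m n) Y)" using Y by blast
 show "tlift G (\<lambda>m n. tlift G (f m n) Y) X = tlift G (\<lambda>p q. tlift G (\<lambda>m n. f m n p q) X) Y"
  using X
 proof (induction X rule: MN.tensor_induct)
  case zero
  have "tlift G (\<lambda>p q. tlift G (\<lambda>m n. f m n p q) \<zero>\<^bsub>tensor A M N\<^esub>) Y = \<zero>\<^sub>G"
  proof -
   have z: "balanced R P Q G (\<lambda>p q. \<zero>\<^sub>G)" by (auto simp: balanced_def)
   have "tlift G (\<lambda>p q. \<zero>\<^sub>G) Y = tlift G (\<lambda>p q. tlift G (\<lambda>m n. f m n p q) \<zero>\<^bsub>tensor A M N\<^esub>) Y"
    using additive_zero[OF MN.additive_tlift[OF G g] MN.ab G] by (intro PQ.tlift_cong[OF G z _ Y]) auto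
   moreover have "tlift G (\<lambda>p q. \<zero>\<^sub>G) Y = \<zero>\<^sub>G"
    by (rule PQ.tensor_eqI[OF G PQ.additive_tlift[OF G z] additiveI _ Y]) (simp_all add: z G)
   ultimately show ?thesis by simp
  qed
  then show ?case
   using additive_zero[OF MN.additive_tlift[OF G bal[OF Y]] MN.ab G] by simp
 next
  case (tens m n)
  have "tlift G (f m n) Y = tlift G (\<lambda>p q. tlift G (\<lambda>m n. f m n p q) (tens A M N m n)) Y"
   using tens by (intro PQ.tlift_cong[OF G _ _ Y] f) (auto simp: G g)
  then show ?case using tens by (simp add: bal Y G)
 next
  case (add X X')
  have b: "balanced R P Q G (\<lambda>p q. tlift G (\<lambda>m n. f m n p q) X)" if "X \<in> carrier (tensor A M N)" for X
  proof (rule balancedI)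
   fix m m' n assume *: "m \<in> carrier P" "m' \<in> carrier P" "n \<in> carrier Q"
   have "tlift G (\<lambda>x y. f x y (m \<oplus>\<^sub>P m') n) X = tlift G (\<lambda>x y. f x y m n \<oplus>\<^sub>G f x y m' n) X"
    using * f by (intro MN.tlift_cong G g that) (auto simp: balanced_def)
   then show "tlift G (\<lambda>x y. f x y (m \<oplus>\<^sub>P m') n) X = tlift G (\<lambda>x y. f x y m n) X \<oplus>\<^sub>G tlift G (\<lambda>x y. f x y m' n) X"
    using * that by (simp add: MN.tlift_add_fun G g)
  next
   fix m n n' assume *: "m \<in> carrier P" "n \<in> carrier Q" "n' \<in> carrier Q"
   have "tlift G (\<lambda>x y. f x y m (n \<oplus>\<^sub>Q n')) X = tlift G (\<lambda>x y. f x y m n \<oplus>\<^sub>G f x y m n') X"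
    using * f by (intro MN.tlift_cong G g that) (auto simp: balanced_def)
   then show "tlift G (\<lambda>x y. f x y m (n \<oplus>\<^sub>Q n')) X = tlift G (\<lambda>x y. f x y m n) X \<oplus>\<^sub>G tlift G (\<lambda>x y. f x y m n') X"
    using * that by (simp add: MN.tlift_add_fun G g)
  next
   fix m a n assume *: "m \<in> carrier P" "a \<in> carrier R" "n \<in> carrier Q"
   show "tlift G (\<lambda>x y. f x y (m \<leftharpoonup>\<^sub>P a) n) X = tlift G (\<lambda>x y. f x y m (a \<rightharpoonup>\<^sub>Q n)) X"
    using * f by (intro MN.tlift_cong G g that PQ.M.ract_closed) (auto simp: balanced_def)
  qed (auto intro: MN.tlift_closed G g that)
  have "tlift G (\<lambda>p q. tlift G (\<lambda>m n. f m n p q) (X \<oplus>\<^bsub>tensor A M N\<^esub> X')) Y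
    = tlift G (\<lambda>p q. tlift G (\<lambda>m n. f m n p q) X \<oplus>\<^sub>G tlift G (\<lambda>m n. f m n p q) X') Y"
   using add additive_add[OF MN.additive_tlift[OF G g]] by (intro PQ.tlift_cong[OF G _ _ Y] b) auto
  also have "\<dots> = tlift G (\<lambda>p q. tlift G (\<lambda>m n. f m n p q) X) Y \<oplus>\<^sub>G tlift G (\<lambda>p q. tlift G (\<lambda>m n. f m n p q) X') Y"
   using add by (intro PQ.tlift_add_fun[OF G _ _ Y] b)
  finally show ?case
   using add additive_add[OF MN.additive_tlift[OF G bal[OF Y]]] by simp
 qed
qed

section \<open>Linear maps and tensor products of bimodules\<close>

lemma right_linear_additive: "right_linear A M N f ==> additive M N f" by (simp add: right_linear_def additive_def)

lemma left_linear_additive: "left_linear A M N f ==> additive M N f" by (simp add: left_linear_def additive_def)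

lemma right_linear_ract:
 "right_linear A M N f ==> m \<in> carrier M ==> a \<in> carrier A ==> f (m \<leftharpoonup>\<^sub>M a) = f m \<leftharpoonup>\<^sub>N a" by (simp add: right_linear_def)

lemma left_linear_lact:
 "left_linear A M N f ==> m \<in> carrier M ==> a \<in> carrier A ==> f (a \<rightharpoonup>\<^sub>M m) = a \<rightharpoonup>\<^sub>N f m" by (simp add: left_linear_def)

lemma right_linearI:
 assumes "additive M N f" "\<And>m a. m \<in> carrier M ==> a \<in> carrier A ==> f (m \<leftharpoonup>\<^sub>M a) = f m \<leftharpoonup>\<^sub>N a"
 shows "right_linear A M N f"
 using assms by (simp add: right_linear_def additive_def)

lemma left_linearI:
 assumes "additive M N f" "\<And>m a. m \<in> carrier M ==> a \<in> carrier A ==> f (a \<rightharpoonup>\<^sub>M m) = a \<rightharpoonup>\<^sub>N f m"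
 shows "left_linear A M N f"
 using assms by (simp add: left_linear_def additive_def)

lemmas right_linear_closed = additive_closed[OF right_linear_additive]
 and left_linear_closed = additive_closed[OF left_linear_additive]
 and right_linear_add = additive_add[OF right_linear_additive]
 and left_linear_add = additive_add[OF left_linear_additive]

lemma right_linear_id: "right_linear A M M (\<lambda>m. m)" by (intro right_linearI additive_id refl)

lemma left_id: "left_linear A M M (\<lambda>m. m)" by (intro left_linearI additive_id refl)

lemma right_linear_comp:
 "right_linear A M N f ==> right_linear A N P g ==> right_linear A M P (\<lambda>m. g (f m))"
 by (rule right_linearI[OF additive_comp[OF right_linear_additive right_linear_additive]])
  (simp_all add: right_linear_ract right_linear_closed)

lemma additive_add_fun:
 assumes "abelian_group H" "additive G H f" "additive G H g"
 shows "additive G H (\<lambda>x. f x \<oplus>\<^sub>H g x)"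
proof -
 interpret H: abelian_group H by fact
 show ?thesis using assms(2,3) by (intro additiveI) (simp_all add: additive_closed additive_add H.a_ac)
qed

context tensor_pair
begin

lemma balanced_lact:
 assumes "bimodule L A M" "l \<in> carrier L"
 shows "balanced A M N MN (\<lambda>m n. tens A M N (l \<rightharpoonup>\<^sub>M m) n)"
proof -
 interpret L: bimodule L A M by fact
 show ?thesis
  using assms(2) by (intro balancedI)
   (simp_all add: L.lact_closed L.lact_add_right tens_add1 tens_add2 L.lact_ract[symmetric]
    tens_middle[symmetric] M.ract_closed N.lact_closed)
qed

lemma balanced_ract:
 assumes "bimodule A R N" "r \<in> carrier R"
 shows "balanced A M N MN (\<lambda>m n. tens A M N m (n \<leftharpoonup>\<^sub>N r))"
proof -
 interpret R: bimodule A R N by fact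
 show ?thesis
  using assms(2) by (intro balancedI) (simp_all add: R.ract_closed R.ract_add_left tens_add1 tens_add2 R.lact_ract
    tens_middle M.ract_closed N.lact_closed)
qed

lemma additive_lact:
 "bimodule L A M ==> l \<in> carrier L ==> additive MN MN (\<lambda>X. l \<rightharpoonup>\<^sub>MN X)"
 unfolding tensor_lact by (intro additive_tlift ab balanced_lact)

lemma additive_ract:
 "bimodule A R N ==> r \<in> carrier R ==> additive MN MN (\<lambda>X. X \<leftharpoonup>\<^sub>MN r)"
 unfolding tensor_ract by (intro additive_tlift ab balanced_ract)

lemma lact_tens:
 "bimodule L A M ==> l \<in> carrier L ==> m \<in> carrier M ==> n \<in> carrier N
  ==> l \<rightharpoonup>\<^sub>MN tens A M N m n = tens A M N (l \<rightharpoonup>\<^sub>M m) n"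
 unfolding tensor_lact by (simp add: balanced_lact ab)

lemma ract_tens:
 "bimodule A R N ==> r \<in> carrier R ==> m \<in> carrier M ==> n \<in> carrier N
  ==> tens A M N m n \<leftharpoonup>\<^sub>MN r = tens A M N m (n \<leftharpoonup>\<^sub>N r)"
 unfolding tensor_ract by (simp add: balanced_ract ab)

lemma tlift_lact:
 assumes "bimodule L A M" "l \<in> carrier L" "abelian_group G" "balanced A M N G s" "X \<in> carrier MN"
 shows "tlift G s (l \<rightharpoonup>\<^sub>MN X) = tlift G (\<lambda>m n. s (l \<rightharpoonup>\<^sub>M m) n) X"
proof -
 interpret L: bimodule L A M by fact
 have "tlift G s (l \<rightharpoonup>\<^sub>MN X) = tlift G (\<lambda>m n. tlift G s (tens A M N (l \<rightharpoonup>\<^sub>M m) n)) X"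
  unfolding tensor_lact using assms by (intro tlift_comp ab balanced_lact additive_tlift)
 also have "\<dots> = tlift G (\<lambda>m n. s (l \<rightharpoonup>\<^sub>M m) n) X"
  using assms balanced_comp[OF balanced_lact[OF assms(1,2)] additive_tlift[OF assms(3,4)]]
  by (intro tlift_cong) (simp_all add: L.lact_closed)
 finally show ?thesis .
qed

lemma tlift_ract:
 assumes "bimodule A R N" "r \<in> carrier R" "abelian_group G" "balanced A M N G s" "X \<in> carrier MN"
 shows "tlift G s (X \<leftharpoonup>\<^sub>MN r) = tlift G (\<lambda>m n. s m (n \<leftharpoonup>\<^sub>N r)) X"
proof -
 interpret R: bimodule A R N by fact
 have "tlift G s (X \<leftharpoonup>\<^sub>MN r) = tlift G (\<lambda>m n. tlift G s (tens A M N m (n \<leftharpoonup>\<^sub>N r))) X"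
  unfolding tensor_ract using assms by (intro tlift_comp ab balanced_ract additive_tlift)
 also have "\<dots> = tlift G (\<lambda>m n. s m (n \<leftharpoonup>\<^sub>N r)) X"
  using assms balanced_comp[OF balanced_ract[OF assms(1,2)] additive_tlift[OF assms(3,4)]]
  by (intro tlift_cong) (simp_all add: R.ract_closed)
 finally show ?thesis .
qed

lemma right_module_tensor:
 assumes R: "bimodule A R N"
 shows "right_module R MN"
proof -
 interpret R: bimodule A R N by fact
 note ab = ab and ad = additive_ract[OF R] and rt = ract_tens[OF R]
 show ?thesis
 proof (intro right_module.intro right_module_axioms.intro R.S.ring_axioms ab)
  fix r s X assume "r \<in> carrier R" "s \<in> carrier R" "X \<in> carrier MN"
  then show "X \<leftharpoonup>\<^sub>MN (r \<oplus>\<^sub>R s) = X \<leftharpoonup>\<^sub>MN r \<oplus>\<^sub>MN X \<leftharpoonup>\<^sub>MN s"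
   by - (rule tensor_eqI[OF ab ad additive_add_fun[OF ab ad ad]], simp_all add: rt R.ract_add_right R.ract_closed tens_add2)
 next
  fix r s X assume "r \<in> carrier R" "s \<in> carrier R" "X \<in> carrier MN"
  then show "X \<leftharpoonup>\<^sub>MN (r \<otimes>\<^sub>R s) = X \<leftharpoonup>\<^sub>MN r \<leftharpoonup>\<^sub>MN s"
   by - (rule tensor_eqI[OF ab ad additive_comp[OF ad ad]], simp_all add: rt R.ract_mult R.ract_closed)
 next
  fix X assume "X \<in> carrier MN"
  then show "X \<leftharpoonup>\<^sub>MN \<one>\<^sub>R = X" by - (rule tensor_eqI[OF ab ad additive_id], simp_all add: rt R.ract_one)
 qed (simp_all add: additive_closed[OF ad] additive_add[OF ad])
qed

lemma balanced_tmap: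
 assumes "tensor_pair A M' N'" "right_linear A M' M f" "left_linear A N' N g"
 shows "balanced A M' N' MN (\<lambda>m n. tens A M N (f m) (g n))"
proof -
 interpret S: tensor_pair A M' N' by fact
 show ?thesis using assms(2,3)
  by (intro balancedI) (simp_all add: right_linear_closed left_linear_closed right_linear_add left_linear_add
   tens_add1 tens_add2 right_linear_ract left_linear_lact tens_middle)
qed

lemma additive_tmap:
 assumes "tensor_pair A M' N'" "right_linear A M' M f" "left_linear A N' N g"
 shows "additive (tensor A M' N') MN (tmap A M N f g)"
 unfolding tmap_def by (rule tensor_pair.additive_tlift[OF assms(1) ab balanced_tmap[OF assms]])

lemma tmap_tens:
 assumes "tensor_pair A M' N'" "right_linear A M' M f" "left_linear A N' N g" "m \<in> carrier M'" "n \<in> carrier N'"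
 shows "tmap A M N f g (tens A M' N' m n) = tens A M N (f m) (g n)"
 unfolding tmap_def by (rule tensor_pair.tlift_tens[OF assms(1) ab balanced_tmap[OF assms(1-3)] assms(4,5)])

lemma tlift_tmap:
 assumes S: "tensor_pair A M' N'" and fg: "right_linear A M' M f" "left_linear A N' N g"
  and G: "abelian_group G" and s: "balanced A M N G s" and X: "X \<in> carrier (tensor A M' N')"
 shows "tlift G s (tmap A M N f g X) = tlift G (\<lambda>m n. s (f m) (g n)) X"
proof -
 interpret S: tensor_pair A M' N' by fact
 have "tlift G s (tmap A M N f g X) = tlift G (\<lambda>m n. tlift G s (tens A M N (f m) (g n))) X"
  unfolding tmap_def by (rule S.tlift_comp[OF ab G balanced_tmap[OF S fg] additive_tlift[OF G s] X])
 also have "\<dots> = tlift G (\<lambda>m n. s (f m) (g n)) X"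
  using fg by (intro S.tlift_cong[OF G balanced_comp[OF balanced_tmap[OF S fg] additive_tlift[OF G s]] _ X])
   (simp add: G s right_linear_closed left_linear_closed)
 finally show ?thesis .
qed

end

section \<open>Comodules\<close>

definition trilinear ::
 "('a, 'y) ring_scheme => ('l, 'a, 'm, 'z1) bimod_scheme => ('a, 'a, 'n, 'z2) bimod_scheme
  => ('a, 'r, 'p, 'z4) bimod_scheme => ('g, 'z3) ring_scheme => ('m => 'n => 'p => 'g) => bool"
 where "trilinear A M N P G t \<longleftrightarrow>
  (\<forall>p\<in>carrier P. balanced A M N G (\<lambda>m n. t m n p)) \<and> (\<forall>m\<in>carrier M. balanced A N P G (t m))"

text \<open>
 A map on triples that is balanced in both places factors through \<open>(M \<otimes> N) \<otimes> P\<close>.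
\<close>

lemma trilinear_balanced:
 assumes MN: "tensor_pair A M N" and NP: "tensor_pair A N P" and N: "bimodule A A N"
  and G: "abelian_group G" and t: "trilinear A M N P G t"
 shows "balanced A (tensor A M N) P G (\<lambda>X p. tlift G (\<lambda>m n. t m n p) X)"
proof -
 interpret MN: tensor_pair A M N by fact
 interpret NP: tensor_pair A N P by fact
 interpret G: abelian_group G by fact
 interpret N: bimodule A A N by fact
 have t1: "\<And>p. p \<in> carrier P ==> balanced A M N G (\<lambda>m n. t m n p)"
  and t2: "\<And>m. m \<in> carrier M ==> balanced A N P G (t m)" using t by (auto simp: trilinear_def)
 show ?thesis
 proof (rule balancedI)
  fix X p q assume *: "X \<in> carrier (tensor A M N)" "p \<in> carrier P" "q \<in> carrier P"
  have "tlift G (\<lambda>m n. t m n (p \<oplus>\<^sub>P q)) X = tlift G (\<lambda>m n. t m n p \<oplus>\<^sub>G t m n q) X"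
   using * balancedD(3)[OF t2] by (intro MN.tlift_cong G t1) auto
  then show "tlift G (\<lambda>m n. t m n (p \<oplus>\<^sub>P q)) X = tlift G (\<lambda>m n. t m n p) X \<oplus>\<^sub>G tlift G (\<lambda>m n. t m n q) X"
   using * by (simp add: MN.tlift_add_fun G t1)
 next
  fix X a p assume *: "X \<in> carrier (tensor A M N)" "a \<in> carrier A" "p \<in> carrier P"
  have "tlift G (\<lambda>m n. t m n (a \<rightharpoonup>\<^sub>P p)) X = tlift G (\<lambda>m n. t m (n \<leftharpoonup>\<^sub>N a) p) X"
   using * balancedD(4)[OF t2] by (intro MN.tlift_cong G t1) (auto simp: NP.N.lact_closed)
  then show "tlift G (\<lambda>m n. t m n p) (X \<leftharpoonup>\<^bsub>tensor A M N\<^esub> a) = tlift G (\<lambda>m n. t m n (a \<rightharpoonup>\<^sub>P p)) X"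
   using * by (simp add: MN.tlift_ract[OF N _ G t1])
 qed (simp_all add: MN.tlift_closed[OF G t1] additive_add[OF MN.additive_tlift[OF G t1]])
qed

text \<open>
 Both the coring over itself and \<open>\<Sigma>\<close> are right comodules on which a second ring acts from
 the left by comodule maps.
\<close>

locale bicomodule = NB: bimodule R A N + right_comodule A C N \<rho>
 for A :: "('a, 'y1) ring_scheme" and R :: "('r, 'y2) ring_scheme"
  and C :: "('a, 'c, 'z1) coring_scheme"
  and N :: "('r, 'a, 'n, 'z2) bimod_scheme" and \<rho> :: "'n => ('n \<times> 'c \<Rightarrow>\<^sub>0 int) set" +
 assumes coact_left: "left_linear R N (tensor A N C) \<rho>"

sublocale coring \<subseteq> CC: tensor_pair A C C by (intro tensor_pair.intro right_module_axioms left_module_axioms)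

context coring
begin

lemmas comult_right_linear = comult_bimod_map[unfolded bimod_map_def, THEN conjunct2]
 and comult_left_linear = comult_bimod_map[unfolded bimod_map_def, THEN conjunct1]
 and counit_right_linear = counit_bimod_map[unfolded bimod_map_def, THEN conjunct2]
 and counit_left_linear = counit_bimod_map[unfolded bimod_map_def, THEN conjunct1]

lemma right_comodule_self: "right_comodule A C C (comult C)"
 by (intro right_comodule.intro right_comodule_axioms.intro coring_axioms right_module_axioms
   comult_right_linear coassoc counit_right)

lemma bicomodule_self: "bicomodule A A C C (comult C)"
 by (intro bicomodule.intro bicomodule_axioms.intro bimodule_axioms right_comodule_self comult_left_linear)

lemma right_module_tensor_coring: "right_module A M ==> right_module A (tensor A M C)"
 by (rule tensor_pair.right_module_tensor)
  (intro tensor_pair.intro left_module_axioms bimodule_axioms | assumption)+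

lemma tensor_pair_coring: "right_module A M ==> tensor_pair A M C" by (intro tensor_pair.intro left_module_axioms)

lemma comult_closed [simp]: "c \<in> carrier C ==> comult C c \<in> carrier (tensor A C C)"
 by (rule right_linear_closed[OF comult_right_linear])

lemma counit_closed [simp]: "c \<in> carrier C ==> counit C c \<in> carrier A"
 using right_linear_closed[OF counit_right_linear] by (simp add: regular_def)

lemma counit_simps:
 "c \<in> carrier C ==> d \<in> carrier C ==> counit C (c \<oplus>\<^sub>C d) = counit C c \<oplus>\<^sub>A counit C d"
 "c \<in> carrier C ==> a \<in> carrier A ==> counit C (c \<leftharpoonup>\<^sub>C a) = counit C c \<otimes>\<^sub>A a"
 "c \<in> carrier C ==> a \<in> carrier A ==> counit C (a \<rightharpoonup>\<^sub>C c) = a \<otimes>\<^sub>A counit C c"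
 using right_linear_add[OF counit_right_linear] right_linear_ract[OF counit_right_linear]
  left_linear_lact[OF counit_left_linear] by (simp_all add: regular_def)

end

sublocale right_comodule \<subseteq> MC: tensor_pair A M C by (intro C.tensor_pair_coring M.right_module_axioms)

sublocale right_comodule \<subseteq> MCC: tensor_pair A "tensor A M C" C
 by (intro C.tensor_pair_coring C.right_module_tensor_coring M.right_module_axioms)

lemma (in right_comodule) coact_closed [simp]: "m \<in> carrier M ==> \<rho> m \<in> carrier (tensor A M C)"
 by (rule right_linear_closed[OF coact_linear])

context bicomodule
begin

lemma tensor_pair_left: "right_module R X ==> tensor_pair R X N" by (intro tensor_pair.intro NB.left_module_axioms)

lemma right_module_tensor_left: "right_module R X ==> right_module A (tensor R X N)"
 by (intro tensor_pair.right_module_tensor[OF tensor_pair_left] NB.bimodule_axioms)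

lemma balanced_tens_tens:
 assumes X: "right_module R X" and x: "x \<in> carrier X"
 shows "balanced A N C (tensor A (tensor R X N) C) (\<lambda>n c. tens A (tensor R X N) C (tens R X N x n) c)"
proof -
 interpret XN: tensor_pair R X N by (rule tensor_pair_left[OF X])
 interpret XNC: tensor_pair A "tensor R X N" C by (rule C.tensor_pair_coring[OF right_module_tensor_left[OF X]])
 show ?thesis using x by (intro balancedI) (simp_all add: XN.tens_add2 XNC.tens_add1 XNC.tens_add2
    XNC.tens_middle[symmetric] XN.ract_tens[OF NB.bimodule_axioms])
qed

lemma balanced_tensor_coact:
 assumes X: "right_module R X" and G: "abelian_group G"
  and s: "balanced A (tensor R X N) C G s"
 shows "balanced R X N G (\<lambda>x n. tlift G (\<lambda>n' c. s (tens R X N x n') c) (\<rho> n))"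
  and "x \<in> carrier X ==> balanced A N C G (\<lambda>n' c. s (tens R X N x n') c)"
proof -
 interpret XN: tensor_pair R X N by (rule tensor_pair_left[OF X])
 interpret G: abelian_group G by fact
 have b: "balanced A N C G (\<lambda>n' c. s (tens R X N x n') c)" if "x \<in> carrier X" for x
  using s that by (intro balancedI)
   (simp_all add: XN.tens_add2 balancedD[OF s] XN.ract_tens[OF NB.bimodule_axioms, symmetric])
 show "x \<in> carrier X ==> balanced A N C G (\<lambda>n' c. s (tens R X N x n') c)" by (rule b)
 show "balanced R X N G (\<lambda>x n. tlift G (\<lambda>n' c. s (tens R X N x n') c) (\<rho> n))"
 proof (rule balancedI)
  fix x x' n assume *: "x \<in> carrier X" "x' \<in> carrier X" "n \<in> carrier N"
  have "tlift G (\<lambda>n' c. s (tens R X N (x \<oplus>\<^sub>X x') n') c) (\<rho> n)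
    = tlift G (\<lambda>n' c. s (tens R X N x n') c \<oplus>\<^sub>G s (tens R X N x' n') c) (\<rho> n)"
   using * by (intro MC.tlift_cong[OF G b]) (simp_all add: XN.tens_add1 balancedD[OF s])
  then show "tlift G (\<lambda>n' c. s (tens R X N (x \<oplus>\<^sub>X x') n') c) (\<rho> n) =
    tlift G (\<lambda>n' c. s (tens R X N x n') c) (\<rho> n) \<oplus>\<^sub>G tlift G (\<lambda>n' c. s (tens R X N x' n') c) (\<rho> n)"
   using * by (simp add: MC.tlift_add_fun[OF G b b])
 next
  fix x a n assume *: "x \<in> carrier X" "a \<in> carrier R" "n \<in> carrier N"
  have "tlift G (\<lambda>n' c. s (tens R X N x n') c) (\<rho> (a \<rightharpoonup>\<^sub>N n))
    = tlift G (\<lambda>n' c. s (tens R X N x (a \<rightharpoonup>\<^sub>N n')) c) (\<rho> n)"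
   using * by (simp add: left_linear_lact[OF coact_left] MC.tlift_lact[OF NB.bimodule_axioms _ G b])
  also have "\<dots> = tlift G (\<lambda>n' c. s (tens R X N (x \<leftharpoonup>\<^sub>X a) n') c) (\<rho> n)"
   using * by (intro MC.tlift_cong[OF G b, symmetric]) (simp_all add: XN.tens_middle XN.M.ract_closed)
  finally show "tlift G (\<lambda>n' c. s (tens R X N (x \<leftharpoonup>\<^sub>X a) n') c) (\<rho> n)
    = tlift G (\<lambda>n' c. s (tens R X N x n') c) (\<rho> (a \<rightharpoonup>\<^sub>N n))" by simp
 qed (simp_all add: MC.tlift_closed[OF G b] right_linear_add[OF coact_linear]
   additive_add[OF MC.additive_tlift[OF G b]])
qed

lemma tensor_coact_eq:
 "tensor_coact A C R X N \<rho> = tlift (tensor A (tensor R X N) C)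
  (\<lambda>x n. tlift (tensor A (tensor R X N) C) (\<lambda>n' c. tens A (tensor R X N) C (tens R X N x n') c) (\<rho> n))"
 by (intro ext) (simp add: tensor_coact_def Let_def)

lemma tensor_coact_tens:
 assumes X: "right_module R X" and xn: "x \<in> carrier X" "n \<in> carrier N"
 shows "tensor_coact A C R X N \<rho> (tens R X N x n)
  = tlift (tensor A (tensor R X N) C) (\<lambda>n' c. tens A (tensor R X N) C (tens R X N x n') c) (\<rho> n)"
proof -
 interpret XN: tensor_pair R X N by (rule tensor_pair_left[OF X])
 interpret XNC: tensor_pair A "tensor R X N" C by (rule C.tensor_pair_coring[OF right_module_tensor_left[OF X]])
 show ?thesis unfolding tensor_coact_eq
  by (rule XN.tlift_tens[OF XNC.ab balanced_tensor_coact(1)[OF X _ XNC.tens_balanced] xn])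
   (rule XNC.ab)
qed

lemma additive_tensor_coact:
 assumes X: "right_module R X"
 shows "additive (tensor R X N) (tensor A (tensor R X N) C) (tensor_coact A C R X N \<rho>)"
proof -
 interpret XN: tensor_pair R X N by (rule tensor_pair_left[OF X])
 interpret XNC: tensor_pair A "tensor R X N" C by (rule C.tensor_pair_coring[OF right_module_tensor_left[OF X]])
 show ?thesis unfolding tensor_coact_eq
  by (rule XN.additive_tlift[OF XNC.ab balanced_tensor_coact(1)[OF X _ XNC.tens_balanced]])
   (rule XNC.ab)
qed

lemma tlift_tensor_coact_tens:
 assumes X: "right_module R X" and G: "abelian_group G"
  and s: "balanced A (tensor R X N) C G s" and xn: "x \<in> carrier X" "n \<in> carrier N"
 shows "tlift G s (tensor_coact A C R X N \<rho> (tens R X N x n)) = tlift G (\<lambda>n' c. s (tens R X N x n') c) (\<rho> n)"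
proof -
 interpret XN: tensor_pair R X N by (rule tensor_pair_left[OF X])
 interpret XNC: tensor_pair A "tensor R X N" C by (rule C.tensor_pair_coring[OF right_module_tensor_left[OF X]])
 have "tlift G s (tensor_coact A C R X N \<rho> (tens R X N x n))
   = tlift G (\<lambda>n' c. tlift G s (tens A (tensor R X N) C (tens R X N x n') c)) (\<rho> n)"
  using xn unfolding tensor_coact_tens[OF X xn]
  by (intro MC.tlift_comp[OF XNC.ab G balanced_tens_tens[OF X] XNC.additive_tlift[OF G s]])
   simp_all
 also have "\<dots> = tlift G (\<lambda>n' c. s (tens R X N x n') c) (\<rho> n)"
  using xn by (intro MC.tlift_cong[OF G balanced_comp[OF balanced_tens_tens[OF X] XNC.additive_tlift[OF G s]]])
   (simp_all add: G s)
 finally show ?thesis .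
qed

lemma tlift_tensor_coact:
 assumes X: "right_module R X" and G: "abelian_group G"
  and s: "balanced A (tensor R X N) C G s" and Y: "Y \<in> carrier (tensor R X N)"
 shows "tlift G s (tensor_coact A C R X N \<rho> Y)
  = tlift G (\<lambda>x n. tlift G (\<lambda>n' c. s (tens R X N x n') c) (\<rho> n)) Y"
proof -
 interpret XN: tensor_pair R X N by (rule tensor_pair_left[OF X])
 interpret XNC: tensor_pair A "tensor R X N" C by (rule C.tensor_pair_coring[OF right_module_tensor_left[OF X]])
 show ?thesis by (rule XN.tensor_eqI[OF G additive_comp[OF additive_tensor_coact[OF X] XNC.additive_tlift[OF G s]]
     XN.additive_tlift[OF G balanced_tensor_coact(1)[OF X G s]] _ Y])
   (simp add: tlift_tensor_coact_tens[OF X G s] G balanced_tensor_coact(1)[OF X G s])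
qed

end

context right_comodule
begin

text \<open>
 Coassociativity in Sweedler form: \<open>t(m\<^sub>[\<^sub>0\<^sub>]\<^sub>[\<^sub>0\<^sub>], m\<^sub>[\<^sub>0\<^sub>]\<^sub>[\<^sub>1\<^sub>], m\<^sub>[\<^sub>1\<^sub>]) = t(m\<^sub>[\<^sub>0\<^sub>], m\<^sub>[\<^sub>1\<^sub>]\<^sub>(\<^sub>1\<^sub>), m\<^sub>[\<^sub>1\<^sub>]\<^sub>(\<^sub>2\<^sub>))\<close> for every
 map \<open>t\<close> that factors through \<open>M \<otimes> C \<otimes> C\<close>.
\<close>

lemma coassoc_tlift:
 assumes G: "abelian_group G" and t: "trilinear A M C C G t" and u: "u \<in> carrier M"
 shows "tlift G (\<lambda>v d. tlift G (\<lambda>m c. t m c d) (\<rho> v)) (\<rho> u)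
  = tlift G (\<lambda>v c. tlift G (t v) (comult C c)) (\<rho> u)"
  and "balanced A M C G (\<lambda>v d. tlift G (\<lambda>m c. t m c d) (\<rho> v))"
  and "balanced A M C G (\<lambda>v c. tlift G (t v) (comult C c))"
proof -
 interpret CB: bicomodule A A C C "comult C" by (rule C.bicomodule_self)
 have M: "right_module A M" by (rule M.right_module_axioms)
 have b: "balanced A (tensor A M C) C G (\<lambda>X d. tlift G (\<lambda>m c. t m c d) X)"
  by (rule trilinear_balanced[OF MC.tensor_pair_axioms C.CC.tensor_pair_axioms C.bimodule_axioms G t])
 have t1: "\<And>p. p \<in> carrier C ==> balanced A M C G (\<lambda>m n. t m n p)"
  and t2: "\<And>m. m \<in> carrier M ==> balanced A C C G (t m)" using t by (auto simp: trilinear_def)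
 have *: "tlift G (\<lambda>n' c. tlift G (\<lambda>m c'. t m c' c) (tens A M C v n')) (comult C c)
   = tlift G (t v) (comult C c)" if "v \<in> carrier M" "c \<in> carrier C" for v c
  using that by (intro C.CC.tlift_cong[OF G CB.balanced_tensor_coact(2)[OF M G b]]) (simp_all add: G t1)
 show "balanced A M C G (\<lambda>v d. tlift G (\<lambda>m c. t m c d) (\<rho> v))"
  by (rule balancedI) (simp_all add: balancedD[OF b] right_linear_add[OF coact_linear] right_linear_ract[OF coact_linear])
 have b2: "balanced A M C G (\<lambda>v c. tlift G (\<lambda>n' c. tlift G (\<lambda>m c'. t m c' c) (tens A M C v n')) (comult C c))"
  by (rule CB.balanced_tensor_coact(1)[OF M G b])
 then show "balanced A M C G (\<lambda>v c. tlift G (t v) (comult C c))"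
  by (auto simp: balanced_def * M.ract_closed C.lact_closed)
 have "tlift G (\<lambda>v d. tlift G (\<lambda>m c. t m c d) (\<rho> v)) (\<rho> u)
   = tlift G (\<lambda>X d. tlift G (\<lambda>m c. t m c d) X) (tmap A (tensor A M C) C \<rho> (\<lambda>c. c) (\<rho> u))"
  using u by (intro MCC.tlift_tmap[OF MC.tensor_pair_axioms coact_linear left_id G b, symmetric]) simp
 also have "\<dots> = tlift G (\<lambda>X d. tlift G (\<lambda>m c. t m c d) X) (tensor_coact A C A M C (comult C) (\<rho> u))"
  using u by (simp add: coact_coassoc)
 also have "\<dots> = tlift G (\<lambda>v c. tlift G (\<lambda>n' c. tlift G (\<lambda>m c'. t m c' c) (tens A M C v n')) (comult C c)) (\<rho> u)"
  using u by (intro CB.tlift_tensor_coact[OF M G b]) simp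
 also have "\<dots> = tlift G (\<lambda>v c. tlift G (t v) (comult C c)) (\<rho> u)"
  using u by (intro MC.tlift_cong[OF G b2 *]) simp_all
 finally show "tlift G (\<lambda>v d. tlift G (\<lambda>m c. t m c d) (\<rho> v)) (\<rho> u)
  = tlift G (\<lambda>v c. tlift G (t v) (comult C c)) (\<rho> u)" .
qed

end

section \<open>Colinear maps\<close>

definition colinear ::
 "('a, 'y) ring_scheme => ('a, 'c, 'z1) coring_scheme
  => ('l1, 'a, 'm, 'z2) bimod_scheme => ('m => ('m \<times> 'c \<Rightarrow>\<^sub>0 int) set)
  => ('l2, 'a, 'n, 'z3) bimod_scheme => ('n => ('n \<times> 'c \<Rightarrow>\<^sub>0 int) set) => ('m => 'n) => bool"
 where "colinear A C M \<rho> N \<sigma> f \<longleftrightarrow> right_linear A M N f \<and>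
  (\<forall>m\<in>carrier M. \<sigma> (f m) = tmap A N C f (\<lambda>c. c) (\<rho> m))"

lemma mem_comod_Hom_iff:
 "f \<in> comod_Hom A C M \<rho> N \<sigma> \<longleftrightarrow> f \<in> extensional (carrier M) \<and> colinear A C M \<rho> N \<sigma> f"
 by (auto simp: comod_Hom_def right_Hom_def colinear_def)

lemma colinear_right_linear: "colinear A C M \<rho> N \<sigma> f ==> right_linear A M N f" by (simp add: colinear_def)

lemmas colinear_closed = right_linear_closed[OF colinear_right_linear]
lemmas colinear_ract = right_linear_ract[OF colinear_right_linear]
lemmas colinear_additive = right_linear_additive[OF colinear_right_linear]

lemma colinear_coact:
 "colinear A C M \<rho> N \<sigma> f ==> m \<in> carrier M ==> \<sigma> (f m) = tmap A N C f (\<lambda>c. c) (\<rho> m)" by (simp add: colinear_def)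

lemma right_linear_cong:
 assumes "right_module A M" "right_linear A M N f" "\<And>m. m \<in> carrier M ==> f m = g m"
 shows "right_linear A M N g"
proof -
 interpret right_module A M by fact
 show ?thesis using assms(2,3) by (auto simp: right_linear_def hom_def Pi_iff ract_closed)
qed

context right_comodule
begin

lemma tmap_coact_cong:
 assumes "right_module A N" "right_linear A M N f" "\<And>m. m \<in> carrier M ==> f m = g m" "X \<in> carrier (tensor A M C)"
 shows "tmap A N C f (\<lambda>c. c) X = tmap A N C g (\<lambda>c. c) X"
proof -
 interpret NC: tensor_pair A N C using assms(1) by (rule C.tensor_pair_coring)
 show ?thesis unfolding tmap_def
  by (intro MC.tlift_cong[OF NC.ab NC.balanced_tmap[OF MC.tensor_pair_axioms assms(2) left_id] _ assms(4)])
   (simp add: assms(3))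
qed

lemma colinear_cong:
 assumes "right_module A N" "colinear A C M \<rho> N \<sigma> f" "\<And>m. m \<in> carrier M ==> f m = g m"
 shows "colinear A C M \<rho> N \<sigma> g"
 using assms right_linear_cong[OF M.right_module_axioms, of N f g] tmap_coact_cong[OF assms(1), of f g]
 by (auto simp: colinear_def)

lemma colinear_restrict:
 assumes "right_module A N" "colinear A C M \<rho> N \<sigma> f"
 shows "restrict f (carrier M) \<in> comod_Hom A C M \<rho> N \<sigma>"
 using colinear_cong[OF assms, of "restrict f (carrier M)"] by (auto simp: mem_comod_Hom_iff)

lemma tlift_colinear:
 assumes N: "right_module A N" and f: "colinear A C M \<rho> N \<sigma> f"
  and G: "abelian_group G" and s: "balanced A N C G s" and m: "m \<in> carrier M"
 shows "tlift G s (\<sigma> (f m)) = tlift G (\<lambda>m c. s (f m) c) (\<rho> m)"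
proof -
 interpret NC: tensor_pair A N C using N by (rule C.tensor_pair_coring)
 show ?thesis
  using m unfolding colinear_coact[OF f m]
  by (intro NC.tlift_tmap[OF MC.tensor_pair_axioms colinear_right_linear[OF f] left_id G s]) simp
qed

lemma colinear_id: "colinear A C M \<rho> M \<rho> (\<lambda>m. m)"
 unfolding colinear_def tmap_def by (simp add: right_linear_id MC.tlift_tens_self)

lemma colinear_comp:
 assumes N: "right_comodule A C N \<sigma>" and P: "right_module A P"
  and f: "colinear A C M \<rho> N \<sigma> f" and g: "colinear A C N \<sigma> P \<pi> g"
 shows "colinear A C M \<rho> P \<pi> (\<lambda>m. g (f m))"
proof -
 interpret N: right_comodule A C N \<sigma> by fact
 interpret PC: tensor_pair A P C using P by (rule C.tensor_pair_coring)
 have "\<pi> (g (f m)) = tmap A P C (\<lambda>m. g (f m)) (\<lambda>c. c) (\<rho> m)" if m: "m \<in> carrier M" for m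
  using tlift_colinear[OF N.M.right_module_axioms f PC.ab
    PC.balanced_tmap[OF N.MC.tensor_pair_axioms colinear_right_linear[OF g] left_id] m]
   colinear_coact[OF g, of "f m"] colinear_closed[OF f m] by (simp add: tmap_def)
 then show ?thesis
  using right_linear_comp[OF colinear_right_linear[OF f] colinear_right_linear[OF g]] by (simp add: colinear_def)
qed

lemma colinear_add:
 assumes N: "right_comodule A C N \<sigma>"
  and f: "colinear A C M \<rho> N \<sigma> f" and g: "colinear A C M \<rho> N \<sigma> g"
 shows "colinear A C M \<rho> N \<sigma> (\<lambda>m. f m \<oplus>\<^sub>N g m)"
proof -
 interpret N: right_comodule A C N \<sigma> by fact
 note fc = colinear_closed[OF f] and gc = colinear_closed[OF g]
 note bal = N.MC.balanced_tmap[OF MC.tensor_pair_axioms _ left_id]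
 have rl: "right_linear A M N (\<lambda>m. f m \<oplus>\<^sub>N g m)"
  using additive_add_fun[OF N.M.ab colinear_additive[OF f] colinear_additive[OF g]] fc gc
  by (intro right_linearI) (simp_all add: colinear_ract[OF f] colinear_ract[OF g] N.M.ract_add_left)
 have "\<sigma> (f m \<oplus>\<^sub>N g m) = tmap A N C (\<lambda>m. f m \<oplus>\<^sub>N g m) (\<lambda>c. c) (\<rho> m)" if m: "m \<in> carrier M" for m
 proof -
  have "tmap A N C (\<lambda>m. f m \<oplus>\<^sub>N g m) (\<lambda>c. c) (\<rho> m)
    = tlift (tensor A N C) (\<lambda>m n. tens A N C (f m) n \<oplus>\<^bsub>tensor A N C\<^esub> tens A N C (g m) n) (\<rho> m)"
   unfolding tmap_def using m by (intro MC.tlift_cong[OF N.MC.ab bal[OF rl]]) (simp_all add: N.MC.tens_add1 fc gc)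
  also have "\<dots> = \<sigma> (f m) \<oplus>\<^bsub>tensor A N C\<^esub> \<sigma> (g m)"
   unfolding colinear_coact[OF f m] colinear_coact[OF g m] tmap_def using m
   by (intro MC.tlift_add_fun[OF N.MC.ab bal bal] colinear_right_linear[OF f] colinear_right_linear[OF g]) simp
  also have "\<dots> = \<sigma> (f m \<oplus>\<^sub>N g m)"
   using m fc gc by (simp add: right_linear_add[OF N.coact_linear])
  finally show ?thesis by simp
 qed
 then show ?thesis using rl by (simp add: colinear_def)
qed

lemma colinear_zero:
 assumes N: "right_comodule A C N \<sigma>"
 shows "colinear A C M \<rho> N \<sigma> (\<lambda>m. \<zero>\<^sub>N)"
proof -
 interpret N: right_comodule A C N \<sigma> by fact
 have z: "\<zero>\<^sub>N \<leftharpoonup>\<^sub>N a = \<zero>\<^sub>N" if "a \<in> carrier A" for a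
  using that by (intro additive_zero[where f = "\<lambda>n. n \<leftharpoonup>\<^sub>N a"] additiveI N.M.ab)
   (simp_all add: N.M.ract_closed N.M.ract_add_left)
 have rl: "right_linear A M N (\<lambda>m. \<zero>\<^sub>N)" by (intro right_linearI additiveI) (simp_all add: z)
 have tz: "tens A N C \<zero>\<^sub>N c = \<zero>\<^bsub>tensor A N C\<^esub>" if "c \<in> carrier C" for c
  using additive_zero[OF balanced_additive1[OF N.MC.tens_balanced that]] N.M.ab N.MC.ab by blast
 have "tmap A N C (\<lambda>m. \<zero>\<^sub>N) (\<lambda>c. c) X = \<zero>\<^bsub>tensor A N C\<^esub>" if "X \<in> carrier (tensor A M C)" for X
  by (rule MC.tensor_eqI[OF N.MC.ab
     N.MC.additive_tmap[OF MC.tensor_pair_axioms rl left_id] additiveI _ that])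
   (simp_all add: N.MC.tmap_tens[OF MC.tensor_pair_axioms rl left_id] tz)
 moreover have "\<sigma> \<zero>\<^sub>N = \<zero>\<^bsub>tensor A N C\<^esub>"
  by (rule additive_zero[OF right_linear_additive[OF N.coact_linear] N.M.ab N.MC.ab])
 ultimately show ?thesis using rl by (simp add: colinear_def)
qed

end

section \<open>The comodule \<open>X \<otimes> N\<close>, and transport of structure\<close>

text \<open>
 To verify that a right linear map is a coaction, it is enough to do so on elements that generate the module additively.
 When these are images of comodule elements under intertwining maps, the axioms carry over; this covers \<open>X \<otimes> N\<close>, which is
 generated by the images of \<open>n \<mapsto> x \<otimes> n\<close>, and transport along isomorphisms.
\<close>

lemma (in right_comodule) coaction_on_image:
 assumes M': "right_module A M'" and lin: "right_linear A M' (tensor A M' C) \<rho>'"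
  and j: "colinear A C M \<rho> M' \<rho>' j" and u: "u \<in> carrier M"
 shows "tmap A (tensor A M' C) C \<rho>' (\<lambda>c. c) (\<rho>' (j u)) = tensor_coact A C A M' C (comult C) (\<rho>' (j u))"
  and "tlift M' (\<lambda>m' c. m' \<leftharpoonup>\<^sub>M' counit C c) (\<rho>' (j u)) = j u"
proof -
 let ?W = "tensor A M' C" and ?WC = "tensor A (tensor A M' C) C"
 interpret M': right_module A M' by fact
 interpret M'C: tensor_pair A M' C by (rule C.tensor_pair_coring[OF M'])
 interpret W: right_module A ?W by (rule C.right_module_tensor_coring[OF M'])
 interpret WC: tensor_pair A ?W C by (rule C.tensor_pair_coring[OF W.right_module_axioms])
 interpret CB: bicomodule A A C C "comult C" by (rule C.bicomodule_self)
 note jl = colinear_right_linear[OF j] and jc = colinear_closed[OF j] and \<rho>'j = colinear_coact[OF j]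
 note tl = M'C.tlift_tmap[OF MC.tensor_pair_axioms jl left_id]
 have b: "balanced A M C ?W (\<lambda>m c. tens A M' C (j m) c)" by (rule M'C.balanced_tmap[OF MC.tensor_pair_axioms jl left_id])
 define t where "t = (\<lambda>n' c d. tens A ?W C (tens A M' C (j n') c) d)"
 have t: "trilinear A M C C ?WC t"
  unfolding trilinear_def
 proof (intro conjI ballI)
  fix d assume "d \<in> carrier C"
  then show "balanced A M C ?WC (\<lambda>n c. t n c d)"
   unfolding t_def by (intro balanced_comp[OF b] balanced_additive1[OF WC.tens_balanced])
 next
  fix n' assume "n' \<in> carrier M"
  then show "balanced A C C ?WC (t n')"
   unfolding t_def using jc by (intro CB.balanced_tens_tens[OF M']) simp
 qed
 have "tmap A ?W C \<rho>' (\<lambda>c. c) (\<rho>' (j u)) = tlift ?WC (\<lambda>n d. tens A ?W C (\<rho>' (j n)) d) (\<rho> u)"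
  unfolding \<rho>'j[OF u] using u unfolding tmap_def[of _ ?W]
  by (intro tl[OF WC.ab WC.balanced_tmap[OF M'C.tensor_pair_axioms lin left_id]]) simp
 also have "\<dots> = tlift ?WC (\<lambda>n' d. tlift ?WC (\<lambda>n'' c. t n'' c d) (\<rho> n')) (\<rho> u)"
 proof (rule MC.tlift_cong[symmetric])
  fix n' d assume *: "n' \<in> carrier M" "d \<in> carrier C"
  show "tlift ?WC (\<lambda>n'' c. t n'' c d) (\<rho> n') = tens A ?W C (\<rho>' (j n')) d"
   unfolding \<rho>'j[OF *(1)] t_def tmap_def using *
   by (intro MC.tlift_comp[OF M'C.ab WC.ab b balanced_additive1[OF WC.tens_balanced *(2)], symmetric]) simp
 qed (use u coassoc_tlift(2)[OF WC.ab t u] WC.ab in simp_all)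
 also have "\<dots> = tlift ?WC (\<lambda>n' c. tlift ?WC (t n') (comult C c)) (\<rho> u)" by (rule coassoc_tlift(1)[OF WC.ab t u])
 also have "\<dots> = tensor_coact A C A M' C (comult C) (\<rho>' (j u))"
  unfolding CB.tensor_coact_eq t_def \<rho>'j[OF u] using u
  by (intro tl[OF WC.ab CB.balanced_tensor_coact(1)[OF M' WC.ab WC.tens_balanced], symmetric]) simp
 finally show "tmap A ?W C \<rho>' (\<lambda>c. c) (\<rho>' (j u)) = tensor_coact A C A M' C (comult C) (\<rho>' (j u))" .
 have bc: "balanced A M' C M' (\<lambda>m' c. m' \<leftharpoonup>\<^sub>M' counit C c)"
  by (rule balancedI) (simp_all add: M'.ract_closed M'.ract_add_left M'.ract_add_right M'.ract_mult C.counit_simps)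
 have bn: "balanced A M C M (\<lambda>m' c. m' \<leftharpoonup>\<^sub>M counit C c)"
  by (rule balancedI) (simp_all add: M.ract_closed M.ract_add_left M.ract_add_right M.ract_mult C.counit_simps)
 have "tlift M' (\<lambda>m' c. m' \<leftharpoonup>\<^sub>M' counit C c) (\<rho>' (j u)) = tlift M' (\<lambda>m' c. j m' \<leftharpoonup>\<^sub>M' counit C c) (\<rho> u)"
  unfolding \<rho>'j[OF u] using u by (intro tl[OF M'.ab bc]) simp
 also have "\<dots> = tlift M' (\<lambda>m' c. j (m' \<leftharpoonup>\<^sub>M counit C c)) (\<rho> u)"
  using u by (intro MC.tlift_cong[symmetric, OF M'.ab balanced_comp[OF bn right_linear_additive[OF jl]]])
   (simp_all add: right_linear_ract[OF jl])
 also have "\<dots> = j u"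
  using u by (subst MC.tlift_comp[symmetric, OF M.ab M'.ab bn right_linear_additive[OF jl]])
   (simp_all add: coact_counit)
 finally show "tlift M' (\<lambda>m' c. m' \<leftharpoonup>\<^sub>M' counit C c) (\<rho>' (j u)) = j u" .
qed

lemma (in bicomodule) colinear_tens:
 assumes X: "right_module R X" and x: "x \<in> carrier X"
 shows "colinear A C N \<rho> (tensor R X N) (tensor_coact A C R X N \<rho>) (tens R X N x)"
proof -
 interpret XN: tensor_pair R X N by (rule tensor_pair_left[OF X])
 show ?thesis unfolding colinear_def tmap_def
  using x balanced_additive2[OF XN.tens_balanced x]
  by (auto intro!: right_linearI simp: tensor_coact_tens[OF X] XN.ract_tens[OF NB.bimodule_axioms])
qed

lemma (in bicomodule) right_comodule_tensor:
 assumes X: "right_module R X"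
 shows "right_comodule A C (tensor R X N) (tensor_coact A C R X N \<rho>)"
proof -
 let ?L = "tensor R X N" and ?tc = "tensor_coact A C R X N \<rho>"
 interpret XN: tensor_pair R X N by (rule tensor_pair_left[OF X])
 interpret L: right_module A ?L by (rule right_module_tensor_left[OF X])
 interpret LC: tensor_pair A ?L C by (rule C.tensor_pair_coring[OF L.right_module_axioms])
 interpret W: right_module A "tensor A ?L C" by (rule C.right_module_tensor_coring[OF L.right_module_axioms])
 interpret WC: tensor_pair A "tensor A ?L C" C by (rule C.tensor_pair_coring[OF W.right_module_axioms])
 interpret CB: bicomodule A A C C "comult C" by (rule C.bicomodule_self)
 let ?W = "tensor A ?L C" and ?WC = "tensor A (tensor A ?L C) C"
 note LM = L.right_module_axioms
 note add = additive_tensor_coact[OF X]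
 have lin: "right_linear A ?L ?W ?tc"
 proof (rule right_linearI[OF add])
  fix Y a assume Y: "Y \<in> carrier ?L" and a: "a \<in> carrier A"
  show "?tc (Y \<leftharpoonup>\<^bsub>?L\<^esub> a) = ?tc Y \<leftharpoonup>\<^bsub>?W\<^esub> a"
  proof (rule XN.tensor_eqI[OF LC.ab
     additive_comp[OF XN.additive_ract[OF NB.bimodule_axioms a] add]
     additive_comp[OF add LC.additive_ract[OF C.bimodule_axioms a]] _ Y])
   fix x n assume xn: "x \<in> carrier X" "n \<in> carrier N"
   note b = balanced_tens_tens[OF X xn(1)]
   have "?tc (tens R X N x n \<leftharpoonup>\<^bsub>?L\<^esub> a) = tlift ?W (\<lambda>n' c. tens A ?L C (tens R X N x n') c) (\<rho> n \<leftharpoonup>\<^bsub>tensor A N C\<^esub> a)"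
    using xn a by (simp add: XN.ract_tens[OF NB.bimodule_axioms] tensor_coact_tens[OF X] NB.ract_closed
      right_linear_ract[OF coact_linear])
   also have "\<dots> = tlift ?W (\<lambda>n' c. tens A ?L C (tens R X N x n') (c \<leftharpoonup>\<^sub>C a)) (\<rho> n)"
    using xn by (intro MC.tlift_ract[OF C.bimodule_axioms a LC.ab b]) simp
   also have "\<dots> = tlift ?W (\<lambda>n' c. tens A ?L C (tens R X N x n') c \<leftharpoonup>\<^bsub>?W\<^esub> a) (\<rho> n)"
    using xn a by (intro MC.tlift_cong[OF LC.ab
       balanced_comp[OF b LC.additive_ract[OF C.bimodule_axioms a]], symmetric])
     (simp_all add: LC.ract_tens[OF C.bimodule_axioms])
   also have "\<dots> = ?tc (tens R X N x n) \<leftharpoonup>\<^bsub>?W\<^esub> a"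
    using xn unfolding tensor_coact_tens[OF X xn] by (intro MC.tlift_comp[OF LC.ab LC.ab b
      LC.additive_ract[OF C.bimodule_axioms a], symmetric]) simp
   finally show "?tc (tens R X N x n \<leftharpoonup>\<^bsub>?L\<^esub> a) = ?tc (tens R X N x n) \<leftharpoonup>\<^bsub>?W\<^esub> a" .
  qed
 qed
 show ?thesis
 proof (intro right_comodule.intro right_comodule_axioms.intro C.coring_axioms LM lin)
  fix Y assume Y: "Y \<in> carrier ?L"
  show "tmap A ?W C ?tc (\<lambda>c. c) (?tc Y) = tensor_coact A C A ?L C (comult C) (?tc Y)"
   by (rule XN.tensor_eqI[OF WC.ab additive_comp[OF add WC.additive_tmap[OF LC.tensor_pair_axioms lin left_id]]
      additive_comp[OF add CB.additive_tensor_coact[OF LM]] coaction_on_image(1)[OF LM lin colinear_tens[OF X]] Y])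
 next
  fix Y assume Y: "Y \<in> carrier ?L"
  have bc: "balanced A ?L C ?L (\<lambda>m' c. m' \<leftharpoonup>\<^bsub>?L\<^esub> counit C c)"
   by (rule balancedI) (simp_all add: L.ract_closed L.ract_add_left L.ract_add_right L.ract_mult C.counit_simps)
  show "tlift ?L (\<lambda>m' c. m' \<leftharpoonup>\<^bsub>?L\<^esub> counit C c) (?tc Y) = Y"
   by (rule XN.tensor_eqI[OF XN.ab additive_comp[OF add LC.additive_tlift[OF XN.ab bc]] additive_id
      coaction_on_image(2)[OF LM lin colinear_tens[OF X]] Y])
 qed
qed

text \<open>
 A module isomorphic to a comodule is a comodule.  This moves comodules into a universe.
\<close>

lemma (in right_comodule) right_comodule_transport:
 assumes M': "right_module A M'" and \<iota>: "right_linear A M M' \<iota>" and \<kappa>: "right_linear A M' M \<kappa>"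
  and inv: "\<And>m. m \<in> carrier M ==> \<kappa> (\<iota> m) = m" "\<And>m. m \<in> carrier M' ==> \<iota> (\<kappa> m) = m"
  and \<rho>': "\<rho>' = (\<lambda>m. tmap A M' C \<iota> (\<lambda>c. c) (\<rho> (\<kappa> m)))"
 shows "right_comodule A C M' \<rho>'" and "colinear A C M \<rho> M' \<rho>' \<iota>" and "colinear A C M' \<rho>' M \<rho> \<kappa>"
proof -
 interpret M': right_module A M' by fact
 interpret M'C: tensor_pair A M' C by (rule C.tensor_pair_coring[OF M'])
 note \<iota>c = right_linear_closed[OF \<iota>] and \<kappa>c = right_linear_closed[OF \<kappa>]
 let ?W = "tensor A M' C"
 note tl = M'C.tlift_tmap[OF MC.tensor_pair_axioms \<iota> left_id]
 have lin_tmap: "right_linear A (tensor A M C) ?W (tmap A M' C \<iota> (\<lambda>c. c))"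
 proof (rule right_linearI[OF M'C.additive_tmap[OF MC.tensor_pair_axioms \<iota> left_id]])
  fix X a assume X: "X \<in> carrier (tensor A M C)" and a: "a \<in> carrier A"
  show "tmap A M' C \<iota> (\<lambda>c. c) (X \<leftharpoonup>\<^bsub>tensor A M C\<^esub> a) = tmap A M' C \<iota> (\<lambda>c. c) X \<leftharpoonup>\<^bsub>?W\<^esub> a"
   using a by - (rule MC.tensor_eqI[OF M'C.ab
     additive_comp[OF MC.additive_ract[OF C.bimodule_axioms a] M'C.additive_tmap[OF MC.tensor_pair_axioms \<iota> left_id]]
     additive_comp[OF M'C.additive_tmap[OF MC.tensor_pair_axioms \<iota> left_id] M'C.additive_ract[OF C.bimodule_axioms a]] _ X],
    simp add: MC.ract_tens[OF C.bimodule_axioms] M'C.ract_tens[OF C.bimodule_axioms] \<iota>c C.ract_closed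
     M'C.tmap_tens[OF MC.tensor_pair_axioms \<iota> left_id])
 qed
 have lin: "right_linear A M' ?W \<rho>'"
  unfolding \<rho>' by (rule right_linear_comp[OF right_linear_comp[OF \<kappa> coact_linear] lin_tmap])
 have \<rho>'\<iota>: "\<rho>' (\<iota> m) = tmap A M' C \<iota> (\<lambda>c. c) (\<rho> m)" if "m \<in> carrier M" for m
  using that by (simp add: \<rho>' inv)
 show \<iota>\<rho>: "colinear A C M \<rho> M' \<rho>' \<iota>" unfolding colinear_def using \<iota> \<rho>'\<iota> by simp
 note image = coaction_on_image[OF M' lin \<iota>\<rho> \<kappa>c]
 show "right_comodule A C M' \<rho>'" by (intro right_comodule.intro right_comodule_axioms.intro C.coring_axioms M' lin)
   (use image in \<open>simp_all only: inv(2)\<close>)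
 show "colinear A C M' \<rho>' M \<rho> \<kappa>"
  unfolding colinear_def
 proof (intro conjI ballI \<kappa>)
  fix x assume x: "x \<in> carrier M'"
  have "tmap A M C \<kappa> (\<lambda>c. c) (\<rho>' x) = tlift (tensor A M C) (\<lambda>m c. tens A M C (\<kappa> (\<iota> m)) c) (\<rho> (\<kappa> x))"
   unfolding \<rho>' tmap_def[of _ M] using x \<kappa>c
   by (intro tl[OF MC.ab MC.balanced_tmap[OF M'C.tensor_pair_axioms \<kappa> left_id]]) simp
  also have "\<dots> = tlift (tensor A M C) (tens A M C) (\<rho> (\<kappa> x))"
   using x \<kappa>c by (intro MC.tlift_cong[symmetric, OF MC.ab MC.tens_balanced]) (simp_all add: inv)
  finally show "\<rho> (\<kappa> x) = tmap A M C \<kappa> (\<lambda>c. c) (\<rho>' x)"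
   using x \<kappa>c by (simp add: MC.tlift_tens_self)
 qed
qed

text \<open>
 Quantifiers over modules range over a universe type.  A module whose carrier injects into that type is moved there by
 copying the additive group; the action of the ring, from the left or from the right, is filled in afterwards.
\<close>

definition copy :: "('m => 'u) => ('l, 'r, 'm, 'z) bimod_scheme => ('l2, 'r2, 'u) bimod"
 where "copy \<iota> M = \<lparr>carrier = \<iota> ` carrier M, mult = undefined, one = undefined, zero = \<iota> \<zero>\<^sub>M,
  add = (\<lambda>x y. \<iota> (inv_into (carrier M) \<iota> x \<oplus>\<^sub>M inv_into (carrier M) \<iota> y)), lact = undefined, ract = undefined\<rparr>"

lemma abelian_group_copy:
 assumes M: "abelian_group M" and inj: "inj_on \<iota> (carrier M)"
 shows "abelian_group (copy \<iota> M\<lparr>lact := l, ract := r\<rparr>)"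
proof -
 interpret M: abelian_group M by fact
 note [simp] = copy_def inv_into_f_f[OF inj]
 show ?thesis
 proof (rule abelian_groupI)
  fix x assume "x \<in> carrier (copy \<iota> M\<lparr>lact := l, ract := r\<rparr>)"
  then obtain m where m: "x = \<iota> m" "m \<in> carrier M" by auto
  then show "\<exists>y\<in>carrier (copy \<iota> M\<lparr>lact := l, ract := r\<rparr>). y \<oplus>\<^bsub>copy \<iota> M\<lparr>lact := l, ract := r\<rparr>\<^esub> x = \<zero>\<^bsub>copy \<iota> M\<lparr>lact := l, ract := r\<rparr>\<^esub>"
   by (intro bexI[of _ "\<iota> (\<ominus>\<^sub>M m)"]) (auto simp: M.l_neg)
 qed (auto simp: M.a_ac)
qed

lemma right_copy_exists:
 fixes M :: "('l, 'r, 'm, 'z) bimod_scheme"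
 assumes M: "right_module R M" and size: "carrier M \<lesssim> (UNIV :: 'u set)"
 obtains M' :: "(unit, 'r, 'u) bimod" and \<iota> \<kappa> where "right_module R M'"
  "right_linear R M M' \<iota>" "right_linear R M' M \<kappa>"
  "\<And>m. m \<in> carrier M ==> \<kappa> (\<iota> m) = m" "\<And>m. m \<in> carrier M' ==> \<iota> (\<kappa> m) = m"
proof -
 interpret right_module R M by fact
 obtain \<iota> :: "'m => 'u" where \<iota>: "inj_on \<iota> (carrier M)" using size by (auto simp: lepoll_def)
 define \<kappa> where "\<kappa> = inv_into (carrier M) \<iota>"
 define M' :: "(unit, 'r, 'u) bimod" where "M' = copy \<iota> M\<lparr>lact := undefined, ract := (\<lambda>x r. \<iota> (\<kappa> x \<leftharpoonup>\<^sub>M r))\<rparr>"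
 have \<kappa>\<iota> [simp]: "\<kappa> (\<iota> m) = m" if "m \<in> carrier M" for m using that \<iota> by (simp add: \<kappa>_def)
 have [simp]: "carrier M' = \<iota> ` carrier M" "add M' = (\<lambda>x y. \<iota> (\<kappa> x \<oplus>\<^sub>M \<kappa> y))" "ract M' = (\<lambda>x r. \<iota> (\<kappa> x \<leftharpoonup>\<^sub>M r))"
  by (simp_all add: M'_def copy_def \<kappa>_def)
 have "abelian_group M'" unfolding M'_def by (rule abelian_group_copy[OF M.abelian_group_axioms \<iota>])
 then have 1: "right_module R M'" by (intro right_module.intro right_module_axioms.intro S.ring_axioms)
   (auto simp: ract_closed ract_add_left ract_add_right ract_mult ract_one)
 have 2: "right_linear R M M' \<iota>" "right_linear R M' M \<kappa>" by (auto intro!: right_linearI additiveI simp: ract_closed)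
 show ?thesis by (rule that[OF 1 2]) auto
qed

lemma right_comodule_copy_exists:
 fixes M :: "('l, 'a, 'm, 'z) bimod_scheme"
 assumes M: "right_comodule A C M \<rho>" and size: "carrier M \<lesssim> (UNIV :: 'u set)"
 obtains M' :: "(unit, 'a, 'u) bimod" and \<rho>' \<iota> \<kappa> where "right_comodule A C M' \<rho>'"
  "colinear A C M \<rho> M' \<rho>' \<iota>" "colinear A C M' \<rho>' M \<rho> \<kappa>"
  "\<And>m. m \<in> carrier M ==> \<kappa> (\<iota> m) = m" "\<And>m. m \<in> carrier M' ==> \<iota> (\<kappa> m) = m"
proof -
 interpret right_comodule A C M \<rho> by fact
 obtain M' :: "(unit, 'a, 'u) bimod" and \<iota> \<kappa> where M': "right_module A M'"
  "right_linear A M M' \<iota>" "right_linear A M' M \<kappa>"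
  "\<And>m. m \<in> carrier M ==> \<kappa> (\<iota> m) = m" "\<And>m. m \<in> carrier M' ==> \<iota> (\<kappa> m) = m"
  by (rule right_copy_exists[OF M.right_module_axioms size]) (rule that)
 show ?thesis by (rule that[OF right_comodule_transport[OF M' refl]]) (simp_all add: M'(4,5))
qed

section \<open>Groups of maps and free modules\<close>

lemma abelian_group_pointwise:
 assumes G: "abelian_group G"
  and car: "\<And>f. f \<in> carrier M ==> f \<in> extensional X" "\<And>f x. f \<in> carrier M ==> x \<in> X ==> f x \<in> carrier G"
  and str: "zero M = pointwise_zero X G" "add M = pointwise_add X G"
  and cl: "pointwise_zero X G \<in> carrier M"
   "\<And>f g. f \<in> carrier M ==> g \<in> carrier M ==> pointwise_add X G f g \<in> carrier M"
   "\<And>f. f \<in> carrier M ==> (\<lambda>x\<in>X. \<ominus>\<^sub>G f x) \<in> carrier M"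
 shows "abelian_group M"
proof -
 interpret G: abelian_group G by fact
 have und: "f x = undefined" if "f \<in> carrier M" "x \<notin> X" for f x
  using car(1)[OF that(1)] that(2) by (simp add: extensional_def)
 show ?thesis
 proof (rule abelian_groupI)
  fix f assume f: "f \<in> carrier M"
  have "pointwise_add X G (\<lambda>x\<in>X. \<ominus>\<^sub>G f x) f = pointwise_zero X G"
   using car(2)[OF f] by (auto simp: pointwise_add_def pointwise_zero_def G.l_neg)
  then show "\<exists>g\<in>carrier M. g \<oplus>\<^sub>M f = \<zero>\<^sub>M"
   using cl(3)[OF f] by (auto simp: str)
  show "\<zero>\<^sub>M \<oplus>\<^sub>M f = f"
   using car(2)[OF f] und[OF f] by (auto simp: str pointwise_add_def pointwise_zero_def)
 next
  fix f g h assume "f \<in> carrier M" "g \<in> carrier M" "h \<in> carrier M"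
  note c = this[THEN car(2)]
  show "f \<oplus>\<^sub>M g \<oplus>\<^sub>M h = f \<oplus>\<^sub>M (g \<oplus>\<^sub>M h)"
   using c by (auto simp: str pointwise_add_def G.a_assoc)
 next
  fix f g assume "f \<in> carrier M" "g \<in> carrier M"
  note c = this[THEN car(2)]
  show "f \<oplus>\<^sub>M g = g \<oplus>\<^sub>M f"
   using c by (auto simp: str pointwise_add_def G.a_comm)
 qed (use cl in \<open>simp_all add: str\<close>)
qed

lemma regular_simps [simp]:
 "carrier (regular A) = carrier A" "zero (regular A) = zero A" "add (regular A) = add A"
 "lact (regular A) = mult A" "ract (regular A) = mult A" by (simp_all add: regular_def)

lemma bimodule_regular: "ring A ==> bimodule A A (regular A)"
proof -
 assume "ring A"
 then interpret ring A .
 have "abelian_group (regular A)" by (rule abelian_groupI) (auto simp: a_ac intro: add.l_inv_ex)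
 then show "bimodule A A (regular A)"
  by (intro bimodule.intro left_module.intro right_module.intro left_module_axioms.intro
    right_module_axioms.intro bimodule_axioms.intro ring_axioms) (simp_all add: l_distr r_distr m_assoc)
qed

lemma tlift_regular: "tlift (regular A) = tlift A" by (rule tlift_cong_group) simp_all

lemma additive_regular: "additive M (regular A) f \<longleftrightarrow> additive M A f" by (simp add: additive_def hom_def)

context ring
begin

definition unit_vector :: "nat => nat => nat => 'a"
 where "unit_vector n j = (\<lambda>i\<in>{..<n}. if i = j then \<one> else \<zero>)"

lemma free_bimod_simps:
 "carrier (free_bimod R n) = {..<n} \<rightarrow>\<^sub>E carrier R"
 "zero (free_bimod R n) = pointwise_zero {..<n} R"
 "add (free_bimod R n) = pointwise_add {..<n} R"
 "lact (free_bimod R n) = (\<lambda>a x. \<lambda>i\<in>{..<n}. a \<otimes> x i)"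
 "ract (free_bimod R n) = (\<lambda>x a. \<lambda>i\<in>{..<n}. x i \<otimes> a)" by (simp_all add: free_bimod_def)

lemma abelian_group_free_bimod: "abelian_group (free_bimod R n)"
proof (rule abelian_group_pointwise[where X = "{..<n}" and G = R, OF abelian_group_axioms])
 show "f \<in> extensional {..<n}" if "f \<in> carrier (free_bimod R n)" for f
  using that by (simp add: free_bimod_simps PiE_def)
 show "f x \<in> carrier R" if "f \<in> carrier (free_bimod R n)" "x \<in> {..<n}" for f x
  using that by (auto simp: free_bimod_simps)
 show "pointwise_zero {..<n} R \<in> carrier (free_bimod R n)" by (simp add: free_bimod_simps pointwise_zero_def)
 show "pointwise_add {..<n} R f g \<in> carrier (free_bimod R n)"
  if "f \<in> carrier (free_bimod R n)" "g \<in> carrier (free_bimod R n)" for f g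
  unfolding free_bimod_simps pointwise_add_def
  using that by (intro restrict_PiE_iff[THEN iffD2] ballI a_closed) (auto simp: free_bimod_simps)
 show "(\<lambda>x\<in>{..<n}. \<ominus> f x) \<in> carrier (free_bimod R n)" if "f \<in> carrier (free_bimod R n)" for f
  unfolding free_bimod_simps
  using that by (intro restrict_PiE_iff[THEN iffD2] ballI a_inv_closed) (auto simp: free_bimod_simps)
qed (simp_all add: free_bimod_simps)

lemma unit_vector_closed: "unit_vector n j \<in> carrier (free_bimod R n)" by (auto simp: free_bimod_simps unit_vector_def)

lemma finsum_free_bimod_apply:
 assumes "finite I" "\<And>j. j \<in> I ==> x j \<in> carrier (free_bimod R n)" "i < n"
 shows "(\<Oplus>\<^bsub>free_bimod R n\<^esub>j\<in>I. x j) i = (\<Oplus>j\<in>I. x j i)"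
 by (rule additive_finsum[where f = "\<lambda>x. x i", OF _ abelian_group_free_bimod abelian_group_axioms assms(1,2)])
  (use assms(3) in \<open>auto intro!: additiveI simp: free_bimod_simps pointwise_add_def\<close>)

text \<open>
 The unit vectors are a basis on both sides; a splitting of \<open>A\<^sup>n \<rightarrow> M\<close> therefore gives a dual basis of \<open>M\<close>.
\<close>

lemma free_bimod_basis:
 assumes x: "x \<in> carrier (free_bimod R n)"
 shows "x = (\<Oplus>\<^bsub>free_bimod R n\<^esub>j\<in>{..<n}. unit_vector n j \<leftharpoonup>\<^bsub>free_bimod R n\<^esub> x j)"
  and "x = (\<Oplus>\<^bsub>free_bimod R n\<^esub>j\<in>{..<n}. x j \<rightharpoonup>\<^bsub>free_bimod R n\<^esub> unit_vector n j)"
proof -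
 interpret F: abelian_group "free_bimod R n" by (rule abelian_group_free_bimod)
 have xc: "x i \<in> carrier R" if "i < n" for i using x that by (auto simp: free_bimod_simps)
 have xu: "x i = undefined" if "\<not> i < n" for i using x that by (auto simp: free_bimod_simps)
 have r: "unit_vector n j \<leftharpoonup>\<^bsub>free_bimod R n\<^esub> x j \<in> carrier (free_bimod R n)"
  and l: "x j \<rightharpoonup>\<^bsub>free_bimod R n\<^esub> unit_vector n j \<in> carrier (free_bimod R n)" if "j < n" for j
  using xc[OF that] by (auto simp: free_bimod_simps unit_vector_def)
 have out: "y i = undefined" if "y \<in> carrier (free_bimod R n)" "\<not> i < n" for y i
  using that by (auto simp: free_bimod_simps)
 have pick: "(\<Oplus>j\<in>{..<n}. if i = j then x j else \<zero>) = x i" if "i < n" for i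
  using add.finprod_singleton[of i "{..<n}" x] that xc by (simp add: Pi_def)
 show "x = (\<Oplus>\<^bsub>free_bimod R n\<^esub>j\<in>{..<n}. unit_vector n j \<leftharpoonup>\<^bsub>free_bimod R n\<^esub> x j)"
 proof
  fix i show "x i = (\<Oplus>\<^bsub>free_bimod R n\<^esub>j\<in>{..<n}. unit_vector n j \<leftharpoonup>\<^bsub>free_bimod R n\<^esub> x j) i"
  proof (cases "i < n")
   case True
   have "(\<Oplus>\<^bsub>free_bimod R n\<^esub>j\<in>{..<n}. unit_vector n j \<leftharpoonup>\<^bsub>free_bimod R n\<^esub> x j) i = (\<Oplus>j\<in>{..<n}. (unit_vector n j \<leftharpoonup>\<^bsub>free_bimod R n\<^esub> x j) i)"
    using True r by (intro finsum_free_bimod_apply) auto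
   also have "\<dots> = (\<Oplus>j\<in>{..<n}. if i = j then x j else \<zero>)"
    using True xc by (intro finsum_cong') (auto simp: free_bimod_simps unit_vector_def)
   finally show ?thesis using pick[OF True] by simp
  next
   case False
   have "(\<Oplus>\<^bsub>free_bimod R n\<^esub>j\<in>{..<n}. unit_vector n j \<leftharpoonup>\<^bsub>free_bimod R n\<^esub> x j) \<in> carrier (free_bimod R n)"
    using r by (intro F.finsum_closed) auto
   from out[OF this False] show ?thesis by (simp add: xu[OF False])
  qed
 qed
 show "x = (\<Oplus>\<^bsub>free_bimod R n\<^esub>j\<in>{..<n}. x j \<rightharpoonup>\<^bsub>free_bimod R n\<^esub> unit_vector n j)"
 proof
  fix i show "x i = (\<Oplus>\<^bsub>free_bimod R n\<^esub>j\<in>{..<n}. x j \<rightharpoonup>\<^bsub>free_bimod R n\<^esub> unit_vector n j) i"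
  proof (cases "i < n")
   case True
   have "(\<Oplus>\<^bsub>free_bimod R n\<^esub>j\<in>{..<n}. x j \<rightharpoonup>\<^bsub>free_bimod R n\<^esub> unit_vector n j) i = (\<Oplus>j\<in>{..<n}. (x j \<rightharpoonup>\<^bsub>free_bimod R n\<^esub> unit_vector n j) i)"
    using True l by (intro finsum_free_bimod_apply) auto
   also have "\<dots> = (\<Oplus>j\<in>{..<n}. if i = j then x j else \<zero>)"
    using True xc by (intro finsum_cong') (auto simp: free_bimod_simps unit_vector_def)
   finally show ?thesis using pick[OF True] by simp
  next
   case False
   have "(\<Oplus>\<^bsub>free_bimod R n\<^esub>j\<in>{..<n}. x j \<rightharpoonup>\<^bsub>free_bimod R n\<^esub> unit_vector n j) \<in> carrier (free_bimod R n)"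
    using l by (intro F.finsum_closed) auto
   from out[OF this False] show ?thesis by (simp add: xu[OF False])
  qed
 qed
qed

end

lemma right_fgp_dual_basis:
 assumes M: "right_module A M" and fgp: "right_fgp A M"
 obtains n :: nat and e \<phi> where "\<And>i. i < n ==> e i \<in> carrier M"
  "\<And>i. i < n ==> right_linear A M (regular A) (\<phi> i)"
  "\<And>m. m \<in> carrier M ==> m = (\<Oplus>\<^sub>M i\<in>{..<n}. e i \<leftharpoonup>\<^sub>M \<phi> i m)"
proof -
 interpret right_module A M by fact
 obtain n i p where i: "right_linear A M (free_bimod A n) i" and p: "right_linear A (free_bimod A n) M p"
  and pi: "\<And>m. m \<in> carrier M ==> p (i m) = m" using fgp by (auto simp: right_fgp_def)
 note F = S.abelian_group_free_bimod[of n]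
 define e where "e j = p (S.unit_vector n j)" for j
 define \<phi> where "\<phi> j m = i m j" for j m
 have ic: "i m \<in> carrier (free_bimod A n)" if "m \<in> carrier M" for m by (rule right_linear_closed[OF i that])
 have \<phi>c: "\<phi> j m \<in> carrier A" if "m \<in> carrier M" "j < n" for j m
  using ic[OF that(1)] that(2) by (auto simp: S.free_bimod_simps \<phi>_def)
 have 1: "e j \<in> carrier M" for j unfolding e_def by (rule right_linear_closed[OF p S.unit_vector_closed])
 have 2: "right_linear A M (regular A) (\<phi> j)" if "j < n" for j
  using that \<phi>c by (intro right_linearI additiveI)
   (simp_all add: \<phi>_def right_linear_add[OF i] right_linear_ract[OF i] S.free_bimod_simps pointwise_add_def)
 have 3: "m = (\<Oplus>\<^sub>M j\<in>{..<n}. e j \<leftharpoonup>\<^sub>M \<phi> j m)" if m: "m \<in> carrier M" for m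
 proof -
  have uc: "S.unit_vector n j \<leftharpoonup>\<^bsub>free_bimod A n\<^esub> i m j \<in> carrier (free_bimod A n)" if "j < n" for j
   using \<phi>c[OF m that] by (auto simp: S.free_bimod_simps S.unit_vector_def \<phi>_def)
  have "m = p (\<Oplus>\<^bsub>free_bimod A n\<^esub>j\<in>{..<n}. S.unit_vector n j \<leftharpoonup>\<^bsub>free_bimod A n\<^esub> i m j)"
   using pi[OF m] S.free_bimod_basis(1)[OF ic[OF m]] by simp
  also have "\<dots> = (\<Oplus>\<^sub>M j\<in>{..<n}. p (S.unit_vector n j \<leftharpoonup>\<^bsub>free_bimod A n\<^esub> i m j))"
   using uc by (intro additive_finsum[OF right_linear_additive[OF p] F M.abelian_group_axioms]) auto
  also have "\<dots> = (\<Oplus>\<^sub>M j\<in>{..<n}. e j \<leftharpoonup>\<^sub>M \<phi> j m)"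
   using \<phi>c[OF m] 1 by (intro M.finsum_cong')
    (auto simp: right_linear_ract[OF p S.unit_vector_closed] e_def \<phi>_def ract_closed)
  finally show ?thesis .
 qed
 show ?thesis by (rule that[OF 1 2 3])
qed

lemma left_fgp_dual_basis:
 assumes M: "left_module A M" and fgp: "left_fgp A M"
 obtains n :: nat and e \<phi> where "\<And>i. i < n ==> e i \<in> carrier M"
  "\<And>i. i < n ==> left_linear A M (regular A) (\<phi> i)"
  "\<And>m. m \<in> carrier M ==> m = (\<Oplus>\<^sub>M i\<in>{..<n}. \<phi> i m \<rightharpoonup>\<^sub>M e i)"
proof -
 interpret left_module A M by fact
 obtain n i p where i: "left_linear A M (free_bimod A n) i" and p: "left_linear A (free_bimod A n) M p"
  and pi: "\<And>m. m \<in> carrier M ==> p (i m) = m" using fgp by (auto simp: left_fgp_def)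
 note F = R.abelian_group_free_bimod[of n]
 define e where "e j = p (R.unit_vector n j)" for j
 define \<phi> where "\<phi> j m = i m j" for j m
 have ic: "i m \<in> carrier (free_bimod A n)" if "m \<in> carrier M" for m by (rule left_linear_closed[OF i that])
 have \<phi>c: "\<phi> j m \<in> carrier A" if "m \<in> carrier M" "j < n" for j m
  using ic[OF that(1)] that(2) by (auto simp: R.free_bimod_simps \<phi>_def)
 have 1: "e j \<in> carrier M" for j unfolding e_def by (rule left_linear_closed[OF p R.unit_vector_closed])
 have 2: "left_linear A M (regular A) (\<phi> j)" if "j < n" for j
  using that \<phi>c by (intro left_linearI additiveI)
   (simp_all add: \<phi>_def left_linear_add[OF i] left_linear_lact[OF i] R.free_bimod_simps pointwise_add_def)
 have 3: "m = (\<Oplus>\<^sub>M j\<in>{..<n}. \<phi> j m \<rightharpoonup>\<^sub>M e j)" if m: "m \<in> carrier M" for m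
 proof -
  have uc: "i m j \<rightharpoonup>\<^bsub>free_bimod A n\<^esub> R.unit_vector n j \<in> carrier (free_bimod A n)" if "j < n" for j
   using \<phi>c[OF m that] by (auto simp: R.free_bimod_simps R.unit_vector_def \<phi>_def)
  have "m = p (\<Oplus>\<^bsub>free_bimod A n\<^esub>j\<in>{..<n}. i m j \<rightharpoonup>\<^bsub>free_bimod A n\<^esub> R.unit_vector n j)"
   using pi[OF m] R.free_bimod_basis(2)[OF ic[OF m]] by simp
  also have "\<dots> = (\<Oplus>\<^sub>M j\<in>{..<n}. p (i m j \<rightharpoonup>\<^bsub>free_bimod A n\<^esub> R.unit_vector n j))"
   using uc by (intro additive_finsum[OF left_linear_additive[OF p] F M.abelian_group_axioms]) auto
  also have "\<dots> = (\<Oplus>\<^sub>M j\<in>{..<n}. \<phi> j m \<rightharpoonup>\<^sub>M e j)"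
   using \<phi>c[OF m] 1 by (intro M.finsum_cong')
    (auto simp: left_linear_lact[OF p R.unit_vector_closed] e_def \<phi>_def lact_closed)
  finally show ?thesis .
 qed
 show ?thesis by (rule that[OF 1 2 3])
qed

section \<open>The left dual ring and its action\<close>

abbreviation (in coring) "Cs \<equiv> left_dual_ring A C"

context coring
begin

lemma Cs_simps:
 "mult Cs = (\<lambda>f g. \<lambda>c\<in>carrier C. g (hit C c f))" "one Cs = restrict (counit C) (carrier C)"
 "zero Cs = pointwise_zero (carrier C) A" "add Cs = pointwise_add (carrier C) A" by (simp_all add: left_dual_ring_def)

lemma Cs_mem_iff: "f \<in> carrier Cs \<longleftrightarrow> f \<in> extensional (carrier C) \<and> left_linear A C (regular A) f"
 by (simp add: left_dual_ring_def left_Hom_def)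

lemma CsI:
 assumes "f \<in> extensional (carrier C)" "\<And>c. c \<in> carrier C ==> f c \<in> carrier A"
  "\<And>c d. c \<in> carrier C ==> d \<in> carrier C ==> f (c \<oplus>\<^sub>C d) = f c \<oplus>\<^sub>A f d"
  "\<And>a c. a \<in> carrier A ==> c \<in> carrier C ==> f (a \<rightharpoonup>\<^sub>C c) = a \<otimes>\<^sub>A f c"
 shows "f \<in> carrier Cs"
 using assms by (auto simp: Cs_mem_iff intro!: left_linearI additiveI)

lemma Cs_closed [simp]: "f \<in> carrier Cs ==> c \<in> carrier C ==> f c \<in> carrier A"
 using left_linear_closed[of A C "regular A" f c] by (simp add: Cs_mem_iff)

lemma Cs_add: "f \<in> carrier Cs ==> c \<in> carrier C ==> d \<in> carrier C ==> f (c \<oplus>\<^sub>C d) = f c \<oplus>\<^sub>A f d"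
 using left_linear_add[of A C "regular A" f c d] by (simp add: Cs_mem_iff)

lemma Cs_lact: "f \<in> carrier Cs ==> a \<in> carrier A ==> c \<in> carrier C ==> f (a \<rightharpoonup>\<^sub>C c) = a \<otimes>\<^sub>A f c"
 using left_linear_lact[of A C "regular A" f c a] by (simp add: Cs_mem_iff)

lemma Cs_additive: "f \<in> carrier Cs ==> additive C A f" by (intro additiveI) (simp_all add: Cs_add)

lemma Cs_ext: "f \<in> carrier Cs ==> g \<in> carrier Cs ==> (\<And>c. c \<in> carrier C ==> f c = g c) ==> f = g"
 by (rule extensionalityI[of _ "carrier C"]) (simp_all add: Cs_mem_iff)

lemma Cs_add_apply: "c \<in> carrier C ==> (f \<oplus>\<^sub>Cs g) c = f c \<oplus>\<^sub>A g c" by (simp add: Cs_simps pointwise_add_def)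

lemma Cs_one_closed: "restrict (counit C) (carrier C) \<in> carrier Cs"
 by (rule CsI) (simp_all add: counit_simps lact_closed)

lemma abelian_group_Cs: "abelian_group Cs"
proof (rule abelian_group_pointwise[where X = "carrier C" and G = A])
 show "(\<lambda>x\<in>carrier C. \<ominus>\<^sub>A f x) \<in> carrier Cs" if "f \<in> carrier Cs" for f
  using that by (intro CsI) (simp_all add: Cs_add Cs_lact lact_closed R.r_minus R.minus_add)
 show "pointwise_zero (carrier C) A \<in> carrier Cs" by (rule CsI) (simp_all add: pointwise_zero_def lact_closed)
 show "pointwise_add (carrier C) A f g \<in> carrier Cs" if "f \<in> carrier Cs" "g \<in> carrier Cs" for f g
  using that by (intro CsI) (simp_all add: pointwise_add_def Cs_add Cs_lact lact_closed R.r_distr R.a_ac)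
 show "f \<in> extensional (carrier C)" if "f \<in> carrier Cs" for f using that by (simp add: Cs_mem_iff)
qed (simp_all add: Cs_simps R.abelian_group_axioms)

end

context right_comodule
begin

abbreviation "Cs \<equiv> left_dual_ring A C"

lemma balanced_coact_eval: "f \<in> carrier Cs ==> balanced A M C M (\<lambda>v c. v \<leftharpoonup>\<^sub>M f c)" by (rule balancedI)
  (simp_all add: M.ract_closed M.ract_add_left M.ract_add_right M.ract_mult C.Cs_add C.Cs_lact)

lemma coact_eval_closed: "f \<in> carrier Cs ==> u \<in> carrier M ==> coact_eval M \<rho> u f \<in> carrier M"
 unfolding coact_eval_def by (intro MC.tlift_closed[OF M.ab balanced_coact_eval]) simp_all

lemma coact_eval_add:
 "f \<in> carrier Cs ==> u \<in> carrier M ==> v \<in> carrier M ==>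
  coact_eval M \<rho> (u \<oplus>\<^sub>M v) f = coact_eval M \<rho> u f \<oplus>\<^sub>M coact_eval M \<rho> v f"
 unfolding coact_eval_def
 by (simp add: right_linear_add[OF coact_linear] additive_add[OF MC.additive_tlift[OF M.ab balanced_coact_eval]])

lemma additive_coact_eval: "f \<in> carrier Cs ==> additive M M (\<lambda>u. coact_eval M \<rho> u f)"
 by (intro additiveI) (simp_all add: coact_eval_closed coact_eval_add)

lemma coact_eval_cong:
 assumes "f \<in> carrier Cs" "\<And>c. c \<in> carrier C ==> f c = g c" "u \<in> carrier M"
 shows "coact_eval M \<rho> u f = coact_eval M \<rho> u g"
 unfolding coact_eval_def using assms(2,3) by (intro MC.tlift_cong[OF M.ab balanced_coact_eval[OF assms(1)]]) simp_all

lemma coact_eval_add_right: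
 assumes "f \<in> carrier Cs" "g \<in> carrier Cs" "u \<in> carrier M"
 shows "coact_eval M \<rho> u (f \<oplus>\<^sub>Cs g) = coact_eval M \<rho> u f \<oplus>\<^sub>M coact_eval M \<rho> u g"
proof -
 interpret Cs: abelian_group Cs by (rule C.abelian_group_Cs)
 have "tlift M (\<lambda>v c. v \<leftharpoonup>\<^sub>M (f \<oplus>\<^sub>Cs g) c) (\<rho> u) = tlift M (\<lambda>v c. v \<leftharpoonup>\<^sub>M f c \<oplus>\<^sub>M v \<leftharpoonup>\<^sub>M g c) (\<rho> u)"
  using assms by (intro MC.tlift_cong[OF M.ab balanced_coact_eval]) (simp_all add: C.Cs_add_apply M.ract_add_right)
 then show ?thesis using assms by (simp add: coact_eval_def MC.tlift_add_fun[OF M.ab] balanced_coact_eval)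
qed

lemma coact_eval_one: "u \<in> carrier M ==> coact_eval M \<rho> u \<one>\<^sub>Cs = u"
 using coact_eval_cong[OF C.Cs_one_closed, of "counit C" u] coact_counit[of u] by (simp add: C.Cs_simps coact_eval_def)

text \<open>\<open>\<rho>(u \<cdot> g) = u\<^sub>[\<^sub>0\<^sub>] \<otimes> u\<^sub>[\<^sub>1\<^sub>]\<^sub>(\<^sub>1\<^sub>) g(u\<^sub>[\<^sub>1\<^sub>]\<^sub>(\<^sub>2\<^sub>))\<close>: the action of the dual ring only touches the last tensorand.\<close>

lemma tlift_coact_coact_eval:
 assumes g: "g \<in> carrier Cs" and u: "u \<in> carrier M" and G: "abelian_group G" and s: "balanced A M C G s"
 shows "tlift G s (\<rho> (coact_eval M \<rho> u g)) = tlift G (\<lambda>v c. s v (hit C c g)) (\<rho> u)"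
  and "balanced A M C G (\<lambda>v c. s v (hit C c g))"
proof -
 define t where "t v c d = s v (c \<leftharpoonup>\<^sub>C g d)" for v c d
 have bC: "balanced A C C C (\<lambda>c d. c \<leftharpoonup>\<^sub>C g d)" by (rule right_comodule.balanced_coact_eval[OF C.right_comodule_self g])
 have t1: "balanced A C C G (t v)" if "v \<in> carrier M" for v
  unfolding t_def by (rule balanced_comp[OF bC balanced_additive2[OF s that]])
 have t: "trilinear A M C C G t"
  unfolding trilinear_def
 proof (intro conjI ballI t1)
  fix d assume "d \<in> carrier C"
  then show "balanced A M C G (\<lambda>v c. t v c d)" unfolding t_def using g
   by (intro balancedI) (simp_all add: balancedD[OF s] C.ract_closed C.ract_add_left C.lact_ract C.lact_closed M.ract_closed)
 qed
 have hit: "tlift G (t v) (comult C c) = s v (hit C c g)" if "v \<in> carrier M" "c \<in> carrier C" for v c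
  unfolding hit_def t_def using that
  by (intro C.CC.tlift_comp[OF C.ab G bC balanced_additive2[OF s], symmetric]) simp_all
 show "balanced A M C G (\<lambda>v c. s v (hit C c g))"
  using coassoc_tlift(3)[OF G t u] by (auto simp: balanced_def hit M.ract_closed C.lact_closed)
 have add\<rho>: "additive M G (\<lambda>v. tlift G s (\<rho> v))"
  by (rule additive_comp[OF right_linear_additive[OF coact_linear] MC.additive_tlift[OF G s]])
 have "tlift G s (\<rho> (coact_eval M \<rho> u g)) = tlift G (\<lambda>v d. tlift G s (\<rho> (v \<leftharpoonup>\<^sub>M g d))) (\<rho> u)"
  unfolding coact_eval_def using u by (intro MC.tlift_comp[OF M.ab G balanced_coact_eval[OF g] add\<rho>]) simp
 also have "\<dots> = tlift G (\<lambda>v d. tlift G (\<lambda>m c. t m c d) (\<rho> v)) (\<rho> u)"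
  using u g by (intro MC.tlift_cong[OF G balanced_comp[OF balanced_coact_eval[OF g] add\<rho>]])
   (simp_all add: t_def right_linear_ract[OF coact_linear] MC.tlift_ract[OF C.bimodule_axioms _ G s])
 also have "\<dots> = tlift G (\<lambda>v c. tlift G (t v) (comult C c)) (\<rho> u)" by (rule coassoc_tlift(1)[OF G t u])
 also have "\<dots> = tlift G (\<lambda>v c. s v (hit C c g)) (\<rho> u)"
  using u by (intro MC.tlift_cong[OF G coassoc_tlift(3)[OF G t u] hit]) simp_all
 finally show "tlift G s (\<rho> (coact_eval M \<rho> u g)) = tlift G (\<lambda>v c. s v (hit C c g)) (\<rho> u)" .
qed

lemma linear_coact_eval:
 assumes F: "right_linear A M N F" and N: "right_module A N" and g: "g \<in> carrier Cs" and u: "u \<in> carrier M"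
 shows "F (coact_eval M \<rho> u g) = tlift N (\<lambda>v c. F v \<leftharpoonup>\<^sub>N g c) (\<rho> u)"
proof -
 interpret N: right_module A N by fact
 have "F (coact_eval M \<rho> u g) = tlift N (\<lambda>v c. F (v \<leftharpoonup>\<^sub>M g c)) (\<rho> u)"
  unfolding coact_eval_def using u
  by (intro MC.tlift_comp[OF M.ab N.ab balanced_coact_eval[OF g] right_linear_additive[OF F]]) simp
 also have "\<dots> = tlift N (\<lambda>v c. F v \<leftharpoonup>\<^sub>N g c) (\<rho> u)"
  using u g by (intro MC.tlift_cong[OF N.ab balanced_comp[OF balanced_coact_eval[OF g] right_linear_additive[OF F]]])
   (simp_all add: right_linear_ract[OF F])
 finally show ?thesis .
qed

lemma colinear_coact_eval:
 assumes N: "right_comodule A C N \<sigma>" and F: "colinear A C M \<rho> N \<sigma> F" and g: "g \<in> carrier Cs" and u: "u \<in> carrier M"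
 shows "F (coact_eval M \<rho> u g) = coact_eval N \<sigma> (F u) g"
proof -
 interpret N: right_comodule A C N \<sigma> by fact
 show ?thesis
  using linear_coact_eval[OF colinear_right_linear[OF F] N.M.right_module_axioms g u]
   tlift_colinear[OF N.M.right_module_axioms F N.M.ab N.balanced_coact_eval[OF g] u] by (simp add: coact_eval_def)
qed

end

lemma (in bicomodule) coact_eval_lact:
 assumes r: "r \<in> carrier R" and u: "u \<in> carrier N" and g: "g \<in> carrier Cs"
 shows "coact_eval N \<rho> (r \<rightharpoonup>\<^sub>N u) g = r \<rightharpoonup>\<^sub>N coact_eval N \<rho> u g"
proof -
 have ad: "additive N N (\<lambda>n. r \<rightharpoonup>\<^sub>N n)"
  using r by (intro additiveI) (simp_all add: NB.lact_closed NB.lact_add_right)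
 have "coact_eval N \<rho> (r \<rightharpoonup>\<^sub>N u) g = tlift N (\<lambda>v c. (r \<rightharpoonup>\<^sub>N v) \<leftharpoonup>\<^sub>N g c) (\<rho> u)"
  using r u unfolding coact_eval_def left_linear_lact[OF coact_left u r]
  by (intro MC.tlift_lact[OF NB.bimodule_axioms r NB.ab balanced_coact_eval[OF g]]) simp
 also have "\<dots> = tlift N (\<lambda>v c. r \<rightharpoonup>\<^sub>N (v \<leftharpoonup>\<^sub>N g c)) (\<rho> u)"
  using r u g by (intro MC.tlift_cong[symmetric, OF NB.ab balanced_comp[OF balanced_coact_eval[OF g] ad]])
   (simp_all add: NB.lact_ract)
 also have "\<dots> = r \<rightharpoonup>\<^sub>N coact_eval N \<rho> u g"
  unfolding coact_eval_def using u by (intro MC.tlift_comp[symmetric, OF NB.ab NB.ab balanced_coact_eval[OF g] ad]) simp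
 finally show ?thesis .
qed

context coring
begin

lemma hit_eq: "coact_eval C (comult C) c f = hit C c f" by (simp add: coact_eval_def hit_def)

lemmas hit_closed = right_comodule.coact_eval_closed[OF right_comodule_self, unfolded hit_eq]
 and hit_add = right_comodule.coact_eval_add[OF right_comodule_self, unfolded hit_eq]
 and additive_hit = right_comodule.additive_coact_eval[OF right_comodule_self, unfolded hit_eq]
 and hit_cong = right_comodule.coact_eval_cong[OF right_comodule_self, unfolded hit_eq]
 and hit_add_right = right_comodule.coact_eval_add_right[OF right_comodule_self, unfolded hit_eq]
 and hit_one = right_comodule.coact_eval_one[OF right_comodule_self, unfolded hit_eq]
 and balanced_hit = right_comodule.balanced_coact_eval[OF right_comodule_self]
 and hit_lact = bicomodule.coact_eval_lact[OF bicomodule_self, unfolded hit_eq]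
 and tlift_comult_hit = right_comodule.tlift_coact_coact_eval[OF right_comodule_self, unfolded hit_eq]

text \<open>
 \<open>\<epsilon>(c\<^sub>(\<^sub>1\<^sub>) g(c\<^sub>(\<^sub>2\<^sub>))) = g(c)\<close>: the multiplication of the dual ring is composition of the operators
 \<open>c \<mapsto> c\<^sub>(\<^sub>1\<^sub>) g(c\<^sub>(\<^sub>2\<^sub>))\<close>, from which \<open>g\<close> is recovered by the counit.
\<close>

lemma counit_hit:
 assumes c: "c \<in> carrier C" and g: "g \<in> carrier Cs"
 shows "counit C (hit C c g) = g c"
proof -
 have ad: "additive C A (counit C)" by (intro additiveI) (simp_all add: counit_simps)
 have b: "balanced A C C C (\<lambda>c' d. counit C c' \<rightharpoonup>\<^sub>C d)"
  by (rule balancedI) (simp_all add: lact_closed lact_add_left lact_add_right lact_mult counit_simps)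
 have "counit C (hit C c g) = tlift A (\<lambda>c1 c2. counit C (c1 \<leftharpoonup>\<^sub>C g c2)) (comult C c)"
  unfolding hit_def using c by (intro CC.tlift_comp[OF M.abelian_group_axioms R.abelian_group_axioms balanced_hit[OF g] ad]) simp
 also have "\<dots> = tlift A (\<lambda>c1 c2. g (counit C c1 \<rightharpoonup>\<^sub>C c2)) (comult C c)"
  using c g by (intro CC.tlift_cong[OF R.abelian_group_axioms balanced_comp[OF balanced_hit[OF g] ad]])
   (simp_all add: counit_simps Cs_lact)
 also have "\<dots> = g (tlift C (\<lambda>c1 c2. counit C c1 \<rightharpoonup>\<^sub>C c2) (comult C c))"
  using c by (intro CC.tlift_comp[symmetric, OF M.abelian_group_axioms R.abelian_group_axioms b Cs_additive[OF g]]) simp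
 finally show ?thesis using c by (simp add: counit_left)
qed

lemma Cs_mult_closed: "f \<in> carrier Cs ==> g \<in> carrier Cs ==> f \<otimes>\<^sub>Cs g \<in> carrier Cs"
 by (rule CsI) (simp_all add: Cs_simps hit_closed hit_add hit_lact Cs_add Cs_lact lact_closed)

lemma Cs_mult_apply: "c \<in> carrier C ==> (f \<otimes>\<^sub>Cs g) c = g (hit C c f)" by (simp add: Cs_simps)

end

lemma (in right_comodule) coact_eval_mult:
 assumes f: "f \<in> carrier Cs" and g: "g \<in> carrier Cs" and u: "u \<in> carrier M"
 shows "coact_eval M \<rho> (coact_eval M \<rho> u f) g = coact_eval M \<rho> u (f \<otimes>\<^sub>Cs g)"
proof -
 have "coact_eval M \<rho> (coact_eval M \<rho> u f) g = tlift M (\<lambda>v c. v \<leftharpoonup>\<^sub>M g (hit C c f)) (\<rho> u)"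
  unfolding coact_eval_def[of _ _ _ g] by (rule tlift_coact_coact_eval(1)[OF f u M.ab balanced_coact_eval[OF g]])
 also have "\<dots> = coact_eval M \<rho> u (f \<otimes>\<^sub>Cs g)"
  unfolding coact_eval_def using u
  by (intro MC.tlift_cong[symmetric, OF M.ab balanced_coact_eval[OF C.Cs_mult_closed[OF f g]]])
   (simp_all add: C.Cs_mult_apply)
 finally show ?thesis .
qed

context coring
begin

lemmas hit_mult = right_comodule.coact_eval_mult[OF right_comodule_self, unfolded hit_eq]

lemma ring_Cs: "ring Cs"
proof (rule ringI)
 show "monoid Cs"
 proof (rule monoidI)
  fix f g h assume fgh: "f \<in> carrier Cs" "g \<in> carrier Cs" "h \<in> carrier Cs"
  then show "f \<otimes>\<^sub>Cs g \<otimes>\<^sub>Cs h = f \<otimes>\<^sub>Cs (g \<otimes>\<^sub>Cs h)"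
   by (intro Cs_ext Cs_mult_closed) (simp_all add: Cs_mult_apply hit_mult hit_closed)
 next
  fix f assume f: "f \<in> carrier Cs"
  show "\<one>\<^sub>Cs \<otimes>\<^sub>Cs f = f" using f Cs_one_closed
   by (intro Cs_ext Cs_mult_closed) (simp_all add: Cs_mult_apply hit_one Cs_simps(2)[symmetric])
  show "f \<otimes>\<^sub>Cs \<one>\<^sub>Cs = f" using f Cs_one_closed
   by (intro Cs_ext Cs_mult_closed) (simp_all add: Cs_mult_apply Cs_simps(2) counit_hit hit_closed)
 qed (use Cs_one_closed Cs_mult_closed in \<open>simp_all add: Cs_simps(2)\<close>)
next
 interpret Cs: abelian_group Cs by (rule abelian_group_Cs)
 fix f g h assume fgh: "f \<in> carrier Cs" "g \<in> carrier Cs" "h \<in> carrier Cs"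
 note ap = Cs_add_apply
 show "(f \<oplus>\<^sub>Cs g) \<otimes>\<^sub>Cs h = f \<otimes>\<^sub>Cs h \<oplus>\<^sub>Cs g \<otimes>\<^sub>Cs h"
  using fgh by (intro Cs_ext Cs_mult_closed Cs.a_closed)
   (simp_all add: ap Cs_mult_apply hit_add_right Cs_add hit_closed)
 show "h \<otimes>\<^sub>Cs (f \<oplus>\<^sub>Cs g) = h \<otimes>\<^sub>Cs f \<oplus>\<^sub>Cs h \<otimes>\<^sub>Cs g"
  using fgh by (intro Cs_ext Cs_mult_closed Cs.a_closed) (simp_all add: ap Cs_mult_apply hit_closed)
qed (rule abelian_group_Cs)

end

section \<open>The dual of a comodule\<close>

sublocale fgp_bicomodule \<subseteq> bicomodule A B C \<Sigma> \<rho>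
 by (intro bicomodule.intro bicomodule_axioms.intro BA.bimodule_axioms right_comodule_axioms coact_left_linear)

context fgp_bicomodule
begin

abbreviation "D \<equiv> dual A \<Sigma>"

lemma D_simps:
 "zero D = pointwise_zero (carrier \<Sigma>) A" "add D = pointwise_add (carrier \<Sigma>) A"
 "lact D = (\<lambda>a f. \<lambda>u\<in>carrier \<Sigma>. a \<otimes>\<^sub>A f u)" "ract D = (\<lambda>f b. \<lambda>u\<in>carrier \<Sigma>. f (b \<rightharpoonup>\<^sub>\<Sigma> u))" by (simp_all add: dual_def)

lemma D_mem_iff: "f \<in> carrier D \<longleftrightarrow> f \<in> extensional (carrier \<Sigma>) \<and> right_linear A \<Sigma> (regular A) f"
 by (simp add: dual_def right_Hom_def)

lemma DI:
 assumes "f \<in> extensional (carrier \<Sigma>)" "\<And>u. u \<in> carrier \<Sigma> ==> f u \<in> carrier A"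
  "\<And>u v. u \<in> carrier \<Sigma> ==> v \<in> carrier \<Sigma> ==> f (u \<oplus>\<^sub>\<Sigma> v) = f u \<oplus>\<^sub>A f v"
  "\<And>a u. a \<in> carrier A ==> u \<in> carrier \<Sigma> ==> f (u \<leftharpoonup>\<^sub>\<Sigma> a) = f u \<otimes>\<^sub>A a"
 shows "f \<in> carrier D"
 using assms by (auto simp: D_mem_iff intro!: right_linearI additiveI)

lemma D_right_linear: "f \<in> carrier D ==> right_linear A \<Sigma> (regular A) f" by (simp add: D_mem_iff)

lemma D_closed [simp]: "f \<in> carrier D ==> u \<in> carrier \<Sigma> ==> f u \<in> carrier A"
 using right_linear_closed[OF D_right_linear] by simp

lemma D_add: "f \<in> carrier D ==> u \<in> carrier \<Sigma> ==> v \<in> carrier \<Sigma> ==> f (u \<oplus>\<^sub>\<Sigma> v) = f u \<oplus>\<^sub>A f v"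
 using right_linear_add[OF D_right_linear] by simp

lemma D_ract: "f \<in> carrier D ==> a \<in> carrier A ==> u \<in> carrier \<Sigma> ==> f (u \<leftharpoonup>\<^sub>\<Sigma> a) = f u \<otimes>\<^sub>A a"
 using right_linear_ract[OF D_right_linear] by simp

lemma D_additive: "f \<in> carrier D ==> additive \<Sigma> A f" by (intro additiveI) (simp_all add: D_add)

lemma D_ext: "f \<in> carrier D ==> g \<in> carrier D ==> (\<And>u. u \<in> carrier \<Sigma> ==> f u = g u) ==> f = g"
 by (rule extensionalityI[of _ "carrier \<Sigma>"]) (simp_all add: D_mem_iff)

lemma D_apply:
 "u \<in> carrier \<Sigma> ==> (f \<oplus>\<^sub>D g) u = f u \<oplus>\<^sub>A g u"
 "u \<in> carrier \<Sigma> ==> (a \<rightharpoonup>\<^sub>D f) u = a \<otimes>\<^sub>A f u"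
 "u \<in> carrier \<Sigma> ==> (f \<leftharpoonup>\<^sub>D b) u = f (b \<rightharpoonup>\<^sub>\<Sigma> u)"
 "u \<in> carrier \<Sigma> ==> \<zero>\<^sub>D u = \<zero>\<^sub>A" by (simp_all add: D_simps pointwise_add_def pointwise_zero_def)

lemma abelian_group_D: "abelian_group D"
proof (rule abelian_group_pointwise[where X = "carrier \<Sigma>" and G = A])
 show "(\<lambda>x\<in>carrier \<Sigma>. \<ominus>\<^sub>A f x) \<in> carrier D" if "f \<in> carrier D" for f
  using that by (intro DI) (simp_all add: D_add D_ract BA.ract_closed BA.S.l_minus BA.S.minus_add)
 show "pointwise_zero (carrier \<Sigma>) A \<in> carrier D" by (rule DI) (simp_all add: pointwise_zero_def BA.ract_closed)
 show "pointwise_add (carrier \<Sigma>) A f g \<in> carrier D" if "f \<in> carrier D" "g \<in> carrier D" for f g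
  using that by (intro DI) (simp_all add: pointwise_add_def D_add D_ract BA.ract_closed BA.S.l_distr BA.S.a_ac)
 show "f \<in> extensional (carrier \<Sigma>)" if "f \<in> carrier D" for f using that by (simp add: D_mem_iff)
qed (simp_all add: D_simps BA.S.abelian_group_axioms)

sublocale D: abelian_group D by (rule abelian_group_D)

lemma D_lact_closed: "a \<in> carrier A ==> f \<in> carrier D ==> a \<rightharpoonup>\<^sub>D f \<in> carrier D"
 by (rule DI) (simp_all add: D_simps D_add D_ract BA.ract_closed BA.S.r_distr BA.S.m_assoc)

lemma D_ract_closed: "f \<in> carrier D ==> b \<in> carrier B ==> f \<leftharpoonup>\<^sub>D b \<in> carrier D"
 by (rule DI) (simp_all add: D_simps D_add D_ract BA.ract_closed BA.lact_closed BA.lact_add_right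
   BA.lact_ract[symmetric])

lemma bimodule_D: "bimodule A B D"
proof (intro bimodule.intro left_module.intro right_module.intro left_module_axioms.intro
  right_module_axioms.intro bimodule_axioms.intro BA.R.ring_axioms BA.S.ring_axioms abelian_group_D)
qed (auto intro!: D_ext simp: D_apply D_lact_closed D_ract_closed BA.S.l_distr BA.S.r_distr BA.S.m_assoc
  BA.lact_closed BA.lact_add_left BA.lact_mult BA.lact_one D_add)

sublocale DB: bimodule A B D by (rule bimodule_D)

lemma tensor_pair_C_D: "tensor_pair A C D" by (intro tensor_pair.intro C.right_module_axioms DB.left_module_axioms)

sublocale CD: tensor_pair A C D by (rule tensor_pair_C_D)

subsection \<open>The elements \<open>f(u\<^sub>[\<^sub>0\<^sub>]) u\<^sub>[\<^sub>1\<^sub>]\<close>\<close>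

lemma balanced_slice:
 assumes "f \<in> carrier D"
 shows "balanced A \<Sigma> C C (\<lambda>v c. f v \<rightharpoonup>\<^sub>C c)"
 using assms by (intro balancedI)
  (simp_all add: C.lact_closed C.lact_add_left C.lact_add_right C.lact_mult D_add D_ract)

lemma slice_closed [simp]: "f \<in> carrier D ==> u \<in> carrier \<Sigma> ==> slice C \<rho> f u \<in> carrier C"
 unfolding slice_def by (intro MC.tlift_closed[OF C.ab balanced_slice]) simp_all

lemma slice_add:
 "f \<in> carrier D ==> u \<in> carrier \<Sigma> ==> v \<in> carrier \<Sigma> ==>
  slice C \<rho> f (u \<oplus>\<^sub>\<Sigma> v) = slice C \<rho> f u \<oplus>\<^sub>C slice C \<rho> f v"
 unfolding slice_def
 by (simp add: right_linear_add[OF coact_linear] additive_add[OF MC.additive_tlift[OF C.ab balanced_slice]])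

lemma slice_add_left:
 assumes "f \<in> carrier D" "g \<in> carrier D" "u \<in> carrier \<Sigma>"
 shows "slice C \<rho> (f \<oplus>\<^sub>D g) u = slice C \<rho> f u \<oplus>\<^sub>C slice C \<rho> g u"
proof -
 have "slice C \<rho> (f \<oplus>\<^sub>D g) u = tlift C (\<lambda>v c. (f v \<rightharpoonup>\<^sub>C c) \<oplus>\<^sub>C (g v \<rightharpoonup>\<^sub>C c)) (\<rho> u)"
  unfolding slice_def using assms
  by (intro MC.tlift_cong[OF C.ab balanced_slice]) (simp_all add: D_apply C.lact_add_left)
 then show ?thesis using assms by (simp add: slice_def MC.tlift_add_fun[OF C.ab] balanced_slice)
qed

lemma slice_lact:
 assumes a: "a \<in> carrier A" and f: "f \<in> carrier D" and u: "u \<in> carrier \<Sigma>"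
 shows "slice C \<rho> (a \<rightharpoonup>\<^sub>D f) u = a \<rightharpoonup>\<^sub>C slice C \<rho> f u"
proof -
 have ad: "additive C C (\<lambda>c. a \<rightharpoonup>\<^sub>C c)"
  using a by (intro additiveI) (simp_all add: C.lact_closed C.lact_add_right)
 have "a \<rightharpoonup>\<^sub>C slice C \<rho> f u = tlift C (\<lambda>v c. a \<rightharpoonup>\<^sub>C f v \<rightharpoonup>\<^sub>C c) (\<rho> u)"
  unfolding slice_def using u by (intro MC.tlift_comp[OF C.ab C.ab balanced_slice[OF f] ad]) simp
 also have "\<dots> = slice C \<rho> (a \<rightharpoonup>\<^sub>D f) u"
  unfolding slice_def using u a f by (intro MC.tlift_cong[OF C.ab balanced_comp[OF balanced_slice[OF f] ad]])
   (simp_all add: D_apply C.lact_mult)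
 finally show ?thesis by simp
qed

lemma slice_ract:
 assumes a: "a \<in> carrier A" and f: "f \<in> carrier D" and u: "u \<in> carrier \<Sigma>"
 shows "slice C \<rho> f (u \<leftharpoonup>\<^sub>\<Sigma> a) = slice C \<rho> f u \<leftharpoonup>\<^sub>C a"
proof -
 have ad: "additive C C (\<lambda>c. c \<leftharpoonup>\<^sub>C a)"
  using a by (intro additiveI) (simp_all add: C.ract_closed C.ract_add_left)
 have "slice C \<rho> f u \<leftharpoonup>\<^sub>C a = tlift C (\<lambda>v c. (f v \<rightharpoonup>\<^sub>C c) \<leftharpoonup>\<^sub>C a) (\<rho> u)"
  unfolding slice_def using u by (intro MC.tlift_comp[OF C.ab C.ab balanced_slice[OF f] ad]) simp
 also have "\<dots> = tlift C (\<lambda>v c. f v \<rightharpoonup>\<^sub>C (c \<leftharpoonup>\<^sub>C a)) (\<rho> u)"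
  using u a f by (intro MC.tlift_cong[OF C.ab balanced_comp[OF balanced_slice[OF f] ad]]) (simp_all add: C.lact_ract)
 also have "\<dots> = slice C \<rho> f (u \<leftharpoonup>\<^sub>\<Sigma> a)"
  unfolding slice_def right_linear_ract[OF coact_linear u a] using u
  by (intro MC.tlift_ract[OF C.bimodule_axioms a C.ab balanced_slice[OF f], symmetric]) simp
 finally show ?thesis by simp
qed

lemma slice_lact_ring:
 assumes b: "b \<in> carrier B" and f: "f \<in> carrier D" and u: "u \<in> carrier \<Sigma>"
 shows "slice C \<rho> (f \<leftharpoonup>\<^sub>D b) u = slice C \<rho> f (b \<rightharpoonup>\<^sub>\<Sigma> u)"
proof -
 have "slice C \<rho> f (b \<rightharpoonup>\<^sub>\<Sigma> u) = tlift C (\<lambda>v c. f (b \<rightharpoonup>\<^sub>\<Sigma> v) \<rightharpoonup>\<^sub>C c) (\<rho> u)"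
  unfolding slice_def left_linear_lact[OF coact_left u b] using u
  by (intro MC.tlift_lact[OF BA.bimodule_axioms b C.ab balanced_slice[OF f]]) simp
 also have "\<dots> = slice C \<rho> (f \<leftharpoonup>\<^sub>D b) u"
  unfolding slice_def using u b f
  by (intro MC.tlift_cong[symmetric, OF C.ab balanced_slice]) (simp_all add: D_apply D_ract_closed)
 finally show ?thesis by simp
qed

lemma D_comp_closed:
 assumes t: "colinear A C \<Sigma> \<rho> \<Sigma> \<rho> t" and f: "f \<in> carrier D"
 shows "(\<lambda>u\<in>carrier \<Sigma>. f (t u)) \<in> carrier D"
 using f by (intro DI) (simp_all add: colinear_closed[OF t] additive_add[OF colinear_additive[OF t]] colinear_ract[OF t]
   D_add D_ract BA.ract_closed)

lemma slice_comp:
 assumes t: "colinear A C \<Sigma> \<rho> \<Sigma> \<rho> t" and f: "f \<in> carrier D" and u: "u \<in> carrier \<Sigma>"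
 shows "slice C \<rho> (\<lambda>u\<in>carrier \<Sigma>. f (t u)) u = slice C \<rho> f (t u)"
proof -
 have "slice C \<rho> f (t u) = tlift C (\<lambda>v c. f (t v) \<rightharpoonup>\<^sub>C c) (\<rho> u)"
  unfolding slice_def by (rule tlift_colinear[OF BA.right_module_axioms t C.ab balanced_slice[OF f] u])
 also have "\<dots> = slice C \<rho> (\<lambda>u\<in>carrier \<Sigma>. f (t u)) u"
  unfolding slice_def using u
  by (intro MC.tlift_cong[symmetric, OF C.ab balanced_slice[OF D_comp_closed[OF t f]]]) simp_all
 finally show ?thesis by simp
qed

text \<open>
 The two ways to pair \<open>\<Sigma>\<close> with \<open>\<^sup>*C\<close> agree: \<open>g(f(u\<^sub>[\<^sub>0\<^sub>]) u\<^sub>[\<^sub>1\<^sub>]) = f(u\<^sub>[\<^sub>0\<^sub>] g(u\<^sub>[\<^sub>1\<^sub>]))\<close>.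
\<close>

lemma Cs_slice:
 assumes g: "g \<in> carrier Cs" and f: "f \<in> carrier D" and u: "u \<in> carrier \<Sigma>"
 shows "g (slice C \<rho> f u) = f (coact_eval \<Sigma> \<rho> u g)"
proof -
 interpret RA: bimodule A A "regular A" by (rule bimodule_regular[OF BA.S.ring_axioms])
 have "g (slice C \<rho> f u) = tlift A (\<lambda>v c. g (f v \<rightharpoonup>\<^sub>C c)) (\<rho> u)"
  unfolding slice_def using u
  by (intro MC.tlift_comp[OF C.ab BA.S.abelian_group_axioms balanced_slice[OF f] C.Cs_additive[OF g]]) simp
 also have "\<dots> = tlift A (\<lambda>v c. f v \<otimes>\<^sub>A g c) (\<rho> u)"
  using u f g by (intro MC.tlift_cong[OF BA.S.abelian_group_axioms balanced_comp[OF balanced_slice[OF f] C.Cs_additive[OF g]]])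
   (simp_all add: C.Cs_lact)
 also have "\<dots> = f (coact_eval \<Sigma> \<rho> u g)"
  using linear_coact_eval[OF D_right_linear[OF f] RA.right_module_axioms g u] by (simp add: tlift_regular)
 finally show ?thesis .
qed

lemma counit_slice:
 assumes f: "f \<in> carrier D" and u: "u \<in> carrier \<Sigma>"
 shows "counit C (slice C \<rho> f u) = f u"
 using Cs_slice[OF C.Cs_one_closed f u] coact_eval_one[OF u] f u by (simp add: C.Cs_simps(2)[symmetric])
  (simp add: C.Cs_simps(2))

lemma slice_coact_eval:
 assumes g: "g \<in> carrier Cs" and f: "f \<in> carrier D" and u: "u \<in> carrier \<Sigma>"
 shows "slice C \<rho> f (coact_eval \<Sigma> \<rho> u g) = hit C (slice C \<rho> f u) g"
proof -
 have "hit C (slice C \<rho> f u) g = tlift C (\<lambda>v c. hit C (f v \<rightharpoonup>\<^sub>C c) g) (\<rho> u)"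
  unfolding slice_def using u by (intro MC.tlift_comp[OF C.ab C.ab balanced_slice[OF f] C.additive_hit[OF g]]) simp
 also have "\<dots> = tlift C (\<lambda>v c. f v \<rightharpoonup>\<^sub>C hit C c g) (\<rho> u)"
  using u f g by (intro MC.tlift_cong[OF C.ab balanced_comp[OF balanced_slice[OF f] C.additive_hit[OF g]]])
   (simp_all add: C.hit_lact)
 also have "\<dots> = slice C \<rho> f (coact_eval \<Sigma> \<rho> u g)"
  unfolding slice_def by (rule tlift_coact_coact_eval(1)[OF g u C.ab balanced_slice[OF f], symmetric])
 finally show ?thesis by simp
qed

text \<open>\<open>\<Delta>(f(u\<^sub>[\<^sub>0\<^sub>]) u\<^sub>[\<^sub>1\<^sub>]) = f(u\<^sub>[\<^sub>0\<^sub>]) u\<^sub>[\<^sub>1\<^sub>] \<otimes> u\<^sub>[\<^sub>2\<^sub>]\<close>\<close>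

lemma tlift_comult_slice:
 assumes f: "f \<in> carrier D" and u: "u \<in> carrier \<Sigma>" and G: "abelian_group G" and s: "balanced A C C G s"
 shows "tlift G s (comult C (slice C \<rho> f u)) = tlift G (\<lambda>v c. s (slice C \<rho> f v) c) (\<rho> u)"
  and "balanced A \<Sigma> C G (\<lambda>v c. s (slice C \<rho> f v) c)"
proof -
 define t where "t v c d = s (f v \<rightharpoonup>\<^sub>C c) d" for v c d
 have t1: "balanced A \<Sigma> C G (\<lambda>v c. t v c d)" if "d \<in> carrier C" for d
  unfolding t_def by (rule balanced_comp[OF balanced_slice[OF f] balanced_additive1[OF s that]])
 have t2: "balanced A C C G (t v)" if "v \<in> carrier \<Sigma>" for v
  unfolding t_def using that f
  by (intro balancedI) (simp_all add: balancedD[OF s] C.lact_closed C.lact_add_right C.lact_ract[symmetric])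
 have t: "trilinear A \<Sigma> C C G t" unfolding trilinear_def using t1 t2 by blast
 have sl: "tlift G (\<lambda>m c. t m c d) (\<rho> v) = s (slice C \<rho> f v) d" if "v \<in> carrier \<Sigma>" "d \<in> carrier C" for v d
  unfolding t_def slice_def using that
  by (intro MC.tlift_comp[OF C.ab G balanced_slice[OF f] balanced_additive1[OF s], symmetric]) simp_all
 show "balanced A \<Sigma> C G (\<lambda>v c. s (slice C \<rho> f v) c)"
  using coassoc_tlift(2)[OF G t u] by (auto simp: balanced_def sl BA.ract_closed C.lact_closed)
 have add\<Delta>: "additive C G (\<lambda>c. tlift G s (comult C c))"
  by (rule additive_comp[OF right_linear_additive[OF C.comult_right_linear] C.CC.additive_tlift[OF G s]])
 have "tlift G s (comult C (slice C \<rho> f u)) = tlift G (\<lambda>v c. tlift G s (comult C (f v \<rightharpoonup>\<^sub>C c))) (\<rho> u)"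
  unfolding slice_def using u by (intro MC.tlift_comp[OF C.ab G balanced_slice[OF f] add\<Delta>]) simp
 also have "\<dots> = tlift G (\<lambda>v c. tlift G (t v) (comult C c)) (\<rho> u)"
  using u f by (intro MC.tlift_cong[OF G balanced_comp[OF balanced_slice[OF f] add\<Delta>]])
   (simp_all add: t_def[abs_def] left_linear_lact[OF C.comult_left_linear] C.CC.tlift_lact[OF C.bimodule_axioms _ G s])
 also have "\<dots> = tlift G (\<lambda>v d. tlift G (\<lambda>m c. t m c d) (\<rho> v)) (\<rho> u)" by (rule coassoc_tlift(1)[OF G t u, symmetric])
 also have "\<dots> = tlift G (\<lambda>v c. s (slice C \<rho> f v) c) (\<rho> u)"
  using u by (intro MC.tlift_cong[OF G coassoc_tlift(2)[OF G t u] sl]) simp_all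
 finally show "tlift G s (comult C (slice C \<rho> f u)) = tlift G (\<lambda>v c. s (slice C \<rho> f v) c) (\<rho> u)" .
qed

subsection \<open>Left colinear maps into the dual\<close>

lemma dual_basis_exists: "\<exists>b. dual_basis A \<Sigma> b"
proof -
 obtain n e \<phi> where e: "\<And>i. i < n ==> e i \<in> carrier \<Sigma>" and \<phi>: "\<And>i. i < n ==> right_linear A \<Sigma> (regular A) (\<phi> i)"
  and s: "\<And>m. m \<in> carrier \<Sigma> ==> m = (\<Oplus>\<^sub>\<Sigma> i\<in>{..<n::nat}. e i \<leftharpoonup>\<^sub>\<Sigma> \<phi> i m)"
  by (rule right_fgp_dual_basis[OF BA.right_module_axioms fgp]) (rule that)
 have "dual_basis A \<Sigma> (n, e, \<lambda>i. restrict (\<phi> i) (carrier \<Sigma>))"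
  unfolding dual_basis_def prod.case
 proof (intro conjI allI impI ballI)
  fix i assume i: "i < n"
  show "e i \<in> carrier \<Sigma>" by (rule e[OF i])
  show "restrict (\<phi> i) (carrier \<Sigma>) \<in> carrier D"
   using right_linear_cong[OF BA.right_module_axioms \<phi>[OF i], of "restrict (\<phi> i) (carrier \<Sigma>)"] by (simp add: D_mem_iff)
 next
  fix u assume u: "u \<in> carrier \<Sigma>"
  then show "u = (\<Oplus>\<^sub>\<Sigma> i\<in>{..<n}. e i \<leftharpoonup>\<^sub>\<Sigma> restrict (\<phi> i) (carrier \<Sigma>) u)" using s[OF u] by simp
 qed
 then show ?thesis by blast
qed

definition "dim = fst (SOME b. dual_basis A \<Sigma> b)"
definition "e = fst (snd (SOME b. dual_basis A \<Sigma> b))"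
definition "\<phi> = snd (snd (SOME b. dual_basis A \<Sigma> b))"

lemma dual_basis_props:
 shows e_closed: "i < dim ==> e i \<in> carrier \<Sigma>" and \<phi>_closed: "i < dim ==> \<phi> i \<in> carrier D"
  and expand: "u \<in> carrier \<Sigma> ==> (\<Oplus>\<^sub>\<Sigma> i\<in>{..<dim}. e i \<leftharpoonup>\<^sub>\<Sigma> \<phi> i u) = u"
 using someI_ex[OF dual_basis_exists] by (auto simp: dual_basis_def dim_def e_def \<phi>_def split: prod.splits)

lemma dual_coact_eq: "dual_coact A C \<Sigma> \<rho> f = (\<Oplus>\<^bsub>tensor A C D\<^esub>i\<in>{..<dim}. tens A C D (slice C \<rho> f (e i)) (\<phi> i))"
 by (simp add: dual_coact_def dim_def e_def \<phi>_def split: prod.splits)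

lemma right_linear_expand:
 assumes N: "right_module A N" and h: "right_linear A \<Sigma> N h" and u: "u \<in> carrier \<Sigma>"
 shows "h u = (\<Oplus>\<^sub>N i\<in>{..<dim}. h (e i) \<leftharpoonup>\<^sub>N \<phi> i u)"
proof -
 interpret N: right_module A N by fact
 have "h u = h (\<Oplus>\<^sub>\<Sigma> i\<in>{..<dim}. e i \<leftharpoonup>\<^sub>\<Sigma> \<phi> i u)" by (simp add: expand u)
 also have "\<dots> = (\<Oplus>\<^sub>N i\<in>{..<dim}. h (e i \<leftharpoonup>\<^sub>\<Sigma> \<phi> i u))"
  using u by (intro additive_finsum[OF right_linear_additive[OF h] BA.ab N.ab])
   (simp_all add: BA.ract_closed e_closed \<phi>_closed)
 also have "\<dots> = (\<Oplus>\<^sub>N i\<in>{..<dim}. h (e i) \<leftharpoonup>\<^sub>N \<phi> i u)"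
  using u by (intro N.M.finsum_cong') (auto simp: right_linear_ract[OF h] right_linear_closed[OF h] N.ract_closed e_closed \<phi>_closed)
 finally show ?thesis .
qed

lemma balanced_dual_eval:
 assumes u: "u \<in> carrier \<Sigma>"
 shows "balanced A C D C (\<lambda>c f. c \<leftharpoonup>\<^sub>C f u)"
 using u by (intro balancedI) (simp_all add: C.ract_closed C.ract_add_left C.ract_add_right C.ract_mult D_apply)

lemma C_tensor_D_expand:
 assumes X: "X \<in> carrier (tensor A C D)"
 shows "X = (\<Oplus>\<^bsub>tensor A C D\<^esub>i\<in>{..<dim}. tens A C D (tlift C (\<lambda>c f. c \<leftharpoonup>\<^sub>C f (e i)) X) (\<phi> i))"
proof -
 note ab = CD.ab
 have lift: "additive (tensor A C D) C (tlift C (\<lambda>c f. c \<leftharpoonup>\<^sub>C f (e i)))" if "i < dim" for i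
  using that by (intro CD.additive_tlift[OF C.ab balanced_dual_eval]) (simp add: e_closed)
 have ti: "additive (tensor A C D) (tensor A C D) (\<lambda>X. tens A C D (tlift C (\<lambda>c f. c \<leftharpoonup>\<^sub>C f (e i)) X) (\<phi> i))" if "i < dim" for i
  using that by (intro additive_comp[OF lift balanced_additive1[OF CD.tens_balanced]]) (simp_all add: \<phi>_closed)
 have ad: "additive (tensor A C D) (tensor A C D) (\<lambda>X. \<Oplus>\<^bsub>tensor A C D\<^esub>i\<in>{..<dim}. tens A C D (tlift C (\<lambda>c f. c \<leftharpoonup>\<^sub>C f (e i)) X) (\<phi> i))"
  by (rule additive_finsum_fun[OF CD.ab]) (use ti in simp)
 show ?thesis
 proof (rule CD.tensor_eqI[OF ab additive_id ad _ X])
  fix c f assume cf: "c \<in> carrier C" "f \<in> carrier D"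
  have fexp: "(\<Oplus>\<^sub>D i\<in>{..<dim}. f (e i) \<rightharpoonup>\<^sub>D \<phi> i) = f"
  proof (rule D_ext[OF _ cf(2)])
   have *: "f (e i) \<rightharpoonup>\<^sub>D \<phi> i \<in> carrier D" if "i < dim" for i
    using that cf by (intro D_lact_closed) (simp_all add: e_closed \<phi>_closed)
   then show "(\<Oplus>\<^sub>D i\<in>{..<dim}. f (e i) \<rightharpoonup>\<^sub>D \<phi> i) \<in> carrier D" by (intro D.finsum_closed) auto
   fix u assume u: "u \<in> carrier \<Sigma>"
   interpret RA: bimodule A A "regular A" by (rule bimodule_regular[OF BA.S.ring_axioms])
   have "(\<Oplus>\<^sub>D i\<in>{..<dim}. f (e i) \<rightharpoonup>\<^sub>D \<phi> i) u = (\<Oplus>\<^bsub>regular A\<^esub>i\<in>{..<dim}. (f (e i) \<rightharpoonup>\<^sub>D \<phi> i) u)"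
    using * u by (intro additive_finsum[where f = "\<lambda>f. f u", OF _ abelian_group_D RA.ab])
     (auto intro!: additiveI simp: D_apply)
   also have "\<dots> = (\<Oplus>\<^bsub>regular A\<^esub>i\<in>{..<dim}. f (e i) \<otimes>\<^sub>A \<phi> i u)"
    using u cf by (intro RA.M.finsum_cong') (auto simp: D_apply e_closed \<phi>_closed)
   also have "\<dots> = f u" using right_linear_expand[OF RA.right_module_axioms D_right_linear[OF cf(2)] u] by simp
   finally show "(\<Oplus>\<^sub>D i\<in>{..<dim}. f (e i) \<rightharpoonup>\<^sub>D \<phi> i) u = f u" .
  qed
  have "tens A C D c f = tens A C D c (\<Oplus>\<^sub>D i\<in>{..<dim}. f (e i) \<rightharpoonup>\<^sub>D \<phi> i)" by (simp add: fexp)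
  also have "\<dots> = (\<Oplus>\<^bsub>tensor A C D\<^esub>i\<in>{..<dim}. tens A C D c (f (e i) \<rightharpoonup>\<^sub>D \<phi> i))"
   using cf by (intro additive_finsum[OF balanced_additive2[OF CD.tens_balanced cf(1)] abelian_group_D ab])
    (auto simp: D_lact_closed e_closed \<phi>_closed)
  also have "\<dots> = (\<Oplus>\<^bsub>tensor A C D\<^esub>i\<in>{..<dim}. tens A C D (tlift C (\<lambda>c f. c \<leftharpoonup>\<^sub>C f (e i)) (tens A C D c f)) (\<phi> i))"
   using cf by (intro CD.T.finsum_cong') (auto simp: C.ab balanced_dual_eval e_closed \<phi>_closed
     CD.tens_middle C.ract_closed)
  finally show "tens A C D c f = (\<Oplus>\<^bsub>tensor A C D\<^esub>i\<in>{..<dim}. tens A C D (tlift C (\<lambda>c f. c \<leftharpoonup>\<^sub>C f (e i)) (tens A C D c f)) (\<phi> i))" .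
 qed
qed

abbreviation "Q \<equiv> Q_set A C \<Sigma> \<rho>"
abbreviation "ev \<equiv> (\<lambda>q u. \<lambda>c\<in>carrier C. q c u)"

lemma ev_closed: "left_linear A C D q ==> u \<in> carrier \<Sigma> ==> ev q u \<in> carrier Cs"
 by (rule C.CsI) (simp_all add: left_linear_closed left_linear_add left_linear_lact D_apply C.lact_closed)

text \<open>
 Since \<open>\<Sigma>\<close> is finitely generated projective, an element of \<open>C \<otimes> \<Sigma>\<^sup>*\<close> is determined by its values on \<open>\<Sigma>\<close>.
 So colinearity of \<open>q\<close> can be tested on elements: \<open>q(c)(u\<^sub>[\<^sub>0\<^sub>]) u\<^sub>[\<^sub>1\<^sub>] = c\<^sub>(\<^sub>1\<^sub>) q(c\<^sub>(\<^sub>2\<^sub>))(u)\<close>.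
\<close>

lemma Q_mem_iff:
 "q \<in> Q \<longleftrightarrow> q \<in> extensional (carrier C) \<and> left_linear A C D q \<and>
  (\<forall>c\<in>carrier C. \<forall>u\<in>carrier \<Sigma>. slice C \<rho> (q c) u = hit C c (ev q u))"
proof (cases "left_linear A C D q")
 case q: True
 note qc = left_linear_closed[OF q]
 have tm: "tmap A C D (\<lambda>d. d) q (comult C c) \<in> carrier (tensor A C D)" if "c \<in> carrier C" for c
  using that by (intro additive_closed[OF CD.additive_tmap[OF C.CC.tensor_pair_axioms right_linear_id q]]) simp
 have dc: "tens A C D (slice C \<rho> f (e i)) (\<phi> i) \<in> carrier (tensor A C D)" if "f \<in> carrier D" "i < dim" for f i
  using that by (simp add: e_closed \<phi>_closed)
 have dcc: "dual_coact A C \<Sigma> \<rho> f \<in> carrier (tensor A C D)" if "f \<in> carrier D" for f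
  unfolding dual_coact_eq using that dc by (intro CD.T.finsum_closed) auto
 have ev_tm: "tlift C (\<lambda>c f. c \<leftharpoonup>\<^sub>C f u) (tmap A C D (\<lambda>d. d) q (comult C c)) = hit C c (ev q u)"
  if "c \<in> carrier C" "u \<in> carrier \<Sigma>" for c u
 proof -
  have "tlift C (\<lambda>c f. c \<leftharpoonup>\<^sub>C f u) (tmap A C D (\<lambda>d. d) q (comult C c)) = tlift C (\<lambda>c d. c \<leftharpoonup>\<^sub>C q d u) (comult C c)"
   using that by (intro CD.tlift_tmap[OF C.CC.tensor_pair_axioms right_linear_id q C.ab balanced_dual_eval]) simp_all
  also have "\<dots> = hit C c (ev q u)"
   unfolding hit_def using that
   by (intro C.CC.tlift_cong[symmetric, OF C.ab C.balanced_hit[OF ev_closed[OF q]]]) simp_all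
  finally show ?thesis .
 qed
 have ev_dc: "tlift C (\<lambda>c f. c \<leftharpoonup>\<^sub>C f u) (dual_coact A C \<Sigma> \<rho> f) = slice C \<rho> f u"
  if f: "f \<in> carrier D" and u: "u \<in> carrier \<Sigma>" for f u
 proof -
  have "tlift C (\<lambda>c f. c \<leftharpoonup>\<^sub>C f u) (dual_coact A C \<Sigma> \<rho> f)
    = (\<Oplus>\<^sub>C i\<in>{..<dim}. tlift C (\<lambda>c f. c \<leftharpoonup>\<^sub>C f u) (tens A C D (slice C \<rho> f (e i)) (\<phi> i)))"
   unfolding dual_coact_eq using f u dc
   by (intro additive_finsum[OF CD.additive_tlift[OF C.ab balanced_dual_eval] CD.ab C.ab]) auto
  also have "\<dots> = (\<Oplus>\<^sub>C i\<in>{..<dim}. slice C \<rho> f (e i) \<leftharpoonup>\<^sub>C \<phi> i u)"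
   using f u by (intro C.M.finsum_cong') (auto simp: C.ab balanced_dual_eval e_closed \<phi>_closed C.ract_closed)
  also have "\<dots> = slice C \<rho> f u"
   using f u by (intro right_linear_expand[OF C.right_module_axioms _ u, symmetric] right_linearI additiveI)
    (simp_all add: slice_add slice_ract)
  finally show ?thesis .
 qed
 have "dual_coact A C \<Sigma> \<rho> (q c) = tmap A C D (\<lambda>d. d) q (comult C c) \<longleftrightarrow>
   (\<forall>u\<in>carrier \<Sigma>. slice C \<rho> (q c) u = hit C c (ev q u))" if c: "c \<in> carrier C" for c
 proof
  assume "dual_coact A C \<Sigma> \<rho> (q c) = tmap A C D (\<lambda>d. d) q (comult C c)"
  then show "\<forall>u\<in>carrier \<Sigma>. slice C \<rho> (q c) u = hit C c (ev q u)"
   using ev_dc[OF qc[OF c]] ev_tm[OF c] by simp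
 next
  assume *: "\<forall>u\<in>carrier \<Sigma>. slice C \<rho> (q c) u = hit C c (ev q u)"
  have "tmap A C D (\<lambda>d. d) q (comult C c) = (\<Oplus>\<^bsub>tensor A C D\<^esub>i\<in>{..<dim}. tens A C D (hit C c (ev q (e i))) (\<phi> i))"
   by (subst C_tensor_D_expand[OF tm[OF c]], intro CD.T.finsum_cong')
    (auto simp: ev_tm c e_closed \<phi>_closed intro!: C.hit_closed ev_closed[OF q])
  also have "\<dots> = dual_coact A C \<Sigma> \<rho> (q c)"
   unfolding dual_coact_eq using * c dc[OF qc[OF c]] by (intro CD.T.finsum_cong') (auto simp: e_closed)
  finally show "dual_coact A C \<Sigma> \<rho> (q c) = tmap A C D (\<lambda>d. d) q (comult C c)" by simp
 qed
 then show ?thesis using q by (simp add: Q_set_def left_Hom_def)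
qed (simp add: Q_set_def left_Hom_def)

lemma Q_left_linear: "q \<in> Q ==> left_linear A C D q" by (simp add: Q_mem_iff)

lemma Q_closed [simp]: "q \<in> Q ==> c \<in> carrier C ==> q c \<in> carrier D" by (rule left_linear_closed[OF Q_left_linear])

lemma Q_add: "q \<in> Q ==> c \<in> carrier C ==> d \<in> carrier C ==> q (c \<oplus>\<^sub>C d) = q c \<oplus>\<^sub>D q d"
 by (rule left_linear_add[OF Q_left_linear])

lemma Q_lact: "q \<in> Q ==> a \<in> carrier A ==> c \<in> carrier C ==> q (a \<rightharpoonup>\<^sub>C c) = a \<rightharpoonup>\<^sub>D q c"
 by (rule left_linear_lact[OF Q_left_linear])

lemma Q_slice: "q \<in> Q ==> c \<in> carrier C ==> u \<in> carrier \<Sigma> ==> slice C \<rho> (q c) u = hit C c (ev q u)"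
 by (simp add: Q_mem_iff)

lemma Q_ev_closed [simp]: "q \<in> Q ==> u \<in> carrier \<Sigma> ==> ev q u \<in> carrier Cs" by (intro ev_closed Q_left_linear)

lemma QI:
 assumes "q \<in> extensional (carrier C)" "\<And>c. c \<in> carrier C ==> q c \<in> carrier D"
  "\<And>c d u. c \<in> carrier C ==> d \<in> carrier C ==> u \<in> carrier \<Sigma> ==> q (c \<oplus>\<^sub>C d) u = q c u \<oplus>\<^sub>A q d u"
  "\<And>a c u. a \<in> carrier A ==> c \<in> carrier C ==> u \<in> carrier \<Sigma> ==> q (a \<rightharpoonup>\<^sub>C c) u = a \<otimes>\<^sub>A q c u"
  "\<And>c u. c \<in> carrier C ==> u \<in> carrier \<Sigma> ==> slice C \<rho> (q c) u = hit C c (ev q u)"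
 shows "q \<in> Q"
 unfolding Q_mem_iff using assms by (intro conjI left_linearI additiveI ballI D_ext)
  (simp_all add: D_apply C.lact_closed D_lact_closed D.a_closed)

lemma Q_ext: "q \<in> Q ==> q' \<in> Q ==> (\<And>c u. c \<in> carrier C ==> u \<in> carrier \<Sigma> ==> q c u = q' c u) ==> q = q'"
proof (rule extensionalityI[of _ "carrier C"])
 fix c assume "q \<in> Q" "q' \<in> Q" "\<And>c u. c \<in> carrier C ==> u \<in> carrier \<Sigma> ==> q c u = q' c u" "c \<in> carrier C"
 then show "q c = q' c" by (intro D_ext) simp_all
qed (simp_all add: Q_mem_iff)

end

section \<open>Modules of comodule maps\<close>

lemma (in right_comodule) colinear_neg:
 assumes N: "right_comodule A C N \<sigma>" and f: "colinear A C M \<rho> N \<sigma> f"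
 shows "colinear A C M \<rho> N \<sigma> (\<lambda>m. \<ominus>\<^sub>N f m)"
proof -
 interpret N: right_comodule A C N \<sigma> by fact
 note fc = colinear_closed[OF f]
 have na: "\<ominus>\<^sub>N n \<leftharpoonup>\<^sub>N a = \<ominus>\<^sub>N (n \<leftharpoonup>\<^sub>N a)" if "n \<in> carrier N" "a \<in> carrier A" for n a
  using that by (intro additive_minus[where f = "\<lambda>n. n \<leftharpoonup>\<^sub>N a"] additiveI N.M.ab)
   (simp_all add: N.M.ract_closed N.M.ract_add_left)
 have rl: "right_linear A M N (\<lambda>m. \<ominus>\<^sub>N f m)"
  using fc by (intro right_linearI additiveI)
   (simp_all add: additive_add[OF colinear_additive[OF f]] colinear_ract[OF f] na N.M.M.minus_add)
 have tn: "tens A N C (\<ominus>\<^sub>N n) c = \<ominus>\<^bsub>tensor A N C\<^esub> tens A N C n c" if "n \<in> carrier N" "c \<in> carrier C" for n c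
  using that by (intro additive_minus[OF balanced_additive1[OF N.MC.tens_balanced]] N.M.ab N.MC.ab)
 note ad = N.MC.additive_tmap[OF MC.tensor_pair_axioms _ left_id]
  and tt = N.MC.tmap_tens[OF MC.tensor_pair_axioms _ left_id]
 note adf = ad[OF colinear_right_linear[OF f]]
 have adn: "additive (tensor A M C) (tensor A N C) (\<lambda>X. \<ominus>\<^bsub>tensor A N C\<^esub> tmap A N C f (\<lambda>c. c) X)"
  by (intro additiveI) (simp_all add: additive_closed[OF adf] additive_add[OF adf] N.MC.T.minus_add)
 have "tmap A N C (\<lambda>m. \<ominus>\<^sub>N f m) (\<lambda>c. c) X = \<ominus>\<^bsub>tensor A N C\<^esub> tmap A N C f (\<lambda>c. c) X"
  if "X \<in> carrier (tensor A M C)" for X by (rule MC.tensor_eqI[OF N.MC.ab ad[OF rl] adn _ that])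
   (simp add: tt[OF rl] tt[OF colinear_right_linear[OF f]] tn fc)
 moreover have "\<sigma> (\<ominus>\<^sub>N n) = \<ominus>\<^bsub>tensor A N C\<^esub> \<sigma> n" if "n \<in> carrier N" for n
  using that by (intro additive_minus[OF right_linear_additive[OF N.coact_linear]] N.M.ab N.MC.ab)
 ultimately show ?thesis using rl fc by (simp add: colinear_def colinear_coact[OF f])
qed

lemma (in right_comodule) abelian_group_comod_Hom:
 assumes N: "right_comodule A C N \<sigma>" and car: "carrier H = comod_Hom A C M \<rho> N \<sigma>"
  and str: "zero H = pointwise_zero (carrier M) N" "add H = pointwise_add (carrier M) N"
 shows "abelian_group H"
proof -
 interpret N: right_comodule A C N \<sigma> by fact
 have memD: "colinear A C M \<rho> N \<sigma> f" if "f \<in> carrier H" for f using that by (simp add: car mem_comod_Hom_iff)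
 have memI: "restrict f (carrier M) \<in> carrier H" if "colinear A C M \<rho> N \<sigma> f" for f
  unfolding car by (rule colinear_restrict[OF N.M.right_module_axioms that])
 show ?thesis
 proof (rule abelian_group_pointwise[where X = "carrier M" and G = N, OF N.M.ab])
  show "pointwise_zero (carrier M) N \<in> carrier H"
   unfolding pointwise_zero_def by (rule memI[OF colinear_zero[OF N]])
  show "pointwise_add (carrier M) N f g \<in> carrier H" if "f \<in> carrier H" "g \<in> carrier H" for f g
   unfolding pointwise_add_def by (rule memI[OF colinear_add[OF N memD memD]]) fact+
  show "(\<lambda>x\<in>carrier M. \<ominus>\<^sub>N f x) \<in> carrier H" if "f \<in> carrier H" for f
   by (rule memI[OF colinear_neg[OF N memD[OF that]]])
  show "f x \<in> carrier N" if "f \<in> carrier H" "x \<in> carrier M" for f x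
   by (rule colinear_closed[OF memD[OF that(1)] that(2)])
 qed (simp_all add: str car mem_comod_Hom_iff)
qed

lemma (in bicomodule) colinear_lact:
 assumes r: "r \<in> carrier R"
 shows "colinear A C N \<rho> N \<rho> (\<lambda>n. r \<rightharpoonup>\<^sub>N n)"
 using r left_linear_lact[OF coact_left _ r]
 by (auto simp: colinear_def tmap_def tensor_lact NB.lact_closed NB.lact_add_right NB.lact_ract
   intro!: right_linearI additiveI)

context fgp_bicomodule
begin

lemma comod_Hom_mod_simps:
 "carrier (comod_Hom_mod A C \<Sigma> \<rho> M \<sigma>) = comod_Hom A C \<Sigma> \<rho> M \<sigma>"
 "zero (comod_Hom_mod A C \<Sigma> \<rho> M \<sigma>) = pointwise_zero (carrier \<Sigma>) M"
 "add (comod_Hom_mod A C \<Sigma> \<rho> M \<sigma>) = pointwise_add (carrier \<Sigma>) M"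
 "ract (comod_Hom_mod A C \<Sigma> \<rho> M \<sigma>) = (\<lambda>h b. \<lambda>u\<in>carrier \<Sigma>. h (b \<rightharpoonup>\<^sub>\<Sigma> u))" by (simp_all add: comod_Hom_mod_def)

text \<open>
 Groups of additive maps on \<open>\<Sigma>\<close> with the action \<open>(hb)(u) = h(bu)\<close> are \<open>B\<close>-modules as soon as they are closed under it.
\<close>

lemma right_module_maps:
 assumes H: "abelian_group H"
  and add: "add H = pointwise_add (carrier \<Sigma>) M" and ract: "ract H = (\<lambda>h b. \<lambda>u\<in>carrier \<Sigma>. h (b \<rightharpoonup>\<^sub>\<Sigma> u))"
  and ext: "\<And>h. h \<in> carrier H ==> h \<in> extensional (carrier \<Sigma>)" and adh: "\<And>h. h \<in> carrier H ==> additive \<Sigma> M h"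
  and cl: "\<And>h b. h \<in> carrier H ==> b \<in> carrier B ==> h \<leftharpoonup>\<^sub>H b \<in> carrier H"
 shows "right_module B H"
proof -
 interpret H: abelian_group H by fact
 have eq: "h = h'" if "h \<in> carrier H" "h' \<in> carrier H" "\<And>u. u \<in> carrier \<Sigma> ==> h u = h' u" for h h'
  by (rule extensionalityI[OF ext[OF that(1)] ext[OF that(2)] that(3)])
 have ap: "(h \<oplus>\<^sub>H h') u = h u \<oplus>\<^sub>M h' u" "(h \<leftharpoonup>\<^sub>H b) u = h (b \<rightharpoonup>\<^sub>\<Sigma> u)" if "u \<in> carrier \<Sigma>" for h h' u b
  using that by (simp_all add: add ract pointwise_add_def)
 show ?thesis
 proof (intro right_module.intro right_module_axioms.intro BA.R.ring_axioms H.abelian_group_axioms cl)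
  fix m r s assume *: "m \<in> carrier H" "r \<in> carrier B" "s \<in> carrier B"
  show "m \<leftharpoonup>\<^sub>H (r \<oplus>\<^sub>B s) = m \<leftharpoonup>\<^sub>H r \<oplus>\<^sub>H m \<leftharpoonup>\<^sub>H s"
   using * by (intro eq) (simp_all add: cl ap BA.lact_add_left BA.lact_closed additive_add[OF adh])
  show "m \<leftharpoonup>\<^sub>H (r \<otimes>\<^sub>B s) = m \<leftharpoonup>\<^sub>H r \<leftharpoonup>\<^sub>H s"
   using * by (intro eq) (simp_all add: cl ap BA.lact_mult BA.lact_closed)
 next
  fix m n r assume *: "m \<in> carrier H" "n \<in> carrier H" "r \<in> carrier B"
  show "(m \<oplus>\<^sub>H n) \<leftharpoonup>\<^sub>H r = m \<leftharpoonup>\<^sub>H r \<oplus>\<^sub>H n \<leftharpoonup>\<^sub>H r"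
   using * by (intro eq) (simp_all add: cl ap BA.lact_closed)
 next
  fix m assume *: "m \<in> carrier H"
  show "m \<leftharpoonup>\<^sub>H \<one>\<^sub>B = m" using * by (intro eq) (simp_all add: cl ap BA.lact_one)
 qed
qed

lemma right_module_comod_Hom_mod:
 assumes M: "right_comodule A C M \<sigma>"
 shows "right_module B (comod_Hom_mod A C \<Sigma> \<rho> M \<sigma>)"
proof (rule right_module_maps[where M = M])
 interpret M: right_comodule A C M \<sigma> by fact
 let ?H = "comod_Hom_mod A C \<Sigma> \<rho> M \<sigma>"
 show "abelian_group ?H" by (rule abelian_group_comod_Hom[OF M]) (simp_all add: comod_Hom_mod_simps)
 have memD: "colinear A C \<Sigma> \<rho> M \<sigma> h" if "h \<in> carrier ?H" for h
  using that by (simp add: comod_Hom_mod_simps mem_comod_Hom_iff)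
 show "additive \<Sigma> M h" if "h \<in> carrier ?H" for h by (rule colinear_additive[OF memD[OF that]])
 show "h \<leftharpoonup>\<^bsub>?H\<^esub> b \<in> carrier ?H" if "h \<in> carrier ?H" "b \<in> carrier B" for h b
  unfolding comod_Hom_mod_simps by (rule colinear_restrict[OF M.M.right_module_axioms
     colinear_comp[OF right_comodule_axioms M.M.right_module_axioms colinear_lact[OF that(2)] memD[OF that(1)]]])
qed (simp_all add: comod_Hom_mod_simps mem_comod_Hom_iff)

section \<open>The Morita context of a comodule\<close>

abbreviation "T \<equiv> comod_End A C \<Sigma> \<rho>"

lemma T_simps:
 "carrier T = comod_Hom A C \<Sigma> \<rho> \<Sigma> \<rho>" "mult T = compose (carrier \<Sigma>)" "one T = (\<lambda>u\<in>carrier \<Sigma>. u)"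
 "zero T = pointwise_zero (carrier \<Sigma>) \<Sigma>" "add T = pointwise_add (carrier \<Sigma>) \<Sigma>" by (simp_all add: comod_End_def)

lemma T_colinear: "t \<in> carrier T ==> colinear A C \<Sigma> \<rho> \<Sigma> \<rho> t" by (simp add: T_simps mem_comod_Hom_iff)

lemma TI: "colinear A C \<Sigma> \<rho> \<Sigma> \<rho> t ==> (\<lambda>u\<in>carrier \<Sigma>. t u) \<in> carrier T"
 unfolding T_simps by (rule colinear_restrict[OF BA.right_module_axioms])

lemma T_closed [simp]: "t \<in> carrier T ==> u \<in> carrier \<Sigma> ==> t u \<in> carrier \<Sigma>" by (rule colinear_closed[OF T_colinear])

lemma T_add: "t \<in> carrier T ==> u \<in> carrier \<Sigma> ==> v \<in> carrier \<Sigma> ==> t (u \<oplus>\<^sub>\<Sigma> v) = t u \<oplus>\<^sub>\<Sigma> t v"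
 by (rule additive_add[OF colinear_additive[OF T_colinear]])

lemma T_coact_eval:
 "t \<in> carrier T ==> g \<in> carrier Cs ==> u \<in> carrier \<Sigma> ==> t (coact_eval \<Sigma> \<rho> u g) = coact_eval \<Sigma> \<rho> (t u) g"
 by (rule colinear_coact_eval[OF right_comodule_axioms T_colinear])

lemma T_ext: "s \<in> carrier T ==> t \<in> carrier T ==> (\<And>u. u \<in> carrier \<Sigma> ==> s u = t u) ==> s = t"
 by (rule extensionalityI[of _ "carrier \<Sigma>"]) (simp_all add: T_simps mem_comod_Hom_iff)

lemma T_apply:
 "u \<in> carrier \<Sigma> ==> (s \<oplus>\<^sub>T t) u = s u \<oplus>\<^sub>\<Sigma> t u" "u \<in> carrier \<Sigma> ==> (s \<otimes>\<^sub>T t) u = s (t u)"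
 "u \<in> carrier \<Sigma> ==> \<one>\<^sub>T u = u" by (simp_all add: T_simps pointwise_add_def compose_def)

lemma abelian_group_T: "abelian_group T"
 by (rule abelian_group_comod_Hom[OF right_comodule_axioms]) (simp_all add: T_simps)

lemma T_one_closed: "\<one>\<^sub>T \<in> carrier T"
 using TI[OF colinear_id] by (simp add: T_simps)

lemma T_mult_closed: "s \<in> carrier T ==> t \<in> carrier T ==> s \<otimes>\<^sub>T t \<in> carrier T"
 using TI[OF colinear_comp[OF right_comodule_axioms BA.right_module_axioms T_colinear T_colinear]]
 by (simp add: T_simps(2) compose_def)

lemma ring_T: "ring T"
proof -
 interpret T: abelian_group T by (rule abelian_group_T)
 show ?thesis
 proof (rule ringI[OF abelian_group_T])
  show "monoid T" by (rule monoidI) (auto intro!: T_ext simp: T_mult_closed T_one_closed T_apply)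
 qed (auto intro!: T_ext T.a_closed T_mult_closed simp: T_mult_closed T_apply T_add)
qed

lemma l_closed: "b \<in> carrier B ==> (\<lambda>u\<in>carrier \<Sigma>. b \<rightharpoonup>\<^sub>\<Sigma> u) \<in> carrier T" by (rule TI[OF colinear_lact])

abbreviation "P \<equiv> Sigma_Tdual \<Sigma> \<rho>"

lemma P_simps [simp]:
 "carrier P = carrier \<Sigma>" "zero P = zero \<Sigma>" "add P = add \<Sigma>" "lact P = (\<lambda>t u. t u)" "ract P = coact_eval \<Sigma> \<rho>"
 by (simp_all add: Sigma_Tdual_def)

lemma bimodule_P: "bimodule T Cs P"
proof (intro bimodule.intro left_module.intro right_module.intro left_module_axioms.intro
  right_module_axioms.intro bimodule_axioms.intro ring_T C.ring_Cs)
 show "abelian_group P" by (rule abelian_groupI) (auto simp: BA.M.a_ac intro: BA.M.l_neg)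
 then show "abelian_group P" .
qed (simp_all add: T_add T_apply coact_eval_closed coact_eval_add coact_eval_add_right coact_eval_mult
  coact_eval_one T_coact_eval)

abbreviation "QM \<equiv> Q_dualT A C \<Sigma> \<rho>"

lemma QM_simps:
 "carrier QM = Q" "zero QM = pointwise_zero (carrier C) D" "add QM = pointwise_add (carrier C) D"
 "lact QM = (\<lambda>f q. \<lambda>c\<in>carrier C. q (hit C c f))" "ract QM = (\<lambda>q t. \<lambda>c\<in>carrier C. compose (carrier \<Sigma>) (q c) t)"
 by (simp_all add: Q_dualT_def)

lemma QM_apply:
 "c \<in> carrier C ==> u \<in> carrier \<Sigma> ==> (q \<oplus>\<^sub>QM q') c u = q c u \<oplus>\<^sub>A q' c u"
 "c \<in> carrier C ==> u \<in> carrier \<Sigma> ==> (f \<rightharpoonup>\<^sub>QM q) c u = q (hit C c f) u"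
 "c \<in> carrier C ==> u \<in> carrier \<Sigma> ==> (q \<leftharpoonup>\<^sub>QM t) c u = q c (t u)"
 by (simp_all add: QM_simps pointwise_add_def D_apply compose_def)

lemma slice_zero: "u \<in> carrier \<Sigma> ==> slice C \<rho> \<zero>\<^sub>D u = \<zero>\<^sub>C"
 by (rule additive_zero[where f = "\<lambda>f. slice C \<rho> f u", OF _ abelian_group_D C.ab])
  (intro additiveI; simp add: slice_add_left)

lemma slice_neg: "f \<in> carrier D ==> u \<in> carrier \<Sigma> ==> slice C \<rho> (\<ominus>\<^sub>D f) u = \<ominus>\<^sub>C slice C \<rho> f u"
 by (rule additive_minus[where f = "\<lambda>f. slice C \<rho> f u", OF _ abelian_group_D C.ab])
  (intro additiveI; simp add: slice_add_left)

lemma additive_hit_right: "c \<in> carrier C ==> additive Cs C (\<lambda>g. hit C c g)"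
 by (intro additiveI) (simp_all add: C.hit_closed C.hit_add_right)

lemma D_neg_apply: "f \<in> carrier D ==> u \<in> carrier \<Sigma> ==> (\<ominus>\<^sub>D f) u = \<ominus>\<^sub>A f u"
 by (rule additive_minus[where f = "\<lambda>f. f u", OF _ abelian_group_D BA.S.abelian_group_axioms])
  (intro additiveI; simp add: D_apply)

lemma Cs_neg_apply: "f \<in> carrier Cs ==> c \<in> carrier C ==> (\<ominus>\<^sub>Cs f) c = \<ominus>\<^sub>A f c"
 by (rule additive_minus[where f = "\<lambda>f. f c", OF _ C.abelian_group_Cs BA.S.abelian_group_axioms])
  (intro additiveI; simp add: C.Cs_add_apply)

lemma pointwise_add_Q: "q \<in> Q ==> q' \<in> Q ==> pointwise_add (carrier C) D q q' \<in> Q"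
proof (rule QI)
 fix c u assume *: "q \<in> Q" "q' \<in> Q" "c \<in> carrier C" "u \<in> carrier \<Sigma>"
 have "ev (pointwise_add (carrier C) D q q') u = ev q u \<oplus>\<^sub>Cs ev q' u"
  using * by (auto simp: pointwise_add_def D_apply C.Cs_simps)
 then show "slice C \<rho> (pointwise_add (carrier C) D q q' c) u = hit C c (ev (pointwise_add (carrier C) D q q') u)"
  using * by (simp add: pointwise_add_def slice_add_left Q_slice C.hit_add_right)
qed (simp_all add: pointwise_add_def D_apply Q_add Q_lact BA.S.a_ac C.lact_closed BA.S.r_distr D.a_closed)

lemma abelian_group_Q:
 assumes "carrier H = Q" "zero H = pointwise_zero (carrier C) D" "add H = pointwise_add (carrier C) D"
 shows "abelian_group H"
proof -
 interpret Cs: ring Cs by (rule C.ring_Cs)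
 show ?thesis
 proof (rule abelian_group_pointwise[where X = "carrier C" and G = D, OF abelian_group_D])
  show "pointwise_zero (carrier C) D \<in> carrier H"
   unfolding assms
  proof (rule QI)
   fix c u assume *: "c \<in> carrier C" "u \<in> carrier \<Sigma>"
   have "ev (pointwise_zero (carrier C) D) u = \<zero>\<^sub>Cs"
    using * by (auto simp: pointwise_zero_def D_apply C.Cs_simps)
   then show "slice C \<rho> (pointwise_zero (carrier C) D c) u = hit C c (ev (pointwise_zero (carrier C) D) u)"
    using * additive_zero[OF additive_hit_right C.abelian_group_Cs C.ab, of c]
    by (simp add: pointwise_zero_def slice_zero)
  qed (simp_all add: pointwise_zero_def D_apply C.lact_closed)
  show "pointwise_add (carrier C) D q q' \<in> carrier H" if "q \<in> carrier H" "q' \<in> carrier H" for q q'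
   using that by (simp add: assms pointwise_add_Q)
  show "(\<lambda>c\<in>carrier C. \<ominus>\<^sub>D q c) \<in> carrier H" if "q \<in> carrier H" for q
   unfolding assms
  proof (rule QI)
   have q: "q \<in> Q" using that assms by simp
   {
    fix c u assume *: "c \<in> carrier C" "u \<in> carrier \<Sigma>"
    have "ev (\<lambda>c\<in>carrier C. \<ominus>\<^sub>D q c) u = \<ominus>\<^sub>Cs ev q u"
     using * q by (intro C.Cs_ext[OF _ Cs.a_inv_closed] C.CsI)
      (simp_all add: D_lact_closed D_neg_apply Cs_neg_apply Q_add Q_lact D_apply C.lact_closed BA.S.minus_add BA.S.r_minus)
    then show "slice C \<rho> ((\<lambda>c\<in>carrier C. \<ominus>\<^sub>D q c) c) u = hit C c (ev (\<lambda>c\<in>carrier C. \<ominus>\<^sub>D q c) u)"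
     using * q additive_minus[OF additive_hit_right C.abelian_group_Cs C.ab, of c "ev q u"]
     by (simp add: slice_neg Q_slice)
   }
  qed (use that assms in \<open>simp_all add: D_lact_closed D_neg_apply Q_add Q_lact D_apply C.lact_closed BA.S.minus_add BA.S.r_minus\<close>)
  show "q \<in> extensional (carrier C)" if "q \<in> carrier H" for q using that by (simp add: assms Q_mem_iff)
 qed (simp_all add: assms)
qed

lemma ev_lact: "f \<in> carrier Cs ==> q \<in> Q ==> u \<in> carrier \<Sigma> ==> ev (f \<rightharpoonup>\<^sub>QM q) u = f \<otimes>\<^sub>Cs ev q u"
 by (auto simp: QM_simps C.Cs_simps C.hit_closed)

lemma ev_ract: "u \<in> carrier \<Sigma> ==> ev (q \<leftharpoonup>\<^sub>QM t) u = ev q (t u)" by (auto simp: QM_simps compose_def)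

lemma Q_lact_closed: "f \<in> carrier Cs ==> q \<in> Q ==> f \<rightharpoonup>\<^sub>QM q \<in> Q"
proof (rule QI)
 fix c u assume *: "f \<in> carrier Cs" "q \<in> Q" "c \<in> carrier C" "u \<in> carrier \<Sigma>"
 then show "slice C \<rho> ((f \<rightharpoonup>\<^sub>QM q) c) u = hit C c (ev (f \<rightharpoonup>\<^sub>QM q) u)"
  unfolding ev_lact[OF *(1,2,4)] by (simp add: QM_simps Q_slice C.hit_closed C.hit_mult)
qed (simp_all add: QM_simps C.hit_closed C.hit_add C.hit_lact Q_add Q_lact D_apply C.lact_closed)

lemma Q_ract_closed: "q \<in> Q ==> t \<in> carrier T ==> q \<leftharpoonup>\<^sub>QM t \<in> Q"
proof (rule QI)
 fix c u assume *: "q \<in> Q" "t \<in> carrier T" "c \<in> carrier C" "u \<in> carrier \<Sigma>"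
 then show "slice C \<rho> ((q \<leftharpoonup>\<^sub>QM t) c) u = hit C c (ev (q \<leftharpoonup>\<^sub>QM t) u)"
  unfolding ev_ract[OF *(4)] by (simp add: QM_simps compose_def slice_comp[OF T_colinear] Q_slice)
qed (use D_comp_closed[OF T_colinear, of _ "q _"] in
  \<open>simp_all add: QM_simps compose_def Q_add Q_lact D_apply C.lact_closed\<close>)

lemma bimodule_QM: "bimodule Cs T QM"
proof -
 interpret QM: abelian_group QM by (rule abelian_group_Q) (simp_all add: QM_simps)
 note [simp] = QM_apply Q_lact_closed Q_ract_closed T_apply C.hit_closed
 have ac: "q \<oplus>\<^sub>QM q' \<in> Q" if "q \<in> Q" "q' \<in> Q" for q q' using that QM.a_closed by (simp add: QM_simps(1))
 show ?thesis
 proof (intro bimodule.intro left_module.intro right_module.intro left_module_axioms.intro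
   right_module_axioms.intro bimodule_axioms.intro ring_T C.ring_Cs QM.abelian_group_axioms)
  interpret Cs: ring Cs by (rule C.ring_Cs)
  interpret T: ring T by (rule ring_T)
  fix f g q assume "f \<in> carrier Cs" "g \<in> carrier Cs" "q \<in> carrier QM"
  then show "(f \<oplus>\<^sub>Cs g) \<rightharpoonup>\<^sub>QM q = (f \<rightharpoonup>\<^sub>QM q) \<oplus>\<^sub>QM (g \<rightharpoonup>\<^sub>QM q)"
   by (intro Q_ext) (simp_all add: QM_simps(1) ac C.hit_add_right Q_add D_apply)
 next
  interpret Cs: ring Cs by (rule C.ring_Cs)
  fix f g q assume "f \<in> carrier Cs" "g \<in> carrier Cs" "q \<in> carrier QM"
  then show "(f \<otimes>\<^sub>Cs g) \<rightharpoonup>\<^sub>QM q = f \<rightharpoonup>\<^sub>QM g \<rightharpoonup>\<^sub>QM q" by (intro Q_ext) (simp_all add: QM_simps(1) C.hit_mult)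
 next
  interpret T: ring T by (rule ring_T)
  fix q s t assume "q \<in> carrier QM" "s \<in> carrier T" "t \<in> carrier T"
  then show "q \<leftharpoonup>\<^sub>QM (s \<oplus>\<^sub>T t) = q \<leftharpoonup>\<^sub>QM s \<oplus>\<^sub>QM q \<leftharpoonup>\<^sub>QM t"
   "q \<leftharpoonup>\<^sub>QM (s \<otimes>\<^sub>T t) = q \<leftharpoonup>\<^sub>QM s \<leftharpoonup>\<^sub>QM t" by (auto intro!: Q_ext simp: QM_simps(1) ac D_add)
 next
  fix q assume "q \<in> carrier QM"
  then show "\<one>\<^sub>Cs \<rightharpoonup>\<^sub>QM q = q"
   using C.Cs_one_closed by (intro Q_ext) (simp_all add: QM_simps(1) C.hit_one C.Cs_simps(2)[symmetric])
  show "q \<leftharpoonup>\<^sub>QM \<one>\<^sub>T = q"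
   using \<open>q \<in> carrier QM\<close> T_one_closed by (intro Q_ext) (simp_all add: QM_simps(1))
 next
  fix f q q' assume "f \<in> carrier Cs" "q \<in> carrier QM" "q' \<in> carrier QM"
  then show "f \<rightharpoonup>\<^sub>QM (q \<oplus>\<^sub>QM q') = (f \<rightharpoonup>\<^sub>QM q) \<oplus>\<^sub>QM (f \<rightharpoonup>\<^sub>QM q')" by (intro Q_ext) (simp_all add: QM_simps(1) ac)
 next
  fix q q' t assume "q \<in> carrier QM" "q' \<in> carrier QM" "t \<in> carrier T"
  then show "(q \<oplus>\<^sub>QM q') \<leftharpoonup>\<^sub>QM t = q \<leftharpoonup>\<^sub>QM t \<oplus>\<^sub>QM q' \<leftharpoonup>\<^sub>QM t" by (intro Q_ext) (simp_all add: QM_simps(1) ac)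
 next
  fix f q t assume "f \<in> carrier Cs" "q \<in> carrier QM" "t \<in> carrier T"
  then show "(f \<rightharpoonup>\<^sub>QM q) \<leftharpoonup>\<^sub>QM t = f \<rightharpoonup>\<^sub>QM (q \<leftharpoonup>\<^sub>QM t)" by (intro Q_ext) (simp_all add: QM_simps(1))
 qed (simp_all add: QM_simps(1))
qed

end

context tensor_pair
begin

lemma left_linear_tlift:
 assumes L: "bimodule L A M" and G: "left_module L G" and f: "balanced A M N G f"
  and eq: "\<And>l m n. l \<in> carrier L ==> m \<in> carrier M ==> n \<in> carrier N ==> f (l \<rightharpoonup>\<^sub>M m) n = l \<rightharpoonup>\<^sub>G f m n"
 shows "left_linear L (tensor A M N) G (tlift G f)"
proof -
 interpret G: left_module L G by fact
 interpret L: bimodule L A M by fact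
 note Gab = G.ab
 show ?thesis
 proof (rule left_linearI[OF additive_tlift[OF Gab f]])
  fix X l assume X: "X \<in> carrier (tensor A M N)" and l: "l \<in> carrier L"
  have ad: "additive G G (\<lambda>x. l \<rightharpoonup>\<^sub>G x)" using l by (intro additiveI) (simp_all add: G.lact_closed G.lact_add_right)
  show "tlift G f (l \<rightharpoonup>\<^bsub>tensor A M N\<^esub> X) = l \<rightharpoonup>\<^sub>G tlift G f X"
   using l by - (rule tensor_eqI[OF Gab additive_comp[OF additive_lact[OF L l] additive_tlift[OF Gab f]]
     additive_comp[OF additive_tlift[OF Gab f] ad] _ X], simp add: lact_tens[OF L] L.lact_closed Gab f eq)
 qed
qed

lemma right_linear_tlift:
 assumes R: "bimodule A R N" and G: "right_module R G" and f: "balanced A M N G f"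
  and eq: "\<And>r m n. r \<in> carrier R ==> m \<in> carrier M ==> n \<in> carrier N ==> f m (n \<leftharpoonup>\<^sub>N r) = f m n \<leftharpoonup>\<^sub>G r"
 shows "right_linear R (tensor A M N) G (tlift G f)"
proof -
 interpret G: right_module R G by fact
 interpret R: bimodule A R N by fact
 note Gab = G.ab
 show ?thesis
 proof (rule right_linearI[OF additive_tlift[OF Gab f]])
  fix X r assume X: "X \<in> carrier (tensor A M N)" and r: "r \<in> carrier R"
  have ad: "additive G G (\<lambda>x. x \<leftharpoonup>\<^sub>G r)" using r by (intro additiveI) (simp_all add: G.ract_closed G.ract_add_left)
  show "tlift G f (X \<leftharpoonup>\<^bsub>tensor A M N\<^esub> r) = tlift G f X \<leftharpoonup>\<^sub>G r"
   using r by - (rule tensor_eqI[OF Gab additive_comp[OF additive_ract[OF R r] additive_tlift[OF Gab f]]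
     additive_comp[OF additive_tlift[OF Gab f] ad] _ X], simp add: ract_tens[OF R] R.ract_closed Gab f eq)
 qed
qed

end

text \<open>
 The data of a Morita context with the connecting maps \<open>t\<close> and \<open>m\<close> given on pairs.  In this form the axioms are identities between
 elements, so they can be transported along a bijection before any tensor product is formed.
\<close>

definition morita_data ::
 "'r ring => 's ring => ('r, 's, 'p) bimod => ('s, 'r, 'q) bimod => ('p => 'q => 'r) => ('q => 'p => 's) => bool"
 where "morita_data R S P Q t m \<longleftrightarrow> bimodule R S P \<and> bimodule S R Q \<and> balanced S P Q R t \<and> balanced R Q P S m \<and>
  (\<forall>p\<in>carrier P. \<forall>q\<in>carrier Q. \<forall>r\<in>carrier R.
   t (r \<rightharpoonup>\<^sub>P p) q = r \<otimes>\<^sub>R t p q \<and> t p (q \<leftharpoonup>\<^sub>Q r) = t p q \<otimes>\<^sub>R r) \<and>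
  (\<forall>p\<in>carrier P. \<forall>q\<in>carrier Q. \<forall>s\<in>carrier S.
   m (s \<rightharpoonup>\<^sub>Q q) p = s \<otimes>\<^sub>S m q p \<and> m q (p \<leftharpoonup>\<^sub>P s) = m q p \<otimes>\<^sub>S s) \<and>
  (\<forall>p\<in>carrier P. \<forall>q\<in>carrier Q. \<forall>p'\<in>carrier P. t p q \<rightharpoonup>\<^sub>P p' = p \<leftharpoonup>\<^sub>P m q p') \<and>
  (\<forall>p\<in>carrier P. \<forall>q\<in>carrier Q. \<forall>q'\<in>carrier Q. m q p \<rightharpoonup>\<^sub>Q q' = q \<leftharpoonup>\<^sub>Q t p q')"

lemma morita_dataD:
 assumes "morita_data R S P Q t m"
 shows "bimodule R S P" "bimodule S R Q" "balanced S P Q R t" "balanced R Q P S m"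
  "\<And>p q r. p \<in> carrier P ==> q \<in> carrier Q ==> r \<in> carrier R ==> t (r \<rightharpoonup>\<^sub>P p) q = r \<otimes>\<^sub>R t p q"
  "\<And>p q r. p \<in> carrier P ==> q \<in> carrier Q ==> r \<in> carrier R ==> t p (q \<leftharpoonup>\<^sub>Q r) = t p q \<otimes>\<^sub>R r"
  "\<And>p q s. p \<in> carrier P ==> q \<in> carrier Q ==> s \<in> carrier S ==> m (s \<rightharpoonup>\<^sub>Q q) p = s \<otimes>\<^sub>S m q p"
  "\<And>p q s. p \<in> carrier P ==> q \<in> carrier Q ==> s \<in> carrier S ==> m q (p \<leftharpoonup>\<^sub>P s) = m q p \<otimes>\<^sub>S s"
  "\<And>p q p'. p \<in> carrier P ==> q \<in> carrier Q ==> p' \<in> carrier P ==> t p q \<rightharpoonup>\<^sub>P p' = p \<leftharpoonup>\<^sub>P m q p'"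
  "\<And>p q q'. p \<in> carrier P ==> q \<in> carrier Q ==> q' \<in> carrier Q ==> m q p \<rightharpoonup>\<^sub>Q q' = q \<leftharpoonup>\<^sub>Q t p q'"
 using assms unfolding morita_data_def by blast+

lemma balanced_regular: "balanced A M N (regular G) f \<longleftrightarrow> balanced A M N G f" by (simp add: balanced_def)

lemma morita_data_context:
 assumes d: "morita_data R S P Q t m"
 shows "morita_context \<lparr>lring = R, rring = S, pmod = P, qmod = Q, tau = tlift R t, mu = tlift S m\<rparr>"
proof -
 note d = morita_dataD[OF d]
 interpret P: bimodule R S P by (rule d)
 interpret Q: bimodule S R Q by (rule d)
 interpret PQ: tensor_pair S P Q by (intro tensor_pair.intro P.right_module_axioms Q.left_module_axioms)
 interpret QP: tensor_pair R Q P by (intro tensor_pair.intro Q.right_module_axioms P.left_module_axioms)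
 interpret RR: bimodule R R "regular R" by (rule bimodule_regular[OF P.R.ring_axioms])
 interpret SS: bimodule S S "regular S" by (rule bimodule_regular[OF P.S.ring_axioms])
 have t: "balanced S P Q (regular R) t" and m: "balanced R Q P (regular S) m" using d by (simp_all add: balanced_regular)
 have "bimod_map R R (tensor S P Q) (regular R) (tlift (regular R) t)"
  unfolding bimod_map_def
  by (intro conjI PQ.left_linear_tlift PQ.right_linear_tlift RR.left_module_axioms RR.right_module_axioms t d(1,2))
   (simp_all add: d)
 moreover have "bimod_map S S (tensor R Q P) (regular S) (tlift (regular S) m)"
  unfolding bimod_map_def
  by (intro conjI QP.left_linear_tlift QP.right_linear_tlift SS.left_module_axioms SS.right_module_axioms m d(1,2))
   (simp_all add: d)
 ultimately show ?thesis
  by (simp add: morita_context_def tensor_pq_def tensor_qp_def d P.R.abelian_group_axioms P.S.abelian_group_axioms tlift_regular)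
qed

lemma bimodule_transport:
 assumes M: "bimodule L R M" and N: "abelian_group N" and J: "additive N M J" "inj_on J (carrier N)"
  and cl: "\<And>l n. l \<in> carrier L ==> n \<in> carrier N ==> l \<rightharpoonup>\<^sub>N n \<in> carrier N"
   "\<And>n r. n \<in> carrier N ==> r \<in> carrier R ==> n \<leftharpoonup>\<^sub>N r \<in> carrier N"
  and lin: "\<And>l n. l \<in> carrier L ==> n \<in> carrier N ==> J (l \<rightharpoonup>\<^sub>N n) = l \<rightharpoonup>\<^sub>M J n"
   "\<And>n r. n \<in> carrier N ==> r \<in> carrier R ==> J (n \<leftharpoonup>\<^sub>N r) = J n \<leftharpoonup>\<^sub>M r"
 shows "bimodule L R N"
proof -
 interpret M: bimodule L R M by fact
 interpret N: abelian_group N by fact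
 note Jc = additive_closed[OF J(1)] and Ja = additive_add[OF J(1)]
 show ?thesis by (intro bimodule.intro left_module.intro right_module.intro left_module_axioms.intro
    right_module_axioms.intro bimodule_axioms.intro M.R.ring_axioms M.S.ring_axioms N)
   ((rule inj_onD[OF J(2)])?; simp add: cl lin Jc Ja M.lact_add_left M.lact_add_right M.lact_mult M.lact_one
    M.ract_add_left M.ract_add_right M.ract_mult M.ract_one M.lact_ract M.lact_closed M.ract_closed)+
qed

text \<open>
 The second module of a context may be replaced along a bijection \<open>d\<close>; all structure is carried over, and \<open>d\<close> is part of an
 isomorphism of contexts.
\<close>

lemma morita_transport:
 assumes d: "morita_data R S P Q t m" and N: "abelian_group N"
  and J: "additive N Q J" "bij_betw J (carrier N) (carrier Q)"
  and cl: "\<And>s n. s \<in> carrier S ==> n \<in> carrier N ==> s \<rightharpoonup>\<^sub>N n \<in> carrier N"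
   "\<And>n r. n \<in> carrier N ==> r \<in> carrier R ==> n \<leftharpoonup>\<^sub>N r \<in> carrier N"
  and lin: "\<And>s n. s \<in> carrier S ==> n \<in> carrier N ==> J (s \<rightharpoonup>\<^sub>N n) = s \<rightharpoonup>\<^sub>Q J n"
   "\<And>n r. n \<in> carrier N ==> r \<in> carrier R ==> J (n \<leftharpoonup>\<^sub>N r) = J n \<leftharpoonup>\<^sub>Q r"
  and t': "\<And>p n. p \<in> carrier P ==> n \<in> carrier N ==> t' p n = t p (J n)"
  and m': "\<And>p n. p \<in> carrier P ==> n \<in> carrier N ==> m' n p = m (J n) p"
 shows "morita_isomorphic \<lparr>lring = R, rring = S, pmod = P, qmod = Q, tau = tlift R t, mu = tlift S m\<rparr>
  \<lparr>lring = R, rring = S, pmod = P, qmod = N, tau = tlift R t', mu = tlift S m'\<rparr>"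
proof -
 note dd = morita_dataD[OF d]
 interpret P: bimodule R S P by (rule dd)
 interpret Q: bimodule S R Q by (rule dd)
 have inj: "inj_on J (carrier N)" using J(2) by (rule bij_betw_imp_inj_on)
 interpret N: bimodule S R N by (rule bimodule_transport[OF dd(2) N J(1) inj cl lin])
 note Jc [simp] = additive_closed[OF J(1)] and Ja = additive_add[OF J(1)]
 have d': "morita_data R S P N t' m'"
  unfolding morita_data_def
 proof (intro conjI ballI dd(1) N.bimodule_axioms)
  show "balanced S P N R t'"
   by (rule balancedI) (simp_all add: t' balancedD[OF dd(3)] Ja P.ract_closed N.lact_closed lin)
  show "balanced R N P S m'"
   by (rule balancedI) (simp_all add: m' balancedD[OF dd(4)] Ja P.lact_closed N.ract_closed lin)
  fix p q q' assume *: "p \<in> carrier P" "q \<in> carrier N" "q' \<in> carrier N"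
  then have "m' q p \<in> carrier S" "t' p q' \<in> carrier R" by (simp_all add: m' t' balancedD[OF dd(3)] balancedD[OF dd(4)])
  with * show "m' q p \<rightharpoonup>\<^sub>N q' = q \<leftharpoonup>\<^sub>N t' p q'" by (intro inj_onD[OF inj]) (simp_all add: lin cl, simp add: dd m' t')
 qed (simp_all add: t' m' dd cl lin P.lact_closed P.ract_closed)
 define \<delta> where "\<delta> = inv_into (carrier N) J"
 have J\<delta>: "J (\<delta> q) = q" and \<delta>c: "\<delta> q \<in> carrier N" if "q \<in> carrier Q" for q
  using that J(2) unfolding \<delta>_def bij_betw_def by (auto intro: f_inv_into_f inv_into_into)
 have \<delta>J: "\<delta> (J n) = n" if "n \<in> carrier N" for n using that inj by (simp add: \<delta>_def)
 have \<delta>lin: "\<delta> (q \<oplus>\<^sub>Q q') = \<delta> q \<oplus>\<^sub>N \<delta> q'" "s \<in> carrier S ==> \<delta> (s \<rightharpoonup>\<^sub>Q q) = s \<rightharpoonup>\<^sub>N \<delta> q"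
  "r \<in> carrier R ==> \<delta> (q \<leftharpoonup>\<^sub>Q r) = \<delta> q \<leftharpoonup>\<^sub>N r"
  if "q \<in> carrier Q" "q' \<in> carrier Q" for q q' s r
  using that by (auto intro!: inj_onD[OF inj] simp: J\<delta> \<delta>c Ja lin cl Q.lact_closed Q.ract_closed)
 have bij\<delta>: "bij_betw \<delta> (carrier Q) (carrier N)"
  unfolding \<delta>_def by (rule bij_betw_inv_into[OF J(2)])
 have ll: "left_linear S Q N \<delta>" and rl: "right_linear R Q N \<delta>"
  by (auto intro!: left_linearI right_linearI additiveI simp: \<delta>lin \<delta>c)
 interpret PQ: tensor_pair S P Q by (intro tensor_pair.intro P.right_module_axioms Q.left_module_axioms)
 interpret QP: tensor_pair R Q P by (intro tensor_pair.intro Q.right_module_axioms P.left_module_axioms)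
 interpret PN: tensor_pair S P N by (intro tensor_pair.intro P.right_module_axioms N.left_module_axioms)
 interpret NP: tensor_pair R N P by (intro tensor_pair.intro N.right_module_axioms P.left_module_axioms)
 note dd' = morita_dataD[OF d']
 have tau: "tlift R t' (tmap S P N (\<lambda>p. p) \<delta> x) = tlift R t x" if "x \<in> carrier (tensor S P Q)" for x
 proof -
  have "tlift R t' (tmap S P N (\<lambda>p. p) \<delta> x) = tlift R (\<lambda>p q. t' p (\<delta> q)) x"
   by (rule PN.tlift_tmap[OF PQ.tensor_pair_axioms right_linear_id ll P.R.abelian_group_axioms dd'(3) that])
  also have "\<dots> = tlift R t x"
   by (intro PQ.tlift_cong[symmetric, OF P.R.abelian_group_axioms dd(3) _ that]) (simp add: t' \<delta>c J\<delta>)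
  finally show ?thesis .
 qed
 have mu: "tlift S m' (tmap R N P \<delta> (\<lambda>p. p) x) = tlift S m x" if "x \<in> carrier (tensor R Q P)" for x
 proof -
  have "tlift S m' (tmap R N P \<delta> (\<lambda>p. p) x) = tlift S (\<lambda>q p. m' (\<delta> q) p) x"
   by (rule NP.tlift_tmap[OF QP.tensor_pair_axioms rl left_id P.S.abelian_group_axioms dd'(4) that])
  also have "\<dots> = tlift S m x"
   by (intro QP.tlift_cong[symmetric, OF P.S.abelian_group_axioms dd(4) _ that]) (simp add: m' \<delta>c J\<delta>)
  finally show ?thesis .
 qed
 have isos: "(\<lambda>r. r) \<in> ring_iso R R" "(\<lambda>r. r) \<in> ring_iso S S" "(\<lambda>p. p) \<in> iso (add_monoid P) (add_monoid P)"
  "\<delta> \<in> iso (add_monoid Q) (add_monoid N)"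
  using bij\<delta> by (auto simp: ring_iso_def ring_hom_def iso_def hom_def bij_betw_def \<delta>lin \<delta>c)
 show ?thesis
  unfolding morita_isomorphic_def by (intro conjI morita_data_context[OF d] morita_data_context[OF d']
    exI[of _ "\<lambda>r. r"] exI[of _ "\<lambda>r. r"] exI[of _ "\<lambda>p. p"] exI[of _ \<delta>])
   (use isos in \<open>simp_all add: tensor_pq_def tensor_qp_def tau mu \<delta>lin\<close>)
qed

lemma (in right_comodule) coact_eval_ract:
 assumes g: "g \<in> carrier Cs" and a: "a \<in> carrier A" and u: "u \<in> carrier M"
 shows "(\<lambda>c\<in>carrier C. g c \<otimes>\<^sub>A a) \<in> carrier Cs"
  and "coact_eval M \<rho> u (\<lambda>c\<in>carrier C. g c \<otimes>\<^sub>A a) = coact_eval M \<rho> u g \<leftharpoonup>\<^sub>M a"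
proof -
 show cl: "(\<lambda>c\<in>carrier C. g c \<otimes>\<^sub>A a) \<in> carrier Cs"
  using g a by (intro C.CsI) (simp_all add: C.Cs_add C.Cs_lact C.lact_closed C.R.l_distr C.R.m_assoc)
 have ad: "additive M M (\<lambda>v. v \<leftharpoonup>\<^sub>M a)"
  using a by (intro additiveI) (simp_all add: M.ract_closed M.ract_add_left)
 have "coact_eval M \<rho> u (\<lambda>c\<in>carrier C. g c \<otimes>\<^sub>A a) = tlift M (\<lambda>v c. v \<leftharpoonup>\<^sub>M g c \<leftharpoonup>\<^sub>M a) (\<rho> u)"
  unfolding coact_eval_def using g a u
  by (intro MC.tlift_cong[OF M.ab balanced_coact_eval[OF cl]]) (simp_all add: M.ract_mult)
 also have "\<dots> = coact_eval M \<rho> u g \<leftharpoonup>\<^sub>M a"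
  unfolding coact_eval_def using u by (intro MC.tlift_comp[symmetric, OF M.ab M.ab balanced_coact_eval[OF g] ad]) simp
 finally show "coact_eval M \<rho> u (\<lambda>c\<in>carrier C. g c \<otimes>\<^sub>A a) = coact_eval M \<rho> u g \<leftharpoonup>\<^sub>M a" .
qed

context fgp_bicomodule
begin

definition tau0 :: "'s => ('c => 's => 'a) => 's => 's"
 where "tau0 u q = (\<lambda>v\<in>carrier \<Sigma>. coact_eval \<Sigma> \<rho> u (\<lambda>c. q c v))"

lemma tau0_apply: "q \<in> Q ==> u \<in> carrier \<Sigma> ==> v \<in> carrier \<Sigma> ==> tau0 u q v = coact_eval \<Sigma> \<rho> u (ev q v)"
 using coact_eval_cong[of "ev q v" "\<lambda>c. q c v" u] by (simp add: tau0_def)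

lemma ev_coact_eval:
 assumes q: "q \<in> Q" and u: "u \<in> carrier \<Sigma>" and g: "g \<in> carrier Cs"
 shows "ev q (coact_eval \<Sigma> \<rho> u g) = ev q u \<otimes>\<^sub>Cs g"
 using assms by (intro C.Cs_ext C.Cs_mult_closed Q_ev_closed)
  (simp_all add: C.Cs_mult_apply coact_eval_closed Cs_slice[symmetric] Q_slice)

lemma ev_add: "q \<in> Q ==> u \<in> carrier \<Sigma> ==> v \<in> carrier \<Sigma> ==> ev q (u \<oplus>\<^sub>\<Sigma> v) = ev q u \<oplus>\<^sub>Cs ev q v"
 by (auto simp: C.Cs_simps pointwise_add_def D_add)

lemma ev_add_left: "u \<in> carrier \<Sigma> ==> ev (q \<oplus>\<^sub>QM q') u = ev q u \<oplus>\<^sub>Cs ev q' u"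
 by (auto simp: C.Cs_simps pointwise_add_def QM_apply)

text \<open>
 That \<open>v \<mapsto> u\<^sub>[\<^sub>0\<^sub>] q(u\<^sub>[\<^sub>1\<^sub>])(v)\<close> is a comodule map is where the colinearity of \<open>q\<close> enters: it moves the coaction of \<open>v\<close> to the
 comultiplication of \<open>u\<^sub>[\<^sub>1\<^sub>]\<close>, and coassociativity moves that to the coaction of \<open>u\<close>.
\<close>

lemma tau0_closed:
 assumes q: "q \<in> Q" and u: "u \<in> carrier \<Sigma>"
 shows "tau0 u q \<in> carrier T"
proof -
 define t where "t v = coact_eval \<Sigma> \<rho> u (ev q v)" for v
 have tc: "t v \<in> carrier \<Sigma>" if "v \<in> carrier \<Sigma>" for v using that q u by (simp add: t_def coact_eval_closed)
 have "right_linear A \<Sigma> \<Sigma> t"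
 proof (intro right_linearI additiveI tc)
  fix v w assume "v \<in> carrier \<Sigma>" "w \<in> carrier \<Sigma>"
  then show "t (v \<oplus>\<^sub>\<Sigma> w) = t v \<oplus>\<^sub>\<Sigma> t w" using q u by (simp add: t_def ev_add coact_eval_add_right)
 next
  fix v a assume va: "v \<in> carrier \<Sigma>" "a \<in> carrier A"
  have "ev q (v \<leftharpoonup>\<^sub>\<Sigma> a) = (\<lambda>c\<in>carrier C. ev q v c \<otimes>\<^sub>A a)" using q va by (auto simp: D_ract)
  then show "t (v \<leftharpoonup>\<^sub>\<Sigma> a) = t v \<leftharpoonup>\<^sub>\<Sigma> a"
   unfolding t_def using va q u by (simp only: coact_eval_ract(2)[OF Q_ev_closed])
 qed
 note rl = this
 have "\<rho> (t v) = tmap A \<Sigma> C t (\<lambda>c. c) (\<rho> v)" if v: "v \<in> carrier \<Sigma>" for v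
 proof -
  let ?G = "tensor A \<Sigma> C"
  note G = MC.ab
  define f where "f w c x d = tens A \<Sigma> C w (q c x \<rightharpoonup>\<^sub>C d)" for w c x d
  have f1: "balanced A \<Sigma> C ?G (f w c)" if "w \<in> carrier \<Sigma>" "c \<in> carrier C" for w c
   unfolding f_def[abs_def] using that q
   by (intro balanced_comp[OF balanced_slice balanced_additive2[OF MC.tens_balanced]]) simp_all
  have f2: "balanced A \<Sigma> C ?G (\<lambda>w c. f w c x d)" if "x \<in> carrier \<Sigma>" "d \<in> carrier C" for x d
   unfolding f_def using that q
   by (intro balancedI) (simp_all add: MC.tens_add1 MC.tens_add2[symmetric] C.lact_closed Q_add Q_lact
     D_apply C.lact_add_left C.lact_mult MC.tens_middle)
  have "\<rho> (t v) = tlift ?G (tens A \<Sigma> C) (\<rho> (t v))" using tc[OF v] by (simp add: MC.tlift_tens_self)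
  also have "\<dots> = tlift ?G (\<lambda>w c. tens A \<Sigma> C w (hit C c (ev q v))) (\<rho> u)"
   unfolding t_def using q v u by (intro tlift_coact_coact_eval(1)[OF _ _ G MC.tens_balanced]) simp_all
  also have "\<dots> = tlift ?G (\<lambda>w c. tlift ?G (f w c) (\<rho> v)) (\<rho> u)"
  proof (rule MC.tlift_cong[OF G])
   show "balanced A \<Sigma> C ?G (\<lambda>w c. tens A \<Sigma> C w (hit C c (ev q v)))"
    using q v u by (intro tlift_coact_coact_eval(2)[OF _ u G MC.tens_balanced]) simp_all
   fix w c assume *: "w \<in> carrier \<Sigma>" "c \<in> carrier C"
   show "tens A \<Sigma> C w (hit C c (ev q v)) = tlift ?G (f w c) (\<rho> v)"
    unfolding Q_slice[OF q *(2) v, symmetric] slice_def f_def[abs_def] using * q v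
    by (intro MC.tlift_comp[OF C.ab G balanced_slice balanced_additive2[OF MC.tens_balanced]]) simp_all
  qed (use u in simp)
  also have "\<dots> = tlift ?G (\<lambda>x d. tlift ?G (\<lambda>w c. f w c x d) (\<rho> u)) (\<rho> v)"
   using u v by (intro tlift_swap(1)[OF MC.tensor_pair_axioms MC.tensor_pair_axioms G f1 f2]) simp_all
  also have "\<dots> = tlift ?G (\<lambda>x d. tens A \<Sigma> C (t x) d) (\<rho> v)"
  proof (rule MC.tlift_cong[OF G, symmetric])
   show "balanced A \<Sigma> C ?G (\<lambda>x d. tens A \<Sigma> C (t x) d)" by (rule MC.balanced_tmap[OF MC.tensor_pair_axioms rl left_id])
   fix x d assume *: "x \<in> carrier \<Sigma>" "d \<in> carrier C"
   have "tens A \<Sigma> C (t x) d = tlift ?G (\<lambda>w c. tens A \<Sigma> C (w \<leftharpoonup>\<^sub>\<Sigma> ev q x c) d) (\<rho> u)"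
    unfolding t_def coact_eval_def using * u q
    by (intro MC.tlift_comp[OF BA.ab G balanced_coact_eval[OF Q_ev_closed[OF q *(1)]] balanced_additive1[OF MC.tens_balanced]]) simp_all
   also have "\<dots> = tlift ?G (\<lambda>w c. f w c x d) (\<rho> u)"
    using * q u by (intro MC.tlift_cong[OF G f2, symmetric]) (simp_all add: f_def MC.tens_middle)
   finally show "tens A \<Sigma> C (t x) d = tlift ?G (\<lambda>w c. f w c x d) (\<rho> u)" .
  qed (use v in simp)
  finally show ?thesis by (simp add: tmap_def)
 qed
 then have "colinear A C \<Sigma> \<rho> \<Sigma> \<rho> t" using rl by (simp add: colinear_def)
 moreover have "tau0 u q = (\<lambda>v\<in>carrier \<Sigma>. t v)"
  using tau0_apply[OF q u] by (auto simp: t_def tau0_def)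
 ultimately show ?thesis using TI by simp
qed

lemma comodule_morita_data: "morita_data T Cs P QM tau0 ev"
 unfolding morita_data_def
proof (intro conjI ballI bimodule_P bimodule_QM)
 interpret QM: bimodule Cs T QM by (rule bimodule_QM)
 note [simp] = tau0_apply tau0_closed coact_eval_closed Q_lact_closed Q_ract_closed QM_simps(1)
 have [simp]: "q \<oplus>\<^sub>QM q' \<in> Q" if "q \<in> Q" "q' \<in> Q" for q q' using QM.M.a_closed that by simp
 show "balanced Cs P QM T tau0"
 proof (rule balancedI)
  fix u v q assume "u \<in> carrier P" "v \<in> carrier P" "q \<in> carrier QM"
  then show "tau0 (u \<oplus>\<^sub>P v) q = tau0 u q \<oplus>\<^sub>T tau0 v q"
   by (intro T_ext QM.S.a_closed) (simp_all add: T_apply coact_eval_add)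
 next
  fix u q q' assume "u \<in> carrier P" "q \<in> carrier QM" "q' \<in> carrier QM"
  then show "tau0 u (q \<oplus>\<^sub>QM q') = tau0 u q \<oplus>\<^sub>T tau0 u q'"
   by (intro T_ext QM.S.a_closed) (simp_all add: T_apply coact_eval_add_right ev_add_left del: restrict_apply)
 next
  fix u g q assume "u \<in> carrier P" "g \<in> carrier Cs" "q \<in> carrier QM"
  then show "tau0 (u \<leftharpoonup>\<^sub>P g) q = tau0 u (g \<rightharpoonup>\<^sub>QM q)"
   by (intro T_ext) (simp_all add: coact_eval_mult ev_lact del: restrict_apply)
 qed simp_all
 show "balanced T QM P Cs ev" by (rule balancedI) (simp_all add: ev_add ev_add_left ev_ract del: restrict_apply)
 {
  fix u q t assume "u \<in> carrier P" "q \<in> carrier QM" "t \<in> carrier T"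
  then show "tau0 (t \<rightharpoonup>\<^sub>P u) q = t \<otimes>\<^sub>T tau0 u q" "tau0 u (q \<leftharpoonup>\<^sub>QM t) = tau0 u q \<otimes>\<^sub>T t"
   by (auto intro!: T_ext T_mult_closed simp: T_apply T_coact_eval ev_ract simp del: restrict_apply)
 next
  fix u q g assume "u \<in> carrier P" "q \<in> carrier QM" "g \<in> carrier Cs"
  then show "ev (g \<rightharpoonup>\<^sub>QM q) u = g \<otimes>\<^sub>Cs ev q u" "ev q (u \<leftharpoonup>\<^sub>P g) = ev q u \<otimes>\<^sub>Cs g"
   by (simp_all add: ev_lact ev_coact_eval del: restrict_apply)
 next
  fix u q v assume "u \<in> carrier P" "q \<in> carrier QM" "v \<in> carrier P"
  then show "tau0 u q \<rightharpoonup>\<^sub>P v = u \<leftharpoonup>\<^sub>P ev q v" by simp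
 next
  fix u q q' assume "u \<in> carrier P" "q \<in> carrier QM" "q' \<in> carrier QM"
  then show "ev q u \<rightharpoonup>\<^sub>QM q' = q \<leftharpoonup>\<^sub>QM tau0 u q'"
   by (intro Q_ext) (simp_all add: QM_apply Q_slice[symmetric] Cs_slice[symmetric] del: restrict_apply,
     simp add: Cs_slice[of "ev q' _", symmetric])
 }
qed

lemma comodule_context_eq:
 "comodule_context A C \<Sigma> \<rho> = \<lparr>lring = T, rring = Cs, pmod = P, qmod = QM, tau = tlift T tau0, mu = tlift Cs ev\<rparr>"
 by (simp add: comodule_context_def tau0_def[abs_def])

end

section \<open>Frobenius systems\<close>

lemma (in right_comodule) coact_eval_ract_left:
 assumes g: "g \<in> carrier Cs" and a: "a \<in> carrier A" and u: "u \<in> carrier M"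
 shows "coact_eval M \<rho> (u \<leftharpoonup>\<^sub>M a) g = coact_eval M \<rho> u (\<lambda>c\<in>carrier C. g (c \<leftharpoonup>\<^sub>C a))"
  and "(\<lambda>c\<in>carrier C. g (c \<leftharpoonup>\<^sub>C a)) \<in> carrier Cs"
proof -
 show cl: "(\<lambda>c\<in>carrier C. g (c \<leftharpoonup>\<^sub>C a)) \<in> carrier Cs"
  using g a by (intro C.CsI) (simp_all add: C.Cs_add C.Cs_lact C.ract_closed C.ract_add_left C.lact_closed C.lact_ract)
 have "coact_eval M \<rho> (u \<leftharpoonup>\<^sub>M a) g = tlift M (\<lambda>v c. v \<leftharpoonup>\<^sub>M g (c \<leftharpoonup>\<^sub>C a)) (\<rho> u)"
  unfolding coact_eval_def right_linear_ract[OF coact_linear u a] using u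
  by (intro MC.tlift_ract[OF C.bimodule_axioms a M.ab balanced_coact_eval[OF g]]) simp
 also have "\<dots> = coact_eval M \<rho> u (\<lambda>c\<in>carrier C. g (c \<leftharpoonup>\<^sub>C a))"
  unfolding coact_eval_def using u by (intro MC.tlift_cong[symmetric, OF M.ab balanced_coact_eval[OF cl]]) simp_all
 finally show "coact_eval M \<rho> (u \<leftharpoonup>\<^sub>M a) g = coact_eval M \<rho> u (\<lambda>c\<in>carrier C. g (c \<leftharpoonup>\<^sub>C a))" .
qed

locale frobenius = coring A C
 for A :: "('a, 'y) ring_scheme" and C :: "('a, 'c, 'z) coring_scheme"
  and z :: 'c and \<theta> :: "('c \<times> 'c \<Rightarrow>\<^sub>0 int) set => 'a" +
 assumes frobenius_system: "frobenius_system A C z \<theta>"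
begin

abbreviation "th c d \<equiv> \<theta> (tens A C C c d)"
abbreviation "thc d \<equiv> (\<lambda>c\<in>carrier C. \<theta> (tens A C C c d))"

lemmas system_props = frobenius_system[unfolded frobenius_system_def]

lemma z_closed [simp]: "z \<in> carrier C" by (rule system_props[THEN conjunct1])

lemma z_central: "a \<in> carrier A ==> a \<rightharpoonup>\<^sub>C z = z \<leftharpoonup>\<^sub>C a"
 by (rule system_props[THEN conjunct2, THEN conjunct1, THEN bspec])

lemma \<theta>_bimod_map: "bimod_map A A (tensor A C C) (regular A) \<theta>"
 by (rule system_props[THEN conjunct2, THEN conjunct2, THEN conjunct1])

lemma middle_raw: "c \<in> carrier C ==> d \<in> carrier C ==>
  tlift C (\<lambda>c1 c2. c1 \<leftharpoonup>\<^sub>C th c2 d) (comult C c) = tlift C (\<lambda>d1 d2. th c d1 \<rightharpoonup>\<^sub>C d2) (comult C d)"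
 by (rule system_props[THEN conjunct2, THEN conjunct2, THEN conjunct2, THEN conjunct1, THEN bspec, THEN bspec])

lemma th_z [simp]: "c \<in> carrier C ==> th z c = counit C c" "c \<in> carrier C ==> th c z = counit C c"
 by (rule system_props[THEN conjunct2, THEN conjunct2, THEN conjunct2, THEN conjunct2, THEN bspec, THEN conjunct1],
   assumption,
   rule system_props[THEN conjunct2, THEN conjunct2, THEN conjunct2, THEN conjunct2, THEN bspec, THEN conjunct2])

lemma \<theta>_additive: "additive (tensor A C C) A \<theta>"
 using left_linear_additive[OF \<theta>_bimod_map[unfolded bimod_map_def, THEN conjunct1]] by (simp only: additive_regular)

lemma balanced_th: "balanced A C C A th" by (rule balanced_comp[OF CC.tens_balanced \<theta>_additive])

lemma th_closed [simp]: "c \<in> carrier C ==> d \<in> carrier C ==> th c d \<in> carrier A" by (rule balancedD(1)[OF balanced_th])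

lemma th_lact: "a \<in> carrier A ==> c \<in> carrier C ==> d \<in> carrier C ==> th (a \<rightharpoonup>\<^sub>C c) d = a \<otimes>\<^sub>A th c d"
 using \<theta>_bimod_map left_linear_lact[of A "tensor A C C" "regular A" \<theta> "tens A C C c d" a]
 by (simp add: bimod_map_def CC.lact_tens[OF bimodule_axioms])

lemma th_ract: "a \<in> carrier A ==> c \<in> carrier C ==> d \<in> carrier C ==> th c (d \<leftharpoonup>\<^sub>C a) = th c d \<otimes>\<^sub>A a"
 using \<theta>_bimod_map right_linear_ract[of A "tensor A C C" "regular A" \<theta> "tens A C C c d" a]
 by (simp add: bimod_map_def CC.ract_tens[OF bimodule_axioms])

lemma thc_closed [simp]: "d \<in> carrier C ==> thc d \<in> carrier Cs"
 by (rule CsI) (simp_all add: balancedD[OF balanced_th] th_lact lact_closed)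

lemma balanced_th_lact: "c \<in> carrier C ==> balanced A C C C (\<lambda>d1 d2. th c d1 \<rightharpoonup>\<^sub>C d2)" by (rule balancedI)
  (simp_all add: balancedD[OF balanced_th] th_ract lact_closed lact_add_left lact_add_right lact_mult)

lemma middle:
 assumes c: "c \<in> carrier C" and d: "d \<in> carrier C"
 shows "hit C c (thc d) = tlift C (\<lambda>d1 d2. th c d1 \<rightharpoonup>\<^sub>C d2) (comult C d)"
proof -
 have "hit C c (thc d) = hit C c (\<lambda>c. th c d)" by (rule hit_cong[OF thc_closed[OF d] _ c]) simp
 also have "\<dots> = tlift C (\<lambda>d1 d2. th c d1 \<rightharpoonup>\<^sub>C d2) (comult C d)"
  unfolding hit_def by (rule middle_raw[OF c d])
 finally show ?thesis .
qed

text \<open>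
 \<open>z\<^sub>(\<^sub>1\<^sub>) \<theta>(z\<^sub>(\<^sub>2\<^sub>) \<otimes> d) = \<theta>(z \<otimes> d\<^sub>(\<^sub>1\<^sub>)) d\<^sub>(\<^sub>2\<^sub>) = d\<close>: the dual ring acts on \<open>z\<close> with \<open>C\<close> as its orbit.  This makes a comodule map
 out of \<open>M \<otimes> C\<close> recoverable from its values on the elements \<open>m \<otimes> z\<close>.
\<close>

lemma hit_z_thc: "d \<in> carrier C ==> hit C z (thc d) = d"
proof -
 assume d: "d \<in> carrier C"
 have "hit C z (thc d) = tlift C (\<lambda>d1 d2. th z d1 \<rightharpoonup>\<^sub>C d2) (comult C d)" using d by (simp add: middle)
 also have "\<dots> = tlift C (\<lambda>d1 d2. counit C d1 \<rightharpoonup>\<^sub>C d2) (comult C d)"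
  using d by (intro CC.tlift_cong[OF M.abelian_group_axioms balanced_th_lact]) simp_all
 finally show ?thesis using d by (simp add: counit_left)
qed

lemma thc_z: "thc z = \<one>\<^sub>Cs" by (auto simp: Cs_simps)

lemma th_hit_z:
 assumes c: "c \<in> carrier C" and g: "g \<in> carrier Cs"
 shows "th c (hit C z g) = g c"
proof -
 have ad: "additive C A (\<lambda>d. th c d)" by (rule balanced_additive2[OF balanced_th c])
 have "th c (hit C z g) = tlift A (\<lambda>c1 c2. th c (c1 \<leftharpoonup>\<^sub>C g c2)) (comult C z)"
  unfolding hit_def by (intro CC.tlift_comp[OF M.abelian_group_axioms R.abelian_group_axioms balanced_hit[OF g] ad]) simp
 also have "\<dots> = tlift A (\<lambda>c1 c2. g (th c c1 \<rightharpoonup>\<^sub>C c2)) (comult C z)"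
  using c g by (intro CC.tlift_cong[OF R.abelian_group_axioms balanced_comp[OF balanced_hit[OF g] ad]])
   (simp_all add: th_ract Cs_lact)
 also have "\<dots> = g (hit C c (thc z))"
  unfolding middle[OF c z_closed] using c
  by (intro CC.tlift_comp[symmetric, OF M.abelian_group_axioms R.abelian_group_axioms balanced_th_lact Cs_additive[OF g]]) simp_all
 finally show ?thesis using c by (simp only: thc_z hit_one)
qed

end

subsection \<open>A Frobenius system gives the adjunction\<close>

context frobenius
begin

text \<open>
 The inverse of \<open>h \<mapsto> (m \<mapsto> h(m \<otimes> z))\<close>: it sends \<open>f\<close> to \<open>m \<otimes> c \<mapsto> f(m)\<^sub>[\<^sub>0\<^sub>] \<theta>(f(m)\<^sub>[\<^sub>1\<^sub>] \<otimes> c)\<close>.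
\<close>

definition Psi ::
 "('l, 'a, 'm, 'z1) bimod_scheme => ('l2, 'a, 'n, 'z2) bimod_scheme => ('n => ('n \<times> 'c \<Rightarrow>\<^sub>0 int) set)
  => ('m => 'n) => ('m \<times> 'c \<Rightarrow>\<^sub>0 int) set => 'n"
 where "Psi M N \<sigma> f = tlift N (\<lambda>m c. coact_eval N \<sigma> (f m) (thc c))"

lemma thc_add: "c \<in> carrier C ==> d \<in> carrier C ==> thc (c \<oplus>\<^sub>C d) = thc c \<oplus>\<^sub>Cs thc d"
 by (auto simp: Cs_simps pointwise_add_def balancedD[OF balanced_th])

lemma thc_lact: "a \<in> carrier A ==> d \<in> carrier C ==> thc (a \<rightharpoonup>\<^sub>C d) = (\<lambda>c\<in>carrier C. thc d (c \<leftharpoonup>\<^sub>C a))"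
 by (auto simp: balancedD(4)[OF balanced_th] ract_closed)

lemma thc_ract: "a \<in> carrier A ==> d \<in> carrier C ==> thc (d \<leftharpoonup>\<^sub>C a) = (\<lambda>c\<in>carrier C. thc d c \<otimes>\<^sub>A a)"
 by (auto simp: th_ract)

lemma balanced_Psi:
 assumes N: "right_comodule A C N \<sigma>" and f: "right_linear A M N f"
 shows "balanced A M C N (\<lambda>m c. coact_eval N \<sigma> (f m) (thc c))"
proof -
 interpret N: right_comodule A C N \<sigma> by fact
 note fc [simp] = right_linear_closed[OF f]
 show ?thesis
 proof (rule balancedI)
  fix m a c assume "m \<in> carrier M" "a \<in> carrier A" "c \<in> carrier C"
  then show "coact_eval N \<sigma> (f (m \<leftharpoonup>\<^sub>M a)) (thc c) = coact_eval N \<sigma> (f m) (thc (a \<rightharpoonup>\<^sub>C c))"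
   by (simp only: right_linear_ract[OF f] thc_lact N.coact_eval_ract_left(1)[OF thc_closed] fc)
 qed (simp_all add: N.coact_eval_closed right_linear_add[OF f] N.coact_eval_add thc_add N.coact_eval_add_right del: restrict_apply)
qed

lemma Psi_tens:
 assumes M: "right_module A M" and N: "right_comodule A C N \<sigma>" and f: "right_linear A M N f"
  and "m \<in> carrier M" "c \<in> carrier C"
 shows "Psi M N \<sigma> f (tens A M C m c) = coact_eval N \<sigma> (f m) (thc c)"
 unfolding Psi_def by (rule tensor_pair.tlift_tens[OF tensor_pair_coring[OF M] _ balanced_Psi[OF N f] assms(4,5)])
  (rule abelian_monoid.intro abelian_group.intro right_module.axioms(2)[OF right_comodule.axioms(2)[OF N]])

text \<open>
 Colinearity is the identity \<open>c\<^sub>(\<^sub>1\<^sub>) \<theta>(c\<^sub>(\<^sub>2\<^sub>) \<otimes> d) = \<theta>(c \<otimes> d\<^sub>(\<^sub>1\<^sub>)) d\<^sub>(\<^sub>2\<^sub>)\<close>, applied with \<open>c\<close> the comodule part of \<open>f(m)\<close>.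
\<close>

lemma colinear_Psi:
 assumes M: "right_module A M" and N: "right_comodule A C N \<sigma>" and f: "right_linear A M N f"
 shows "colinear A C (tensor A M C) (tensor_coact A C A M C (comult C)) N \<sigma> (Psi M N \<sigma> f)"
proof -
 interpret N: right_comodule A C N \<sigma> by fact
 interpret MC: tensor_pair A M C by (rule tensor_pair_coring[OF M])
 interpret CB: bicomodule A A C C "comult C" by (rule bicomodule_self)
 interpret L: right_comodule A C "tensor A M C" "tensor_coact A C A M C (comult C)"
  by (rule CB.right_comodule_tensor[OF M])
 let ?G = "tensor A N C" and ?F = "Psi M N \<sigma> f"
 note G = N.MC.ab and Nab = N.M.ab
 note fc [simp] = right_linear_closed[OF f]
 have ad: "additive (tensor A M C) N ?F"
  unfolding Psi_def by (rule MC.additive_tlift[OF Nab balanced_Psi[OF N f]])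
 have rl: "right_linear A (tensor A M C) N ?F"
 proof (rule right_linearI[OF ad])
  fix X a assume X: "X \<in> carrier (tensor A M C)" and a: "a \<in> carrier A"
  have ada: "additive N N (\<lambda>n. n \<leftharpoonup>\<^sub>N a)" using a by (intro additiveI) (simp_all add: N.M.ract_closed N.M.ract_add_left)
  show "?F (X \<leftharpoonup>\<^bsub>tensor A M C\<^esub> a) = ?F X \<leftharpoonup>\<^sub>N a"
  proof (rule MC.tensor_eqI[OF Nab additive_comp[OF MC.additive_ract[OF bimodule_axioms a] ad] additive_comp[OF ad ada] _ X])
   fix m c assume *: "m \<in> carrier M" "c \<in> carrier C"
   have "coact_eval N \<sigma> (f m) (thc (c \<leftharpoonup>\<^sub>C a)) = coact_eval N \<sigma> (f m) (thc c) \<leftharpoonup>\<^sub>N a"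
    unfolding thc_ract[OF a *(2)] using * a by (intro N.coact_eval_ract(2)[OF thc_closed]) simp_all
   then show "?F (tens A M C m c \<leftharpoonup>\<^bsub>tensor A M C\<^esub> a) = ?F (tens A M C m c) \<leftharpoonup>\<^sub>N a"
    using * a by (simp add: MC.ract_tens[OF bimodule_axioms] Psi_tens[OF M N f] ract_closed)
  qed
 qed
 have "\<sigma> (?F X) = tmap A N C ?F (\<lambda>c. c) (tensor_coact A C A M C (comult C) X)" if X: "X \<in> carrier (tensor A M C)" for X
 proof (rule MC.tensor_eqI[OF G additive_comp[OF ad right_linear_additive[OF N.coact_linear]]
    additive_comp[OF CB.additive_tensor_coact[OF M] N.MC.additive_tmap[OF L.MC.tensor_pair_axioms rl left_id]] _ X])
  fix m c assume m: "m \<in> carrier M" and c: "c \<in> carrier C"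
  let ?n = "f m"
  have n: "?n \<in> carrier N" using m by simp
  define t where "t v x d1 d2 = tens A N C v (th x d1 \<rightharpoonup>\<^sub>C d2)" for v x d1 d2
  have t1: "balanced A C C ?G (t v x)" if "v \<in> carrier N" "x \<in> carrier C" for v x
   unfolding t_def[abs_def] using that
   by (intro balanced_comp[OF balanced_th_lact balanced_additive2[OF N.MC.tens_balanced]])
  have t2: "balanced A N C ?G (\<lambda>v x. t v x d1 d2)" if "d1 \<in> carrier C" "d2 \<in> carrier C" for d1 d2
   unfolding t_def using that
   by (intro balancedI) (simp_all add: N.MC.tens_add1 N.MC.tens_add2[symmetric] lact_closed balancedD[OF balanced_th]
     th_lact lact_add_left lact_mult N.MC.tens_middle)
  have "\<sigma> (?F (tens A M C m c)) = tlift ?G (tens A N C) (\<sigma> (coact_eval N \<sigma> ?n (thc c)))"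
   using m c n by (simp add: Psi_tens[OF M N f] N.MC.tlift_tens_self N.coact_eval_closed)
  also have "\<dots> = tlift ?G (\<lambda>v x. tens A N C v (hit C x (thc c))) (\<sigma> ?n)"
   using n c by (intro N.tlift_coact_coact_eval(1)[OF _ _ G N.MC.tens_balanced]) simp_all
  also have "\<dots> = tlift ?G (\<lambda>v x. tlift ?G (t v x) (comult C c)) (\<sigma> ?n)"
  proof (rule N.MC.tlift_cong[OF G])
   show "balanced A N C ?G (\<lambda>v x. tens A N C v (hit C x (thc c)))"
    using n c by (intro N.tlift_coact_coact_eval(2)[OF _ n G N.MC.tens_balanced]) simp_all
   fix v x assume *: "v \<in> carrier N" "x \<in> carrier C"
   show "tens A N C v (hit C x (thc c)) = tlift ?G (t v x) (comult C c)"
    unfolding middle[OF *(2) c] t_def[abs_def] using * c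
    by (intro CC.tlift_comp[OF M.abelian_group_axioms G balanced_th_lact balanced_additive2[OF N.MC.tens_balanced]]) simp_all
  qed (use n in simp)
  also have "\<dots> = tlift ?G (\<lambda>d1 d2. tlift ?G (\<lambda>v x. t v x d1 d2) (\<sigma> ?n)) (comult C c)"
   using n c by (intro tlift_swap(1)[OF N.MC.tensor_pair_axioms CC.tensor_pair_axioms G t1 t2]) simp_all
  also have "\<dots> = tlift ?G (\<lambda>d1 d2. tens A N C (?F (tens A M C m d1)) d2) (comult C c)"
  proof (rule CC.tlift_cong[OF G, symmetric])
   show "balanced A C C ?G (\<lambda>d1 d2. tens A N C (?F (tens A M C m d1)) d2)"
    by (rule CB.balanced_tensor_coact(2)[OF M G N.MC.balanced_tmap[OF L.MC.tensor_pair_axioms rl left_id] m])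
   fix d1 d2 assume *: "d1 \<in> carrier C" "d2 \<in> carrier C"
   have "tens A N C (?F (tens A M C m d1)) d2 = tlift ?G (\<lambda>v x. tens A N C (v \<leftharpoonup>\<^sub>N thc d1 x) d2) (\<sigma> ?n)"
    unfolding Psi_tens[OF M N f m *(1)] unfolding coact_eval_def using * n
    by (intro N.MC.tlift_comp[OF Nab G N.balanced_coact_eval[OF thc_closed[OF *(1)]] balanced_additive1[OF N.MC.tens_balanced]]) simp_all
   also have "\<dots> = tlift ?G (\<lambda>v x. t v x d1 d2) (\<sigma> ?n)"
    using * n by (intro N.MC.tlift_cong[OF G t2, symmetric]) (simp_all add: t_def N.MC.tens_middle)
   finally show "tens A N C (?F (tens A M C m d1)) d2 = tlift ?G (\<lambda>v x. t v x d1 d2) (\<sigma> ?n)" .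
  qed (use c in simp)
  also have "\<dots> = tmap A N C ?F (\<lambda>c. c) (tensor_coact A C A M C (comult C) (tens A M C m c))"
   unfolding tmap_def
   by (rule CB.tlift_tensor_coact_tens[OF M G N.MC.balanced_tmap[OF L.MC.tensor_pair_axioms rl left_id] m c, symmetric])
  finally show "\<sigma> (?F (tens A M C m c)) = tmap A N C ?F (\<lambda>c. c) (tensor_coact A C A M C (comult C) (tens A M C m c))" .
 qed
 then show ?thesis using rl by (simp add: colinear_def)
qed

lemma adjunction_bij:
 assumes M: "right_module A M" and N: "right_comodule A C N \<sigma>"
 shows "bij_betw (\<lambda>h. \<lambda>m\<in>carrier M. h (tens A M C m z))
  (comod_Hom A C (tensor A M C) (tensor_coact A C A M C (comult C)) N \<sigma>) (right_Hom A M N)"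
proof -
 interpret N: right_comodule A C N \<sigma> by fact
 interpret M: right_module A M by fact
 interpret MC: tensor_pair A M C by (rule tensor_pair_coring[OF M])
 interpret CB: bicomodule A A C C "comult C" by (rule bicomodule_self)
 interpret L: right_comodule A C "tensor A M C" "tensor_coact A C A M C (comult C)"
  by (rule CB.right_comodule_tensor[OF M])
 let ?H = "comod_Hom A C (tensor A M C) (tensor_coact A C A M C (comult C)) N \<sigma>"
 let ?\<Phi> = "\<lambda>h. \<lambda>m\<in>carrier M. h (tens A M C m z)"
 let ?\<Psi> = "\<lambda>f. restrict (Psi M N \<sigma> f) (carrier (tensor A M C))"
 have hD: "colinear A C (tensor A M C) (tensor_coact A C A M C (comult C)) N \<sigma> h" if "h \<in> ?H" for h
  using that by (simp add: mem_comod_Hom_iff)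
 have \<Phi>h: "right_linear A M N (?\<Phi> h)" if h: "h \<in> ?H" for h
 proof -
  note hc = hD[OF h]
  show ?thesis
 proof (intro right_linearI additiveI)
  fix m a assume *: "m \<in> carrier M" "a \<in> carrier A"
  have "tens A M C (m \<leftharpoonup>\<^sub>M a) z = tens A M C m z \<leftharpoonup>\<^bsub>tensor A M C\<^esub> a"
   using * by (simp add: MC.tens_middle MC.ract_tens[OF bimodule_axioms] z_central)
  then show "?\<Phi> h (m \<leftharpoonup>\<^sub>M a) = ?\<Phi> h m \<leftharpoonup>\<^sub>N a" using * by (simp add: M.ract_closed colinear_ract[OF hc])
 qed (simp_all add: colinear_closed[OF hc] MC.tens_add1 additive_add[OF colinear_additive[OF hc]])
 qed
 show ?thesis
 proof (rule bij_betw_byWitness[where f' = ?\<Psi>])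
  show "\<forall>h\<in>?H. ?\<Psi> (?\<Phi> h) = h"
  proof
   fix h assume h: "h \<in> ?H"
   note hc = hD[OF h]
   note \<Phi>h = \<Phi>h[OF h]
   have eq: "Psi M N \<sigma> (?\<Phi> h) X = h X" if X: "X \<in> carrier (tensor A M C)" for X
   proof (rule MC.tensor_eqI[OF N.M.ab colinear_additive[OF colinear_Psi[OF M N \<Phi>h]]
      colinear_additive[OF hc] _ X])
    fix m c assume *: "m \<in> carrier M" "c \<in> carrier C"
    have "Psi M N \<sigma> (?\<Phi> h) (tens A M C m c) = coact_eval N \<sigma> (h (tens A M C m z)) (thc c)"
     using * by (simp add: Psi_tens[OF M N \<Phi>h])
    also have "\<dots> = h (coact_eval (tensor A M C) (tensor_coact A C A M C (comult C)) (tens A M C m z) (thc c))"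
     using * by (intro L.colinear_coact_eval[OF N hc, symmetric]) simp_all
    also have "\<dots> = h (tens A M C m (hit C z (thc c)))"
     using CB.colinear_coact_eval[OF L.right_comodule_axioms CB.colinear_tens[OF M *(1)] thc_closed[OF *(2)] z_closed] by (simp add: hit_eq)
    finally show "Psi M N \<sigma> (?\<Phi> h) (tens A M C m c) = h (tens A M C m c)" using * by (simp add: hit_z_thc)
   qed
   have "h \<in> extensional (carrier (tensor A M C))" using h by (simp add: mem_comod_Hom_iff)
   then show "?\<Psi> (?\<Phi> h) = h" by (intro extensionalityI[of _ "carrier (tensor A M C)"]) (simp_all add: eq)
  qed
  show "\<forall>f\<in>right_Hom A M N. ?\<Phi> (?\<Psi> f) = f"
  proof
   fix f assume "f \<in> right_Hom A M N"
   then have f: "right_linear A M N f" "f \<in> extensional (carrier M)" by (simp_all add: right_Hom_def)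
   show "?\<Phi> (?\<Psi> f) = f" by (rule extensionalityI[of _ "carrier M"])
     (simp_all add: f Psi_tens[OF M N f(1)] thc_z N.coact_eval_one right_linear_closed[OF f(1)] del: th_z)
  qed
  show "?\<Phi> ` ?H \<subseteq> right_Hom A M N" using \<Phi>h by (auto simp: right_Hom_def)
  show "?\<Psi> ` right_Hom A M N \<subseteq> ?H"
   using L.colinear_restrict[OF N.M.right_module_axioms colinear_Psi[OF M N]] by (auto simp: right_Hom_def)
 qed
qed

theorem frobenius_coring: "frobenius_coring TYPE('u) A C"
 unfolding frobenius_coring_def
proof (intro conjI coring_axioms)
 let ?\<Phi> = "\<lambda>(M :: (unit, 'a, 'u) bimod) (N :: (unit, 'a, 'u) bimod) (\<sigma> :: 'u => ('u \<times> 'c \<Rightarrow>\<^sub>0 int) set)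
   (h :: ('u \<times> 'c \<Rightarrow>\<^sub>0 int) set => 'u). \<lambda>m\<in>carrier M. h (tens A M C m z)"
 show "\<exists>\<Phi> :: (unit, 'a, 'u) bimod => (unit, 'a, 'u) bimod => ('u => ('u \<times> 'c \<Rightarrow>\<^sub>0 int) set)
      => (('u \<times> 'c \<Rightarrow>\<^sub>0 int) set => 'u) => ('u => 'u).
   (\<forall>M N \<sigma>. right_module A M \<and> right_comodule A C N \<sigma> \<longrightarrow>
    bij_betw (\<Phi> M N \<sigma>)
     (comod_Hom A C (tensor A M C) (tensor_coact A C A M C (comult C)) N \<sigma>)
     (right_Hom A M N)) \<and>
   (\<forall>M M' N \<sigma> f. \<forall>h \<in> comod_Hom A C (tensor A M C) (tensor_coact A C A M C (comult C)) N \<sigma>.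
    right_module A M \<and> right_module A M' \<and> right_comodule A C N \<sigma> \<and> f \<in> right_Hom A M' M \<longrightarrow>
    \<Phi> M' N \<sigma> (compose (carrier (tensor A M' C)) h (tmap A M C f (\<lambda>c. c)))
     = compose (carrier M') (\<Phi> M N \<sigma> h) f) \<and>
   (\<forall>M N \<sigma> N' \<sigma>' g. \<forall>h \<in> comod_Hom A C (tensor A M C) (tensor_coact A C A M C (comult C)) N \<sigma>.
    right_module A M \<and> right_comodule A C N \<sigma> \<and> right_comodule A C N' \<sigma>' \<and>
    g \<in> comod_Hom A C N \<sigma> N' \<sigma>' \<longrightarrow>
    \<Phi> M N' \<sigma>' (compose (carrier (tensor A M C)) g h)
     = compose (carrier M) g (\<Phi> M N \<sigma> h))"
 proof (rule exI[of _ ?\<Phi>], intro conjI allI impI ballI)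
  fix M N :: "(unit, 'a, 'u) bimod" and \<sigma> assume "right_module A M \<and> right_comodule A C N \<sigma>"
  then show "bij_betw (?\<Phi> M N \<sigma>) (comod_Hom A C (tensor A M C) (tensor_coact A C A M C (comult C)) N \<sigma>) (right_Hom A M N)"
   by (intro adjunction_bij) simp_all
 next
  fix M M' N :: "(unit, 'a, 'u) bimod" and \<sigma> f h
  assume a: "right_module A M \<and> right_module A M' \<and> right_comodule A C N \<sigma> \<and> f \<in> right_Hom A M' M"
  then interpret M: tensor_pair A M C by (intro tensor_pair_coring) simp
  interpret M': tensor_pair A M' C using a by (intro tensor_pair_coring) simp
  have f: "right_linear A M' M f" using a by (simp add: right_Hom_def)
  show "?\<Phi> M' N \<sigma> (compose (carrier (tensor A M' C)) h (tmap A M C f (\<lambda>c. c))) = compose (carrier M') (?\<Phi> M N \<sigma> h) f"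
   by (auto simp: compose_def M.tmap_tens[OF M'.tensor_pair_axioms f left_id] right_linear_closed[OF f])
 next
  fix M N N' :: "(unit, 'a, 'u) bimod" and \<sigma> \<sigma>' g h
  assume a: "right_module A M \<and> right_comodule A C N \<sigma> \<and> right_comodule A C N' \<sigma>' \<and> g \<in> comod_Hom A C N \<sigma> N' \<sigma>'"
  then interpret M: tensor_pair A M C by (intro tensor_pair_coring) simp
  show "?\<Phi> M N' \<sigma>' (compose (carrier (tensor A M C)) g h) = compose (carrier M) g (?\<Phi> M N \<sigma> h)"
   by (auto simp: compose_def)
 qed
qed

end

section \<open>The Morita context of a Frobenius system\<close>

locale frobenius_fgp = fgp_bicomodule A B C \<Sigma> \<rho> + frobenius A C z \<theta>
 for A :: "('a, 'y1) ring_scheme" and B :: "('b, 'y2) ring_scheme"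
  and C :: "('a, 'c, 'z1) coring_scheme"
  and \<Sigma> :: "('b, 'a, 's, 'z2) bimod_scheme" and \<rho> :: "'s => ('s \<times> 'c \<Rightarrow>\<^sub>0 int) set"
  and z :: 'c and \<theta> :: "('c \<times> 'c \<Rightarrow>\<^sub>0 int) set => 'a"
begin

definition J :: "('s => 'a) => 'c => 's => 'a"
 where "J f = (\<lambda>c\<in>carrier C. \<lambda>u\<in>carrier \<Sigma>. th c (slice C \<rho> f u))"

lemma J_apply: "c \<in> carrier C ==> u \<in> carrier \<Sigma> ==> J f c u = th c (slice C \<rho> f u)" by (simp add: J_def)

lemma ev_J: "u \<in> carrier \<Sigma> ==> ev (J f) u = thc (slice C \<rho> f u)" by (auto simp: J_def)

lemma J_closed:
 assumes f: "f \<in> carrier D"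
 shows "J f \<in> Q"
proof (rule QI)
 show Jc: "J f c \<in> carrier D" if c: "c \<in> carrier C" for c
  using that f by (intro DI) (simp_all add: J_def slice_add slice_ract balancedD[OF balanced_th] th_ract BA.ract_closed)
 fix c u assume c: "c \<in> carrier C" and u: "u \<in> carrier \<Sigma>"
 have "slice C \<rho> (J f c) u = tlift C (\<lambda>v d. th c (slice C \<rho> f v) \<rightharpoonup>\<^sub>C d) (\<rho> u)"
  unfolding slice_def[of _ _ "J f c"] using u c
  by (intro MC.tlift_cong[OF C.ab balanced_slice[OF Jc[OF c]]]) (simp_all add: J_apply)
 also have "\<dots> = hit C c (thc (slice C \<rho> f u))"
  unfolding middle[OF c slice_closed[OF f u]]
  by (rule tlift_comult_slice(1)[OF f u C.ab balanced_th_lact[OF c], symmetric])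
 finally show "slice C \<rho> (J f c) u = hit C c (ev (J f) u)" by (simp only: ev_J[OF u])
qed (use f in \<open>simp_all add: J_def balancedD[OF balanced_th] th_lact C.lact_closed\<close>)

lemma J_inverse:
 assumes f: "f \<in> carrier D" shows "J f z = f"
 using f by (intro D_ext[OF Q_closed[OF J_closed]]) (simp_all add: J_apply counit_slice)

text \<open>
 \<open>\<theta>(c \<otimes> q(z)(u\<^sub>[\<^sub>0\<^sub>]) u\<^sub>[\<^sub>1\<^sub>]) = \<theta>(c \<otimes> z\<^sub>(\<^sub>1\<^sub>)) q(z\<^sub>(\<^sub>2\<^sub>))(u) = q(c\<^sub>(\<^sub>1\<^sub>) \<theta>(c\<^sub>(\<^sub>2\<^sub>) \<otimes> z))(u) = q(c)(u)\<close>, where the first step is the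
 colinearity of \<open>q\<close>.
\<close>

lemma J_surj:
 assumes q: "q \<in> Q" shows "J (q z) = q"
proof (rule Q_ext[OF J_closed q])
 show "q z \<in> carrier D" using q by simp
 fix c u assume "c \<in> carrier C" "u \<in> carrier \<Sigma>"
 then show "J (q z) c u = q c u"
  using q th_hit_z[of c "ev q u"] by (simp add: J_apply Q_slice del: restrict_apply) simp
qed

lemma bij_J: "bij_betw J (carrier D) Q"
 by (rule bij_betw_byWitness[where f' = "\<lambda>q. q z"]) (auto simp: J_inverse J_surj J_closed)

lemma J_add: "f \<in> carrier D ==> g \<in> carrier D ==> J (f \<oplus>\<^sub>D g) = pointwise_add (carrier C) D (J f) (J g)"
 by (intro Q_ext[OF J_closed pointwise_add_Q[OF J_closed J_closed]] D.a_closed)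
  (simp_all add: J_apply slice_add_left balancedD[OF balanced_th] pointwise_add_def D_apply)

lemma bimod_iso_J: "bimod_iso A B D (Q_AB A C \<Sigma> \<rho>) J"
 unfolding bimod_iso_def bimod_map_def
proof (intro conjI left_linearI right_linearI)
 show "bij_betw J (carrier D) (carrier (Q_AB A C \<Sigma> \<rho>))" using bij_J by (simp add: Q_AB_def)
 show "additive D (Q_AB A C \<Sigma> \<rho>) J" "additive D (Q_AB A C \<Sigma> \<rho>) J"
  by (intro additiveI; simp add: Q_AB_def J_closed J_add)+
 fix f a assume *: "f \<in> carrier D" "a \<in> carrier A"
 show "J (a \<rightharpoonup>\<^sub>D f) = a \<rightharpoonup>\<^bsub>Q_AB A C \<Sigma> \<rho>\<^esub> J f"
 proof
  fix c show "J (a \<rightharpoonup>\<^sub>D f) c = (a \<rightharpoonup>\<^bsub>Q_AB A C \<Sigma> \<rho>\<^esub> J f) c"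
   using * by (cases "c \<in> carrier C") (auto simp: J_def Q_AB_def slice_lact balancedD(4)[OF balanced_th] C.ract_closed)
 qed
next
 fix f b assume *: "f \<in> carrier D" "b \<in> carrier B"
 show "J (f \<leftharpoonup>\<^sub>D b) = J f \<leftharpoonup>\<^bsub>Q_AB A C \<Sigma> \<rho>\<^esub> b"
 proof
  fix c show "J (f \<leftharpoonup>\<^sub>D b) c = (J f \<leftharpoonup>\<^bsub>Q_AB A C \<Sigma> \<rho>\<^esub> b) c"
   using * by (cases "c \<in> carrier C") (auto simp: J_def Q_AB_def slice_lact_ring BA.lact_closed intro!: restrict_ext)
 qed
qed

text \<open>
 The given formulas for the action and the connecting maps are those of the context on \<open>Q\<close> read through \<open>J\<close>.
\<close>

lemma frobenius_morita:
 "morita_isomorphic (comodule_context A C \<Sigma> \<rho>) (frobenius_context A C \<Sigma> \<rho> z \<theta>)"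
proof -
 let ?N = "Sigma_star_dualT A C \<Sigma> \<rho> z \<theta>"
 let ?t = "\<lambda>u f. \<lambda>v\<in>carrier \<Sigma>. coact_eval \<Sigma> \<rho> u (\<lambda>c. \<theta> (tens A C C c (slice C \<rho> f v)))"
 let ?m = "\<lambda>f u. \<lambda>c\<in>carrier C. \<theta> (tens A C C c (slice C \<rho> f u))"
 have N [simp]: "carrier ?N = carrier D" "zero ?N = zero D" "add ?N = add D"
  "lact ?N = (\<lambda>g f. \<lambda>u\<in>carrier \<Sigma>. \<theta> (tens A C C (hit C z g) (slice C \<rho> f u)))" "ract ?N = compose (carrier \<Sigma>)"
  by (simp_all add: Sigma_star_dualT_def)
 have lactJ: "g \<rightharpoonup>\<^bsub>?N\<^esub> f = (g \<rightharpoonup>\<^sub>QM J f) z" if "g \<in> carrier Cs" "f \<in> carrier D" for g f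
  using that by (auto simp: QM_simps J_def C.hit_closed)
 have ractJ: "f \<leftharpoonup>\<^bsub>?N\<^esub> t = (J f \<leftharpoonup>\<^sub>QM t) z" if "t \<in> carrier T" "f \<in> carrier D" for t f
  using that J_inverse[OF that(2)] by (simp add: QM_simps)
 have abN: "abelian_group ?N" by (rule abelian_groupI) (auto simp: D.a_ac intro: D.l_neg)
 have tJ: "?t u f = tau0 u (J f)" if "u \<in> carrier \<Sigma>" "f \<in> carrier D" for u f
  unfolding tau0_def
 proof (rule restrict_ext)
  fix v assume v: "v \<in> carrier \<Sigma>"
  have "coact_eval \<Sigma> \<rho> u (ev (J f) v) = coact_eval \<Sigma> \<rho> u (\<lambda>c. th c (slice C \<rho> f v))"
   using v that J_closed[OF that(2)] by (intro coact_eval_cong[OF Q_ev_closed]) (simp_all add: J_apply)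
  moreover have "coact_eval \<Sigma> \<rho> u (ev (J f) v) = coact_eval \<Sigma> \<rho> u (\<lambda>c. J f c v)"
   using v that J_closed[OF that(2)] by (intro coact_eval_cong[OF Q_ev_closed]) simp_all
  ultimately show "coact_eval \<Sigma> \<rho> u (\<lambda>c. th c (slice C \<rho> f v)) = coact_eval \<Sigma> \<rho> u (\<lambda>c. J f c v)" by simp
 qed
 have "morita_isomorphic \<lparr>lring = T, rring = Cs, pmod = P, qmod = QM, tau = tlift T tau0, mu = tlift Cs ev\<rparr>
  \<lparr>lring = T, rring = Cs, pmod = P, qmod = ?N, tau = tlift T ?t, mu = tlift Cs ?m\<rparr>"
 proof (rule morita_transport[OF comodule_morita_data abN, where J = J])
  show "additive ?N QM J" by (intro additiveI) (simp_all add: QM_simps J_closed J_add)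
  show "bij_betw J (carrier ?N) (carrier QM)" using bij_J by (simp add: QM_simps)
  fix g f assume "g \<in> carrier Cs" "f \<in> carrier ?N"
  then show "g \<rightharpoonup>\<^bsub>?N\<^esub> f \<in> carrier ?N" "J (g \<rightharpoonup>\<^bsub>?N\<^esub> f) = g \<rightharpoonup>\<^sub>QM J f"
   using Q_lact_closed[OF _ J_closed, of g f] by (simp_all add: lactJ J_surj del: N(4))
 next
  fix f t assume "f \<in> carrier ?N" "t \<in> carrier T"
  then show "f \<leftharpoonup>\<^bsub>?N\<^esub> t \<in> carrier ?N" "J (f \<leftharpoonup>\<^bsub>?N\<^esub> t) = J f \<leftharpoonup>\<^sub>QM t"
   using Q_ract_closed[OF J_closed, of f t] by (simp_all add: ractJ J_surj del: N(5))
 next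
  fix u f assume "u \<in> carrier P" "f \<in> carrier ?N"
  then show "?t u f = tau0 u (J f)" "?m f u = ev (J f) u" by (simp_all add: tJ ev_J)
 qed
 then show ?thesis by (simp add: comodule_context_eq frobenius_context_def)
qed

end

section \<open>Sizes\<close>

lemma lists_lepoll_infinite:
 assumes inf: "infinite (UNIV :: 'u set)" and S: "S \<lesssim> (UNIV :: 'u set)"
 shows "lists S \<lesssim> (UNIV :: 'u set)"
proof -
 have "lists (UNIV :: 'u set) \<approx> (UNIV :: 'u set)"
  unfolding eqpoll_iff_card_of_ordIso by (rule card_of_lists_infinite[OF inf])
 then show ?thesis using lists_lepoll_mono[OF S] lepoll_trans2 by blast
qed

text \<open>
 An infinite universe absorbs finite sequences.  Hence it has room for tensor products, for duals of finitely generated modules,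
 and for the groups of linear maps out of them.
\<close>

lemma lepoll_finitely_determined:
 fixes n :: nat
 assumes inf: "infinite (UNIV :: 'u set)" and S: "S \<lesssim> (UNIV :: 'u set)"
  and val: "\<And>h i. h \<in> H ==> i < n ==> k h i \<in> S"
  and det: "\<And>h h'. h \<in> H ==> h' \<in> H ==> (\<And>i. i < n ==> k h i = k h' i) ==> h = h'"
 shows "H \<lesssim> (UNIV :: 'u set)"
proof -
 have "inj_on (\<lambda>h. map (k h) [0..<n]) H" by (rule inj_onI, rule det) auto
 moreover have "(\<lambda>h. map (k h) [0..<n]) ` H \<subseteq> lists S" using val by auto
 ultimately have "H \<lesssim> lists S" by (auto simp: lepoll_def)
 then show ?thesis using lists_lepoll_infinite[OF inf S] lepoll_trans by blast
qed

lemma times_lepoll_infinite: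
 assumes inf: "infinite (UNIV :: 'u set)" and S: "S \<lesssim> (UNIV :: 'u set)" and T: "T \<lesssim> (UNIV :: 'u set)"
 shows "S \<times> T \<lesssim> (UNIV :: 'u set)"
proof -
 obtain f :: "_ => 'u" where f: "inj_on f S" using S by (auto simp: lepoll_def)
 obtain g :: "_ => 'u" where g: "inj_on g T" using T by (auto simp: lepoll_def)
 let ?k = "\<lambda>p (i :: nat). if i = 0 then f (fst p) else g (snd p)"
 show ?thesis
 proof (rule lepoll_finitely_determined[OF inf, where S = UNIV and n = 2 and k = ?k])
  fix p q assume pq: "p \<in> S \<times> T" "q \<in> S \<times> T" and eq: "\<And>i. i < 2 ==> ?k p i = ?k q i"
  have "f (fst p) = f (fst q)" "g (snd p) = g (snd q)" using eq[of 0] eq[of 1] by simp_all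
  then show "p = q" using pq inj_onD[OF f] inj_onD[OF g] by (metis mem_Times_iff prod.expand)
 qed simp_all
qed

lemma (in tensor_pair) tensor_lepoll:
 assumes inf: "infinite (UNIV :: 'u set)" and M: "carrier M \<lesssim> (UNIV :: 'u set)" and N: "carrier N \<lesssim> (UNIV :: 'u set)"
 shows "carrier (tensor A M N) \<lesssim> (UNIV :: 'u set)"
proof -
 define s where "s ps = foldr (\<lambda>p X. tens A M N (fst p) (snd p) \<oplus>\<^bsub>tensor A M N\<^esub> X) ps \<zero>\<^bsub>tensor A M N\<^esub>" for ps
 have sc: "s ps \<in> carrier (tensor A M N)" if "ps \<in> lists (carrier M \<times> carrier N)" for ps
  using that by (induction ps) (auto simp: s_def)
 have app: "s (ps @ qs) = s ps \<oplus>\<^bsub>tensor A M N\<^esub> s qs"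
  if "ps \<in> lists (carrier M \<times> carrier N)" "qs \<in> lists (carrier M \<times> carrier N)" for ps qs
  using that(1)
 proof (induction ps)
  case Nil then show ?case using sc[OF that(2)] by (simp add: s_def)
 next
  case (Cons p ps)
  then show ?case using sc[of ps] sc[OF that(2)] Cons by (auto simp: s_def T.a_assoc)
 qed
 have "X \<in> s ` lists (carrier M \<times> carrier N)" if "X \<in> carrier (tensor A M N)" for X
  using that
 proof (induction X rule: tensor_induct)
  case zero
  have "s [] = \<zero>\<^bsub>tensor A M N\<^esub>" by (simp add: s_def)
  then show ?case by (metis image_eqI lists.Nil)
 next
  case (tens m n)
  then have "s [(m, n)] = tens A M N m n" by (simp add: s_def)
  then show ?case using tens by (metis (no_types, lifting) SigmaI image_eqI lists.Cons lists.Nil)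
 next
  case (add X Y)
  then obtain ps qs where "X = s ps" "Y = s qs" "ps \<in> lists (carrier M \<times> carrier N)" "qs \<in> lists (carrier M \<times> carrier N)"
   by blast
  then have "X \<oplus>\<^bsub>tensor A M N\<^esub> Y = s (ps @ qs)" "ps @ qs \<in> lists (carrier M \<times> carrier N)"
   using app[of ps qs] by simp_all
  then show ?case by (rule image_eqI)
 qed
 then have "carrier (tensor A M N) \<subseteq> s ` lists (carrier M \<times> carrier N)" by (rule subsetI)
 then have "carrier (tensor A M N) \<lesssim> s ` lists (carrier M \<times> carrier N)" by (rule subset_imp_lepoll)
 also have "s ` lists (carrier M \<times> carrier N) \<lesssim> lists (carrier M \<times> carrier N)" by (rule image_lepoll)
 also have "lists (carrier M \<times> carrier N) \<lesssim> (UNIV :: 'u set)"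
  by (rule lists_lepoll_infinite[OF inf times_lepoll_infinite[OF inf M N]])
 finally show ?thesis .
qed

section \<open>The adjunction gives a Frobenius system\<close>

context coring
begin

text \<open>
 The adjunction is applied to \<open>M = A\<close>, where \<open>A \<otimes> C = C\<close> and \<open>Hom\<^sub>A(A, N) = N\<close>; so \<open>Hom\<^sup>C(C, N) = N\<close>, naturally in \<open>N\<close>, and \<open>z\<close> is the
 element that corresponds to the identity of \<open>C\<close>.  The left multiplications of \<open>A\<close> are module maps on \<open>A\<close>, and naturality with
 respect to them says that \<open>z\<close> commutes with \<open>A\<close>.
\<close>

lemma frobenius_coring_universal_element:
 assumes frob: "frobenius_coring TYPE('u) A C" and sA: "carrier A \<lesssim> (UNIV :: 'u set)" and sC: "carrier C \<lesssim> (UNIV :: 'u set)"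
 obtains z where "z \<in> carrier C" "\<And>a. a \<in> carrier A ==> a \<rightharpoonup>\<^sub>C z = z \<leftharpoonup>\<^sub>C a"
  "\<And>(N :: (unit, 'a, 'u) bimod) \<sigma> n. right_comodule A C N \<sigma> ==> n \<in> carrier N ==>
   \<exists>k. colinear A C C (comult C) N \<sigma> k \<and> k z = n"
  "\<And>(N :: (unit, 'a, 'u) bimod) \<sigma> k k' c. right_comodule A C N \<sigma> ==> colinear A C C (comult C) N \<sigma> k
   ==> colinear A C C (comult C) N \<sigma> k' ==> k z = k' z ==> c \<in> carrier C ==> k c = k' c"
proof -
 let ?\<Delta> = "\<lambda>M. tensor_coact A C A M C (comult C)"
 obtain \<Phi> :: "(unit, 'a, 'u) bimod => (unit, 'a, 'u) bimod => ('u => ('u \<times> 'c \<Rightarrow>\<^sub>0 int) set)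
      => (('u \<times> 'c \<Rightarrow>\<^sub>0 int) set => 'u) => ('u => 'u)"
  where raw: "\<forall>M N \<sigma>. right_module A M \<and> right_comodule A C N \<sigma> \<longrightarrow>
    bij_betw (\<Phi> M N \<sigma>) (comod_Hom A C (tensor A M C) (?\<Delta> M) N \<sigma>) (right_Hom A M N)"
   "\<forall>M M' N \<sigma> f. \<forall>h \<in> comod_Hom A C (tensor A M C) (?\<Delta> M) N \<sigma>.
    right_module A M \<and> right_module A M' \<and> right_comodule A C N \<sigma> \<and> f \<in> right_Hom A M' M \<longrightarrow>
    \<Phi> M' N \<sigma> (compose (carrier (tensor A M' C)) h (tmap A M C f (\<lambda>c. c))) = compose (carrier M') (\<Phi> M N \<sigma> h) f"
   "\<forall>M N \<sigma> N' \<sigma>' g. \<forall>h \<in> comod_Hom A C (tensor A M C) (?\<Delta> M) N \<sigma>.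
    right_module A M \<and> right_comodule A C N \<sigma> \<and> right_comodule A C N' \<sigma>' \<and> g \<in> comod_Hom A C N \<sigma> N' \<sigma>' \<longrightarrow>
    \<Phi> M N' \<sigma>' (compose (carrier (tensor A M C)) g h) = compose (carrier M) g (\<Phi> M N \<sigma> h)"
  using frob[unfolded frobenius_coring_def, THEN conjunct2] by (elim exE conjE) (rule that)
 note bij = raw(1)[rule_format, OF conjI]
  and nat1 = raw(2)[rule_format, OF _ conjI[OF _ conjI[OF _ conjI]]]
  and nat2 = raw(3)[rule_format, OF _ conjI[OF _ conjI[OF _ conjI]]]
 interpret CB: bicomodule A A C C "comult C" by (rule bicomodule_self)
 interpret RA: bimodule A A "regular A" by (rule bimodule_regular[OF R.ring_axioms])
 obtain A' :: "(unit, 'a, 'u) bimod" and \<iota> \<kappa> where A': "right_module A A'"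
  and \<iota>: "right_linear A (regular A) A' \<iota>" and \<kappa>: "right_linear A A' (regular A) \<kappa>"
  and \<kappa>\<iota>: "\<And>a. a \<in> carrier (regular A) ==> \<kappa> (\<iota> a) = a" and \<iota>\<kappa>: "\<And>x. x \<in> carrier A' ==> \<iota> (\<kappa> x) = x"
  by (rule right_copy_exists[OF RA.right_module_axioms, where 'u = 'u]) (simp add: sA, rule that)
 obtain C' :: "(unit, 'a, 'u) bimod" and \<gamma> \<iota>C \<kappa>C where C': "right_comodule A C C' \<gamma>"
  and \<iota>C: "colinear A C C (comult C) C' \<gamma> \<iota>C" and \<kappa>C: "colinear A C C' \<gamma> C (comult C) \<kappa>C"
  and \<kappa>\<iota>C: "\<And>c. c \<in> carrier C ==> \<kappa>C (\<iota>C c) = c" and \<iota>\<kappa>C: "\<And>x. x \<in> carrier C' ==> \<iota>C (\<kappa>C x) = x"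
  by (rule right_comodule_copy_exists[OF right_comodule_self sC]) (rule that)
 interpret A': right_module A A' by fact
 interpret C': right_comodule A C C' \<gamma> by fact
 interpret AC: tensor_pair A A' C by (rule tensor_pair_coring[OF A'])
 interpret L: right_comodule A C "tensor A A' C" "?\<Delta> A'" by (rule CB.right_comodule_tensor[OF A'])
 let ?L = "tensor A A' C"
 note \<kappa>c = right_linear_closed[OF \<kappa>, simplified] and \<iota>c = right_linear_closed[OF \<iota>, simplified]
 note \<kappa>r = right_linear_ract[OF \<kappa>, simplified] and \<iota>r = right_linear_ract[OF \<iota>, simplified]
 define e where "e = \<iota> \<one>\<^sub>A"
 have ec [simp]: "e \<in> carrier A'" by (simp add: e_def \<iota>c)
 have \<kappa>e: "\<kappa> e = \<one>\<^sub>A" by (simp add: e_def \<kappa>\<iota>)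
 have ea: "e \<leftharpoonup>\<^sub>A' \<kappa> x = x" if "x \<in> carrier A'" for x
  using that \<iota>r[of "\<one>\<^sub>A" "\<kappa> x"] by (simp add: e_def \<kappa>c \<iota>\<kappa>)
 \<comment> \<open>The canonical isomorphism from \<open>A \<otimes> C\<close> to \<open>C\<close>, with inverse \<open>c \<mapsto> 1 \<otimes> c\<close>.\<close>
 define p where "p = tlift C (\<lambda>x c. \<kappa> x \<rightharpoonup>\<^sub>C c)"
 have bp: "balanced A A' C C (\<lambda>x c. \<kappa> x \<rightharpoonup>\<^sub>C c)"
  by (rule balancedI) (simp_all add: \<kappa>c lact_closed lact_add_left lact_add_right lact_mult \<kappa>r
    right_linear_add[OF \<kappa>, simplified])
 have p_tens: "p (tens A A' C x c) = \<kappa> x \<rightharpoonup>\<^sub>C c" if "x \<in> carrier A'" "c \<in> carrier C" for x c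
  unfolding p_def using that by (simp add: bp M.abelian_group_axioms)
 have pe: "p (tens A A' C e c) = c" if "c \<in> carrier C" for c
  using that by (simp add: p_tens \<kappa>e lact_one)
 have p_add: "additive ?L C p" unfolding p_def by (rule AC.additive_tlift[OF M.abelian_group_axioms bp])
 have ep: "tens A A' C e (p X) = X" if X: "X \<in> carrier ?L" for X
  by (rule AC.tensor_eqI[OF AC.ab additive_comp[OF p_add balanced_additive2[OF AC.tens_balanced ec]] additive_id _ X])
   (simp add: p_tens AC.tens_middle[symmetric] \<kappa>c ea)
 have col_e: "colinear A C C (comult C) ?L (?\<Delta> A') (tens A A' C e)" by (rule CB.colinear_tens[OF A' ec])
 have p_lin: "right_linear A ?L C p"
 proof (rule right_linearI[OF p_add])
  fix X a assume X: "X \<in> carrier ?L" and a: "a \<in> carrier A"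
  have "X \<leftharpoonup>\<^bsub>?L\<^esub> a = tens A A' C e (p X \<leftharpoonup>\<^sub>C a)"
   using X a additive_closed[OF p_add X] colinear_ract[OF col_e, of "p X" a] by (simp add: ep)
  then show "p (X \<leftharpoonup>\<^bsub>?L\<^esub> a) = p X \<leftharpoonup>\<^sub>C a"
   using X a additive_closed[OF p_add X] by (simp add: pe ract_closed)
 qed
 have p_col: "colinear A C ?L (?\<Delta> A') C (comult C) p"
  unfolding colinear_def
 proof (intro conjI ballI p_lin)
  fix X assume X: "X \<in> carrier ?L"
  note pX = additive_closed[OF p_add X]
  have "tmap A C C p (\<lambda>c. c) (?\<Delta> A' (tens A A' C e (p X))) = tlift (tensor A C C) (\<lambda>c1 c2. tens A C C (p (tens A A' C e c1)) c2) (comult C (p X))"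
   unfolding tmap_def
   by (rule CB.tlift_tensor_coact_tens[OF A' CC.ab CC.balanced_tmap[OF L.MC.tensor_pair_axioms p_lin left_id] ec pX])
  also have "\<dots> = tlift (tensor A C C) (tens A C C) (comult C (p X))"
   using pX by (intro CC.tlift_cong[symmetric, OF CC.ab CC.tens_balanced]) (simp_all add: pe)
  also have "\<dots> = comult C (p X)" using pX by (simp add: CC.tlift_tens_self)
  finally show "comult C (p X) = tmap A C C p (\<lambda>c. c) (?\<Delta> A' X)" using ep[OF X] by simp
 qed
 define h0 where "h0 = restrict (\<lambda>X. \<iota>C (p X)) (carrier ?L)"
 have h0: "h0 \<in> comod_Hom A C ?L (?\<Delta> A') C' \<gamma>"
  unfolding h0_def by (intro L.colinear_restrict[OF C'.M.right_module_axioms] L.colinear_comp[OF right_comodule_self C'.M.right_module_axioms p_col \<iota>C])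
 define \<zeta> where "\<zeta> = \<Phi> A' C' \<gamma> h0"
 have \<zeta>: "\<zeta> \<in> right_Hom A A' C'"
  unfolding \<zeta>_def using bij[OF A' C'] h0 by (auto simp: bij_betw_def)
 then have \<zeta>l: "right_linear A A' C' \<zeta>" by (simp add: right_Hom_def)
 define z where "z = \<kappa>C (\<zeta> e)"
 have zc: "z \<in> carrier C" unfolding z_def by (intro colinear_closed[OF \<kappa>C] right_linear_closed[OF \<zeta>l] ec)
 define hk where "hk k = restrict (\<lambda>X. k (p X)) (carrier ?L)" for k :: "'c => 'u"
 have hk: "hk k \<in> comod_Hom A C ?L (?\<Delta> A') N \<sigma>"
  if N: "right_comodule A C N \<sigma>" and k: "colinear A C C (comult C) N \<sigma> k" for N :: "(unit, 'a, 'u) bimod" and \<sigma> k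
 proof -
  interpret N: right_comodule A C N \<sigma> by fact
  show ?thesis unfolding hk_def
   by (intro L.colinear_restrict[OF N.M.right_module_axioms] L.colinear_comp[OF right_comodule_self N.M.right_module_axioms p_col k])
 qed
 have eval: "\<Phi> A' N \<sigma> (hk k) e = k z"
  if N: "right_comodule A C N \<sigma>" and k: "colinear A C C (comult C) N \<sigma> k" for N :: "(unit, 'a, 'u) bimod" and \<sigma> k
 proof -
  interpret N: right_comodule A C N \<sigma> by fact
  let ?g = "restrict (\<lambda>x. k (\<kappa>C x)) (carrier C')"
  have g: "?g \<in> comod_Hom A C C' \<gamma> N \<sigma>"
   by (intro C'.colinear_restrict[OF N.M.right_module_axioms] C'.colinear_comp[OF right_comodule_self N.M.right_module_axioms \<kappa>C k])
  have "hk k = compose (carrier ?L) ?g h0"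
   using additive_closed[OF p_add] colinear_closed[OF \<iota>C] by (auto simp: hk_def h0_def compose_def \<kappa>\<iota>C)
  then have "\<Phi> A' N \<sigma> (hk k) = compose (carrier A') ?g \<zeta>"
   using nat2[OF h0 A' C' N g] by (simp add: \<zeta>_def)
  then show ?thesis using right_linear_closed[OF \<zeta>l ec] by (simp add: compose_def z_def)
 qed
 show ?thesis
 proof (rule that[OF zc])
  fix N :: "(unit, 'a, 'u) bimod" and \<sigma> k k' c
  assume N: "right_comodule A C N \<sigma>" and k: "colinear A C C (comult C) N \<sigma> k"
   and k': "colinear A C C (comult C) N \<sigma> k'" and eq: "k z = k' z" and c: "c \<in> carrier C"
  have mem: "\<Phi> A' N \<sigma> (hk k) \<in> right_Hom A A' N" if "colinear A C C (comult C) N \<sigma> k" for k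
   using bij[OF A' N] hk[OF N that] by (auto simp: bij_betw_def)
  have "\<Phi> A' N \<sigma> (hk k) = \<Phi> A' N \<sigma> (hk k')"
  proof (rule extensionalityI[of _ "carrier A'"])
   fix x assume x: "x \<in> carrier A'"
   have "\<Phi> A' N \<sigma> (hk k) x = k z \<leftharpoonup>\<^sub>N \<kappa> x" if "colinear A C C (comult C) N \<sigma> k" for k
    using right_linear_ract[of A A' N "\<Phi> A' N \<sigma> (hk k)" e "\<kappa> x"] mem[OF that] x
    by (simp add: eval[OF N that] ea \<kappa>c right_Hom_def)
   then show "\<Phi> A' N \<sigma> (hk k) x = \<Phi> A' N \<sigma> (hk k') x" using k k' eq by simp
  qed (use mem k k' in \<open>auto simp: right_Hom_def\<close>)
  then have "hk k = hk k'"
   using bij[OF A' N] hk[OF N k] hk[OF N k'] by (auto simp: bij_betw_def dest: inj_onD)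
  then have "hk k (tens A A' C e c) = hk k' (tens A A' C e c)" by simp
  then show "k c = k' c" using c by (simp add: hk_def pe)
 next
  fix N :: "(unit, 'a, 'u) bimod" and \<sigma> n
  assume N: "right_comodule A C N \<sigma>" and n: "n \<in> carrier N"
  interpret N: right_comodule A C N \<sigma> by fact
  let ?f = "\<lambda>x\<in>carrier A'. n \<leftharpoonup>\<^sub>N \<kappa> x"
  have "right_linear A A' N ?f"
   using n by (intro right_linearI additiveI)
    (simp_all add: \<kappa>c \<kappa>r N.M.ract_closed N.M.ract_mult N.M.ract_add_right right_linear_add[OF \<kappa>, simplified] A'.ract_closed)
  then have "?f \<in> right_Hom A A' N" by (simp add: right_Hom_def)
  then obtain h where h: "h \<in> comod_Hom A C ?L (?\<Delta> A') N \<sigma>" "\<Phi> A' N \<sigma> h = ?f"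
   using bij[OF A' N] by (metis (no_types, lifting) bij_betw_def imageE)
  have hc: "colinear A C ?L (?\<Delta> A') N \<sigma> h" using h by (simp add: mem_comod_Hom_iff)
  define k where "k c = h (tens A A' C e c)" for c
  have k: "colinear A C C (comult C) N \<sigma> k"
   unfolding k_def by (rule CB.colinear_comp[OF L.right_comodule_axioms N.M.right_module_axioms col_e hc])
  have "hk k = h" by (rule extensionalityI[of _ "carrier ?L"]) (use h in \<open>auto simp: hk_def k_def ep mem_comod_Hom_iff\<close>)
  then have "k z = n" using eval[OF N k] h(2) n by (simp add: \<kappa>e N.M.ract_one)
  then show "\<exists>k. colinear A C C (comult C) N \<sigma> k \<and> k z = n" using k by blast
 next
  fix a assume a: "a \<in> carrier A"
  let ?f = "\<lambda>x\<in>carrier A'. \<iota> (a \<otimes>\<^sub>A \<kappa> x)"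
  have f: "right_linear A A' A' ?f"
   using a by (intro right_linearI additiveI)
    (simp_all add: \<kappa>c \<kappa>r \<iota>c R.r_distr right_linear_add[OF \<kappa>, simplified] right_linear_add[OF \<iota>, simplified]
     A'.ract_closed R.m_assoc[symmetric] \<iota>r)
  then have fH: "?f \<in> right_Hom A A' A'" by (simp add: right_Hom_def)
  let ?k = "\<lambda>c. \<iota>C (a \<rightharpoonup>\<^sub>C c)"
  have k: "colinear A C C (comult C) C' \<gamma> ?k"
   by (rule CB.colinear_comp[OF right_comodule_self C'.M.right_module_axioms CB.colinear_lact[OF a] \<iota>C])
  have "p (tmap A A' C ?f (\<lambda>c. c) X) = a \<rightharpoonup>\<^sub>C p X" if X: "X \<in> carrier ?L" for X
   by (rule AC.tensor_eqI[OF M.abelian_group_axioms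
      additive_comp[OF AC.additive_tmap[OF AC.tensor_pair_axioms f left_id] p_add]
      additive_comp[OF p_add colinear_additive[OF CB.colinear_lact[OF a]]] _ X])
    (use a in \<open>simp add: AC.tmap_tens[OF AC.tensor_pair_axioms f left_id] p_tens \<iota>c \<kappa>c \<kappa>\<iota> lact_mult\<close>)
  then have "compose (carrier ?L) h0 (tmap A A' C ?f (\<lambda>c. c)) = hk ?k"
   using additive_closed[OF AC.additive_tmap[OF AC.tensor_pair_axioms f left_id]]
   by (auto simp: compose_def h0_def hk_def)
  then have "\<iota>C (a \<rightharpoonup>\<^sub>C z) = compose (carrier A') \<zeta> ?f e"
   using nat1[OF h0 A' A' C' fH] eval[OF C' k] by (simp add: \<zeta>_def)
  also have "\<dots> = \<zeta> (e \<leftharpoonup>\<^sub>A' a)" using a \<iota>r[of "\<one>\<^sub>A" a] by (simp add: compose_def \<kappa>e) (simp add: e_def)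
  also have "\<dots> = \<iota>C (z \<leftharpoonup>\<^sub>C a)"
   using a right_linear_closed[OF \<zeta>l ec] zc by (simp add: right_linear_ract[OF \<zeta>l] colinear_ract[OF \<iota>C] z_def \<iota>\<kappa>C)
  finally have "\<kappa>C (\<iota>C (a \<rightharpoonup>\<^sub>C z)) = \<kappa>C (\<iota>C (z \<leftharpoonup>\<^sub>C a))" by simp
  then show "a \<rightharpoonup>\<^sub>C z = z \<leftharpoonup>\<^sub>C a" using a zc by (simp add: \<kappa>\<iota>C lact_closed ract_closed)
 qed
qed

text \<open>
 The uniqueness half of the universal property, for comodules of any type whose carrier injects into the universe.
\<close>

lemma colinear_eq_if_copies_eq:
 assumes N: "right_comodule A C N \<sigma>" and size: "carrier N \<lesssim> (UNIV :: 'u set)"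
  and un: "\<And>(N :: (unit, 'a, 'u) bimod) \<sigma> k k' c. right_comodule A C N \<sigma> ==> colinear A C C (comult C) N \<sigma> k
   ==> colinear A C C (comult C) N \<sigma> k' ==> k z = k' z ==> c \<in> carrier C ==> k c = k' c"
  and k: "colinear A C C (comult C) N \<sigma> k" and k': "colinear A C C (comult C) N \<sigma> k'"
  and eq: "k z = k' z" and c: "c \<in> carrier C"
 shows "k c = k' c"
proof -
 interpret CB: bicomodule A A C C "comult C" by (rule bicomodule_self)
 obtain N' :: "(unit, 'a, 'u) bimod" and \<sigma>' \<iota> \<kappa> where N': "right_comodule A C N' \<sigma>'"
  and \<iota>: "colinear A C N \<sigma> N' \<sigma>' \<iota>" and \<kappa>: "colinear A C N' \<sigma>' N \<sigma> \<kappa>"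
  and inv: "\<And>m. m \<in> carrier N ==> \<kappa> (\<iota> m) = m" "\<And>m. m \<in> carrier N' ==> \<iota> (\<kappa> m) = m"
  by (rule right_comodule_copy_exists[OF N size]) (rule that)
 interpret N': right_comodule A C N' \<sigma>' by fact
 note comp = CB.colinear_comp[OF N N'.M.right_module_axioms _ \<iota>]
 have "\<iota> (k c) = \<iota> (k' c)" by (rule un[OF N' comp[OF k] comp[OF k'] _ c]) (simp add: eq)
 then have "\<kappa> (\<iota> (k c)) = \<kappa> (\<iota> (k' c))" by (rule arg_cong)
 then show ?thesis unfolding inv(1)[OF colinear_closed[OF k c]] inv(1)[OF colinear_closed[OF k' c]] .
qed

text \<open>
 The crucial identity is \<open>\<Delta>(K\<^sub>c(d)) = c\<^sub>(\<^sub>1\<^sub>) \<otimes> K\<^bsub>c\<^sub>(\<^sub>2\<^sub>)\<^esub>(d)\<close>: as maps of \<open>d\<close> both sides are colinear, and at \<open>z\<close> both are \<open>\<Delta>(c)\<close>.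
 Applying \<open>\<epsilon>\<close> to the second factor gives \<open>K\<^sub>c(d) = c\<^sub>(\<^sub>1\<^sub>) \<theta>(c\<^sub>(\<^sub>2\<^sub>) \<otimes> d)\<close>; colinearity of \<open>K\<^sub>c\<close> and the left counit give
 \<open>K\<^sub>c(d) = \<theta>(c \<otimes> d\<^sub>(\<^sub>1\<^sub>)) d\<^sub>(\<^sub>2\<^sub>)\<close>.
\<close>

theorem frobenius_coring_imp_system:
 assumes frob: "frobenius_coring TYPE('u) A C" and inf: "infinite (UNIV :: 'u set)"
  and sA: "carrier A \<lesssim> (UNIV :: 'u set)" and sC: "carrier C \<lesssim> (UNIV :: 'u set)"
 shows "\<exists>z \<theta>. frobenius_system A C z \<theta>"
proof -
 obtain z where z: "z \<in> carrier C" and za: "\<And>a. a \<in> carrier A ==> a \<rightharpoonup>\<^sub>C z = z \<leftharpoonup>\<^sub>C a"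
  and ex: "\<And>(N :: (unit, 'a, 'u) bimod) \<sigma> n. right_comodule A C N \<sigma> ==> n \<in> carrier N ==>
   \<exists>k. colinear A C C (comult C) N \<sigma> k \<and> k z = n"
  and un: "\<And>(N :: (unit, 'a, 'u) bimod) \<sigma> k k' c. right_comodule A C N \<sigma> ==> colinear A C C (comult C) N \<sigma> k
   ==> colinear A C C (comult C) N \<sigma> k' ==> k z = k' z ==> c \<in> carrier C ==> k c = k' c"
  by (rule frobenius_coring_universal_element[OF frob sA sC]) (rule that)
 interpret CB: bicomodule A A C C "comult C" by (rule bicomodule_self)
 let ?\<Delta> = "tensor_coact A C A C C (comult C)" and ?CC = "tensor A C C"
 interpret W: right_comodule A C ?CC ?\<Delta> by (rule CB.right_comodule_tensor[OF right_module_axioms])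
 note Wm = right_module_tensor_coring[OF right_module_axioms]
 have "\<exists>k. colinear A C C (comult C) C (comult C) k \<and> k z = d" if d: "d \<in> carrier C" for d
 proof -
  obtain C' :: "(unit, 'a, 'u) bimod" and \<gamma> \<iota> \<kappa> where C': "right_comodule A C C' \<gamma>"
   and \<iota>: "colinear A C C (comult C) C' \<gamma> \<iota>" and \<kappa>: "colinear A C C' \<gamma> C (comult C) \<kappa>"
   and inv: "\<And>c. c \<in> carrier C ==> \<kappa> (\<iota> c) = c" "\<And>x. x \<in> carrier C' ==> \<iota> (\<kappa> x) = x"
   by (rule right_comodule_copy_exists[OF right_comodule_self sC]) (rule that)
  obtain k where k: "colinear A C C (comult C) C' \<gamma> k" "k z = \<iota> d"
   using ex[OF C' colinear_closed[OF \<iota> d]] by blast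
  show ?thesis
   using CB.colinear_comp[OF C' right_module_axioms k(1) \<kappa>] inv(1)[OF d] k(2) by (intro exI[of _ "\<lambda>c. \<kappa> (k c)"]) simp
 qed
 then obtain K where K: "\<And>d. d \<in> carrier C ==> colinear A C C (comult C) C (comult C) (K d)"
  and Kz: "\<And>d. d \<in> carrier C ==> K d z = d" by metis
 have uniqC: "k c = k' c" if "colinear A C C (comult C) C (comult C) k" "colinear A C C (comult C) C (comult C) k'" "k z = k' z" "c \<in> carrier C" for k k' c
  by (rule colinear_eq_if_copies_eq[OF right_comodule_self sC _ that]) (rule un)
 note Kc [simp] = colinear_closed[OF K]
 have K_add: "K (d \<oplus>\<^sub>C d') c = K d c \<oplus>\<^sub>C K d' c" if "d \<in> carrier C" "d' \<in> carrier C" "c \<in> carrier C" for d d' c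
  using that by - (rule uniqC[OF K CB.colinear_add[OF right_comodule_self K K]], simp_all add: Kz)
 have K_lact: "K (a \<rightharpoonup>\<^sub>C d) c = a \<rightharpoonup>\<^sub>C K d c" if "a \<in> carrier A" "d \<in> carrier C" "c \<in> carrier C" for a d c
  using that z by - (rule uniqC[OF K CB.colinear_comp[OF right_comodule_self right_module_axioms K CB.colinear_lact]], simp_all add: Kz lact_closed)
 have K_ract: "K (d \<leftharpoonup>\<^sub>C a) c = K d (a \<rightharpoonup>\<^sub>C c)" if "a \<in> carrier A" "d \<in> carrier C" "c \<in> carrier C" for a d c
  using that z by - (rule uniqC[OF K CB.colinear_comp[OF right_comodule_self right_module_axioms CB.colinear_lact K]], simp_all add: Kz ract_closed za colinear_ract[OF K])
 have bK: "balanced A C C A (\<lambda>d c. counit C (K d c))"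
  by (rule balancedI) (simp_all add: K_add K_ract additive_add[OF colinear_additive[OF K]] counit_simps)
 define \<theta> where "\<theta> = tlift A (\<lambda>d c. counit C (K d c))"
 have \<theta>_tens: "\<theta> (tens A C C d c) = counit C (K d c)" if "d \<in> carrier C" "c \<in> carrier C" for d c
  unfolding \<theta>_def using that by (simp add: bK R.abelian_group_axioms)
 have bc: "balanced A C C C (\<lambda>x y. x \<leftharpoonup>\<^sub>C counit C y)"
  by (rule balancedI) (simp_all add: ract_closed ract_add_left ract_add_right ract_mult counit_simps)
 have bc2: "balanced A C C C (\<lambda>x y. counit C x \<rightharpoonup>\<^sub>C y)"
  by (rule balancedI) (simp_all add: lact_closed lact_add_left lact_add_right lact_mult counit_simps)
 have comultK: "comult C (K c d) = tlift ?CC (\<lambda>x y. tens A C C x (K y d)) (comult C c)"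
  if c: "c \<in> carrier C" and d: "d \<in> carrier C" for c d
 proof -
  have b: "balanced A C C ?CC (\<lambda>x y. tens A C C x (K y d))" if "d \<in> carrier C" for d
   using that by (intro balancedI) (simp_all add: CC.tens_add1 CC.tens_add2 K_add K_lact CC.tens_middle)
  have col: "colinear A C C (comult C) ?CC ?\<Delta> (\<lambda>d. tlift ?CC (\<lambda>x y. tens A C C x (K y d)) X)" if "X \<in> carrier ?CC" for X
   using that
  proof (induction X rule: CC.tensor_induct)
   case zero
   show ?case by (rule CB.colinear_cong[OF Wm CB.colinear_zero[OF W.right_comodule_axioms]])
     (simp add: additive_zero[OF CC.additive_tlift[OF CC.ab b] CC.ab CC.ab])
  next
   case (tens x y)
   show ?case by (rule CB.colinear_cong[OF Wm CB.colinear_comp[OF right_comodule_self Wm K[OF tens(2)]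
       CB.colinear_tens[OF right_module_axioms tens(1)]]]) (simp add: b CC.ab tens)
  next
   case (add X Y)
   show ?case by (rule CB.colinear_cong[OF Wm CB.colinear_add[OF W.right_comodule_axioms add(3,4)]])
     (simp add: additive_add[OF CC.additive_tlift[OF CC.ab b]] add)
  qed
  have \<Delta>col: "colinear A C C (comult C) ?CC ?\<Delta> (comult C)"
   unfolding colinear_def using comult_right_linear coassoc by simp
  show ?thesis
  proof (rule colinear_eq_if_copies_eq[OF W.right_comodule_axioms CC.tensor_lepoll[OF inf sC sC] _
     CB.colinear_comp[OF right_comodule_self Wm K[OF c] \<Delta>col] col[OF comult_closed[OF c]] _ d])
   have "tlift ?CC (\<lambda>x y. tens A C C x (K y z)) (comult C c) = tlift ?CC (tens A C C) (comult C c)"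
    using c by (intro CC.tlift_cong[symmetric, OF CC.ab CC.tens_balanced]) (simp_all add: Kz)
   then show "comult C (K c z) = tlift ?CC (\<lambda>x y. tens A C C x (K y z)) (comult C c)"
    using c by (simp add: Kz CC.tlift_tens_self)
  qed (rule un)
 qed
 have "frobenius_system A C z \<theta>"
  unfolding frobenius_system_def
 proof (intro conjI ballI z)
  show "a \<rightharpoonup>\<^sub>C z = z \<leftharpoonup>\<^sub>C a" if "a \<in> carrier A" for a by (rule za[OF that])
  interpret RA: bimodule A A "regular A" by (rule bimodule_regular[OF R.ring_axioms])
  have bKr: "balanced A C C (regular A) (\<lambda>d c. counit C (K d c))" using bK by (simp add: balanced_regular)
  have \<theta>r: "\<theta> = tlift (regular A) (\<lambda>d c. counit C (K d c))" by (simp add: \<theta>_def tlift_regular)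
  show "bimod_map A A ?CC (regular A) \<theta>"
   unfolding \<theta>r bimod_map_def
   by (intro conjI CC.left_linear_tlift CC.right_linear_tlift bimodule_axioms RA.left_module_axioms RA.right_module_axioms bKr)
    (simp_all add: K_lact counit_simps colinear_ract[OF K])
 next
  fix c d assume c: "c \<in> carrier C" and d: "d \<in> carrier C"
  have bKd: "balanced A C C ?CC (\<lambda>x y. tens A C C x (K y d))"
   using d by (intro balancedI) (simp_all add: CC.tens_add1 CC.tens_add2 K_add K_lact CC.tens_middle)
  have bKc: "balanced A C C C (\<lambda>x y. counit C (K c x) \<rightharpoonup>\<^sub>C y)"
   using c by (intro balancedI) (simp_all add: additive_add[OF colinear_additive[OF K]] counit_simps colinear_ract[OF K]
    lact_closed lact_add_left lact_add_right lact_mult)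
  have "tlift C (\<lambda>x y. x \<leftharpoonup>\<^sub>C counit C y) (comult C (K c d))
    = tlift C (\<lambda>x y. tlift C (\<lambda>x y. x \<leftharpoonup>\<^sub>C counit C y) (tens A C C x (K y d))) (comult C c)"
   unfolding comultK[OF c d] using c
   by (intro CC.tlift_comp[OF CC.ab M.abelian_group_axioms bKd CC.additive_tlift[OF M.abelian_group_axioms bc]]) simp
  also have "\<dots> = tlift C (\<lambda>x y. x \<leftharpoonup>\<^sub>C \<theta> (tens A C C y d)) (comult C c)"
   using c d by (intro CC.tlift_cong[OF M.abelian_group_axioms balanced_comp[OF bKd CC.additive_tlift[OF M.abelian_group_axioms bc]]])
    (simp_all add: bc M.abelian_group_axioms \<theta>_tens)
  finally have 1: "K c d = tlift C (\<lambda>x y. x \<leftharpoonup>\<^sub>C \<theta> (tens A C C y d)) (comult C c)"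
   using c d by (simp add: counit_right)
  have "tlift C (\<lambda>x y. counit C x \<rightharpoonup>\<^sub>C y) (comult C (K c d)) = tlift C (\<lambda>x y. counit C (K c x) \<rightharpoonup>\<^sub>C y) (comult C d)"
   by (rule CB.tlift_colinear[OF right_module_axioms K[OF c] M.abelian_group_axioms bc2 d])
  also have "\<dots> = tlift C (\<lambda>x y. \<theta> (tens A C C c x) \<rightharpoonup>\<^sub>C y) (comult C d)"
   using c d by (intro CC.tlift_cong[OF M.abelian_group_axioms bKc]) (simp_all add: \<theta>_tens)
  finally have 2: "K c d = tlift C (\<lambda>x y. \<theta> (tens A C C c x) \<rightharpoonup>\<^sub>C y) (comult C d)"
   using c d by (simp add: counit_left)
  show "tlift C (\<lambda>c1 c2. c1 \<leftharpoonup>\<^sub>C \<theta> (tens A C C c2 d)) (comult C c)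
    = tlift C (\<lambda>d1 d2. \<theta> (tens A C C c d1) \<rightharpoonup>\<^sub>C d2) (comult C d)"
   using 1 2 by simp
 next
  fix c assume c: "c \<in> carrier C"
  have "K z c = c" by (rule uniqC[OF K[OF z] CB.colinear_id _ c]) (simp add: Kz z)
  then show "\<theta> (tens A C C z c) = counit C c" using c z by (simp add: \<theta>_tens)
  show "\<theta> (tens A C C c z) = counit C c" using c z by (simp add: \<theta>_tens Kz)
 qed
 then show ?thesis by blast
qed

end

section \<open>Recovering a Frobenius system\<close>

context fgp_bicomodule
begin

abbreviation "QB \<equiv> Q_AB A C \<Sigma> \<rho>"

lemma QB_simps:
 "carrier QB = Q" "zero QB = pointwise_zero (carrier C) D" "add QB = pointwise_add (carrier C) D"
 "lact QB = (\<lambda>a q. \<lambda>c\<in>carrier C. q (c \<leftharpoonup>\<^sub>C a))"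
 "ract QB = (\<lambda>q b. \<lambda>c\<in>carrier C. \<lambda>u\<in>carrier \<Sigma>. q c (b \<rightharpoonup>\<^sub>\<Sigma> u))" by (simp_all add: Q_AB_def)

lemma QB_apply:
 "c \<in> carrier C ==> (q \<oplus>\<^sub>QB q') c = q c \<oplus>\<^sub>D q' c"
 "c \<in> carrier C ==> (q \<leftharpoonup>\<^sub>QB b) c = q c \<leftharpoonup>\<^sub>D b"
 "c \<in> carrier C ==> (a \<rightharpoonup>\<^sub>QB q) c = q (c \<leftharpoonup>\<^sub>C a)" by (simp_all add: QB_simps pointwise_add_def D_simps)

lemma QB_ract: "b \<in> carrier B ==> q \<leftharpoonup>\<^sub>QB b = q \<leftharpoonup>\<^sub>QM (\<lambda>u\<in>carrier \<Sigma>. b \<rightharpoonup>\<^sub>\<Sigma> u)"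
 by (auto simp: QB_simps QM_simps compose_def intro!: restrict_ext)

lemma QB_ract_closed: "q \<in> Q ==> b \<in> carrier B ==> q \<leftharpoonup>\<^sub>QB b \<in> Q" by (simp add: QB_ract Q_ract_closed l_closed)

lemma right_module_QB: "right_module B QB"
proof -
 interpret QB: abelian_group QB by (rule abelian_group_Q) (simp_all add: QB_simps)
 note [simp] = QB_apply QB_ract_closed D_apply BA.lact_closed
 have ac [simp]: "q \<oplus>\<^sub>QB q' \<in> Q" if "q \<in> Q" "q' \<in> Q" for q q' using that QB.a_closed by (simp add: QB_simps(1))
 show ?thesis
 proof (intro right_module.intro right_module_axioms.intro BA.R.ring_axioms QB.abelian_group_axioms)
  fix m r s assume "m \<in> carrier QB" "r \<in> carrier B" "s \<in> carrier B"
  then have *: "m \<in> Q" "r \<in> carrier B" "s \<in> carrier B" by (simp_all add: QB_simps(1))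
  show "m \<leftharpoonup>\<^sub>QB (r \<oplus>\<^sub>B s) = m \<leftharpoonup>\<^sub>QB r \<oplus>\<^sub>QB m \<leftharpoonup>\<^sub>QB s"
   using * by (intro Q_ext) (simp_all add: BA.lact_add_left D_add)
  show "m \<leftharpoonup>\<^sub>QB (r \<otimes>\<^sub>B s) = m \<leftharpoonup>\<^sub>QB r \<leftharpoonup>\<^sub>QB s"
   using * by (intro Q_ext) (simp_all add: BA.lact_mult)
 next
  fix m n r assume "m \<in> carrier QB" "n \<in> carrier QB" "r \<in> carrier B"
  then have *: "m \<in> Q" "n \<in> Q" "r \<in> carrier B" by (simp_all add: QB_simps(1))
  show "(m \<oplus>\<^sub>QB n) \<leftharpoonup>\<^sub>QB r = m \<leftharpoonup>\<^sub>QB r \<oplus>\<^sub>QB n \<leftharpoonup>\<^sub>QB r"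
   using * by (intro Q_ext) simp_all
 next
  fix m assume "m \<in> carrier QB"
  then have *: "m \<in> Q" by (simp add: QB_simps(1))
  show "m \<leftharpoonup>\<^sub>QB \<one>\<^sub>B = m" using * by (intro Q_ext) (simp_all add: BA.lact_one)
 qed (simp_all add: QB_simps(1))
qed

sublocale QBS: tensor_pair B QB \<Sigma> by (intro tensor_pair.intro right_module_QB BA.left_module_axioms)

lemma balanced_ev: "balanced B QB \<Sigma> Cs ev"
proof (rule balancedI)
 fix q q' u assume "q \<in> carrier QB" "q' \<in> carrier QB" "u \<in> carrier \<Sigma>"
 then show "ev (q \<oplus>\<^sub>QB q') u = ev q u \<oplus>\<^sub>Cs ev q' u" by (auto simp: QB_apply D_apply C.Cs_simps pointwise_add_def)
next
 fix q b u assume "q \<in> carrier QB" "b \<in> carrier B" "u \<in> carrier \<Sigma>"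
 then show "ev (q \<leftharpoonup>\<^sub>QB b) u = ev q (b \<rightharpoonup>\<^sub>\<Sigma> u)" by (auto simp: QB_apply D_apply)
qed (simp_all add: QB_simps(1) ev_add del: restrict_apply)

text \<open>
 The common consequence of the four conditions: the unit of the dual ring lies in the image of the trace map
 \<open>Q \<otimes>\<^sub>B \<Sigma> \<rightarrow> \<^sup>*C\<close>, and \<open>B\<close> maps onto \<open>T\<close>.
\<close>

definition trace_unital :: bool
 where "trace_unital \<longleftrightarrow> (\<exists>X\<in>carrier (tensor B QB \<Sigma>). tlift Cs ev X = \<one>\<^sub>Cs) \<and>
  (\<forall>t\<in>carrier T. \<exists>b\<in>carrier B. \<forall>u\<in>carrier \<Sigma>. t u = b \<rightharpoonup>\<^sub>\<Sigma> u)"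

text \<open>Then \<open>C\<close> is spanned by the elements \<open>f(u\<^sub>[\<^sub>0\<^sub>]) u\<^sub>[\<^sub>1\<^sub>]\<close>: \<open>d = d\<^sub>(\<^sub>1\<^sub>) \<epsilon>(d\<^sub>(\<^sub>2\<^sub>))\<close>, and \<open>\<epsilon>\<close> is a sum of terms \<open>q(-)(u)\<close>.\<close>

lemma trace_unital_span:
 assumes X: "X \<in> carrier (tensor B QB \<Sigma>)" and X1: "tlift Cs ev X = \<one>\<^sub>Cs"
  and G: "abelian_group G" and F: "additive C G F" and F': "additive C G F'" and d: "d \<in> carrier C"
  and eq: "\<And>f u. f \<in> carrier D ==> u \<in> carrier \<Sigma> ==> F (slice C \<rho> f u) = F' (slice C \<rho> f u)"
 shows "F d = F' d"
proof -
 note ad = additive_hit_right[OF d] and Csab = C.abelian_group_Cs and Cab = C.ab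
 have "d = hit C d (tlift Cs ev X)" using d by (simp add: X1 C.hit_one)
 also have "\<dots> = tlift C (\<lambda>q u. hit C d (ev q u)) X" by (rule QBS.tlift_comp[OF Csab Cab balanced_ev ad X])
 finally have d_eq: "d = tlift C (\<lambda>q u. hit C d (ev q u)) X" .
 note b = balanced_comp[OF balanced_ev ad]
 have "F (tlift C (\<lambda>q u. hit C d (ev q u)) X) = tlift G (\<lambda>q u. F (hit C d (ev q u))) X"
  by (rule QBS.tlift_comp[OF Cab G b F X])
 also have "\<dots> = tlift G (\<lambda>q u. F' (hit C d (ev q u))) X"
  using d by (intro QBS.tlift_cong[OF G balanced_comp[OF b F] _ X])
   (simp add: QB_simps(1) Q_slice[symmetric] eq del: restrict_apply)
 also have "\<dots> = F' (tlift C (\<lambda>q u. hit C d (ev q u)) X)" by (rule QBS.tlift_comp[OF Cab G b F' X, symmetric])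
 finally show "F d = F' d" using d_eq by simp
qed

text \<open>
 Every \<open>\<tau>(u \<otimes> q)\<close> is left multiplication by some \<open>b \<in> B\<close>, so \<open>J\<close>, being \<open>B\<close>-linear, also commutes with the action of \<open>\<tau>(u \<otimes> q)\<close>;
 this gives \<open>\<theta>(c \<otimes> f(u\<^sub>[\<^sub>0\<^sub>]) u\<^sub>[\<^sub>1\<^sub>]) = J(f)(c)(u)\<close>.  The remaining identities need only be checked for \<open>d = f(u\<^sub>[\<^sub>0\<^sub>]) u\<^sub>[\<^sub>1\<^sub>]\<close>, where they become
 statements about \<open>J(f) \<in> Q\<close>; the associativity of the Morita context yields \<open>\<theta>(z \<otimes> d) = \<epsilon>(d)\<close>.
\<close>

theorem trace_unital_imp_system:
 assumes tu: "trace_unital" and J: "bimod_iso A B D QB J"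
 shows "\<exists>z \<theta>. frobenius_system A C z \<theta>"
proof -
 obtain X where X: "X \<in> carrier (tensor B QB \<Sigma>)" and X1: "tlift Cs ev X = \<one>\<^sub>Cs"
  using tu by (auto simp: trace_unital_def)
 have Tl: "\<exists>b\<in>carrier B. \<forall>u\<in>carrier \<Sigma>. t u = b \<rightharpoonup>\<^sub>\<Sigma> u" if "t \<in> carrier T" for t
  using tu that by (auto simp: trace_unital_def)
 have Jl: "left_linear A D QB J" and Jr: "right_linear B D QB J" and Jb: "bij_betw J (carrier D) Q"
  using J by (simp_all add: bimod_iso_def bimod_map_def QB_simps(1))
 note Aab = BA.S.abelian_group_axioms and Cab = C.ab and Sab = BA.ab
 have Jc [simp]: "J f \<in> Q" if "f \<in> carrier D" for f using left_linear_closed[OF Jl that] by (simp add: QB_simps(1))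
 have J_add: "J (f \<oplus>\<^sub>D g) c u = J f c u \<oplus>\<^sub>A J g c u"
  if "f \<in> carrier D" "g \<in> carrier D" "c \<in> carrier C" "u \<in> carrier \<Sigma>" for f g c u
  using that by (simp add: left_linear_add[OF Jl] QB_apply D_apply)
 have J_lact: "J (a \<rightharpoonup>\<^sub>D f) c u = J f (c \<leftharpoonup>\<^sub>C a) u"
  if "f \<in> carrier D" "a \<in> carrier A" "c \<in> carrier C" for a f c u
  using that by (simp add: left_linear_lact[OF Jl] QB_apply)
 have J_ract: "J (f \<leftharpoonup>\<^sub>D b) c u = J f c (b \<rightharpoonup>\<^sub>\<Sigma> u)"
  if "f \<in> carrier D" "b \<in> carrier B" "c \<in> carrier C" "u \<in> carrier \<Sigma>" for b f c u
  using that by (simp add: right_linear_ract[OF Jr] QB_apply D_apply)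
 define I where "I = inv_into (carrier D) J"
 have Ic [simp]: "I q \<in> carrier D" and JI: "J (I q) = q" if "q \<in> Q" for q
  using that bij_betwE[OF bij_betw_inv_into[OF Jb]] bij_betw_inv_into_right[OF Jb that] by (simp_all add: I_def)
 have IJ: "I (J f) = f" if "f \<in> carrier D" for f
  using bij_betw_inv_into_left[OF Jb that] by (simp add: I_def)
 have Jinj: "f = g" if "J f = J g" "f \<in> carrier D" "g \<in> carrier D" for f g
  using that Jb by (auto simp: bij_betw_def dest: inj_onD)
 have QBc: "q \<oplus>\<^sub>QB q' \<in> Q" if "q \<in> Q" "q' \<in> Q" for q q' using QBS.M.M.a_closed that by (simp add: QB_simps(1))
 have I_add: "I (q \<oplus>\<^sub>QB q') = I q \<oplus>\<^sub>D I q'" if "q \<in> Q" "q' \<in> Q" for q q'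
  using that by (intro Jinj) (simp_all add: JI QBc left_linear_add[OF Jl])
 have I_ract: "I (q \<leftharpoonup>\<^sub>QB b) = I q \<leftharpoonup>\<^sub>D b" if "q \<in> Q" "b \<in> carrier B" for q b
  using that by (intro Jinj) (simp_all add: JI QB_ract_closed right_linear_ract[OF Jr] D_ract_closed)

 define th where "th c d = tlift A (\<lambda>q u. J (q d) c u) X" for c d
 define thc where "thc d = (\<lambda>c\<in>carrier C. th c d)" for d
 define z where "z = tlift C (\<lambda>q u. slice C \<rho> (I q) u) X"
 have bth: "balanced B QB \<Sigma> A (\<lambda>q u. J (q d) c u)" if "c \<in> carrier C" "d \<in> carrier C" for c d
  using that by (intro balancedI) (simp_all add: QB_simps(1) QB_apply J_add D_add J_ract)
 have bz: "balanced B QB \<Sigma> C (\<lambda>q u. slice C \<rho> (I q) u)"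
  by (rule balancedI) (simp_all add: QB_simps(1) I_add slice_add_left slice_add I_ract slice_lact_ring)
 have th_closed [simp]: "th c d \<in> carrier A" if "c \<in> carrier C" "d \<in> carrier C" for c d
  unfolding th_def by (rule QBS.tlift_closed[OF Aab bth[OF that] X])
 have z [simp]: "z \<in> carrier C" unfolding z_def by (rule QBS.tlift_closed[OF Cab bz X])

 note span = trace_unital_span[OF X X1]

 have ad_coact: "additive Cs \<Sigma> (\<lambda>g. coact_eval \<Sigma> \<rho> u g)" if u: "u \<in> carrier \<Sigma>" for u
  using u by (intro additiveI) (simp_all add: coact_eval_closed coact_eval_add_right)
 have sum_coact: "tlift \<Sigma> (\<lambda>q w. coact_eval \<Sigma> \<rho> u (ev q w)) X = u" if u: "u \<in> carrier \<Sigma>" for u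
  using QBS.tlift_comp[OF C.abelian_group_Cs Sab balanced_ev ad_coact[OF u] X] u by (simp only: X1 coact_eval_one)

 \<comment> \<open>The form is determined by \<open>J\<close>; here every \<open>\<tau>(u \<otimes> q)\<close> is multiplication by an element of \<open>B\<close>.\<close>
 have th_slice: "th c (slice C \<rho> f u) = J f c u" if c: "c \<in> carrier C" and f: "f \<in> carrier D" and u: "u \<in> carrier \<Sigma>" for c f u
 proof -
  have key: "J (q (slice C \<rho> f u)) c w = J f c (coact_eval \<Sigma> \<rho> u (ev q w))" if q: "q \<in> Q" and w: "w \<in> carrier \<Sigma>" for q w
  proof -
   obtain b where b: "b \<in> carrier B" "\<And>v. v \<in> carrier \<Sigma> ==> tau0 u q v = b \<rightharpoonup>\<^sub>\<Sigma> v" using Tl[OF tau0_closed[OF q u]] by blast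
   have bv: "coact_eval \<Sigma> \<rho> u (ev q v) = b \<rightharpoonup>\<^sub>\<Sigma> v" if "v \<in> carrier \<Sigma>" for v
    using b(2)[OF that] tau0_apply[OF q u that] by (simp del: restrict_apply)
   have "q (slice C \<rho> f u) = f \<leftharpoonup>\<^sub>D b"
   proof (rule D_ext)
    fix v assume v: "v \<in> carrier \<Sigma>"
    have "q (slice C \<rho> f u) v = ev q v (slice C \<rho> f u)" using f u by simp
    also have "\<dots> = f (coact_eval \<Sigma> \<rho> u (ev q v))" by (rule Cs_slice[OF Q_ev_closed[OF q v] f u])
    also have "\<dots> = (f \<leftharpoonup>\<^sub>D b) v" unfolding bv[OF v] using v by (simp add: D_apply)
    finally show "q (slice C \<rho> f u) v = (f \<leftharpoonup>\<^sub>D b) v" .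
   qed (use q f u b in \<open>simp_all add: D_ract_closed\<close>)
   then show ?thesis unfolding bv[OF w] using f b(1) c w by (simp add: J_ract)
  qed
  have adJ: "additive \<Sigma> A (\<lambda>v. J f c v)" using D_additive[OF Q_closed[OF Jc[OF f] c]] .
  have bco: "balanced B QB \<Sigma> \<Sigma> (\<lambda>q w. coact_eval \<Sigma> \<rho> u (ev q w))" by (rule balanced_comp[OF balanced_ev ad_coact[OF u]])
  have "th c (slice C \<rho> f u) = tlift A (\<lambda>q w. J f c (coact_eval \<Sigma> \<rho> u (ev q w))) X"
   unfolding th_def using c f u by (intro QBS.tlift_cong[OF Aab bth _ X]) (simp_all add: QB_simps(1) key del: restrict_apply)
  also have "\<dots> = J f c (tlift \<Sigma> (\<lambda>q w. coact_eval \<Sigma> \<rho> u (ev q w)) X)"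
   by (rule QBS.tlift_comp[OF Sab Aab bco adJ X, symmetric])
  finally show ?thesis by (simp only: sum_coact[OF u])
 qed

 have th_add2: "th c (d \<oplus>\<^sub>C d') = th c d \<oplus>\<^sub>A th c d'" if "c \<in> carrier C" "d \<in> carrier C" "d' \<in> carrier C" for c d d'
 proof -
  have "th c (d \<oplus>\<^sub>C d') = tlift A (\<lambda>q u. J (q d) c u \<oplus>\<^sub>A J (q d') c u) X"
   unfolding th_def using that by (intro QBS.tlift_cong[OF Aab bth _ X]) (simp_all add: QB_simps(1) Q_add J_add)
  also have "\<dots> = th c d \<oplus>\<^sub>A th c d'" unfolding th_def using that by (intro QBS.tlift_add_fun[OF Aab bth bth X])
  finally show ?thesis .
 qed
 have th_add1: "th (c \<oplus>\<^sub>C c') d = th c d \<oplus>\<^sub>A th c' d" if "c \<in> carrier C" "c' \<in> carrier C" "d \<in> carrier C" for c c' d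
 proof -
  have "th (c \<oplus>\<^sub>C c') d = tlift A (\<lambda>q u. J (q d) c u \<oplus>\<^sub>A J (q d) c' u) X"
   unfolding th_def using that by (intro QBS.tlift_cong[OF Aab bth _ X]) (simp_all add: QB_simps(1) Q_add D_apply)
  also have "\<dots> = th c d \<oplus>\<^sub>A th c' d" unfolding th_def using that by (intro QBS.tlift_add_fun[OF Aab bth bth X])
  finally show ?thesis .
 qed
 have th_mid: "th (c \<leftharpoonup>\<^sub>C a) d = th c (a \<rightharpoonup>\<^sub>C d)" if "c \<in> carrier C" "a \<in> carrier A" "d \<in> carrier C" for c a d
  unfolding th_def using that by (intro QBS.tlift_cong[OF Aab bth _ X])
   (simp_all add: QB_simps(1) Q_lact J_lact C.ract_closed)
 have th_lact: "th (a \<rightharpoonup>\<^sub>C c) d = a \<otimes>\<^sub>A th c d" if "c \<in> carrier C" "a \<in> carrier A" "d \<in> carrier C" for c a d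
 proof -
  have ad: "additive A A (\<lambda>x. a \<otimes>\<^sub>A x)" using that by (intro additiveI) (simp_all add: BA.S.r_distr)
  have "th (a \<rightharpoonup>\<^sub>C c) d = tlift A (\<lambda>q u. a \<otimes>\<^sub>A J (q d) c u) X"
   unfolding th_def using that by (intro QBS.tlift_cong[OF Aab bth _ X]) (simp_all add: QB_simps(1) Q_lact D_apply C.lact_closed)
  also have "\<dots> = a \<otimes>\<^sub>A th c d"
   unfolding th_def using that by (intro QBS.tlift_comp[OF Aab Aab bth ad X, symmetric])
  finally show ?thesis .
 qed
 have ad_th: "additive C A (\<lambda>d. th c d)" if "c \<in> carrier C" for c using that by (intro additiveI) (simp_all add: th_add2)
 have bal_th: "balanced A C C A th" by (rule balancedI) (simp_all add: th_add1 th_add2 th_mid)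
 have th_ract: "th c (d \<leftharpoonup>\<^sub>C a) = th c d \<otimes>\<^sub>A a" if c: "c \<in> carrier C" and a: "a \<in> carrier A" and d: "d \<in> carrier C" for c a d
 proof (rule span[OF Aab _ _ d])
  show "additive C A (\<lambda>d. th c (d \<leftharpoonup>\<^sub>C a))" "additive C A (\<lambda>d. th c d \<otimes>\<^sub>A a)"
   using c a by (intro additiveI; simp add: C.ract_closed C.ract_add_left th_add2 BA.S.l_distr)+
  fix f u assume "f \<in> carrier D" "u \<in> carrier \<Sigma>"
  then show "th c (slice C \<rho> f u \<leftharpoonup>\<^sub>C a) = th c (slice C \<rho> f u) \<otimes>\<^sub>A a"
   using c a by (simp add: slice_ract[symmetric] th_slice BA.ract_closed D_ract)
 qed
 have thc_closed [simp]: "thc d \<in> carrier Cs" if "d \<in> carrier C" for d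
  using that by (intro C.CsI) (simp_all add: thc_def th_add1 th_lact C.lact_closed)
 have thc_slice: "thc (slice C \<rho> f u) = ev (J f) u" if "f \<in> carrier D" "u \<in> carrier \<Sigma>" for f u
  using that by (auto simp: thc_def th_slice)
 have thc_add: "thc (d \<oplus>\<^sub>C d') = thc d \<oplus>\<^sub>Cs thc d'" if "d \<in> carrier C" "d' \<in> carrier C" for d d'
  using that by (auto simp: thc_def C.Cs_simps pointwise_add_def th_add2)
 have ad_hit_thc: "additive C C (\<lambda>d. hit C c (thc d))" if "c \<in> carrier C" for c
  using that by (intro additiveI) (simp_all add: C.hit_closed thc_add C.hit_add_right)
 have b_th_lact: "balanced A C C C (\<lambda>d1 d2. th c d1 \<rightharpoonup>\<^sub>C d2)" if "c \<in> carrier C" for c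
  using that by (intro balancedI)
   (simp_all add: th_add2 th_ract C.lact_closed C.lact_add_left C.lact_add_right C.lact_mult)
 have middle: "hit C c (thc d) = tlift C (\<lambda>d1 d2. th c d1 \<rightharpoonup>\<^sub>C d2) (comult C d)" if c: "c \<in> carrier C" and d: "d \<in> carrier C" for c d
 proof (rule span[OF Cab ad_hit_thc[OF c] _ d])
  show "additive C C (\<lambda>d. tlift C (\<lambda>d1 d2. th c d1 \<rightharpoonup>\<^sub>C d2) (comult C d))"
   by (rule additive_comp[OF right_linear_additive[OF C.comult_right_linear] C.CC.additive_tlift[OF Cab b_th_lact[OF c]]])
  fix f u assume f: "f \<in> carrier D" and u: "u \<in> carrier \<Sigma>"
  have "tlift C (\<lambda>d1 d2. th c d1 \<rightharpoonup>\<^sub>C d2) (comult C (slice C \<rho> f u)) = tlift C (\<lambda>v e. th c (slice C \<rho> f v) \<rightharpoonup>\<^sub>C e) (\<rho> u)"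
   by (rule tlift_comult_slice(1)[OF f u Cab b_th_lact[OF c]])
  also have "\<dots> = slice C \<rho> (J f c) u"
   unfolding slice_def[of _ _ "J f c"] using c f u
   by (intro MC.tlift_cong[OF Cab tlift_comult_slice(2)[OF f u Cab b_th_lact[OF c]]]) (simp_all add: th_slice)
  also have "\<dots> = hit C c (thc (slice C \<rho> f u))"
   unfolding thc_slice[OF f u] using c f u by (simp add: Q_slice del: restrict_apply)
  finally show "hit C c (thc (slice C \<rho> f u)) = tlift C (\<lambda>d1 d2. th c d1 \<rightharpoonup>\<^sub>C d2) (comult C (slice C \<rho> f u))" by simp
 qed
 have th_z: "th c z = counit C c" if c: "c \<in> carrier C" for c
 proof -
  have ad: "additive Cs A (\<lambda>g. g c)" using c by (intro additiveI) (simp_all add: C.Cs_add_apply)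
  have "th c z = tlift A (\<lambda>q u. th c (slice C \<rho> (I q) u)) X"
   unfolding z_def by (rule QBS.tlift_comp[OF Cab Aab bz ad_th[OF c] X])
  also have "\<dots> = tlift A (\<lambda>q u. ev q u c) X"
   using c by (intro QBS.tlift_cong[OF Aab balanced_comp[OF bz ad_th[OF c]] _ X]) (simp add: QB_simps(1) th_slice JI)
  also have "\<dots> = tlift Cs ev X c" by (rule QBS.tlift_comp[OF C.abelian_group_Cs Aab balanced_ev ad X, symmetric])
  finally show ?thesis using c by (simp add: X1 C.Cs_simps)
 qed
 have hit_z: "hit C z (thc d) = d" if d: "d \<in> carrier C" for d
 proof (rule span[OF Cab ad_hit_thc[OF z] additive_id d])
  fix f u assume f: "f \<in> carrier D" and u: "u \<in> carrier \<Sigma>"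
  define S where "S g = slice C \<rho> (I (g \<rightharpoonup>\<^sub>QM J f)) u" for g
  interpret QM: bimodule Cs T QM by (rule bimodule_QM)
  have adS: "additive Cs C S"
  proof (rule additiveI)
   fix g h assume *: "g \<in> carrier Cs" "h \<in> carrier Cs"
   have "(g \<oplus>\<^sub>Cs h) \<rightharpoonup>\<^sub>QM J f = (g \<rightharpoonup>\<^sub>QM J f) \<oplus>\<^sub>QB (h \<rightharpoonup>\<^sub>QM J f)"
    using QM.lact_add_left[of g h "J f"] * f by (simp add: QM_simps(1,3) QB_simps(3))
   then show "S (g \<oplus>\<^sub>Cs h) = S g \<oplus>\<^sub>C S h"
    using * f u by (simp add: S_def I_add Q_lact_closed slice_add_left)
  qed (use f u in \<open>simp add: S_def Q_lact_closed\<close>)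
  note ad = C.additive_hit[OF Q_ev_closed[OF Jc[OF f] u]]
  have "hit C z (thc (slice C \<rho> f u)) = tlift C (\<lambda>q w. hit C (slice C \<rho> (I q) w) (ev (J f) u)) X"
   unfolding thc_slice[OF f u] z_def by (rule QBS.tlift_comp[OF Cab Cab bz ad X])
  also have "\<dots> = tlift C (\<lambda>q w. S (ev q w)) X"
  proof (rule QBS.tlift_cong[OF Cab balanced_comp[OF bz ad] _ X])
   fix q w assume "q \<in> carrier QB" and w: "w \<in> carrier \<Sigma>"
   then have q: "q \<in> Q" by (simp add: QB_simps(1))
   obtain b where b: "b \<in> carrier B" "\<And>v. v \<in> carrier \<Sigma> ==> tau0 w (J f) v = b \<rightharpoonup>\<^sub>\<Sigma> v"
    using Tl[OF tau0_closed[OF Jc[OF f] w]] by blast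
   have tb: "tau0 w (J f) = (\<lambda>v\<in>carrier \<Sigma>. b \<rightharpoonup>\<^sub>\<Sigma> v)"
    using b(2) by (intro extensionalityI[of _ "carrier \<Sigma>"]) (simp_all add: tau0_def)
   have "hit C (slice C \<rho> (I q) w) (ev (J f) u) = slice C \<rho> (I q) (coact_eval \<Sigma> \<rho> w (ev (J f) u))"
    using q f u w by (intro slice_coact_eval[symmetric]) simp_all
   also have "\<dots> = slice C \<rho> (I q) (b \<rightharpoonup>\<^sub>\<Sigma> u)"
    using tau0_apply[OF Jc[OF f] w u] b(2)[OF u] by simp
   also have "\<dots> = slice C \<rho> (I (q \<leftharpoonup>\<^sub>QB b)) u"
    using q b u by (simp add: I_ract slice_lact_ring)
   also have "q \<leftharpoonup>\<^sub>QB b = ev q w \<rightharpoonup>\<^sub>QM J f"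
    unfolding QB_ract[OF b(1)] tb[symmetric]
    using morita_dataD(10)[OF comodule_morita_data, of w q "J f"] q w f by (simp add: QM_simps(1))
   finally show "hit C (slice C \<rho> (I q) w) (ev (J f) u) = S (ev q w)" by (simp only: S_def)
  qed
  also have "\<dots> = S (tlift Cs ev X)" by (rule QBS.tlift_comp[OF C.abelian_group_Cs Cab balanced_ev adS X, symmetric])
  also have "\<dots> = slice C \<rho> f u"
   using QM.lact_one[of "J f"] f by (simp add: X1 S_def QM_simps(1) IJ)
  finally show "hit C z (thc (slice C \<rho> f u)) = slice C \<rho> f u" .
 qed
 have z_th: "th z d = counit C d" if d: "d \<in> carrier C" for d
  using C.counit_hit[OF z thc_closed[OF d]] hit_z[OF d] by (simp add: thc_def)
 have za: "a \<rightharpoonup>\<^sub>C z = z \<leftharpoonup>\<^sub>C a" if a: "a \<in> carrier A" for a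
 proof -
  have "thc (a \<rightharpoonup>\<^sub>C z) = thc (z \<leftharpoonup>\<^sub>C a)"
   using a by (auto simp: thc_def th_mid[symmetric] th_ract th_z C.ract_closed C.counit_simps)
  then have "hit C z (thc (a \<rightharpoonup>\<^sub>C z)) = hit C z (thc (z \<leftharpoonup>\<^sub>C a))" by simp
  then show ?thesis using a by (simp add: hit_z C.lact_closed C.ract_closed)
 qed
 define \<theta> where "\<theta> = tlift A th"
 have \<theta>_tens: "\<theta> (tens A C C c d) = th c d" if "c \<in> carrier C" "d \<in> carrier C" for c d
  unfolding \<theta>_def using that by (simp add: bal_th Aab)
 have "frobenius_system A C z \<theta>"
  unfolding frobenius_system_def
 proof (intro conjI ballI z)
  show "a \<rightharpoonup>\<^sub>C z = z \<leftharpoonup>\<^sub>C a" if "a \<in> carrier A" for a by (rule za[OF that])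
  interpret RA: bimodule A A "regular A" by (rule bimodule_regular[OF BA.S.ring_axioms])
  have b: "balanced A C C (regular A) th" using bal_th by (simp add: balanced_regular)
  have \<theta>r: "\<theta> = tlift (regular A) th" by (simp add: \<theta>_def tlift_regular)
  show "bimod_map A A (tensor A C C) (regular A) \<theta>"
   unfolding \<theta>r bimod_map_def
   by (intro conjI C.CC.left_linear_tlift C.CC.right_linear_tlift C.bimodule_axioms RA.left_module_axioms RA.right_module_axioms b)
    (simp_all add: th_lact th_ract)
 next
  fix c d assume c: "c \<in> carrier C" and d: "d \<in> carrier C"
  have "tlift C (\<lambda>c1 c2. c1 \<leftharpoonup>\<^sub>C \<theta> (tens A C C c2 d)) (comult C c) = hit C c (thc d)"
   unfolding hit_def using c d
   by (intro C.CC.tlift_cong[symmetric, OF Cab C.balanced_hit[OF thc_closed[OF d]]]) (simp_all add: thc_def \<theta>_tens)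
  also have "\<dots> = tlift C (\<lambda>d1 d2. \<theta> (tens A C C c d1) \<rightharpoonup>\<^sub>C d2) (comult C d)"
   unfolding middle[OF c d] using c d by (intro C.CC.tlift_cong[OF Cab b_th_lact[OF c]]) (simp_all add: \<theta>_tens)
  finally show "tlift C (\<lambda>c1 c2. c1 \<leftharpoonup>\<^sub>C \<theta> (tens A C C c2 d)) (comult C c)
    = tlift C (\<lambda>d1 d2. \<theta> (tens A C C c d1) \<rightharpoonup>\<^sub>C d2) (comult C d)" .
 qed (simp_all add: \<theta>_tens th_z z_th)
 then show ?thesis by blast
qed

section \<open>Strict contexts\<close>

text \<open>
 A preimage of the unit under \<open>\<mu>\<close> is a tensor over \<open>T\<close>; as \<open>B\<close> maps onto \<open>T\<close>, it gives a tensor over \<open>B\<close>.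
\<close>

lemma strict_imp_trace_unital:
 assumes "strict_comodule_context A B C \<Sigma> \<rho>"
 shows trace_unital
proof -
 have l: "(\<lambda>b. \<lambda>u\<in>carrier \<Sigma>. b \<rightharpoonup>\<^sub>\<Sigma> u) ` carrier B = carrier T"
  using assms unfolding strict_comodule_context_def ring_iso_def bij_betw_def by simp
 have Tl: "\<exists>b\<in>carrier B. t = (\<lambda>u\<in>carrier \<Sigma>. b \<rightharpoonup>\<^sub>\<Sigma> u)" if "t \<in> carrier T" for t
  using that l by (metis (no_types, lifting) imageE)
 have bij: "bij_betw (tlift Cs ev) (carrier (tensor T QM P)) (carrier Cs)"
  using assms by (simp add: strict_comodule_context_def strict_context_def comodule_context_eq tensor_qp_def bimod_iso_def)
 have "\<one>\<^sub>Cs \<in> carrier Cs" using C.Cs_one_closed by (simp add: C.Cs_simps)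
 then have "\<one>\<^sub>Cs \<in> tlift Cs ev ` carrier (tensor T QM P)" by (simp only: bij_betw_imp_surj_on[OF bij])
 then obtain Y where Y: "Y \<in> carrier (tensor T QM P)" "\<one>\<^sub>Cs = tlift Cs ev Y" by (rule imageE)
 interpret QM: bimodule Cs T QM by (rule bimodule_QM)
 interpret PB: bimodule T Cs P by (rule bimodule_P)
 interpret QP: tensor_pair T QM P by (intro tensor_pair.intro QM.right_module_axioms PB.left_module_axioms)
 let ?G = "tensor B QB \<Sigma>"
 note G = QBS.ab
 have b: "balanced T QM P ?G (tens B QB \<Sigma>)"
 proof (rule balancedI)
  fix q q' u assume "q \<in> carrier QM" "q' \<in> carrier QM" "u \<in> carrier P"
  then show "tens B QB \<Sigma> (q \<oplus>\<^sub>QM q') u = tens B QB \<Sigma> q u \<oplus>\<^bsub>?G\<^esub> tens B QB \<Sigma> q' u"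
   using QBS.tens_add1[of q q' u] by (simp add: QM_simps QB_simps)
 next
  fix q t u assume *: "q \<in> carrier QM" "t \<in> carrier T" "u \<in> carrier P"
  obtain r where r: "r \<in> carrier B" "t = (\<lambda>u\<in>carrier \<Sigma>. r \<rightharpoonup>\<^sub>\<Sigma> u)" using Tl[OF *(2)] by blast
  then show "tens B QB \<Sigma> (q \<leftharpoonup>\<^sub>QM t) u = tens B QB \<Sigma> q (t \<rightharpoonup>\<^sub>P u)"
   using * QBS.tens_middle[of q r u] by (simp add: QM_simps(1) QB_simps(1) QB_ract[symmetric])
 qed (simp_all add: QM_simps QB_simps QBS.tens_add2)
 let ?X = "tlift ?G (tens B QB \<Sigma>) Y"
 have "tlift Cs ev ?X = tlift Cs (\<lambda>q u. tlift Cs ev (tens B QB \<Sigma> q u)) Y"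
  by (rule QP.tlift_comp[OF G C.abelian_group_Cs b QBS.additive_tlift[OF C.abelian_group_Cs balanced_ev] Y(1)])
 also have "\<dots> = tlift Cs ev Y"
  by (rule QP.tlift_cong[OF C.abelian_group_Cs balanced_comp[OF b QBS.additive_tlift[OF C.abelian_group_Cs balanced_ev]] _ Y(1)])
   (simp add: balanced_ev C.abelian_group_Cs QM_simps QB_simps del: restrict_apply)
 finally have X1: "tlift Cs ev ?X = \<one>\<^sub>Cs" unfolding Y(2) .
 show ?thesis
  unfolding trace_unital_def
 proof (intro conjI ballI)
  show "\<exists>X\<in>carrier ?G. tlift Cs ev X = \<one>\<^sub>Cs" by (rule bexI[where x = ?X]) (rule X1, rule QP.tlift_closed[OF G b Y(1)])
  fix t assume "t \<in> carrier T"
  from Tl[OF this] obtain r where "r \<in> carrier B" "t = (\<lambda>u\<in>carrier \<Sigma>. r \<rightharpoonup>\<^sub>\<Sigma> u)" by blast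
  then show "\<exists>b\<in>carrier B. \<forall>u\<in>carrier \<Sigma>. t u = b \<rightharpoonup>\<^sub>\<Sigma> u" by (intro bexI[of _ r]) simp_all
 qed
qed

end

section \<open>The dual ring of a finitely generated projective coring as a comodule\<close>

locale fgp_coring = coring A C for A :: "('a, 'y) ring_scheme" and C :: "('a, 'c, 'z) coring_scheme" +
 assumes left_fgp_C: "left_fgp A C"
begin

definition "left_basis = (SOME (n :: nat, c, h). (\<forall>i<n. c i \<in> carrier C \<and> h i \<in> carrier Cs) \<and>
 (\<forall>x\<in>carrier C. (\<Oplus>\<^sub>C i\<in>{..<n}. h i x \<rightharpoonup>\<^sub>C c i) = x))"
definition "rank = fst left_basis"
definition "cb = fst (snd left_basis)"
definition "hb = snd (snd left_basis)"

lemma left_basis_props: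
 shows cb_closed [simp]: "i < rank ==> cb i \<in> carrier C" and hb_closed [simp]: "i < rank ==> hb i \<in> carrier Cs"
  and left_expand: "x \<in> carrier C ==> (\<Oplus>\<^sub>C i\<in>{..<rank}. hb i x \<rightharpoonup>\<^sub>C cb i) = x"
proof -
 obtain n :: nat and c h where c: "\<And>i. i < n ==> c i \<in> carrier C"
  and h: "\<And>i. i < n ==> left_linear A C (regular A) (h i)"
  and s: "\<And>m. m \<in> carrier C ==> m = (\<Oplus>\<^sub>C i\<in>{..<n}. h i m \<rightharpoonup>\<^sub>C c i)"
  by (rule left_fgp_dual_basis[OF left_module_axioms left_fgp_C]) (rule that)
 have hc: "restrict (h i) (carrier C) \<in> carrier Cs" if "i < n" for i
  using h[OF that] left_linear_closed[OF h[OF that]] left_linear_add[OF h[OF that]] left_linear_lact[OF h[OF that]]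
  by (intro CsI) (simp_all add: lact_closed)
 have "case (n, c, \<lambda>i. restrict (h i) (carrier C)) of (n :: nat, c, h) =>
  (\<forall>i<n. c i \<in> carrier C \<and> h i \<in> carrier Cs) \<and> (\<forall>x\<in>carrier C. (\<Oplus>\<^sub>C i\<in>{..<n}. h i x \<rightharpoonup>\<^sub>C c i) = x)"
  using c hc s[symmetric] by simp
 then have "case left_basis of (n :: nat, c, h) =>
  (\<forall>i<n. c i \<in> carrier C \<and> h i \<in> carrier Cs) \<and> (\<forall>x\<in>carrier C. (\<Oplus>\<^sub>C i\<in>{..<n}. h i x \<rightharpoonup>\<^sub>C c i) = x)"
  unfolding left_basis_def by (rule someI)
 then show "i < rank ==> cb i \<in> carrier C" "i < rank ==> hb i \<in> carrier Cs"
  "x \<in> carrier C ==> (\<Oplus>\<^sub>C i\<in>{..<rank}. hb i x \<rightharpoonup>\<^sub>C cb i) = x" by (auto simp: rank_def cb_def hb_def split: prod.splits)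
qed

lemma Cs_separates:
 assumes "c \<in> carrier C" "d \<in> carrier C" "\<And>g. g \<in> carrier Cs ==> g c = g d"
 shows "c = d"
proof -
 have "(\<Oplus>\<^sub>C i\<in>{..<rank}. hb i c \<rightharpoonup>\<^sub>C cb i) = (\<Oplus>\<^sub>C i\<in>{..<rank}. hb i d \<rightharpoonup>\<^sub>C cb i)"
  using assms(1,2) by (intro M.finsum_cong') (auto simp: lact_closed assms(3)[OF hb_closed])
 then show ?thesis using assms(1,2) by (simp only: left_expand)
qed

definition Csm :: "(unit, 'a, 'c => 'a) bimod"
 where "Csm = \<lparr>carrier = carrier Cs, mult = undefined, one = undefined, zero = zero Cs, add = add Cs,
  lact = undefined, ract = (\<lambda>g a. \<lambda>c\<in>carrier C. g c \<otimes>\<^sub>A a)\<rparr>"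

lemma Csm_simps [simp]:
 "carrier Csm = carrier Cs" "zero Csm = zero Cs" "add Csm = add Cs" by (simp_all add: Csm_def)

lemma Csm_ract_apply: "c \<in> carrier C ==> (g \<leftharpoonup>\<^sub>Csm a) c = g c \<otimes>\<^sub>A a" by (simp add: Csm_def)

lemma Csm_ract_closed: "g \<in> carrier Cs ==> a \<in> carrier A ==> g \<leftharpoonup>\<^sub>Csm a \<in> carrier Cs"
 by (rule CsI) (simp_all add: Csm_def Cs_add Cs_lact lact_closed R.l_distr R.m_assoc)

lemma hit_ract_right: "c \<in> carrier C ==> g \<in> carrier Cs ==> a \<in> carrier A ==> hit C c (g \<leftharpoonup>\<^sub>Csm a) = hit C c g \<leftharpoonup>\<^sub>C a"
 using right_comodule.coact_eval_ract(2)[OF right_comodule_self, of g a c] by (simp add: hit_eq Csm_def)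

lemma right_module_Csm: "right_module A Csm"
proof -
 interpret Cs: ring Cs by (rule ring_Cs)
 have "abelian_group Csm" by (rule abelian_groupI) (auto simp: Cs.a_ac intro: Cs.l_neg)
 then show ?thesis by (intro right_module.intro right_module_axioms.intro R.ring_axioms)
   (auto intro!: Cs_ext Cs.a_closed simp: Csm_ract_closed Csm_ract_apply Cs_add_apply R.r_distr R.l_distr R.m_assoc)
qed

sublocale Csm: right_module A Csm by (rule right_module_Csm)
sublocale CsmC: tensor_pair A Csm C by (rule tensor_pair_coring[OF right_module_Csm])

text \<open>
 The evaluations \<open>h \<otimes> d \<mapsto> h(c) d\<close> separate the elements of \<open>\<^sup>*C \<otimes> C\<close>, because \<open>C\<close> is finitely generated projective.
\<close>

definition Ev :: "'c => (('c => 'a) \<times> 'c \<Rightarrow>\<^sub>0 int) set => 'c"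
 where "Ev c = tlift C (\<lambda>g d. g c \<rightharpoonup>\<^sub>C d)"

lemma balanced_Ev: "c \<in> carrier C ==> balanced A Csm C C (\<lambda>g d. g c \<rightharpoonup>\<^sub>C d)" by (rule balancedI)
  (simp_all add: lact_closed lact_add_left lact_add_right lact_mult Csm_ract_apply Cs_add_apply)

lemma Ev_tens: "c \<in> carrier C ==> g \<in> carrier Cs ==> d \<in> carrier C ==> Ev c (tens A Csm C g d) = g c \<rightharpoonup>\<^sub>C d"
 unfolding Ev_def by (simp add: balanced_Ev M.abelian_group_axioms)

lemma right_linear_Ev:
 assumes c: "c \<in> carrier C"
 shows "right_linear A (tensor A Csm C) C (Ev c)"
 unfolding Ev_def using c
 by (intro CsmC.right_linear_tlift bimodule_axioms right_module_axioms balanced_Ev) (simp_all add: lact_ract)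

lemmas Ev_additive = right_linear_additive[OF right_linear_Ev]
lemmas Ev_closed = right_linear_closed[OF right_linear_Ev]

lemma Cs_expand:
 assumes g: "g \<in> carrier Cs"
 shows "(\<Oplus>\<^sub>Csm i\<in>{..<rank}. hb i \<leftharpoonup>\<^sub>Csm g (cb i)) = g"
proof (rule Cs_ext[OF _ g])
 have cl: "hb i \<leftharpoonup>\<^sub>Csm g (cb i) \<in> carrier Csm" if "i < rank" for i using that g by (simp add: Csm_ract_closed)
 have "(\<Oplus>\<^sub>Csm i\<in>{..<rank}. hb i \<leftharpoonup>\<^sub>Csm g (cb i)) \<in> carrier Csm" by (rule Csm.M.finsum_closed) (use cl in auto)
 then show "(\<Oplus>\<^sub>Csm i\<in>{..<rank}. hb i \<leftharpoonup>\<^sub>Csm g (cb i)) \<in> carrier Cs" by simp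
 fix c assume c: "c \<in> carrier C"
 have ad: "additive Csm A (\<lambda>g. g c)" using c by (intro additiveI) (simp_all add: Cs_add_apply)
 have "(\<Oplus>\<^sub>Csm i\<in>{..<rank}. hb i \<leftharpoonup>\<^sub>Csm g (cb i)) c = (\<Oplus>\<^sub>A i\<in>{..<rank}. (hb i \<leftharpoonup>\<^sub>Csm g (cb i)) c)"
  using cl by (intro additive_finsum[OF ad Csm.ab R.abelian_group_axioms]) auto
 also have "\<dots> = (\<Oplus>\<^sub>A i\<in>{..<rank}. g (hb i c \<rightharpoonup>\<^sub>C cb i))"
  using c g by (intro R.finsum_cong') (auto simp: Csm_ract_apply Cs_lact lact_closed)
 also have "\<dots> = g (\<Oplus>\<^sub>C i\<in>{..<rank}. hb i c \<rightharpoonup>\<^sub>C cb i)"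
  using c by (intro additive_finsum[OF Cs_additive[OF g] M.abelian_group_axioms R.abelian_group_axioms, symmetric])
   (auto simp: lact_closed)
 finally show "(\<Oplus>\<^sub>Csm i\<in>{..<rank}. hb i \<leftharpoonup>\<^sub>Csm g (cb i)) c = g c" by (simp only: left_expand[OF c])
qed

lemma tens_expand:
 assumes X: "X \<in> carrier (tensor A Csm C)"
 shows "(\<Oplus>\<^bsub>tensor A Csm C\<^esub>i\<in>{..<rank}. tens A Csm C (hb i) (Ev (cb i) X)) = X"
proof (rule CsmC.tensor_eqI[OF CsmC.ab _ additive_id _ X])
 show "additive (tensor A Csm C) (tensor A Csm C) (\<lambda>X. \<Oplus>\<^bsub>tensor A Csm C\<^esub>i\<in>{..<rank}. tens A Csm C (hb i) (Ev (cb i) X))"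
  by (intro additive_finsum_fun[OF CsmC.ab] additive_comp[OF Ev_additive balanced_additive2[OF CsmC.tens_balanced]]) simp_all
 fix g d assume g: "g \<in> carrier Csm" and d: "d \<in> carrier C"
 then have gc: "g \<in> carrier Cs" by simp
 have cl: "hb i \<leftharpoonup>\<^sub>Csm g (cb i) \<in> carrier Csm" if "i < rank" for i using that gc by (simp add: Csm_ract_closed)
 have "(\<Oplus>\<^bsub>tensor A Csm C\<^esub>i\<in>{..<rank}. tens A Csm C (hb i) (Ev (cb i) (tens A Csm C g d)))
   = (\<Oplus>\<^bsub>tensor A Csm C\<^esub>i\<in>{..<rank}. tens A Csm C (hb i \<leftharpoonup>\<^sub>Csm g (cb i)) d)"
  using gc d cl by (intro CsmC.T.finsum_cong') (auto simp: Ev_tens CsmC.tens_middle)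
 also have "\<dots> = tens A Csm C (\<Oplus>\<^sub>Csm i\<in>{..<rank}. hb i \<leftharpoonup>\<^sub>Csm g (cb i)) d"
  using cl by (intro additive_finsum[OF balanced_additive1[OF CsmC.tens_balanced d] Csm.ab CsmC.ab, symmetric]) auto
 finally show "(\<Oplus>\<^bsub>tensor A Csm C\<^esub>i\<in>{..<rank}. tens A Csm C (hb i) (Ev (cb i) (tens A Csm C g d))) = tens A Csm C g d"
  by (simp only: Cs_expand[OF gc])
qed

lemma Ev_inj:
 assumes X: "X \<in> carrier (tensor A Csm C)" and Y: "Y \<in> carrier (tensor A Csm C)"
  and eq: "\<And>c. c \<in> carrier C ==> Ev c X = Ev c Y"
 shows "X = Y"
proof -
 have "(\<Oplus>\<^bsub>tensor A Csm C\<^esub>i\<in>{..<rank}. tens A Csm C (hb i) (Ev (cb i) X))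
   = (\<Oplus>\<^bsub>tensor A Csm C\<^esub>i\<in>{..<rank}. tens A Csm C (hb i) (Ev (cb i) Y))"
  using Y eq by (intro CsmC.T.finsum_cong') (auto simp: Ev_closed)
 then show ?thesis by (simp only: tens_expand[OF X] tens_expand[OF Y])
qed

text \<open>
 The coaction of \<open>\<^sup>*C\<close> is dual to right multiplication: it is the only \<open>g\<^sub>[\<^sub>0\<^sub>] \<otimes> g\<^sub>[\<^sub>1\<^sub>]\<close> with
 \<open>g\<^sub>[\<^sub>0\<^sub>](c) g\<^sub>[\<^sub>1\<^sub>] = c\<^sub>(\<^sub>1\<^sub>) g(c\<^sub>(\<^sub>2\<^sub>))\<close> for all \<open>c\<close>.
\<close>

definition \<sigma> :: "('c => 'a) => (('c => 'a) \<times> 'c \<Rightarrow>\<^sub>0 int) set"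
 where "\<sigma> g = (\<Oplus>\<^bsub>tensor A Csm C\<^esub>i\<in>{..<rank}. tens A Csm C (hb i) (hit C (cb i) g))"

lemma \<sigma>_closed: "g \<in> carrier Cs ==> \<sigma> g \<in> carrier (tensor A Csm C)"
 unfolding \<sigma>_def by (rule CsmC.T.finsum_closed) (auto simp: hit_closed)

lemma Ev_\<sigma>:
 assumes c: "c \<in> carrier C" and g: "g \<in> carrier Cs"
 shows "Ev c (\<sigma> g) = hit C c g"
proof -
 have "Ev c (\<sigma> g) = (\<Oplus>\<^sub>C i\<in>{..<rank}. Ev c (tens A Csm C (hb i) (hit C (cb i) g)))"
  unfolding \<sigma>_def using g
  by (intro additive_finsum[OF Ev_additive[OF c] CsmC.ab M.abelian_group_axioms]) (auto simp: hit_closed)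
 also have "\<dots> = (\<Oplus>\<^sub>C i\<in>{..<rank}. hit C (hb i c \<rightharpoonup>\<^sub>C cb i) g)"
  using c g by (intro M.finsum_cong') (auto simp: Ev_tens hit_closed hit_lact lact_closed)
 also have "\<dots> = hit C (\<Oplus>\<^sub>C i\<in>{..<rank}. hb i c \<rightharpoonup>\<^sub>C cb i) g"
  using c by (intro additive_finsum[OF additive_hit[OF g] M.abelian_group_axioms M.abelian_group_axioms, symmetric]) (auto simp: lact_closed)
 finally show ?thesis by (simp only: left_expand[OF c])
qed

text \<open>
 After evaluation at \<open>c\<close>, both sides of coassociativity become \<open>\<Delta>(c\<^sub>(\<^sub>1\<^sub>) g(c\<^sub>(\<^sub>2\<^sub>)))\<close>.
\<close>

lemma right_comodule_Csm: "right_comodule A C Csm \<sigma>"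
proof -
 interpret CB: bicomodule A A C C "comult C" by (rule bicomodule_self)
 interpret Cs: ring Cs by (rule ring_Cs)
 let ?W = "tensor A Csm C" and ?CC = "tensor A C C"
 interpret W: right_module A ?W by (rule right_module_tensor_coring[OF right_module_Csm])
 interpret WC: tensor_pair A ?W C by (rule tensor_pair_coring[OF W.right_module_axioms])
 have lin: "right_linear A Csm ?W \<sigma>"
 proof (intro right_linearI additiveI)
  fix g h assume "g \<in> carrier Csm" "h \<in> carrier Csm"
  then show "\<sigma> (g \<oplus>\<^sub>Csm h) = \<sigma> g \<oplus>\<^bsub>?W\<^esub> \<sigma> h"
   by (intro Ev_inj) (simp_all add: \<sigma>_closed additive_add[OF Ev_additive] Ev_\<sigma> hit_add_right)
 next
  fix g a assume "g \<in> carrier Csm" "a \<in> carrier A"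
  then show "\<sigma> (g \<leftharpoonup>\<^sub>Csm a) = \<sigma> g \<leftharpoonup>\<^bsub>?W\<^esub> a"
   by (intro Ev_inj) (simp_all add: \<sigma>_closed Csm_ract_closed W.ract_closed right_linear_ract[OF right_linear_Ev] Ev_\<sigma> hit_ract_right)
 qed (simp add: \<sigma>_closed)
 \<comment> \<open>An element of \<open>\<^sup>*C \<otimes> C \<otimes> C\<close> is determined by its evaluations in the first place.\<close>
 have inj: "Z = Z'" if Z: "Z \<in> carrier (tensor A ?W C)" "Z' \<in> carrier (tensor A ?W C)"
  and eq: "\<And>c. c \<in> carrier C ==> tmap A C C (Ev c) (\<lambda>d. d) Z = tmap A C C (Ev c) (\<lambda>d. d) Z'" for Z Z'
 proof -
  have rl: "right_linear A C ?W (tens A Csm C (hb i))" if "i < rank" for i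
   using that balanced_additive2[OF CsmC.tens_balanced, of "hb i"]
   by (intro right_linearI) (simp_all add: CsmC.ract_tens[OF bimodule_axioms])
  define G where "G i X = tmap A ?W C (tens A Csm C (hb i)) (\<lambda>d. d) X" for i X
  note adE = CC.additive_tmap[OF WC.tensor_pair_axioms right_linear_Ev left_id]
  have adG: "additive ?CC (tensor A ?W C) (G i)" if "i < rank" for i
   unfolding G_def[abs_def] by (rule WC.additive_tmap[OF CC.tensor_pair_axioms rl[OF that] left_id])
  have exp: "(\<Oplus>\<^bsub>tensor A ?W C\<^esub>i\<in>{..<rank}. G i (tmap A C C (Ev (cb i)) (\<lambda>d. d) Z)) = Z" if Z: "Z \<in> carrier (tensor A ?W C)" for Z
  proof (rule WC.tensor_eqI[OF WC.ab _ additive_id _ Z])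
   show "additive (tensor A ?W C) (tensor A ?W C) (\<lambda>Z. \<Oplus>\<^bsub>tensor A ?W C\<^esub>i\<in>{..<rank}. G i (tmap A C C (Ev (cb i)) (\<lambda>d. d) Z))"
    by (rule additive_finsum_fun[OF WC.ab]) (rule additive_comp[OF adE adG]; simp)
   fix X d assume X: "X \<in> carrier ?W" and d: "d \<in> carrier C"
   have cl: "tens A Csm C (hb i) (Ev (cb i) X) \<in> carrier ?W" if "i < rank" for i using that X by (simp add: Ev_closed)
   have "(\<Oplus>\<^bsub>tensor A ?W C\<^esub>i\<in>{..<rank}. G i (tmap A C C (Ev (cb i)) (\<lambda>d. d) (tens A ?W C X d)))
     = (\<Oplus>\<^bsub>tensor A ?W C\<^esub>i\<in>{..<rank}. tens A ?W C (tens A Csm C (hb i) (Ev (cb i) X)) d)"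
    using X d cl by (intro WC.T.finsum_cong')
     (auto simp: G_def CC.tmap_tens[OF WC.tensor_pair_axioms right_linear_Ev left_id]
      WC.tmap_tens[OF CC.tensor_pair_axioms rl left_id] Ev_closed)
   also have "\<dots> = tens A ?W C (\<Oplus>\<^bsub>?W\<^esub>i\<in>{..<rank}. tens A Csm C (hb i) (Ev (cb i) X)) d"
    using cl by (intro additive_finsum[OF balanced_additive1[OF WC.tens_balanced d] CsmC.ab WC.ab, symmetric]) auto
   finally show "(\<Oplus>\<^bsub>tensor A ?W C\<^esub>i\<in>{..<rank}. G i (tmap A C C (Ev (cb i)) (\<lambda>d. d) (tens A ?W C X d))) = tens A ?W C X d"
    by (simp only: tens_expand[OF X])
  qed
  have "(\<Oplus>\<^bsub>tensor A ?W C\<^esub>i\<in>{..<rank}. G i (tmap A C C (Ev (cb i)) (\<lambda>d. d) Z))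
    = (\<Oplus>\<^bsub>tensor A ?W C\<^esub>i\<in>{..<rank}. G i (tmap A C C (Ev (cb i)) (\<lambda>d. d) Z'))"
   using Z eq by (intro WC.T.finsum_cong') (auto simp: additive_closed[OF adE] additive_closed[OF adG])
  then show ?thesis by (simp only: exp[OF Z(1)] exp[OF Z(2)])
 qed
 show ?thesis
 proof (intro right_comodule.intro right_comodule_axioms.intro coring_axioms right_module_Csm lin)
  fix g assume "g \<in> carrier Csm"
  then have g: "g \<in> carrier Cs" by simp
  note \<sigma>g = \<sigma>_closed[OF g]
  note tm = WC.additive_tmap[OF CsmC.tensor_pair_axioms lin left_id]
  show "tmap A ?W C \<sigma> (\<lambda>c. c) (\<sigma> g) = tensor_coact A C A Csm C (comult C) (\<sigma> g)"
  proof (rule inj[OF additive_closed[OF tm \<sigma>g] additive_closed[OF CB.additive_tensor_coact[OF right_module_Csm] \<sigma>g]])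
   fix c assume c: "c \<in> carrier C"
   note G = CC.ab
   note bE = CC.balanced_tmap[OF WC.tensor_pair_axioms right_linear_Ev[OF c] left_id]
   define f where "f c1 c2 h d = tens A C C (c1 \<leftharpoonup>\<^sub>C h c2) d" for c1 c2 d and h :: "'c => 'a"
   have f1: "balanced A Csm C ?CC (f c1 c2)" if "c1 \<in> carrier C" "c2 \<in> carrier C" for c1 c2
    unfolding f_def[abs_def] using that
    by (intro balancedI) (simp_all add: CC.tens_middle CC.tens_add2 lact_closed lact_add_left lact_add_right lact_mult Cs_add_apply Csm_ract_apply)
   have f2: "balanced A C C ?CC (\<lambda>c1 c2. f c1 c2 h d)" if "h \<in> carrier Csm" "d \<in> carrier C" for h d
    unfolding f_def using that
    by (intro balanced_comp[OF balanced_hit balanced_additive1[OF CC.tens_balanced]]) simp_all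
   have bh: "balanced A Csm C ?CC (\<lambda>h d. tens A C C (hit C c h) d)"
    using c by (intro balancedI) (simp_all add: hit_closed hit_add_right hit_ract_right CC.tens_add1 CC.tens_add2 CC.tens_middle)
   have fh: "tlift ?CC (\<lambda>c1 c2. f c1 c2 h d) (comult C c) = tens A C C (hit C c h) d" if "h \<in> carrier Csm" "d \<in> carrier C" for h d
    unfolding hit_def f_def using that c
    by (intro CC.tlift_comp[OF M.abelian_group_axioms G balanced_hit balanced_additive1[OF CC.tens_balanced], symmetric]) simp_all
   have fE: "tlift ?CC (f c1 c2) (\<sigma> g) = tens A C C c1 (hit C c2 g)" if "c1 \<in> carrier C" "c2 \<in> carrier C" for c1 c2
   proof -
    have "tens A C C c1 (hit C c2 g) = tens A C C c1 (Ev c2 (\<sigma> g))" by (simp add: Ev_\<sigma> that g)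
    also have "\<dots> = tlift ?CC (\<lambda>h d. tens A C C c1 (h c2 \<rightharpoonup>\<^sub>C d)) (\<sigma> g)"
     unfolding Ev_def using that
     by (intro CsmC.tlift_comp[OF M.abelian_group_axioms G balanced_Ev balanced_additive2[OF CC.tens_balanced] \<sigma>g])
    also have "\<dots> = tlift ?CC (f c1 c2) (\<sigma> g)"
     using that by (intro CsmC.tlift_cong[OF G f1 _ \<sigma>g, symmetric]) (simp_all add: f_def CC.tens_middle)
    finally show ?thesis by simp
   qed
   have "tmap A C C (Ev c) (\<lambda>d. d) (tmap A ?W C \<sigma> (\<lambda>c. c) (\<sigma> g)) = tlift ?CC (\<lambda>h d. tens A C C (Ev c (\<sigma> h)) d) (\<sigma> g)"
    unfolding tmap_def[of _ C] by (rule WC.tlift_tmap[OF CsmC.tensor_pair_axioms lin left_id G bE \<sigma>g])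
   also have "\<dots> = tlift ?CC (\<lambda>h d. tlift ?CC (\<lambda>c1 c2. f c1 c2 h d) (comult C c)) (\<sigma> g)"
    using c by (intro CsmC.tlift_cong[symmetric, OF G tlift_swap(2)[OF CsmC.tensor_pair_axioms CC.tensor_pair_axioms G f2 f1 \<sigma>g] _ \<sigma>g])
     (simp_all add: fh Ev_\<sigma>)
   also have "\<dots> = tlift ?CC (\<lambda>c1 c2. tlift ?CC (f c1 c2) (\<sigma> g)) (comult C c)"
    using c by (intro tlift_swap(1)[OF CsmC.tensor_pair_axioms CC.tensor_pair_axioms G f2 f1 \<sigma>g]) simp_all
   also have "\<dots> = tlift ?CC (\<lambda>c1 c2. tens A C C c1 (hit C c2 g)) (comult C c)"
    using c g by (intro CC.tlift_cong[symmetric, OF G tlift_comult_hit(2)[OF g c G CC.tens_balanced]]) (simp_all add: fE)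
   also have "\<dots> = comult C (hit C c g)"
    using tlift_comult_hit(1)[OF g c G CC.tens_balanced] c g by (simp add: CC.tlift_tens_self hit_closed)
   finally have 1: "tmap A C C (Ev c) (\<lambda>d. d) (tmap A ?W C \<sigma> (\<lambda>c. c) (\<sigma> g)) = comult C (hit C c g)" .
   have add\<Delta>: "additive C ?CC (comult C)" by (rule right_linear_additive[OF comult_right_linear])
   have "tmap A C C (Ev c) (\<lambda>d. d) (tensor_coact A C A Csm C (comult C) (\<sigma> g)) = comult C (Ev c (\<sigma> g))"
   proof (rule CsmC.tensor_eqI[OF G additive_comp[OF CB.additive_tensor_coact[OF right_module_Csm]
       CC.additive_tmap[OF WC.tensor_pair_axioms right_linear_Ev[OF c] left_id]]
      additive_comp[OF Ev_additive[OF c] add\<Delta>] _ \<sigma>g])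
    fix h d assume h: "h \<in> carrier Csm" and d: "d \<in> carrier C"
    have "tmap A C C (Ev c) (\<lambda>d. d) (tensor_coact A C A Csm C (comult C) (tens A Csm C h d))
      = tlift ?CC (\<lambda>d1 d2. tens A C C (Ev c (tens A Csm C h d1)) d2) (comult C d)"
     unfolding tmap_def[of _ C] by (rule CB.tlift_tensor_coact_tens[OF right_module_Csm G bE h d])
    also have "\<dots> = tlift ?CC (\<lambda>d1 d2. tens A C C (h c \<rightharpoonup>\<^sub>C d1) d2) (comult C d)"
     using c h d by (intro CC.tlift_cong[OF G CB.balanced_tensor_coact(2)[OF right_module_Csm G bE h]]) (simp_all add: Ev_tens)
    also have "\<dots> = h c \<rightharpoonup>\<^bsub>?CC\<^esub> comult C d" by (simp add: tensor_lact)
    also have "\<dots> = comult C (Ev c (tens A Csm C h d))"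
     using c h d by (simp add: Ev_tens left_linear_lact[OF comult_left_linear])
    finally show "tmap A C C (Ev c) (\<lambda>d. d) (tensor_coact A C A Csm C (comult C) (tens A Csm C h d)) = comult C (Ev c (tens A Csm C h d))" .
   qed
   then show "tmap A C C (Ev c) (\<lambda>d. d) (tmap A ?W C \<sigma> (\<lambda>c. c) (\<sigma> g)) = tmap A C C (Ev c) (\<lambda>d. d) (tensor_coact A C A Csm C (comult C) (\<sigma> g))"
    using 1 by (simp add: Ev_\<sigma> c g)
  qed
  have bc: "balanced A Csm C Csm (\<lambda>h d. h \<leftharpoonup>\<^sub>Csm counit C d)"
   by (rule balancedI) (simp_all add: Csm.ract_closed[simplified] Csm.ract_add_left[simplified] Csm.ract_add_right[simplified] Csm.ract_mult[simplified] counit_simps)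
  have cl: "tlift Csm (\<lambda>h d. h \<leftharpoonup>\<^sub>Csm counit C d) (\<sigma> g) \<in> carrier Cs"
   using CsmC.tlift_closed[OF Csm.ab bc \<sigma>g] by simp
  show "tlift Csm (\<lambda>h d. h \<leftharpoonup>\<^sub>Csm counit C d) (\<sigma> g) = g"
  proof (rule Cs_ext[OF cl g])
   fix c assume c: "c \<in> carrier C"
   have ad: "additive Csm A (\<lambda>g. g c)" using c by (intro additiveI) (simp_all add: Cs_add_apply)
   have adc: "additive C A (counit C)" by (intro additiveI) (simp_all add: counit_simps)
   have "tlift Csm (\<lambda>h d. h \<leftharpoonup>\<^sub>Csm counit C d) (\<sigma> g) c = tlift A (\<lambda>h d. (h \<leftharpoonup>\<^sub>Csm counit C d) c) (\<sigma> g)"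
    by (rule CsmC.tlift_comp[OF Csm.ab R.abelian_group_axioms bc ad \<sigma>g])
   also have "\<dots> = tlift A (\<lambda>h d. counit C (h c \<rightharpoonup>\<^sub>C d)) (\<sigma> g)"
    using c by (intro CsmC.tlift_cong[OF R.abelian_group_axioms balanced_comp[OF bc ad] _ \<sigma>g]) (simp add: Csm_ract_apply counit_simps)
   also have "\<dots> = counit C (Ev c (\<sigma> g))"
    unfolding Ev_def using c by (intro CsmC.tlift_comp[OF M.abelian_group_axioms R.abelian_group_axioms balanced_Ev adc \<sigma>g, symmetric])
   finally show "tlift Csm (\<lambda>h d. h \<leftharpoonup>\<^sub>Csm counit C d) (\<sigma> g) c = g c" by (simp add: Ev_\<sigma> counit_hit c g)
  qed
 qed
qed

lemma Cs_lepoll: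
 assumes "infinite (UNIV :: 'u set)" and "carrier A \<lesssim> (UNIV :: 'u set)"
 shows "carrier Cs \<lesssim> (UNIV :: 'u set)"
proof (rule lepoll_finitely_determined[OF assms, where n = rank and k = "\<lambda>g i. g (cb i)"])
 fix g h assume gh: "g \<in> carrier Cs" "h \<in> carrier Cs" and eq: "\<And>i. i < rank ==> g (cb i) = h (cb i)"
 have "(\<Oplus>\<^sub>Csm i\<in>{..<rank}. hb i \<leftharpoonup>\<^sub>Csm g (cb i)) = (\<Oplus>\<^sub>Csm i\<in>{..<rank}. hb i \<leftharpoonup>\<^sub>Csm h (cb i))"
  using gh eq by (intro Csm.M.finsum_cong') (auto simp: Csm_ract_closed)
 then show "g = h" by (simp only: Cs_expand gh)
qed simp

end

section \<open>Inverse equivalences\<close>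

locale fgp_pair = fgp_bicomodule A B C \<Sigma> \<rho> + fgp_coring A C
 for A :: "('a, 'y1) ring_scheme" and B :: "('b, 'y2) ring_scheme"
  and C :: "('a, 'c, 'z1) coring_scheme"
  and \<Sigma> :: "('b, 'a, 's, 'z2) bimod_scheme" and \<rho> :: "'s => ('s \<times> 'c \<Rightarrow>\<^sub>0 int) set"

lemma (in fgp_bicomodule) tensor_pair_comod_Hom:
 "right_comodule A C M \<mu> ==> tensor_pair B (comod_Hom_mod A C \<Sigma> \<rho> M \<mu>) \<Sigma>"
 by (intro tensor_pair.intro right_module_comod_Hom_mod BA.left_module_axioms)

lemma (in fgp_bicomodule) balanced_eval:
 assumes M: "right_comodule A C M \<mu>"
 shows "balanced B (comod_Hom_mod A C \<Sigma> \<rho> M \<mu>) \<Sigma> M (\<lambda>h u. h u)" by (rule balancedI)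
  (auto simp: comod_Hom_mod_simps mem_comod_Hom_iff pointwise_add_def
   intro: colinear_closed additive_add[OF colinear_additive])

context fgp_pair
begin

text \<open>
 A comodule map \<open>h\<close> from \<open>\<Sigma>\<close> to \<open>\<^sup>*C\<close> is the same as an element \<open>q\<close> of \<open>Q\<close>, via \<open>q(c)(u) = h(u)(c)\<close>.
 Hence the counit of the adjunction at \<open>\<^sup>*C\<close> is the map \<open>Q \<otimes>\<^sub>B \<Sigma> \<rightarrow> \<^sup>*C\<close>.
\<close>

lemma trace_unital_from_counit:
 assumes M: "right_comodule A C M \<mu>" and \<kappa>: "colinear A C M \<mu> Csm \<sigma> \<kappa>"
  and X: "X \<in> carrier (tensor B (comod_Hom_mod A C \<Sigma> \<rho> M \<mu>) \<Sigma>)"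
  and X1: "\<kappa> (tlift M (\<lambda>h u. h u) X) = \<one>\<^sub>Cs"
  and Tl: "\<And>t. t \<in> carrier T ==> \<exists>b\<in>carrier B. \<forall>u\<in>carrier \<Sigma>. t u = b \<rightharpoonup>\<^sub>\<Sigma> u"
 shows trace_unital
proof -
 let ?H = "comod_Hom_mod A C \<Sigma> \<rho> M \<mu>"
 interpret M: right_comodule A C M \<mu> by fact
 interpret H: tensor_pair B ?H \<Sigma> by (rule tensor_pair_comod_Hom[OF M])
 define qq where "qq h = (\<lambda>c\<in>carrier C. \<lambda>u\<in>carrier \<Sigma>. \<kappa> (h u) c)" for h
 have hD: "colinear A C \<Sigma> \<rho> M \<mu> h" if "h \<in> carrier ?H" for h
  using that by (simp add: comod_Hom_mod_simps mem_comod_Hom_iff)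
 have \<alpha>: "colinear A C \<Sigma> \<rho> Csm \<sigma> (\<lambda>u. \<kappa> (h u))" if "h \<in> carrier ?H" for h
  by (rule colinear_comp[OF M right_module_Csm hD[OF that] \<kappa>])
 have \<alpha>c [simp]: "\<kappa> (h u) \<in> carrier Cs" if "h \<in> carrier ?H" "u \<in> carrier \<Sigma>" for h u
  using colinear_closed[OF \<alpha>[OF that(1)] that(2)] by simp
 have ev_qq: "ev (qq h) u = \<kappa> (h u)" if "h \<in> carrier ?H" "u \<in> carrier \<Sigma>" for h u
  using \<alpha>c[OF that] that by (intro extensionalityI[of _ "carrier C"]) (simp_all add: qq_def C.Cs_mem_iff)
 have qQ: "qq h \<in> Q" if h: "h \<in> carrier ?H" for h
 proof (rule QI)
  show qD: "qq h c \<in> carrier D" if c: "c \<in> carrier C" for c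
   using c h colinear_ract[OF \<alpha>[OF h]] additive_add[OF colinear_additive[OF \<alpha>[OF h]]]
   by (intro DI) (simp_all add: qq_def C.Cs_add_apply Csm_ract_apply BA.ract_closed)
  fix c u assume c: "c \<in> carrier C" and u: "u \<in> carrier \<Sigma>"
  have "slice C \<rho> (qq h c) u = tlift C (\<lambda>v d. \<kappa> (h v) c \<rightharpoonup>\<^sub>C d) (\<rho> u)"
   unfolding slice_def using c u by (intro MC.tlift_cong[OF C.ab balanced_slice[OF qD[OF c]]]) (simp_all add: qq_def)
  also have "\<dots> = Ev c (\<sigma> (\<kappa> (h u)))"
   unfolding Ev_def by (rule tlift_colinear[OF right_module_Csm \<alpha>[OF h] C.ab balanced_Ev[OF c] u, symmetric])
  also have "\<dots> = hit C c (ev (qq h) u)" unfolding ev_qq[OF h u] using c u h by (simp add: Ev_\<sigma>)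
  finally show "slice C \<rho> (qq h c) u = hit C c (ev (qq h) u)" .
 qed (use h in \<open>simp_all add: qq_def C.Cs_add C.Cs_lact C.lact_closed\<close>)
 let ?G = "tensor B QB \<Sigma>"
 note G = QBS.ab and Csab = C.abelian_group_Cs
 have QBc: "q \<oplus>\<^sub>QB q' \<in> Q" if "q \<in> Q" "q' \<in> Q" for q q' using QBS.M.M.a_closed that by (simp add: QB_simps(1))
 have b: "balanced B ?H \<Sigma> ?G (\<lambda>h u. tens B QB \<Sigma> (qq h) u)"
 proof (rule balancedI)
  fix h h' u assume h: "h \<in> carrier ?H" "h' \<in> carrier ?H" and u: "u \<in> carrier \<Sigma>"
  have "qq (h \<oplus>\<^bsub>?H\<^esub> h') = qq h \<oplus>\<^sub>QB qq h'"
   using h H.M.M.a_closed[OF h] by (intro Q_ext qQ QBc)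
    (simp_all add: QB_apply D_apply qq_def comod_Hom_mod_simps(3) pointwise_add_def
     additive_add[OF colinear_additive[OF \<kappa>]] colinear_closed[OF hD] C.Cs_add_apply)
  then show "tens B QB \<Sigma> (qq (h \<oplus>\<^bsub>?H\<^esub> h')) u = tens B QB \<Sigma> (qq h) u \<oplus>\<^bsub>?G\<^esub> tens B QB \<Sigma> (qq h') u"
   using h u qQ by (simp add: QB_simps(1) QBS.tens_add1)
 next
  fix h r u assume h: "h \<in> carrier ?H" and r: "r \<in> carrier B" and u: "u \<in> carrier \<Sigma>"
  have "qq (h \<leftharpoonup>\<^bsub>?H\<^esub> r) = qq h \<leftharpoonup>\<^sub>QB r"
   using h r by (intro Q_ext qQ QB_ract_closed H.M.ract_closed)
    (simp_all add: QB_apply D_apply qq_def comod_Hom_mod_simps(4) BA.lact_closed)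
  then show "tens B QB \<Sigma> (qq (h \<leftharpoonup>\<^bsub>?H\<^esub> r)) u = tens B QB \<Sigma> (qq h) (r \<rightharpoonup>\<^sub>\<Sigma> u)"
   using h r u qQ by (simp add: QB_simps(1) QBS.tens_middle)
 qed (use qQ in \<open>simp_all add: QB_simps(1) QBS.tens_add2\<close>)
 let ?X = "tlift ?G (\<lambda>h u. tens B QB \<Sigma> (qq h) u) X"
 note ad_ev = QBS.additive_tlift[OF Csab balanced_ev]
 have ad\<kappa>: "additive M Cs \<kappa>" using colinear_additive[OF \<kappa>] by (simp add: additive_def hom_def)
 have "tlift Cs ev ?X = tlift Cs (\<lambda>h u. tlift Cs ev (tens B QB \<Sigma> (qq h) u)) X"
  by (rule H.tlift_comp[OF G Csab b ad_ev X])
 also have "\<dots> = tlift Cs (\<lambda>h u. \<kappa> (h u)) X" by (rule H.tlift_cong[OF Csab balanced_comp[OF b ad_ev] _ X])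
   (simp add: qQ QB_simps(1) balanced_ev Csab ev_qq del: restrict_apply)
 also have "\<dots> = \<one>\<^sub>Cs"
  unfolding X1[symmetric] by (rule H.tlift_comp[OF M.M.ab Csab balanced_eval[OF M] ad\<kappa> X, symmetric])
 finally have X1': "tlift Cs ev ?X = \<one>\<^sub>Cs" .
 show ?thesis
  unfolding trace_unital_def
 proof (intro conjI ballI Tl)
  show "\<exists>X\<in>carrier ?G. tlift Cs ev X = \<one>\<^sub>Cs" by (rule bexI[where x = ?X]) (rule X1', rule H.tlift_closed[OF G b X])
 qed
qed

text \<open>
 The unit of the adjunction at \<open>B\<close> shows that every \<open>t \<in> T\<close> is a multiplication, since \<open>u \<mapsto> 1 \<otimes> t(u)\<close> is a comodule map \<open>\<Sigma> \<rightarrow> B \<otimes> \<Sigma>\<close>;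
 the counit at \<open>\<^sup>*C\<close> gives the unit of the dual ring.
\<close>

lemma inverse_equivalences_imp_trace_unital:
 assumes inv: "inverse_equivalences TYPE('u) A B C \<Sigma> \<rho>" and inf: "infinite (UNIV :: 'u set)"
  and sA: "carrier A \<lesssim> (UNIV :: 'u set)" and sB: "carrier B \<lesssim> (UNIV :: 'u set)"
 shows trace_unital
proof -
 have unit: "bij_betw (\<lambda>x. \<lambda>u\<in>carrier \<Sigma>. tens B X \<Sigma> x u) (carrier X)
   (carrier (comod_Hom_mod A C \<Sigma> \<rho> (tensor B X \<Sigma>) (tensor_coact A C B X \<Sigma> \<rho>)))"
  if "right_module B X" for X :: "(unit, 'b, 'u) bimod"
  using inv that unfolding inverse_equivalences_def Let_def by blast
 have counit: "bij_betw (tlift M (\<lambda>h u. h u)) (carrier (tensor B (comod_Hom_mod A C \<Sigma> \<rho> M \<mu>) \<Sigma>)) (carrier M)"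
  if "right_comodule A C M \<mu>" for M :: "(unit, 'a, 'u) bimod" and \<mu>
  using inv that unfolding inverse_equivalences_def Let_def by blast
 have Tl: "\<exists>b\<in>carrier B. \<forall>u\<in>carrier \<Sigma>. t u = b \<rightharpoonup>\<^sub>\<Sigma> u" if t: "t \<in> carrier T" for t
 proof -
  interpret RB: bimodule B B "regular B" by (rule bimodule_regular[OF BA.R.ring_axioms])
  obtain X :: "(unit, 'b, 'u) bimod" and \<iota> \<kappa> where X: "right_module B X"
   and \<iota>: "right_linear B (regular B) X \<iota>" and \<kappa>: "right_linear B X (regular B) \<kappa>"
   and \<kappa>\<iota>: "\<And>a. a \<in> carrier (regular B) ==> \<kappa> (\<iota> a) = a" and \<iota>\<kappa>: "\<And>x. x \<in> carrier X ==> \<iota> (\<kappa> x) = x"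
   by (rule right_copy_exists[OF RB.right_module_axioms, where 'u = 'u]) (simp add: sB, rule that)
  interpret XS: tensor_pair B X \<Sigma> by (rule tensor_pair_left[OF X])
  interpret XSc: right_comodule A C "tensor B X \<Sigma>" "tensor_coact A C B X \<Sigma> \<rho>" by (rule right_comodule_tensor[OF X])
  note \<kappa>c = right_linear_closed[OF \<kappa>, simplified]
  define e where "e = \<iota> \<one>\<^sub>B"
  have e: "e \<in> carrier X" "\<kappa> e = \<one>\<^sub>B" using right_linear_closed[OF \<iota>, of "\<one>\<^sub>B"] by (simp_all add: e_def \<kappa>\<iota>)
  have "(\<lambda>u\<in>carrier \<Sigma>. tens B X \<Sigma> e (t u)) \<in> comod_Hom A C \<Sigma> \<rho> (tensor B X \<Sigma>) (tensor_coact A C B X \<Sigma> \<rho>)"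
   by (intro colinear_restrict[OF XSc.M.right_module_axioms]
     colinear_comp[OF right_comodule_axioms XSc.M.right_module_axioms T_colinear[OF t] colinear_tens[OF X e(1)]])
  then obtain x where x: "x \<in> carrier X" and eq: "(\<lambda>u\<in>carrier \<Sigma>. tens B X \<Sigma> e (t u)) = (\<lambda>u\<in>carrier \<Sigma>. tens B X \<Sigma> x u)"
   using bij_betw_imp_surj_on[OF unit[OF X]] unfolding comod_Hom_mod_simps by (metis (no_types, lifting) imageE)
  have bp: "balanced B X \<Sigma> \<Sigma> (\<lambda>x u. \<kappa> x \<rightharpoonup>\<^sub>\<Sigma> u)"
   by (rule balancedI) (simp_all add: \<kappa>c BA.lact_closed BA.lact_add_left BA.lact_add_right BA.lact_mult
     right_linear_ract[OF \<kappa>, simplified] right_linear_add[OF \<kappa>, simplified])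
  have "t u = \<kappa> x \<rightharpoonup>\<^sub>\<Sigma> u" if u: "u \<in> carrier \<Sigma>" for u
  proof -
   have "tens B X \<Sigma> e (t u) = tens B X \<Sigma> x u" using fun_cong[OF eq, of u] u by simp
   then have "tlift \<Sigma> (\<lambda>x u. \<kappa> x \<rightharpoonup>\<^sub>\<Sigma> u) (tens B X \<Sigma> e (t u)) = tlift \<Sigma> (\<lambda>x u. \<kappa> x \<rightharpoonup>\<^sub>\<Sigma> u) (tens B X \<Sigma> x u)" by simp
   then show ?thesis using e x t u by (simp add: bp BA.ab BA.lact_one)
  qed
  then show ?thesis using \<kappa>c[OF x] by blast
 qed
 obtain M :: "(unit, 'a, 'u) bimod" and \<mu> \<iota> \<kappa> where M: "right_comodule A C M \<mu>"
  and \<iota>: "colinear A C Csm \<sigma> M \<mu> \<iota>" and \<kappa>: "colinear A C M \<mu> Csm \<sigma> \<kappa>"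
  and \<kappa>\<iota>: "\<And>g. g \<in> carrier Csm ==> \<kappa> (\<iota> g) = g" and "\<And>x. x \<in> carrier M ==> \<iota> (\<kappa> x) = x"
  by (rule right_comodule_copy_exists[OF right_comodule_Csm, where 'u = 'u]) (simp add: Cs_lepoll[OF inf sA], rule that)
 have one: "\<one>\<^sub>Cs \<in> carrier Csm" using C.Cs_one_closed by (simp add: C.Cs_simps)
 have "\<iota> \<one>\<^sub>Cs \<in> tlift M (\<lambda>h u. h u) ` carrier (tensor B (comod_Hom_mod A C \<Sigma> \<rho> M \<mu>) \<Sigma>)"
  unfolding bij_betw_imp_surj_on[OF counit[OF M]] by (rule colinear_closed[OF \<iota> one])
 then obtain X where X: "X \<in> carrier (tensor B (comod_Hom_mod A C \<Sigma> \<rho> M \<mu>) \<Sigma>)"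
  "\<iota> \<one>\<^sub>Cs = tlift M (\<lambda>h u. h u) X" by (rule imageE)
 show ?thesis by (rule trace_unital_from_counit[OF M \<kappa> X(1) _ Tl]) (simp_all only: X(2)[symmetric] \<kappa>\<iota>[OF one])
qed

end

section \<open>Progenerators\<close>

lemma left_copy_exists:
 fixes M :: "('l, 'r, 'm, 'z) bimod_scheme"
 assumes M: "left_module R M" and size: "carrier M \<lesssim> (UNIV :: 'u set)"
 obtains M' :: "('l, unit, 'u) bimod" and \<iota> \<kappa> where "left_module R M'"
  "left_linear R M M' \<iota>" "left_linear R M' M \<kappa>"
  "\<And>m. m \<in> carrier M ==> \<kappa> (\<iota> m) = m" "\<And>m. m \<in> carrier M' ==> \<iota> (\<kappa> m) = m"
proof -
 interpret left_module R M by fact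
 obtain \<iota> :: "'m => 'u" where \<iota>: "inj_on \<iota> (carrier M)" using size by (auto simp: lepoll_def)
 define \<kappa> where "\<kappa> = inv_into (carrier M) \<iota>"
 have \<kappa>\<iota> [simp]: "\<kappa> (\<iota> m) = m" if "m \<in> carrier M" for m using that \<iota> by (simp add: \<kappa>_def)
 define M' :: "('l, unit, 'u) bimod" where "M' = copy \<iota> M\<lparr>lact := (\<lambda>r x. \<iota> (r \<rightharpoonup>\<^sub>M \<kappa> x)), ract := undefined\<rparr>"
 have [simp]: "carrier M' = \<iota> ` carrier M" "add M' = (\<lambda>x y. \<iota> (\<kappa> x \<oplus>\<^sub>M \<kappa> y))" "lact M' = (\<lambda>r x. \<iota> (r \<rightharpoonup>\<^sub>M \<kappa> x))"
  by (simp_all add: M'_def copy_def \<kappa>_def)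
 have "abelian_group M'" unfolding M'_def by (rule abelian_group_copy[OF M.abelian_group_axioms \<iota>])
 then have 1: "left_module R M'" by (intro left_module.intro left_module_axioms.intro R.ring_axioms)
   (auto simp: lact_closed lact_add_left lact_add_right lact_mult lact_one)
 have 2: "left_linear R M M' \<iota>" "left_linear R M' M \<kappa>" by (auto intro!: left_linearI additiveI simp: lact_closed)
 show ?thesis by (rule that[OF 1 2]) auto
qed

context fgp_pair
begin

text \<open>
 Elements of \<open>T\<close> commute with the action of \<open>\<^sup>*C\<close>, that is, with all \<open>B\<close>-endomorphisms of \<open>\<Sigma>\<close>, in particular with the rank one
 operators \<open>u \<mapsto> p(u) v\<close>: \<open>t(p(w) v) = p(t(w)) v\<close>.  As \<open>\<Sigma>\<close> is a generator, \<open>1 \<in> B\<close> is a sum of elements \<open>p(w)\<close>, and so \<open>t\<close> is a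
 multiplication.  For fixed \<open>p\<close>, the element of \<open>\<^sup>*C\<close> that acts as \<open>u \<mapsto> p(u) v\<close> is a comodule map of \<open>v\<close>, hence an element of \<open>Q\<close>; a
 dual basis of \<open>\<Sigma>\<close> over \<open>B\<close> writes the identity as a sum of such operators.
\<close>

lemma dual_progenerator_imp_trace_unital:
 assumes prog: "dual_progenerator TYPE('u) A B C \<Sigma> \<rho>" and sB: "carrier B \<lesssim> (UNIV :: 'u set)"
 shows trace_unital
proof -
 have bij: "bij_betw (\<lambda>f. \<lambda>u\<in>carrier \<Sigma>. coact_eval \<Sigma> \<rho> u f) (carrier Cs) (left_Hom B \<Sigma> \<Sigma>)"
  using prog by (simp add: dual_progenerator_def ring_iso_def left_End_op_def)
 have ex: "\<exists>f\<in>carrier Cs. \<forall>u\<in>carrier \<Sigma>. coact_eval \<Sigma> \<rho> u f = g u" if g: "left_linear B \<Sigma> \<Sigma> g" for g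
 proof -
  have "restrict g (carrier \<Sigma>) \<in> left_Hom B \<Sigma> \<Sigma>"
   using left_linear_closed[OF g] left_linear_add[OF g] left_linear_lact[OF g]
   by (auto simp: left_Hom_def BA.lact_closed intro!: left_linearI additiveI)
  then obtain f where f: "f \<in> carrier Cs" "restrict g (carrier \<Sigma>) = (\<lambda>u\<in>carrier \<Sigma>. coact_eval \<Sigma> \<rho> u f)"
   using bij_betw_imp_surj_on[OF bij] by (metis (no_types, lifting) imageE)
  have "coact_eval \<Sigma> \<rho> u f = g u" if "u \<in> carrier \<Sigma>" for u using fun_cong[OF f(2), of u] that by simp
  then show ?thesis using f(1) by blast
 qed
 have faithful: "f = g" if fg: "f \<in> carrier Cs" "g \<in> carrier Cs"
  and eq: "\<And>u. u \<in> carrier \<Sigma> ==> coact_eval \<Sigma> \<rho> u f = coact_eval \<Sigma> \<rho> u g" for f g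
 proof (rule inj_onD[OF bij_betw_imp_inj_on[OF bij] _ fg])
  show "(\<lambda>u\<in>carrier \<Sigma>. coact_eval \<Sigma> \<rho> u f) = (\<lambda>u\<in>carrier \<Sigma>. coact_eval \<Sigma> \<rho> u g)" by (rule restrict_ext) (rule eq)
 qed
 have fgpB: "left_fgp B \<Sigma>" and gen: "left_generator TYPE('u) B \<Sigma>"
  using prog by (simp_all add: dual_progenerator_def left_progenerator_def)
 \<comment> \<open>The element \<open>[p, v]\<close> of the dual ring that acts as the rank one operator \<open>u \<mapsto> p(u) v\<close>.\<close>
 have "\<exists>f\<in>carrier Cs. \<forall>u\<in>carrier \<Sigma>. coact_eval \<Sigma> \<rho> u f = p u \<rightharpoonup>\<^sub>\<Sigma> v"
  if p: "left_linear B \<Sigma> (regular B) p" and v: "v \<in> carrier \<Sigma>" for p v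
  using v left_linear_closed[OF p] left_linear_add[OF p] left_linear_lact[OF p]
  by (intro ex left_linearI additiveI) (simp_all add: BA.lact_closed BA.lact_add_left BA.lact_mult)
 then obtain br where br [simp]: "\<And>p v. left_linear B \<Sigma> (regular B) p ==> v \<in> carrier \<Sigma> ==> br p v \<in> carrier Cs"
  and br_eval: "\<And>p v u. left_linear B \<Sigma> (regular B) p ==> v \<in> carrier \<Sigma> ==> u \<in> carrier \<Sigma> ==>
   coact_eval \<Sigma> \<rho> u (br p v) = p u \<rightharpoonup>\<^sub>\<Sigma> v" by metis
 have Tl: "\<exists>b\<in>carrier B. \<forall>u\<in>carrier \<Sigma>. t u = b \<rightharpoonup>\<^sub>\<Sigma> u" if t: "t \<in> carrier T" for t
 proof -
  interpret RB: bimodule B B "regular B" by (rule bimodule_regular[OF BA.R.ring_axioms])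
  obtain X :: "('b, unit, 'u) bimod" and \<iota> \<kappa> where X: "left_module B X"
   and \<iota>: "left_linear B (regular B) X \<iota>" and \<kappa>: "left_linear B X (regular B) \<kappa>"
   and \<kappa>\<iota>: "\<And>a. a \<in> carrier (regular B) ==> \<kappa> (\<iota> a) = a" and \<iota>\<kappa>: "\<And>x. x \<in> carrier X ==> \<iota> (\<kappa> x) = x"
   by (rule left_copy_exists[OF RB.left_module_axioms, where 'u = 'u]) (simp add: sB, rule that)
  interpret X: left_module B X by fact
  note \<kappa>c = left_linear_closed[OF \<kappa>, simplified]
  let ?S = "\<Union>h\<in>left_Hom B \<Sigma> X. h ` carrier \<Sigma>"
  have gen1: "h w \<in> carrier X \<and> (\<exists>b\<in>carrier B. \<forall>v\<in>carrier \<Sigma>. t (\<kappa> (h w) \<rightharpoonup>\<^sub>\<Sigma> v) = b \<rightharpoonup>\<^sub>\<Sigma> v)"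
   if h: "left_linear B \<Sigma> X h" and w: "w \<in> carrier \<Sigma>" for h w
  proof -
   have p: "left_linear B \<Sigma> (regular B) (\<lambda>u. \<kappa> (h u))"
    by (rule left_linearI[OF additive_comp[OF left_linear_additive[OF h] left_linear_additive[OF \<kappa>]]])
     (simp add: left_linear_lact[OF h] left_linear_lact[OF \<kappa>, simplified] left_linear_closed[OF h])
   have "t (\<kappa> (h w) \<rightharpoonup>\<^sub>\<Sigma> v) = \<kappa> (h (t w)) \<rightharpoonup>\<^sub>\<Sigma> v" if v: "v \<in> carrier \<Sigma>" for v
    using T_coact_eval[OF t br[OF p v] w] t w v by (simp add: br_eval[OF p v])
   then show ?thesis using t w left_linear_closed[OF h] \<kappa>c by (intro conjI bexI[of _ "\<kappa> (h (t w))"]) simp_all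
  qed
  have "generate (add_monoid X) ?S = carrier X"
   using gen X by (simp add: left_generator_def)
  then have "\<iota> \<one>\<^sub>B \<in> generate (add_monoid X) ?S"
   using left_linear_closed[OF \<iota>, of "\<one>\<^sub>B"] by simp
  moreover have "x \<in> carrier X \<and> (\<exists>b\<in>carrier B. \<forall>v\<in>carrier \<Sigma>. t (\<kappa> x \<rightharpoonup>\<^sub>\<Sigma> v) = b \<rightharpoonup>\<^sub>\<Sigma> v)"
   if "x \<in> generate (add_monoid X) ?S" for x
   using that
  proof (induction x rule: generate.induct)
   case one
   have z: "\<zero>\<^sub>B \<rightharpoonup>\<^sub>\<Sigma> v = \<zero>\<^sub>\<Sigma>" if "v \<in> carrier \<Sigma>" for v
    using that by (intro additive_zero[where f = "\<lambda>b. b \<rightharpoonup>\<^sub>\<Sigma> v"] additiveI BA.R.abelian_group_axioms BA.ab)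
     (simp_all add: BA.lact_closed BA.lact_add_left)
   have "\<kappa> \<zero>\<^sub>X = \<zero>\<^sub>B"
    using additive_zero[OF left_linear_additive[OF \<kappa>] X.ab RB.ab] by simp
   moreover have "t \<zero>\<^sub>\<Sigma> = \<zero>\<^sub>\<Sigma>" by (rule additive_zero[OF colinear_additive[OF T_colinear[OF t]] BA.ab BA.ab])
   ultimately show ?case using z by (auto intro!: bexI[of _ "\<zero>\<^sub>B"])
  next
   case (incl x)
   then show ?case using gen1 by (auto simp: left_Hom_def)
  next
   case (inv x)
   then obtain h w where h: "left_linear B \<Sigma> X h" and w: "w \<in> carrier \<Sigma>" and x: "x = h w" by (auto simp: left_Hom_def)
   have "inv\<^bsub>add_monoid X\<^esub> x = h (\<ominus>\<^sub>\<Sigma> w)"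
    using additive_minus[OF left_linear_additive[OF h] BA.ab X.ab w] by (simp add: x a_inv_def)
   then show ?case using gen1[OF h, of "\<ominus>\<^sub>\<Sigma> w"] w by simp
  next
   case (eng x y)
   then obtain a b where ab: "a \<in> carrier B" "b \<in> carrier B"
    "\<And>v. v \<in> carrier \<Sigma> ==> t (\<kappa> x \<rightharpoonup>\<^sub>\<Sigma> v) = a \<rightharpoonup>\<^sub>\<Sigma> v" "\<And>v. v \<in> carrier \<Sigma> ==> t (\<kappa> y \<rightharpoonup>\<^sub>\<Sigma> v) = b \<rightharpoonup>\<^sub>\<Sigma> v" by blast
   have xy: "x \<in> carrier X" "y \<in> carrier X" using eng by simp_all
   have "t (\<kappa> (x \<oplus>\<^sub>X y) \<rightharpoonup>\<^sub>\<Sigma> v) = (a \<oplus>\<^sub>B b) \<rightharpoonup>\<^sub>\<Sigma> v" if v: "v \<in> carrier \<Sigma>" for v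
    using ab xy v t by (simp add: left_linear_add[OF \<kappa>, simplified] BA.lact_add_left \<kappa>c T_add BA.lact_closed)
   then show ?case using ab(1,2) xy by (auto intro!: bexI[of _ "a \<oplus>\<^sub>B b"])
  qed
  ultimately obtain b where "b \<in> carrier B" "\<And>v. v \<in> carrier \<Sigma> ==> t (\<kappa> (\<iota> \<one>\<^sub>B) \<rightharpoonup>\<^sub>\<Sigma> v) = b \<rightharpoonup>\<^sub>\<Sigma> v" by blast
  then show ?thesis by (intro bexI[of _ b]) (simp_all add: \<kappa>\<iota> BA.lact_one)
 qed
 obtain n :: nat and w p where w: "\<And>i. i < n ==> w i \<in> carrier \<Sigma>"
  and p: "\<And>i. i < n ==> left_linear B \<Sigma> (regular B) (p i)"
  and sum: "\<And>u. u \<in> carrier \<Sigma> ==> u = (\<Oplus>\<^sub>\<Sigma> i\<in>{..<n}. p i u \<rightharpoonup>\<^sub>\<Sigma> w i)"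
  by (rule left_fgp_dual_basis[OF BA.left_module_axioms fgpB]) (rule that)
 define qq where "qq p = (\<lambda>c\<in>carrier C. \<lambda>u\<in>carrier \<Sigma>. br p u c)" for p
 have ev_qq: "ev (qq p) u = br p u" if "left_linear B \<Sigma> (regular B) p" "u \<in> carrier \<Sigma>" for p u
  using br[OF that] that by (intro extensionalityI[of _ "carrier C"]) (simp_all add: qq_def C.Cs_mem_iff)
 have qQ: "qq p \<in> Q" if p: "left_linear B \<Sigma> (regular B) p" for p
 proof -
  interpret Cs: ring Cs by (rule C.ring_Cs)
  note pc = left_linear_closed[OF p, simplified]
  have add: "br p (u \<oplus>\<^sub>\<Sigma> v) = br p u \<oplus>\<^sub>Cs br p v" if "u \<in> carrier \<Sigma>" "v \<in> carrier \<Sigma>" for u v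
   using that p by (intro faithful) (simp_all add: coact_eval_add_right br_eval BA.lact_add_right pc)
  have ract: "br p (u \<leftharpoonup>\<^sub>\<Sigma> a) = (\<lambda>c\<in>carrier C. br p u c \<otimes>\<^sub>A a)" if "u \<in> carrier \<Sigma>" "a \<in> carrier A" for u a
   using that p by (intro faithful coact_eval_ract(1))
    (simp_all add: coact_eval_ract(2) br_eval BA.lact_ract pc BA.ract_closed)
  have act: "br p (coact_eval \<Sigma> \<rho> u g) = br p u \<otimes>\<^sub>Cs g" if "u \<in> carrier \<Sigma>" "g \<in> carrier Cs" for u g
   using that p by (intro faithful)
    (simp_all add: coact_eval_mult[symmetric] br_eval coact_eval_lact pc coact_eval_closed)
  show ?thesis
  proof (rule QI)
   show qD: "qq p c \<in> carrier D" if c: "c \<in> carrier C" for c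
    using c p by (intro DI) (simp_all add: qq_def add ract C.Cs_add_apply BA.ract_closed)
   fix c u assume c: "c \<in> carrier C" and u: "u \<in> carrier \<Sigma>"
   show "slice C \<rho> (qq p c) u = hit C c (ev (qq p) u)"
    unfolding ev_qq[OF p u]
   proof (rule Cs_separates)
    fix g assume g: "g \<in> carrier Cs"
    have "g (slice C \<rho> (qq p c) u) = qq p c (coact_eval \<Sigma> \<rho> u g)" by (rule Cs_slice[OF g qD[OF c] u])
    also have "\<dots> = (br p u \<otimes>\<^sub>Cs g) c" using c u g by (simp add: qq_def coact_eval_closed act)
    finally show "g (slice C \<rho> (qq p c) u) = g (hit C c (br p u))" using c by (simp add: C.Cs_mult_apply)
   qed (use c u p qD in \<open>simp_all add: C.hit_closed\<close>)
  qed (use p in \<open>simp_all add: qq_def C.Cs_add C.Cs_lact C.lact_closed\<close>)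
 qed
 let ?G = "tensor B QB \<Sigma>"
 let ?X = "\<Oplus>\<^bsub>?G\<^esub>i\<in>{..<n}. tens B QB \<Sigma> (qq (p i)) (w i)"
 interpret Cs: ring Cs by (rule C.ring_Cs)
 have Xi: "tens B QB \<Sigma> (qq (p i)) (w i) \<in> carrier ?G" if "i < n" for i
  using that qQ[OF p] w by (simp add: QB_simps(1))
 have "tlift Cs ev ?X = (\<Oplus>\<^sub>Cs i\<in>{..<n}. tlift Cs ev (tens B QB \<Sigma> (qq (p i)) (w i)))"
  using Xi by (intro additive_finsum[OF QBS.additive_tlift[OF C.abelian_group_Cs balanced_ev] QBS.ab C.abelian_group_Cs]) auto
 also have "\<dots> = (\<Oplus>\<^sub>Cs i\<in>{..<n}. br (p i) (w i))"
  using p w qQ by (intro Cs.finsum_cong') (auto simp: QB_simps(1) balanced_ev C.abelian_group_Cs ev_qq simp del: restrict_apply)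
 also have "\<dots> = \<one>\<^sub>Cs"
 proof (rule faithful)
  show "(\<Oplus>\<^sub>Cs i\<in>{..<n}. br (p i) (w i)) \<in> carrier Cs" using p w by (intro Cs.finsum_closed) auto
  fix u assume u: "u \<in> carrier \<Sigma>"
  have ad: "additive Cs \<Sigma> (\<lambda>g. coact_eval \<Sigma> \<rho> u g)" using u by (intro additiveI) (simp_all add: coact_eval_closed coact_eval_add_right)
  have "coact_eval \<Sigma> \<rho> u (\<Oplus>\<^sub>Cs i\<in>{..<n}. br (p i) (w i)) = (\<Oplus>\<^sub>\<Sigma> i\<in>{..<n}. coact_eval \<Sigma> \<rho> u (br (p i) (w i)))"
   using p w by (intro additive_finsum[OF ad C.abelian_group_Cs BA.ab]) auto
  also have "\<dots> = (\<Oplus>\<^sub>\<Sigma> i\<in>{..<n}. p i u \<rightharpoonup>\<^sub>\<Sigma> w i)"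
   using p w u left_linear_closed[OF p] by (intro BA.M.finsum_cong') (auto simp: br_eval BA.lact_closed)
  also have "\<dots> = coact_eval \<Sigma> \<rho> u \<one>\<^sub>Cs" using sum[OF u] u by (simp add: coact_eval_one)
  finally show "coact_eval \<Sigma> \<rho> u (\<Oplus>\<^sub>Cs i\<in>{..<n}. br (p i) (w i)) = coact_eval \<Sigma> \<rho> u \<one>\<^sub>Cs" .
 qed simp
 finally have X1: "tlift Cs ev ?X = \<one>\<^sub>Cs" .
 show ?thesis
  unfolding trace_unital_def
 proof (intro conjI ballI Tl)
  show "\<exists>X\<in>carrier ?G. tlift Cs ev X = \<one>\<^sub>Cs"
   by (rule bexI[where x = ?X]) (rule X1, rule QBS.T.finsum_closed, use Xi in auto)
 qed
qed

end

section \<open>Exact sequences on arbitrary carriers\<close>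

definition additive_iso :: "('g, 'z1) ring_scheme => ('h, 'z2) ring_scheme => ('g => 'h) => ('h => 'g) => bool"
 where "additive_iso G H \<alpha> \<beta> \<longleftrightarrow> additive G H \<alpha> \<and> additive H G \<beta> \<and>
  (\<forall>x\<in>carrier G. \<beta> (\<alpha> x) = x) \<and> (\<forall>y\<in>carrier H. \<alpha> (\<beta> y) = y)"

lemma additive_iso_sym: "additive_iso G H \<alpha> \<beta> ==> additive_iso H G \<beta> \<alpha>" by (simp add: additive_iso_def)

lemma exact_transport:
 assumes \<alpha>: "additive_iso X X' \<alpha> \<alpha>'" and \<beta>: "additive_iso Y Y' \<beta> \<beta>'" and \<gamma>: "additive_iso Z Z' \<gamma> \<gamma>'"
  and Z: "abelian_group Z" "abelian_group Z'"
  and fg: "additive X Y f" "additive Y Z g"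
  and f': "\<And>x. x \<in> carrier X' ==> f' x = \<beta> (f (\<alpha>' x))" and g': "\<And>y. y \<in> carrier Y' ==> g' y = \<gamma> (g (\<beta>' y))"
  and ex: "exact X Y Z f g"
 shows "exact X' Y' Z' f' g'"
proof -
 have cl: "\<And>x. x \<in> carrier X ==> \<alpha> x \<in> carrier X'" "\<And>x. x \<in> carrier X' ==> \<alpha>' x \<in> carrier X"
  "\<And>y. y \<in> carrier Y ==> \<beta> y \<in> carrier Y'" "\<And>y. y \<in> carrier Y' ==> \<beta>' y \<in> carrier Y"
  and inv: "\<And>x. x \<in> carrier X ==> \<alpha>' (\<alpha> x) = x" "\<And>y. y \<in> carrier Y ==> \<beta>' (\<beta> y) = y"
  "\<And>y. y \<in> carrier Y' ==> \<beta> (\<beta>' y) = y" "\<And>z. z \<in> carrier Z ==> \<gamma>' (\<gamma> z) = z"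
  using \<alpha> \<beta> \<gamma> unfolding additive_iso_def by (meson additive_closed)+
 have z: "\<gamma> \<zero>\<^sub>Z = \<zero>\<^sub>Z'" using \<gamma> additive_zero[of Z Z' \<gamma>] Z by (simp add: additive_iso_def)
 have \<gamma>0: "\<gamma> c = \<zero>\<^sub>Z' \<longleftrightarrow> c = \<zero>\<^sub>Z" if "c \<in> carrier Z" for c
  using inv(4)[OF that] inv(4)[OF abelian_group.axioms(1)[OF Z(1), THEN abelian_monoid.zero_closed]] z by metis
 note fc = additive_closed[OF fg(1)] and gc = additive_closed[OF fg(2)]
 have E: "(\<exists>x\<in>carrier X. y = f x) \<longleftrightarrow> g y = \<zero>\<^sub>Z" if "y \<in> carrier Y" for y
  using ex that unfolding exact_def by blast
 have "y \<in> f' ` carrier X' \<longleftrightarrow> g' y = \<zero>\<^sub>Z'" if y: "y \<in> carrier Y'" for y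
 proof -
  have "y \<in> f' ` carrier X' \<longleftrightarrow> (\<exists>x\<in>carrier X. \<beta>' y = f x)"
  proof
   assume "y \<in> f' ` carrier X'"
   then obtain x where x: "x \<in> carrier X'" "y = f' x" by blast
   then have "\<beta>' y = f (\<alpha>' x)" by (simp add: f' inv fc cl)
   then show "\<exists>x\<in>carrier X. \<beta>' y = f x" using cl(2)[OF x(1)] by blast
  next
   assume "\<exists>x\<in>carrier X. \<beta>' y = f x"
   then obtain x where x: "x \<in> carrier X" "\<beta>' y = f x" by blast
   then have "y = f' (\<alpha> x)" using inv(3)[OF y] by (simp add: f' cl inv)
   then show "y \<in> f' ` carrier X'" using cl(1)[OF x(1)] by blast
  qed
  also have "\<dots> \<longleftrightarrow> g' y = \<zero>\<^sub>Z'" using E[OF cl(4)[OF y]] by (simp add: g' y \<gamma>0 gc cl)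
  finally show ?thesis .
 qed
 moreover have "f' ` carrier X' \<subseteq> carrier Y'" by (auto simp: f' cl fc)
 ultimately show ?thesis unfolding exact_def by blast
qed

lemma exact_iso:
 assumes "additive_iso X X' \<alpha> \<alpha>'" "additive_iso Y Y' \<beta> \<beta>'" "additive_iso Z Z' \<gamma> \<gamma>'"
  and "abelian_group Z" "abelian_group Z'" and "additive X Y f" "additive Y Z g" "additive X' Y' f'" "additive Y' Z' g'"
  and f': "\<And>x. x \<in> carrier X' ==> f' x = \<beta> (f (\<alpha>' x))" and g': "\<And>y. y \<in> carrier Y' ==> g' y = \<gamma> (g (\<beta>' y))"
 shows "exact X Y Z f g \<longleftrightarrow> exact X' Y' Z' f' g'"
proof
 show "exact X Y Z f g" if "exact X' Y' Z' f' g'"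
 proof (rule exact_transport[OF assms(1-3)[THEN additive_iso_sym] assms(5,4,8,9) _ _ that])
  have *: "\<alpha>' (\<alpha> x) = x" "\<alpha> x \<in> carrier X'" if "x \<in> carrier X" for x
   using assms(1) that additive_closed unfolding additive_iso_def by metis+
  have **: "\<beta>' (\<beta> x) = x" "\<beta> x \<in> carrier Y'" if "x \<in> carrier Y" for x
   using assms(2) that additive_closed unfolding additive_iso_def by metis+
  have ***: "\<gamma>' (\<gamma> x) = x" if "x \<in> carrier Z" for x
   using assms(3) that unfolding additive_iso_def by metis
  show "f x = \<beta>' (f' (\<alpha> x))" if "x \<in> carrier X" for x
   using that by (simp add: f' * ** additive_closed[OF assms(6)])
  show "g x = \<gamma>' (g' (\<beta> x))" if "x \<in> carrier Y" for x
   using that by (simp add: g' ** *** additive_closed[OF assms(7)])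
 qed
qed (rule exact_transport[OF assms(1-7) f' g'])

lemma additive_iso_tmap:
 assumes X: "tensor_pair B X S" and X': "tensor_pair B X' S"
  and \<iota>: "right_linear B X X' \<iota>" and \<kappa>: "right_linear B X' X \<kappa>"
  and inv: "\<And>x. x \<in> carrier X ==> \<kappa> (\<iota> x) = x" "\<And>x. x \<in> carrier X' ==> \<iota> (\<kappa> x) = x"
 shows "additive_iso X X' \<iota> \<kappa>"
  and "additive_iso (tensor B X S) (tensor B X' S) (tmap B X' S \<iota> (\<lambda>u. u)) (tmap B X S \<kappa> (\<lambda>u. u))"
proof -
 interpret X: tensor_pair B X S by fact
 interpret X': tensor_pair B X' S by fact
 show "additive_iso X X' \<iota> \<kappa>" using inv \<iota> \<kappa> by (simp add: additive_iso_def right_linear_additive)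
 have ad: "additive (tensor B X S) (tensor B X' S) (tmap B X' S \<iota> (\<lambda>u. u))"
  "additive (tensor B X' S) (tensor B X S) (tmap B X S \<kappa> (\<lambda>u. u))"
  by (rule X'.additive_tmap[OF X \<iota> left_id], rule X.additive_tmap[OF X' \<kappa> left_id])
 note t = X'.tmap_tens[OF X \<iota> left_id] X.tmap_tens[OF X' \<kappa> left_id]
 show "additive_iso (tensor B X S) (tensor B X' S) (tmap B X' S \<iota> (\<lambda>u. u)) (tmap B X S \<kappa> (\<lambda>u. u))"
  unfolding additive_iso_def
 proof (intro conjI ad ballI)
  show "tmap B X S \<kappa> (\<lambda>u. u) (tmap B X' S \<iota> (\<lambda>u. u) x) = x" if "x \<in> carrier (tensor B X S)" for x
   by (rule X.tensor_eqI[OF X.ab additive_comp[OF ad(1) ad(2)] additive_id _ that])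
    (simp add: t inv right_linear_closed[OF \<iota>])
  show "tmap B X' S \<iota> (\<lambda>u. u) (tmap B X S \<kappa> (\<lambda>u. u) x) = x" if "x \<in> carrier (tensor B X' S)" for x
   by (rule X'.tensor_eqI[OF X'.ab additive_comp[OF ad(2) ad(1)] additive_id _ that])
    (simp add: t inv right_linear_closed[OF \<kappa>])
 qed
qed

text \<open>
 Being relative to a universe is harmless: faithful flatness decides exactness of all sequences of
 modules whose underlying sets inject into the universe.
\<close>

lemma faithfully_flat_exact:
 fixes X :: "('l1, 'b, 'x, 'z1) bimod_scheme" and Y :: "('l2, 'b, 'y, 'z2) bimod_scheme" and Z :: "('l3, 'b, 'z, 'z3) bimod_scheme"
 assumes ff: "faithfully_flat TYPE('u) B S"
  and X: "right_module B X" "carrier X \<lesssim> (UNIV :: 'u set)" and Y: "right_module B Y" "carrier Y \<lesssim> (UNIV :: 'u set)"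
  and Z: "right_module B Z" "carrier Z \<lesssim> (UNIV :: 'u set)"
  and f: "right_linear B X Y f" and g: "right_linear B Y Z g"
 shows "exact X Y Z f g \<longleftrightarrow> exact (tensor B X S) (tensor B Y S) (tensor B Z S) (tmap B Y S f (\<lambda>u. u)) (tmap B Z S g (\<lambda>u. u))"
proof -
 have S: "left_module B S" using ff by (simp add: faithfully_flat_def)
 obtain X' :: "(unit, 'b, 'u) bimod" and i i' where X': "right_module B X'" "right_linear B X X' i" "right_linear B X' X i'"
  "\<And>m. m \<in> carrier X ==> i' (i m) = m" "\<And>m. m \<in> carrier X' ==> i (i' m) = m"
  by (rule right_copy_exists[OF X]) (rule that)
 obtain Y' :: "(unit, 'b, 'u) bimod" and j j' where Y': "right_module B Y'" "right_linear B Y Y' j" "right_linear B Y' Y j'"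
  "\<And>m. m \<in> carrier Y ==> j' (j m) = m" "\<And>m. m \<in> carrier Y' ==> j (j' m) = m"
  by (rule right_copy_exists[OF Y]) (rule that)
 obtain Z' :: "(unit, 'b, 'u) bimod" and k k' where Z': "right_module B Z'" "right_linear B Z Z' k" "right_linear B Z' Z k'"
  "\<And>m. m \<in> carrier Z ==> k' (k m) = m" "\<And>m. m \<in> carrier Z' ==> k (k' m) = m"
  by (rule right_copy_exists[OF Z]) (rule that)
 have tp: "tensor_pair B X S" "tensor_pair B Y S" "tensor_pair B Z S" "tensor_pair B X' S" "tensor_pair B Y' S" "tensor_pair B Z' S"
  by (intro tensor_pair.intro X Y Z X'(1) Y'(1) Z'(1) S)+
 interpret TX: tensor_pair B X S by fact
 interpret TY: tensor_pair B Y S by fact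
 interpret TZ: tensor_pair B Z S by fact
 interpret TX': tensor_pair B X' S by fact
 interpret TY': tensor_pair B Y' S by fact
 interpret TZ': tensor_pair B Z' S by fact
 define f' where "f' x = j (f (i' x))" for x
 define g' where "g' y = k (g (j' y))" for y
 have f': "right_linear B X' Y' f'" unfolding f'_def[abs_def] by (rule right_linear_comp[OF right_linear_comp[OF X'(3) f] Y'(2)])
 have g': "right_linear B Y' Z' g'" unfolding g'_def[abs_def] by (rule right_linear_comp[OF right_linear_comp[OF Y'(3) g] Z'(2)])
 note iso = additive_iso_tmap[OF tp(1,4) X'(2-5)] additive_iso_tmap[OF tp(2,5) Y'(2-5)] additive_iso_tmap[OF tp(3,6) Z'(2-5)]
 note ad = TY.additive_tmap[OF tp(1) f left_id] TZ.additive_tmap[OF tp(2) g left_id]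
  TY'.additive_tmap[OF tp(4) f' left_id] TZ'.additive_tmap[OF tp(5) g' left_id]
 have "exact X Y Z f g \<longleftrightarrow> exact X' Y' Z' f' g'" by (rule exact_iso[OF iso(1) iso(3) iso(5) TZ.M.ab TZ'.M.ab
     f[THEN right_linear_additive] g[THEN right_linear_additive] f'[THEN right_linear_additive] g'[THEN right_linear_additive]])
   (simp_all add: f'_def g'_def)
 also have "\<dots> \<longleftrightarrow> exact (tensor B X' S) (tensor B Y' S) (tensor B Z' S) (tmap B Y' S f' (\<lambda>u. u)) (tmap B Z' S g' (\<lambda>u. u))"
  using ff X'(1) Y'(1) Z'(1) f' g' unfolding faithfully_flat_def by meson
 also have "\<dots> \<longleftrightarrow> exact (tensor B X S) (tensor B Y S) (tensor B Z S) (tmap B Y S f (\<lambda>u. u)) (tmap B Z S g (\<lambda>u. u))"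
 proof (rule exact_iso[OF iso(2) iso(4) iso(6) TZ.ab TZ'.ab ad, symmetric])
  fix x assume x: "x \<in> carrier (tensor B X' S)"
  note a = additive_comp[OF additive_comp[OF TX.additive_tmap[OF tp(4) X'(3) left_id] ad(1)] TY'.additive_tmap[OF tp(2) Y'(2) left_id]]
  show "tmap B Y' S f' (\<lambda>u. u) x = tmap B Y' S j (\<lambda>u. u) (tmap B Y S f (\<lambda>u. u) (tmap B X S i' (\<lambda>u. u) x))"
   by (rule TX'.tensor_eqI[OF TY'.ab ad(3) a _ x])
    (simp add: TY'.tmap_tens[OF tp(4) f' left_id] TX.tmap_tens[OF tp(4) X'(3) left_id] TY.tmap_tens[OF tp(1) f left_id]
     TY'.tmap_tens[OF tp(2) Y'(2) left_id] right_linear_closed[OF X'(3)] right_linear_closed[OF f] f'_def)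
 next
  fix x assume x: "x \<in> carrier (tensor B Y' S)"
  note a = additive_comp[OF additive_comp[OF TY.additive_tmap[OF tp(5) Y'(3) left_id] ad(2)] TZ'.additive_tmap[OF tp(3) Z'(2) left_id]]
  show "tmap B Z' S g' (\<lambda>u. u) x = tmap B Z' S k (\<lambda>u. u) (tmap B Z S g (\<lambda>u. u) (tmap B Y S j' (\<lambda>u. u) x))"
   by (rule TY'.tensor_eqI[OF TZ'.ab ad(4) a _ x])
    (simp add: TZ'.tmap_tens[OF tp(5) g' left_id] TY.tmap_tens[OF tp(5) Y'(3) left_id] TZ.tmap_tens[OF tp(2) g left_id]
     TZ'.tmap_tens[OF tp(3) Z'(2) left_id] right_linear_closed[OF Y'(3)] right_linear_closed[OF g] g'_def)
 qed
 finally show ?thesis .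
qed

lemma (in tensor_pair) tmap_zero:
 assumes X: "tensor_pair A M' N" and x: "x \<in> carrier (tensor A M' N)"
 shows "right_linear A M' M (\<lambda>m. \<zero>\<^sub>M)" and "tmap A M N (\<lambda>m. \<zero>\<^sub>M) (\<lambda>n. n) x = \<zero>\<^bsub>tensor A M N\<^esub>"
proof -
 interpret X: tensor_pair A M' N by fact
 have "\<zero>\<^sub>M \<leftharpoonup>\<^sub>M a = \<zero>\<^sub>M" if "a \<in> carrier A" for a
  using that by (intro additive_zero[where f = "\<lambda>m. m \<leftharpoonup>\<^sub>M a"] additiveI M.ab) (simp_all add: M.ract_closed M.ract_add_left)
 then show rl: "right_linear A M' M (\<lambda>m. \<zero>\<^sub>M)" by (intro right_linearI additiveI) simp_all
 have "tens A M N \<zero>\<^sub>M n = \<zero>\<^bsub>tensor A M N\<^esub>" if "n \<in> carrier N" for n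
  by (rule additive_zero[OF balanced_additive1[OF tens_balanced that] M.ab ab])
 then show "tmap A M N (\<lambda>m. \<zero>\<^sub>M) (\<lambda>n. n) x = \<zero>\<^bsub>tensor A M N\<^esub>"
  by - (rule X.tensor_eqI[OF ab additive_tmap[OF X rl left_id] additiveI _ x];
   simp add: tmap_tens[OF X rl left_id])
qed

section \<open>The Galois condition with faithful flatness\<close>

context fgp_bicomodule
begin

definition RH :: "('l, 'a, 'm, 'z) bimod_scheme => (unit, 'b, 's => 'm) bimod"
 where "RH N = \<lparr>carrier = right_Hom A \<Sigma> N, mult = undefined, one = undefined,
  zero = pointwise_zero (carrier \<Sigma>) N, add = pointwise_add (carrier \<Sigma>) N,
  lact = undefined, ract = (\<lambda>h b. \<lambda>u\<in>carrier \<Sigma>. h (b \<rightharpoonup>\<^sub>\<Sigma> u))\<rparr>"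

lemma RH_simps:
 "carrier (RH N) = {h \<in> extensional (carrier \<Sigma>). right_linear A \<Sigma> N h}"
 "zero (RH N) = pointwise_zero (carrier \<Sigma>) N" "add (RH N) = pointwise_add (carrier \<Sigma>) N"
 "ract (RH N) = (\<lambda>h b. \<lambda>u\<in>carrier \<Sigma>. h (b \<rightharpoonup>\<^sub>\<Sigma> u))" by (simp_all add: RH_def right_Hom_def)

lemma RH_linear: "h \<in> carrier (RH N) ==> right_linear A \<Sigma> N h" by (simp add: RH_simps)

lemmas RH_closed = right_linear_closed[OF RH_linear]

lemma RH_ext: "h \<in> carrier (RH N) ==> h' \<in> carrier (RH N) ==> (\<And>u. u \<in> carrier \<Sigma> ==> h u = h' u) ==> h = h'"
 by (rule extensionalityI[of _ "carrier \<Sigma>"]) (simp_all add: RH_simps)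

lemma RH_I: "right_linear A \<Sigma> N h ==> (\<lambda>u\<in>carrier \<Sigma>. h u) \<in> carrier (RH N)"
 using right_linear_cong[OF BA.right_module_axioms, of N h "restrict h (carrier \<Sigma>)"] by (simp add: RH_simps)

lemma right_module_RH:
 assumes N: "right_module A N"
 shows "right_module B (RH N)"
proof -
 interpret N: right_module A N by fact
 note cl = RH_closed and ad = right_linear_add[OF RH_linear] and ra = right_linear_ract[OF RH_linear]
 have neg: "\<ominus>\<^sub>N n \<leftharpoonup>\<^sub>N a = \<ominus>\<^sub>N (n \<leftharpoonup>\<^sub>N a)" if "n \<in> carrier N" "a \<in> carrier A" for n a
  using that by (intro additive_minus[where f = "\<lambda>n. n \<leftharpoonup>\<^sub>N a"] additiveI N.ab)
   (simp_all add: N.ract_closed N.ract_add_left)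
 have z: "\<zero>\<^sub>N \<leftharpoonup>\<^sub>N a = \<zero>\<^sub>N" if "a \<in> carrier A" for a
  using that by (intro additive_zero[where f = "\<lambda>n. n \<leftharpoonup>\<^sub>N a"] additiveI N.ab)
   (simp_all add: N.ract_closed N.ract_add_left)
 have "abelian_group (RH N)"
 proof (rule abelian_group_pointwise[where X = "carrier \<Sigma>" and G = N, OF N.ab])
  show "pointwise_zero (carrier \<Sigma>) N \<in> carrier (RH N)"
   unfolding pointwise_zero_def by (intro RH_I right_linearI additiveI) (simp_all add: z)
  show "pointwise_add (carrier \<Sigma>) N f g \<in> carrier (RH N)" if "f \<in> carrier (RH N)" "g \<in> carrier (RH N)" for f g
   unfolding pointwise_add_def using that
   by (intro RH_I right_linearI additiveI) (simp_all add: cl ad ra N.ract_add_left N.M.a_ac)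
  show "(\<lambda>x\<in>carrier \<Sigma>. \<ominus>\<^sub>N f x) \<in> carrier (RH N)" if "f \<in> carrier (RH N)" for f
   using that by (intro RH_I right_linearI additiveI) (simp_all add: cl ad ra neg N.M.minus_add)
  show "f x \<in> carrier N" if "f \<in> carrier (RH N)" "x \<in> carrier \<Sigma>" for f x by (rule cl[OF that])
 qed (simp_all add: RH_simps)
 then show ?thesis
 proof (rule right_module_maps[where M = N])
  fix h b assume *: "h \<in> carrier (RH N)" "b \<in> carrier B"
  then show "h \<leftharpoonup>\<^bsub>RH N\<^esub> b \<in> carrier (RH N)"
   unfolding RH_simps(4)
   by (intro RH_I right_linearI additiveI) (simp_all add: cl ad ra BA.lact_closed BA.lact_add_right BA.lact_ract[symmetric])
 qed (simp_all add: RH_simps right_linear_additive[of A])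
qed

lemma tensor_pair_RH: "right_module A N ==> tensor_pair B (RH N) \<Sigma>"
 by (intro tensor_pair.intro right_module_RH BA.left_module_axioms)

lemma linear_maps_lepoll:
 assumes inf: "infinite (UNIV :: 'u set)" and N: "right_module A N" and size: "carrier N \<lesssim> (UNIV :: 'u set)"
  and H: "H \<subseteq> carrier (RH N)"
 shows "H \<lesssim> (UNIV :: 'u set)"
proof (rule lepoll_finitely_determined[OF inf size, where n = dim and k = "\<lambda>h i. h (e i)"])
 interpret N: right_module A N by fact
 show "h (e i) \<in> carrier N" if "h \<in> H" "i < dim" for h i using that H RH_closed e_closed by blast
 fix h h' assume hh: "h \<in> H" "h' \<in> H" and eq: "\<And>i. i < dim ==> h (e i) = h' (e i)"
 then have *: "h \<in> carrier (RH N)" "h' \<in> carrier (RH N)" using H by blast+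
 show "h = h'"
 proof (rule RH_ext[OF *])
  fix u assume u: "u \<in> carrier \<Sigma>"
  have "(\<Oplus>\<^sub>N i\<in>{..<dim}. h (e i) \<leftharpoonup>\<^sub>N \<phi> i u) = (\<Oplus>\<^sub>N i\<in>{..<dim}. h' (e i) \<leftharpoonup>\<^sub>N \<phi> i u)"
   using * u by (intro N.M.finsum_cong') (auto simp: eq N.ract_closed RH_closed e_closed \<phi>_closed)
  then show "h u = h' u" using right_linear_expand[OF N RH_linear[OF *(1)] u] right_linear_expand[OF N RH_linear[OF *(2)] u] by simp
 qed
qed

end

locale galois_bicomodule = fgp_bicomodule A B C \<Sigma> \<rho>
 for A :: "('a, 'y1) ring_scheme" and B :: "('b, 'y2) ring_scheme"
  and C :: "('a, 'c, 'z1) coring_scheme"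
  and \<Sigma> :: "('b, 'a, 's, 'z2) bimod_scheme" and \<rho> :: "'s => ('s \<times> 'c \<Rightarrow>\<^sub>0 int) set" +
 assumes can: "bimod_iso A A (tensor B D \<Sigma>) C (tlift C (slice C \<rho>))"
begin

lemma tensor_pair_D_Sigma: "tensor_pair B D \<Sigma>" by (intro tensor_pair.intro DB.right_module_axioms BA.left_module_axioms)

sublocale DS: tensor_pair B D \<Sigma> by (rule tensor_pair_D_Sigma)

lemma can_tens: "f \<in> carrier D ==> u \<in> carrier \<Sigma> ==> tlift C (slice C \<rho>) (tens B D \<Sigma> f u) = slice C \<rho> f u"
 by (intro DS.tlift_tens[OF C.ab] balancedI) (simp_all add: slice_add slice_add_left slice_lact_ring)

lemma can_bij: "bij_betw (tlift C (slice C \<rho>)) (carrier (tensor B D \<Sigma>)) (carrier C)"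
 and can_left_linear: "left_linear A (tensor B D \<Sigma>) C (tlift C (slice C \<rho>))"
 using can by (simp_all add: bimod_iso_def bimod_map_def)

definition "can_inv = inv_into (carrier (tensor B D \<Sigma>)) (tlift C (slice C \<rho>))"

lemma can_can_inv [simp]: "c \<in> carrier C ==> tlift C (slice C \<rho>) (can_inv c) = c"
 unfolding can_inv_def by (rule bij_betw_inv_into_right[OF can_bij])

lemma can_inv_closed [simp]: "c \<in> carrier C ==> can_inv c \<in> carrier (tensor B D \<Sigma>)"
 unfolding can_inv_def by (rule bij_betw_apply[OF bij_betw_inv_into[OF can_bij]])

lemma can_inv_eqI: "X \<in> carrier (tensor B D \<Sigma>) ==> tlift C (slice C \<rho>) X = c ==> can_inv c = X"
 unfolding can_inv_def using bij_betw_inv_into_left[OF can_bij] by blast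

lemma can_inv_slice [simp]: "f \<in> carrier D ==> u \<in> carrier \<Sigma> ==> can_inv (slice C \<rho> f u) = tens B D \<Sigma> f u"
 by (intro can_inv_eqI) (simp_all add: can_tens)

lemma additive_can_inv: "additive C (tensor B D \<Sigma>) can_inv"
 by (intro additiveI can_inv_eqI) (simp_all add: left_linear_add[OF can_left_linear])

lemma can_inv_lact: "a \<in> carrier A ==> c \<in> carrier C ==> can_inv (a \<rightharpoonup>\<^sub>C c) = a \<rightharpoonup>\<^bsub>tensor B D \<Sigma>\<^esub> can_inv c"
 using left_linear_lact[OF can_left_linear, of "can_inv c" a] additive_closed[OF DS.additive_lact[OF DB.bimodule_axioms]]
 by (intro can_inv_eqI) simp_all

text \<open>
 Surjectivity of the canonical map, in the form in which it is used.
\<close>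

lemma additive_slice_eq:
 assumes G: "abelian_group G" and F: "additive C G F" "additive C G F'"
  and eq: "\<And>f u. f \<in> carrier D ==> u \<in> carrier \<Sigma> ==> F (slice C \<rho> f u) = F' (slice C \<rho> f u)" and c: "c \<in> carrier C"
 shows "F c = F' c"
proof -
 note ca = left_linear_additive[OF can_left_linear]
 have "F (tlift C (slice C \<rho>) (can_inv c)) = F' (tlift C (slice C \<rho>) (can_inv c))"
  by (rule DS.tensor_eqI[OF G additive_comp[OF ca F(1)] additive_comp[OF ca F(2)] _ can_inv_closed[OF c]])
   (simp add: can_tens eq)
 then show ?thesis using c by simp
qed

definition rank1 :: "('l, 'a, 'm, 'z) bimod_scheme => 'm => ('s => 'a) => 's => 'm"
 where "rank1 N n f = (\<lambda>u\<in>carrier \<Sigma>. n \<leftharpoonup>\<^sub>N f u)"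

text \<open>
 The inverse of the isomorphism \<open>Hom\<^sub>A(\<Sigma>, N) \<otimes>\<^sub>B \<Sigma> \<rightarrow> N \<otimes>\<^sub>A C\<close>, \<open>h \<otimes> u \<mapsto> h(u\<^sub>[\<^sub>0\<^sub>]) \<otimes> u\<^sub>[\<^sub>1\<^sub>]\<close>, which is obtained
 from the canonical map by tensoring with \<open>N\<close>.
\<close>

definition K :: "('l, 'a, 'm, 'z) bimod_scheme => 'm => 'c => (('s => 'm) \<times> 's \<Rightarrow>\<^sub>0 int) set"
 where "K N n c = tlift (tensor B (RH N) \<Sigma>) (\<lambda>f w. tens B (RH N) \<Sigma> (rank1 N n f) w) (can_inv c)"

lemma rank1_closed: "right_module A N ==> n \<in> carrier N ==> f \<in> carrier D ==> rank1 N n f \<in> carrier (RH N)"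
 unfolding rank1_def by (intro RH_I right_linearI additiveI)
  (simp_all add: right_module.ract_closed right_module.ract_add_right right_module.ract_mult D_add D_ract)

lemma balanced_rank1:
 assumes N: "right_module A N" and n: "n \<in> carrier N"
 shows "balanced B D \<Sigma> (tensor B (RH N) \<Sigma>) (\<lambda>f w. tens B (RH N) \<Sigma> (rank1 N n f) w)"
proof -
 interpret N: right_module A N by fact
 interpret P: tensor_pair B "RH N" \<Sigma> by (rule tensor_pair_RH[OF N])
 note rc = rank1_closed[OF N n]
 have 1: "rank1 N n (f \<oplus>\<^sub>D g) = rank1 N n f \<oplus>\<^bsub>RH N\<^esub> rank1 N n g" if "f \<in> carrier D" "g \<in> carrier D" for f g
  using that n by (intro RH_ext[where N = N] rc P.M.M.a_closed) (simp_all add: rank1_def RH_simps(3) pointwise_add_def D_apply N.ract_add_right)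
 have 2: "rank1 N n (f \<leftharpoonup>\<^sub>D b) = rank1 N n f \<leftharpoonup>\<^bsub>RH N\<^esub> b" if "f \<in> carrier D" "b \<in> carrier B" for f b
  using that n by (intro RH_ext[where N = N] rc P.M.ract_closed D_ract_closed) (simp_all add: rank1_def RH_simps(4) D_apply BA.lact_closed)
 show ?thesis by (rule balancedI) (simp_all add: 1 2 rc P.tens_add1 P.tens_add2 P.tens_middle)
qed

lemma K_closed: "right_module A N ==> n \<in> carrier N ==> c \<in> carrier C ==> K N n c \<in> carrier (tensor B (RH N) \<Sigma>)"
 unfolding K_def by (intro DS.tlift_closed balanced_rank1 tensor_pair.ab tensor_pair_RH can_inv_closed)

lemma K_slice:
 "right_module A N ==> n \<in> carrier N ==> f \<in> carrier D ==> u \<in> carrier \<Sigma> ==>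
  K N n (slice C \<rho> f u) = tens B (RH N) \<Sigma> (rank1 N n f) u"
 unfolding K_def by (simp add: balanced_rank1 tensor_pair.ab[OF tensor_pair_RH])

lemma additive_K: "right_module A N ==> n \<in> carrier N ==> additive C (tensor B (RH N) \<Sigma>) (K N n)"
 unfolding K_def
 by (rule additive_comp[OF additive_can_inv DS.additive_tlift[OF tensor_pair.ab[OF tensor_pair_RH] balanced_rank1]])

lemma balanced_K:
 assumes N: "right_module A N"
 shows "balanced A N C (tensor B (RH N) \<Sigma>) (K N)"
proof -
 interpret N: right_module A N by fact
 interpret P: tensor_pair B "RH N" \<Sigma> by (rule tensor_pair_RH[OF N])
 let ?G = "tensor B (RH N) \<Sigma>"
 note rc = rank1_closed[OF N] and G = P.ab
 have 1: "rank1 N (n \<oplus>\<^sub>N n') f = rank1 N n f \<oplus>\<^bsub>RH N\<^esub> rank1 N n' f" if "f \<in> carrier D" "n \<in> carrier N" "n' \<in> carrier N" for f n n'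
  using that by (intro RH_ext[where N = N] rc P.M.M.a_closed) (simp_all add: rank1_def RH_simps(3) pointwise_add_def N.ract_add_left)
 have 2: "rank1 N n (a \<rightharpoonup>\<^sub>D f) = rank1 N (n \<leftharpoonup>\<^sub>N a) f" if "f \<in> carrier D" "n \<in> carrier N" "a \<in> carrier A" for f n a
  using that by (intro RH_ext[where N = N] rc D_lact_closed N.ract_closed) (simp_all add: rank1_def D_apply N.ract_mult)
 show ?thesis
 proof (rule balancedI)
  fix m m' c assume *: "m \<in> carrier N" "m' \<in> carrier N" "c \<in> carrier C"
  have "K N (m \<oplus>\<^sub>N m') c = tlift ?G (\<lambda>f w. tens B (RH N) \<Sigma> (rank1 N m f) w \<oplus>\<^bsub>?G\<^esub> tens B (RH N) \<Sigma> (rank1 N m' f) w) (can_inv c)"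
   unfolding K_def using * by (intro DS.tlift_cong[OF G balanced_rank1[OF N]]) (simp_all add: 1 rc P.tens_add1)
  then show "K N (m \<oplus>\<^sub>N m') c = K N m c \<oplus>\<^bsub>?G\<^esub> K N m' c"
   using * by (simp add: K_def DS.tlift_add_fun[OF G] balanced_rank1[OF N])
 next
  fix n a c assume *: "n \<in> carrier N" "a \<in> carrier A" "c \<in> carrier C"
  have "K N n (a \<rightharpoonup>\<^sub>C c) = tlift (tensor B (RH N) \<Sigma>) (\<lambda>f w. tens B (RH N) \<Sigma> (rank1 N n (a \<rightharpoonup>\<^sub>D f)) w) (can_inv c)"
   unfolding K_def can_inv_lact[OF *(2,3)]
   by (rule DS.tlift_lact[OF DB.bimodule_axioms *(2) G balanced_rank1[OF N *(1)] can_inv_closed[OF *(3)]])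
  also have "\<dots> = K N (n \<leftharpoonup>\<^sub>N a) c"
   unfolding K_def using * by (intro DS.tlift_cong[symmetric] G balanced_rank1[OF N] N.ract_closed) (simp_all add: 2)
  finally show "K N (n \<leftharpoonup>\<^sub>N a) c = K N n (a \<rightharpoonup>\<^sub>C c)" by simp
 qed (simp_all add: K_closed N additive_add[OF additive_K[OF N]])
qed

text \<open>
 \<open>K\<close> is inverse to \<open>h \<otimes> u \<mapsto> h(u\<^sub>[\<^sub>0\<^sub>]) \<otimes> u\<^sub>[\<^sub>1\<^sub>]\<close>.  By a dual basis of \<open>\<Sigma>\<close> it suffices to consider \<open>h = n f(-)\<close>, for which the image
 is \<open>n \<otimes> f(u\<^sub>[\<^sub>0\<^sub>]) u\<^sub>[\<^sub>1\<^sub>]\<close>.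
\<close>

lemma tlift_K_coact:
 assumes N: "right_module A N" and h: "h \<in> carrier (RH N)" and u: "u \<in> carrier \<Sigma>"
 shows "tlift (tensor B (RH N) \<Sigma>) (\<lambda>v c. K N (h v) c) (\<rho> u) = tens B (RH N) \<Sigma> h u"
  and "balanced A \<Sigma> C (tensor B (RH N) \<Sigma>) (\<lambda>v c. K N (h v) c)"
proof -
 interpret N: right_module A N by fact
 interpret P: tensor_pair B "RH N" \<Sigma> by (rule tensor_pair_RH[OF N])
 let ?G = "tensor B (RH N) \<Sigma>"
 note G = P.ab and bK = balancedD[OF balanced_K[OF N]]
 note hl = right_linear_closed[OF RH_linear[OF h]] right_linear_add[OF RH_linear[OF h]] right_linear_ract[OF RH_linear[OF h]]
 show b: "balanced A \<Sigma> C ?G (\<lambda>v c. K N (h v) c)" by (rule balancedI) (simp_all add: bK hl)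
 have he: "h (e i) \<in> carrier N" if "i < dim" for i using that by (simp add: hl e_closed)
 have ad: "additive (tensor A \<Sigma> C) ?G (\<lambda>X. \<Oplus>\<^bsub>?G\<^esub>i\<in>{..<dim}. K N (h (e i)) (tlift C (\<lambda>v c. \<phi> i v \<rightharpoonup>\<^sub>C c) X))"
  by (rule additive_finsum_fun[OF G])
   (auto intro!: additive_comp[OF MC.additive_tlift[OF C.ab balanced_slice] additive_K[OF N]] simp: \<phi>_closed he)
 have "tlift ?G (\<lambda>v c. K N (h v) c) (\<rho> u) = (\<Oplus>\<^bsub>?G\<^esub>i\<in>{..<dim}. K N (h (e i)) (tlift C (\<lambda>v c. \<phi> i v \<rightharpoonup>\<^sub>C c) (\<rho> u)))"
 proof (rule MC.tensor_eqI[OF G MC.additive_tlift[OF G b] ad _ coact_closed[OF u]])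
  fix v c assume v: "v \<in> carrier \<Sigma>" and c: "c \<in> carrier C"
  have "K N (h v) c = K N (\<Oplus>\<^sub>N i\<in>{..<dim}. h (e i) \<leftharpoonup>\<^sub>N \<phi> i v) c"
   using right_linear_expand[OF N RH_linear[OF h] v] by simp
  also have "\<dots> = (\<Oplus>\<^bsub>?G\<^esub>i\<in>{..<dim}. K N (h (e i) \<leftharpoonup>\<^sub>N \<phi> i v) c)"
   using v he by (intro additive_finsum[OF balanced_additive1[OF balanced_K[OF N] c] N.ab G])
    (auto simp: N.ract_closed \<phi>_closed)
  also have "\<dots> = (\<Oplus>\<^bsub>?G\<^esub>i\<in>{..<dim}. K N (h (e i)) (tlift C (\<lambda>v c. \<phi> i v \<rightharpoonup>\<^sub>C c) (tens A \<Sigma> C v c)))"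
   using v c he by (intro P.T.finsum_cong')
    (auto simp: bK \<phi>_closed C.ab balanced_slice C.lact_closed N.ract_closed K_closed[OF N])
  finally show "tlift ?G (\<lambda>v c. K N (h v) c) (tens A \<Sigma> C v c)
   = (\<Oplus>\<^bsub>?G\<^esub>i\<in>{..<dim}. K N (h (e i)) (tlift C (\<lambda>v c. \<phi> i v \<rightharpoonup>\<^sub>C c) (tens A \<Sigma> C v c)))"
   using v c by (simp add: b G)
 qed
 also have "\<dots> = (\<Oplus>\<^bsub>?G\<^esub>i\<in>{..<dim}. tens B (RH N) \<Sigma> (rank1 N (h (e i)) (\<phi> i)) u)"
  using u he by (intro P.T.finsum_cong') (auto simp: slice_def[symmetric] K_slice[OF N] \<phi>_closed rank1_closed[OF N])
 also have "\<dots> = tens B (RH N) \<Sigma> (\<Oplus>\<^bsub>RH N\<^esub>i\<in>{..<dim}. rank1 N (h (e i)) (\<phi> i)) u"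
  using u he by (intro additive_finsum[OF balanced_additive1[OF P.tens_balanced] P.M.ab G, symmetric])
   (auto simp: rank1_closed[OF N] \<phi>_closed)
 also have "(\<Oplus>\<^bsub>RH N\<^esub>i\<in>{..<dim}. rank1 N (h (e i)) (\<phi> i)) = h"
 proof (rule RH_ext[OF _ h])
  show "(\<Oplus>\<^bsub>RH N\<^esub>i\<in>{..<dim}. rank1 N (h (e i)) (\<phi> i)) \<in> carrier (RH N)"
   using he by (intro P.M.M.finsum_closed) (auto simp: rank1_closed[OF N] \<phi>_closed)
  fix v assume v: "v \<in> carrier \<Sigma>"
  have "additive (RH N) N (\<lambda>h. h v)" using v by (intro additiveI) (simp_all add: RH_closed RH_simps(3) pointwise_add_def)
  then have "(\<Oplus>\<^bsub>RH N\<^esub>i\<in>{..<dim}. rank1 N (h (e i)) (\<phi> i)) v = (\<Oplus>\<^sub>N i\<in>{..<dim}. rank1 N (h (e i)) (\<phi> i) v)"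
   using he by (intro additive_finsum[where f = "\<lambda>h. h v"] P.M.ab N.ab) (auto simp: rank1_closed[OF N] \<phi>_closed)
  then show "(\<Oplus>\<^bsub>RH N\<^esub>i\<in>{..<dim}. rank1 N (h (e i)) (\<phi> i)) v = h v"
   using v right_linear_expand[OF N RH_linear[OF h] v] by (simp add: rank1_def)
 qed
 finally show "tlift ?G (\<lambda>v c. K N (h v) c) (\<rho> u) = tens B (RH N) \<Sigma> h u" .
qed

end

context galois_bicomodule
begin

context
 fixes M :: "('l, 'a, 'm, 'z3) bimod_scheme" and \<mu> :: "'m => ('m \<times> 'c \<Rightarrow>\<^sub>0 int) set"
 assumes M: "right_comodule A C M \<mu>"
begin

interpretation M: right_comodule A C M \<mu> by (rule M)

abbreviation (input) "N \<equiv> tensor A M C"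
abbreviation (input) "H \<equiv> comod_Hom_mod A C \<Sigma> \<rho> M \<mu>"
abbreviation (input) "RM \<equiv> tensor B (RH M) \<Sigma>"
abbreviation (input) "RN \<equiv> tensor B (RH N) \<Sigma>"

text \<open>The two maps \<open>Hom\<^sub>A(\<Sigma>, M) \<rightarrow> Hom\<^sub>A(\<Sigma>, M \<otimes> C)\<close> whose equalizer consists of the comodule maps.\<close>

definition "g1 h = (\<lambda>u\<in>carrier \<Sigma>. tmap A M C h (\<lambda>c. c) (\<rho> u))"
definition "g2 h = (\<lambda>u\<in>carrier \<Sigma>. \<mu> (h u))"
definition "gd h = (\<lambda>u\<in>carrier \<Sigma>. g1 h u \<ominus>\<^sub>N g2 h u)"

lemma right_module_N: "right_module A N" by (rule C.right_module_tensor_coring[OF M.M.right_module_axioms])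

interpretation PM: tensor_pair B "RH M" \<Sigma> by (rule tensor_pair_RH[OF M.M.right_module_axioms])
interpretation PN: tensor_pair B "RH N" \<Sigma> by (rule tensor_pair_RH[OF right_module_N])
interpretation PH: tensor_pair B H \<Sigma> by (rule tensor_pair_comod_Hom[OF M])

lemma tmap_coact_linear:
 assumes h: "h \<in> carrier (RH M)"
 shows "right_linear A \<Sigma> N (\<lambda>u. tmap A M C h (\<lambda>c. c) (\<rho> u))"
proof -
 note hl = RH_linear[OF h]
 note ad = M.MC.additive_tmap[OF MC.tensor_pair_axioms hl left_id]
 have b: "balanced A \<Sigma> C N (\<lambda>v c. tens A M C (h v) c)" by (rule M.MC.balanced_tmap[OF MC.tensor_pair_axioms hl left_id])
 show ?thesis
 proof (rule right_linearI[OF additive_comp[OF right_linear_additive[OF coact_linear] ad]])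
  fix u a assume u: "u \<in> carrier \<Sigma>" and a: "a \<in> carrier A"
  note adr = M.MC.additive_ract[OF C.bimodule_axioms a]
  have "tmap A M C h (\<lambda>c. c) (\<rho> (u \<leftharpoonup>\<^sub>\<Sigma> a)) = tlift N (\<lambda>v c. tens A M C (h v) (c \<leftharpoonup>\<^sub>C a)) (\<rho> u)"
   unfolding tmap_def right_linear_ract[OF coact_linear u a]
   by (rule MC.tlift_ract[OF C.bimodule_axioms a M.MC.ab b coact_closed[OF u]])
  also have "\<dots> = tlift N (\<lambda>v c. tens A M C (h v) c \<leftharpoonup>\<^sub>N a) (\<rho> u)"
   using u a by (intro MC.tlift_cong[symmetric] M.MC.ab balanced_comp[OF b adr])
    (simp_all add: M.MC.ract_tens[OF C.bimodule_axioms] RH_closed[OF h])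
  also have "\<dots> = tmap A M C h (\<lambda>c. c) (\<rho> u) \<leftharpoonup>\<^sub>N a"
   unfolding tmap_def by (rule MC.tlift_comp[OF M.MC.ab M.MC.ab b adr coact_closed[OF u], symmetric])
  finally show "tmap A M C h (\<lambda>c. c) (\<rho> (u \<leftharpoonup>\<^sub>\<Sigma> a)) = tmap A M C h (\<lambda>c. c) (\<rho> u) \<leftharpoonup>\<^sub>N a" .
 qed
qed

lemma g1_closed: "h \<in> carrier (RH M) ==> g1 h \<in> carrier (RH N)"
 unfolding g1_def by (rule RH_I[OF tmap_coact_linear])

lemma g2_closed: "h \<in> carrier (RH M) ==> g2 h \<in> carrier (RH N)"
 unfolding g2_def by (rule RH_I[OF right_linear_comp[OF RH_linear M.coact_linear]])

lemma g1_linear: "right_linear B (RH M) (RH N) g1"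
proof (rule right_linearI[OF additiveI[OF g1_closed]])
 fix h h' assume h: "h \<in> carrier (RH M)" "h' \<in> carrier (RH M)"
 have hh: "h \<oplus>\<^bsub>RH M\<^esub> h' \<in> carrier (RH M)" by (rule PM.M.M.a_closed[OF h])
 note T = M.MC.tmap_tens[OF MC.tensor_pair_axioms RH_linear left_id]
  and ad = M.MC.additive_tmap[OF MC.tensor_pair_axioms RH_linear left_id]
 have "tmap A M C (h \<oplus>\<^bsub>RH M\<^esub> h') (\<lambda>c. c) X = tmap A M C h (\<lambda>c. c) X \<oplus>\<^sub>N tmap A M C h' (\<lambda>c. c) X"
  if "X \<in> carrier (tensor A \<Sigma> C)" for X
 proof (rule MC.tensor_eqI[OF M.MC.ab ad[OF hh] additive_add_fun[OF M.MC.ab ad[OF h(1)] ad[OF h(2)]] _ that])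
  fix u c assume *: "u \<in> carrier \<Sigma>" "c \<in> carrier C"
  then have "(h \<oplus>\<^bsub>RH M\<^esub> h') u = h u \<oplus>\<^sub>M h' u" by (simp add: RH_simps(3) pointwise_add_def)
  then show "tmap A M C (h \<oplus>\<^bsub>RH M\<^esub> h') (\<lambda>c. c) (tens A \<Sigma> C u c) = tmap A M C h (\<lambda>c. c) (tens A \<Sigma> C u c) \<oplus>\<^sub>N tmap A M C h' (\<lambda>c. c) (tens A \<Sigma> C u c)"
   using * h hh by (simp add: T RH_closed M.MC.tens_add1)
 qed
 then show "g1 (h \<oplus>\<^bsub>RH M\<^esub> h') = g1 h \<oplus>\<^bsub>RH N\<^esub> g1 h'"
  using h hh by (intro RH_ext[where N = N] g1_closed PN.M.M.a_closed) (simp_all add: g1_def RH_simps(3) pointwise_add_def)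
next
 fix h b assume h: "h \<in> carrier (RH M)" and b: "b \<in> carrier B"
 note hb = PM.M.ract_closed[OF h b]
 note bh = M.MC.balanced_tmap[OF MC.tensor_pair_axioms RH_linear[OF h] left_id]
 have "tmap A M C h (\<lambda>c. c) (\<rho> (b \<rightharpoonup>\<^sub>\<Sigma> u)) = tmap A M C (h \<leftharpoonup>\<^bsub>RH M\<^esub> b) (\<lambda>c. c) (\<rho> u)" if u: "u \<in> carrier \<Sigma>" for u
 proof -
  have "tmap A M C h (\<lambda>c. c) (\<rho> (b \<rightharpoonup>\<^sub>\<Sigma> u)) = tlift N (\<lambda>v c. tens A M C (h (b \<rightharpoonup>\<^sub>\<Sigma> v)) c) (\<rho> u)"
   unfolding tmap_def left_linear_lact[OF coact_left u b]
   by (rule MC.tlift_lact[OF BA.bimodule_axioms b M.MC.ab bh coact_closed[OF u]])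
  also have "\<dots> = tmap A M C (h \<leftharpoonup>\<^bsub>RH M\<^esub> b) (\<lambda>c. c) (\<rho> u)"
   unfolding tmap_def using u b
   by (intro MC.tlift_cong[symmetric] M.MC.ab M.MC.balanced_tmap[OF MC.tensor_pair_axioms RH_linear[OF hb] left_id])
    (simp_all add: RH_simps(4))
  finally show ?thesis .
 qed
 then show "g1 (h \<leftharpoonup>\<^bsub>RH M\<^esub> b) = g1 h \<leftharpoonup>\<^bsub>RH N\<^esub> b"
  using h b hb by (intro RH_ext[where N = N] g1_closed PN.M.ract_closed)
   (simp_all add: g1_def RH_simps(4)[of N] BA.lact_closed)
qed

lemma g2_linear: "right_linear B (RH M) (RH N) g2"
proof (rule right_linearI[OF additiveI[OF g2_closed]])
 fix h h' assume h: "h \<in> carrier (RH M)" "h' \<in> carrier (RH M)"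
 then show "g2 (h \<oplus>\<^bsub>RH M\<^esub> h') = g2 h \<oplus>\<^bsub>RH N\<^esub> g2 h'"
  by (intro RH_ext[where N = N] g2_closed PN.M.M.a_closed PM.M.M.a_closed)
   (simp_all add: g2_def RH_simps(3) pointwise_add_def RH_closed right_linear_add[OF M.coact_linear])
next
 fix h b assume "h \<in> carrier (RH M)" "b \<in> carrier B"
 then show "g2 (h \<leftharpoonup>\<^bsub>RH M\<^esub> b) = g2 h \<leftharpoonup>\<^bsub>RH N\<^esub> b"
  by (intro RH_ext[where N = N] g2_closed PN.M.ract_closed PM.M.ract_closed) (simp_all add: g2_def RH_simps(4) BA.lact_closed)
qed

lemma gd_eq: "h \<in> carrier (RH M) ==> gd h = g1 h \<ominus>\<^bsub>RH N\<^esub> g2 h" and gd_closed: "h \<in> carrier (RH M) ==> gd h \<in> carrier (RH N)"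
proof -
 assume h: "h \<in> carrier (RH M)"
 note g = g1_closed[OF h] g2_closed[OF h]
 have n: "(\<ominus>\<^bsub>RH N\<^esub> k) u = \<ominus>\<^sub>N k u" if "k \<in> carrier (RH N)" "u \<in> carrier \<Sigma>" for k u
  using that by (intro additive_minus[where f = "\<lambda>k. k u"] additiveI PN.M.ab M.MC.ab)
   (simp_all add: RH_closed RH_simps(3) pointwise_add_def)
 have c: "g1 h \<ominus>\<^bsub>RH N\<^esub> g2 h \<in> carrier (RH N)" by (rule PN.M.M.minus_closed[OF g])
 have "restrict (g1 h \<ominus>\<^bsub>RH N\<^esub> g2 h) (carrier \<Sigma>) = gd h"
  unfolding gd_def using g
  by (intro restrict_ext) (simp add: PN.M.M.minus_eq M.MC.T.minus_eq n[symmetric], simp add: RH_simps(3) pointwise_add_def)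
 then show eq: "gd h = g1 h \<ominus>\<^bsub>RH N\<^esub> g2 h"
  using c by (simp add: RH_simps(1) extensional_restrict)
 show "gd h \<in> carrier (RH N)" using c eq by simp
qed

lemma gd_add: "h \<in> carrier (RH M) ==> gd h \<oplus>\<^bsub>RH N\<^esub> g2 h = g1 h"
 by (simp add: gd_eq PN.M.M.minus_eq g1_closed g2_closed PN.M.M.a_assoc PN.M.M.l_neg)

lemma gd_linear: "right_linear B (RH M) (RH N) gd"
proof (rule right_linearI[OF additiveI[OF gd_closed]])
 note c = PM.M.M.a_closed PM.M.ract_closed gd_closed g2_closed PN.M.M.a_closed PN.M.ract_closed
 fix h h' assume h: "h \<in> carrier (RH M)" "h' \<in> carrier (RH M)"
 have "gd (h \<oplus>\<^bsub>RH M\<^esub> h') \<oplus>\<^bsub>RH N\<^esub> g2 (h \<oplus>\<^bsub>RH M\<^esub> h') = g1 h \<oplus>\<^bsub>RH N\<^esub> g1 h'"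
  using h by (simp add: gd_add c right_linear_add[OF g1_linear])
 also have "\<dots> = (gd h \<oplus>\<^bsub>RH N\<^esub> gd h') \<oplus>\<^bsub>RH N\<^esub> g2 (h \<oplus>\<^bsub>RH M\<^esub> h')"
  using h by (simp add: gd_add[symmetric] c right_linear_add[OF g2_linear] PN.M.M.a_ac)
 finally have "gd (h \<oplus>\<^bsub>RH M\<^esub> h') \<oplus>\<^bsub>RH N\<^esub> g2 (h \<oplus>\<^bsub>RH M\<^esub> h')
  = (gd h \<oplus>\<^bsub>RH N\<^esub> gd h') \<oplus>\<^bsub>RH N\<^esub> g2 (h \<oplus>\<^bsub>RH M\<^esub> h')" .
 then show "gd (h \<oplus>\<^bsub>RH M\<^esub> h') = gd h \<oplus>\<^bsub>RH N\<^esub> gd h'" using h by (simp add: c)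
next
 note c = PM.M.ract_closed gd_closed g2_closed PN.M.ract_closed
 fix h b assume h: "h \<in> carrier (RH M)" and b: "b \<in> carrier B"
 have "gd (h \<leftharpoonup>\<^bsub>RH M\<^esub> b) \<oplus>\<^bsub>RH N\<^esub> g2 (h \<leftharpoonup>\<^bsub>RH M\<^esub> b) = g1 (h \<leftharpoonup>\<^bsub>RH M\<^esub> b)" using h b by (simp add: gd_add c)
 also have "\<dots> = gd h \<leftharpoonup>\<^bsub>RH N\<^esub> b \<oplus>\<^bsub>RH N\<^esub> g2 (h \<leftharpoonup>\<^bsub>RH M\<^esub> b)"
  using h b by (simp add: right_linear_ract[OF g1_linear] right_linear_ract[OF g2_linear] PN.M.ract_add_left[symmetric] c gd_add)
 finally show "gd (h \<leftharpoonup>\<^bsub>RH M\<^esub> b) = gd h \<leftharpoonup>\<^bsub>RH N\<^esub> b" using h b by (simp add: c)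
qed

lemma gd_zero_iff:
 assumes h: "h \<in> carrier (RH M)"
 shows "gd h = \<zero>\<^bsub>RH N\<^esub> \<longleftrightarrow> h \<in> carrier H"
proof -
 have "gd h = \<zero>\<^bsub>RH N\<^esub> \<longleftrightarrow> g1 h = g2 h"
  using g1_closed[OF h] g2_closed[OF h] by (simp add: gd_eq[OF h] PN.M.M.minus_eq PN.M.M.add.inv_solve_right' PN.M.M.r_neg)
 also have "\<dots> \<longleftrightarrow> (\<forall>u\<in>carrier \<Sigma>. \<mu> (h u) = tmap A M C h (\<lambda>c. c) (\<rho> u))"
  unfolding g1_def g2_def by (auto simp: restrict_def fun_eq_iff)
 also have "\<dots> \<longleftrightarrow> h \<in> carrier H" using h by (simp add: comod_Hom_mod_simps RH_simps comod_Hom_def right_Hom_def)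
 finally show ?thesis .
qed

lemma H_subset: "carrier H \<subseteq> carrier (RH M)" by (auto simp: comod_Hom_mod_simps RH_simps comod_Hom_def right_Hom_def)

lemma H_incl: "right_linear B H (RH M) (\<lambda>h. h)"
 by (intro right_linearI additiveI) (use H_subset in \<open>auto simp: comod_Hom_mod_simps(3,4) RH_simps(3,4)\<close>)

lemma tmap_g1_K:
 assumes n: "n \<in> carrier M" and d: "d \<in> carrier C"
 shows "tmap B (RH N) \<Sigma> g1 (\<lambda>u. u) (K M n d) = tlift RN (\<lambda>c. K N (tens A M C n c)) (comult C d)"
proof -
 have b: "balanced A C C RN (\<lambda>c. K N (tens A M C n c))"
  using n by (intro balancedI) (simp_all add: balancedD[OF balanced_K[OF right_module_N]] M.MC.tens_add2
   M.MC.ract_tens[OF C.bimodule_axioms, symmetric])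
 note Mm = M.M.right_module_axioms
 show ?thesis
 proof (rule additive_slice_eq[OF PN.ab
    additive_comp[OF additive_K[OF Mm n] PN.additive_tmap[OF PM.tensor_pair_axioms g1_linear left_id]]
    additive_comp[OF right_linear_additive[OF C.comult_right_linear] C.CC.additive_tlift[OF PN.ab b]] _ d])
  fix f u assume f: "f \<in> carrier D" and u: "u \<in> carrier \<Sigma>"
  have r: "rank1 M n f \<in> carrier (RH M)" by (rule rank1_closed[OF Mm n f])
  have g: "g1 (rank1 M n f) v = tens A M C n (slice C \<rho> f v)" if v: "v \<in> carrier \<Sigma>" for v
  proof -
   have "tens A M C n (slice C \<rho> f v) = tlift N (\<lambda>w c. tens A M C n (f w \<rightharpoonup>\<^sub>C c)) (\<rho> v)"
    unfolding slice_def by (rule MC.tlift_comp[OF C.ab M.MC.ab balanced_slice[OF f]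
       balanced_additive2[OF M.MC.tens_balanced n] coact_closed[OF v]])
   also have "\<dots> = g1 (rank1 M n f) v"
    unfolding g1_def tmap_def restrict_apply if_P[OF v] using n f v
    by (intro MC.tlift_cong M.MC.ab balanced_comp[OF balanced_slice[OF f] balanced_additive2[OF M.MC.tens_balanced n]])
     (simp_all add: rank1_def M.MC.tens_middle)
   finally show ?thesis by simp
  qed
  have "tlift RN (\<lambda>c. K N (tens A M C n c)) (comult C (slice C \<rho> f u))
    = tlift RN (\<lambda>v. K N (tens A M C n (slice C \<rho> f v))) (\<rho> u)" by (rule tlift_comult_slice(1)[OF f u PN.ab b])
  also have "\<dots> = tlift RN (\<lambda>v c. K N (g1 (rank1 M n f) v) c) (\<rho> u)"
   using u by (intro MC.tlift_cong[OF PN.ab tlift_comult_slice(2)[OF f u PN.ab b]]) (simp_all add: g)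
  also have "\<dots> = tens B (RH N) \<Sigma> (g1 (rank1 M n f)) u" by (rule tlift_K_coact(1)[OF right_module_N g1_closed[OF r] u])
  finally show "tmap B (RH N) \<Sigma> g1 (\<lambda>u. u) (K M n (slice C \<rho> f u)) = tlift RN (\<lambda>c. K N (tens A M C n c)) (comult C (slice C \<rho> f u))"
   using u by (simp add: K_slice[OF Mm n f] PN.tmap_tens[OF PM.tensor_pair_axioms g1_linear left_id r])
 qed
qed

lemma tmap_g2_K:
 assumes n: "n \<in> carrier M" and d: "d \<in> carrier C"
 shows "tmap B (RH N) \<Sigma> g2 (\<lambda>u. u) (K M n d) = K N (\<mu> n) d"
proof -
 note Mm = M.M.right_module_axioms and mc = M.coact_closed[OF n]
 show ?thesis
 proof (rule additive_slice_eq[OF PN.ab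
    additive_comp[OF additive_K[OF Mm n] PN.additive_tmap[OF PM.tensor_pair_axioms g2_linear left_id]]
    additive_K[OF right_module_N mc] _ d])
  fix f u assume f: "f \<in> carrier D" and u: "u \<in> carrier \<Sigma>"
  have r: "rank1 M n f \<in> carrier (RH M)" by (rule rank1_closed[OF Mm n f])
  have "g2 (rank1 M n f) = rank1 N (\<mu> n) f"
   using n f unfolding g2_def rank1_def by (intro restrict_ext) (simp add: right_linear_ract[OF M.coact_linear])
  then show "tmap B (RH N) \<Sigma> g2 (\<lambda>u. u) (K M n (slice C \<rho> f u)) = K N (\<mu> n) (slice C \<rho> f u)"
   using u by (simp add: K_slice[OF Mm n f] K_slice[OF right_module_N mc f] PN.tmap_tens[OF PM.tensor_pair_axioms g2_linear left_id r])
 qed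
qed

text \<open>
 Under \<open>K\<close> the two maps correspond to \<open>M \<otimes> \<Delta>\<close> and \<open>\<mu> \<otimes> C\<close>, which agree on \<open>\<mu>(m)\<close> by coassociativity.
\<close>

lemma tmap_gd_kernel:
 assumes m: "m \<in> carrier M"
 shows "tlift RM (K M) (\<mu> m) \<in> carrier RM"
  and "tmap B (RH N) \<Sigma> gd (\<lambda>u. u) (tlift RM (K M) (\<mu> m)) = \<zero>\<^sub>RN"
proof -
 note Mm = M.M.right_module_axioms and GM = PM.ab and GN = PN.ab
 note bM = balanced_K[OF Mm] and bN = balanced_K[OF right_module_N]
 let ?w = "tlift RM (K M) (\<mu> m)"
 show w: "?w \<in> carrier RM" by (rule M.MC.tlift_closed[OF GM bM M.coact_closed[OF m]])
 note a1 = PN.additive_tmap[OF PM.tensor_pair_axioms g1_linear left_id]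
  and a2 = PN.additive_tmap[OF PM.tensor_pair_axioms g2_linear left_id]
  and ad = PN.additive_tmap[OF PM.tensor_pair_axioms gd_linear left_id]
 note t1 = PN.tmap_tens[OF PM.tensor_pair_axioms g1_linear left_id]
  and t2 = PN.tmap_tens[OF PM.tensor_pair_axioms g2_linear left_id]
  and td = PN.tmap_tens[OF PM.tensor_pair_axioms gd_linear left_id]
 have sum: "tmap B (RH N) \<Sigma> gd (\<lambda>u. u) ?w \<oplus>\<^sub>RN tmap B (RH N) \<Sigma> g2 (\<lambda>u. u) ?w = tmap B (RH N) \<Sigma> g1 (\<lambda>u. u) ?w"
  by (rule PM.tensor_eqI[OF GN additive_add_fun[OF GN ad a2] a1 _ w])
   (simp add: t1 t2 td PN.tens_add1[symmetric] gd_closed g2_closed gd_add)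
 have t: "trilinear A M C C RN (\<lambda>n c d. K N (tens A M C n c) d)"
  unfolding trilinear_def
 proof (intro conjI ballI)
  show "balanced A M C RN (\<lambda>n c. K N (tens A M C n c) p)" if "p \<in> carrier C" for p
   by (rule balanced_comp[OF M.MC.tens_balanced balanced_additive1[OF bN that]])
  show "balanced A C C RN (\<lambda>c. K N (tens A M C n c))" if "n \<in> carrier M" for n
   using that by (intro balancedI) (simp_all add: balancedD[OF bN] M.MC.tens_add2 M.MC.ract_tens[OF C.bimodule_axioms, symmetric])
 qed
 note ca = M.coassoc_tlift[OF GN t m]
 have "tmap B (RH N) \<Sigma> g1 (\<lambda>u. u) ?w = tlift RN (\<lambda>n d. tmap B (RH N) \<Sigma> g1 (\<lambda>u. u) (K M n d)) (\<mu> m)"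
  by (rule M.MC.tlift_comp[OF GM GN bM a1 M.coact_closed[OF m]])
 also have "\<dots> = tlift RN (\<lambda>n d. tlift RN (\<lambda>c. K N (tens A M C n c)) (comult C d)) (\<mu> m)"
  using m by (intro M.MC.tlift_cong[OF GN balanced_comp[OF bM a1]] tmap_g1_K) simp_all
 also have "\<dots> = tlift RN (\<lambda>n d. tlift RN (\<lambda>m c. K N (tens A M C m c) d) (\<mu> n)) (\<mu> m)" by (rule ca(1)[symmetric])
 also have "\<dots> = tlift RN (\<lambda>n d. tmap B (RH N) \<Sigma> g2 (\<lambda>u. u) (K M n d)) (\<mu> m)"
 proof (rule M.MC.tlift_cong[OF GN ca(2) _ M.coact_closed[OF m]])
  fix n d assume n: "n \<in> carrier M" and d: "d \<in> carrier C"
  show "tlift RN (\<lambda>m c. K N (tens A M C m c) d) (\<mu> n) = tmap B (RH N) \<Sigma> g2 (\<lambda>u. u) (K M n d)"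
   unfolding tmap_g2_K[OF n d]
   by (rule M.MC.additive_eq_tlift[OF GN balanced_additive1[OF bN d] M.coact_closed[OF n], symmetric])
 qed
 also have "\<dots> = tmap B (RH N) \<Sigma> g2 (\<lambda>u. u) ?w" by (rule M.MC.tlift_comp[OF GM GN bM a2 M.coact_closed[OF m], symmetric])
 finally have eq: "tmap B (RH N) \<Sigma> g1 (\<lambda>u. u) ?w = tmap B (RH N) \<Sigma> g2 (\<lambda>u. u) ?w" .
 show "tmap B (RH N) \<Sigma> gd (\<lambda>u. u) ?w = \<zero>\<^sub>RN"
  using sum eq additive_closed[OF ad w] additive_closed[OF a2 w] by (metis PN.T.add.r_cancel_one')
qed

lemma eval_K:
 assumes m: "m \<in> carrier M"
 shows "tlift M (\<lambda>h u. h u) (tlift RM (K M) (\<mu> m)) = m" and "balanced B (RH M) \<Sigma> M (\<lambda>h u. h u)"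
proof -
 note Mm = M.M.right_module_axioms and Mab = M.M.ab
 note bM = balanced_K[OF Mm] and mc = M.coact_closed[OF m]
 show be: "balanced B (RH M) \<Sigma> M (\<lambda>h u. h u)"
  by (rule balancedI) (simp_all add: RH_closed right_linear_add[OF RH_linear] RH_simps(3,4) pointwise_add_def)
 note ae = PM.additive_tlift[OF Mab be]
 have K1: "tlift M (\<lambda>h u. h u) (K M n d) = n \<leftharpoonup>\<^sub>M counit C d" if n: "n \<in> carrier M" and d: "d \<in> carrier C" for n d
 proof (rule additive_slice_eq[OF Mab additive_comp[OF additive_K[OF Mm n] ae] _ _ d])
  show "additive C M (\<lambda>d. n \<leftharpoonup>\<^sub>M counit C d)"
   using n by (intro additiveI) (simp_all add: M.M.ract_closed C.counit_simps M.M.ract_add_right)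
  show "tlift M (\<lambda>h u. h u) (K M n (slice C \<rho> f u)) = n \<leftharpoonup>\<^sub>M counit C (slice C \<rho> f u)" if "f \<in> carrier D" "u \<in> carrier \<Sigma>" for f u
   using that n by (simp add: K_slice[OF Mm n] rank1_closed[OF Mm n] be Mab counit_slice) (simp add: rank1_def)
 qed
 have "tlift M (\<lambda>h u. h u) (tlift RM (K M) (\<mu> m)) = tlift M (\<lambda>n d. tlift M (\<lambda>h u. h u) (K M n d)) (\<mu> m)"
  by (rule M.MC.tlift_comp[OF PM.ab Mab bM ae mc])
 also have "\<dots> = tlift M (\<lambda>n d. n \<leftharpoonup>\<^sub>M counit C d) (\<mu> m)" by (rule M.MC.tlift_cong[OF Mab balanced_comp[OF bM ae] K1 mc])
 finally show "tlift M (\<lambda>h u. h u) (tlift RM (K M) (\<mu> m)) = m" by (simp add: M.coact_counit m)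
qed

text \<open>
 Surjectivity of the counit.  By flatness, \<open>Hom\<^sup>C(\<Sigma>, M) \<otimes>\<^sub>B \<Sigma>\<close> is the kernel of the difference of the two maps, read as maps
 \<open>M \<otimes> C \<rightarrow> M \<otimes> C \<otimes> C\<close>.  This kernel contains \<open>\<mu>(m)\<close>, and the counit sends the corresponding tensor to \<open>m\<close>.
\<close>

lemma counit_descent:
 assumes ff: "faithfully_flat TYPE('u) B \<Sigma>" and inf: "infinite (UNIV :: 'u set)"
  and sC: "carrier C \<lesssim> (UNIV :: 'u set)" and sM: "carrier M \<lesssim> (UNIV :: 'u set)"
 shows "m \<in> carrier M ==> \<exists>X\<in>carrier (tensor B H \<Sigma>). tlift M (\<lambda>h u. h u) X = m"
  and "inj_on (tmap B (RH M) \<Sigma> (\<lambda>h. h) (\<lambda>u. u)) (carrier (tensor B H \<Sigma>))"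
proof -
 note Mm = M.M.right_module_axioms
 have sN: "carrier N \<lesssim> (UNIV :: 'u set)" by (rule M.MC.tensor_lepoll[OF inf sM sC])
 have sizes: "carrier H \<lesssim> (UNIV :: 'u set)" "carrier (RH M) \<lesssim> (UNIV :: 'u set)" "carrier (RH N) \<lesssim> (UNIV :: 'u set)"
  by (rule linear_maps_lepoll[OF inf Mm sM H_subset], rule linear_maps_lepoll[OF inf Mm sM subset_refl],
    rule linear_maps_lepoll[OF inf right_module_N sN subset_refl])
 note mods = PH.M.right_module_axioms sizes(1) PM.M.right_module_axioms sizes(2)
 have "exact H (RH M) (RH N) (\<lambda>h. h) gd"
  unfolding exact_def using H_subset gd_zero_iff by auto
 then have ex: "exact (tensor B H \<Sigma>) RM RN (tmap B (RH M) \<Sigma> (\<lambda>h. h) (\<lambda>u. u)) (tmap B (RH N) \<Sigma> gd (\<lambda>u. u))"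
  by (rule faithfully_flat_exact[OF ff mods PN.M.right_module_axioms sizes(3) H_incl gd_linear, THEN iffD1])
 show "\<exists>X\<in>carrier (tensor B H \<Sigma>). tlift M (\<lambda>h u. h u) X = m" if m: "m \<in> carrier M"
 proof -
  have "tlift RM (K M) (\<mu> m) \<in> tmap B (RH M) \<Sigma> (\<lambda>h. h) (\<lambda>u. u) ` carrier (tensor B H \<Sigma>)"
   using ex tmap_gd_kernel[OF m] unfolding exact_def by simp
  then obtain X where X: "X \<in> carrier (tensor B H \<Sigma>)" "tlift RM (K M) (\<mu> m) = tmap B (RH M) \<Sigma> (\<lambda>h. h) (\<lambda>u. u) X"
   by (rule imageE)
  have "tlift M (\<lambda>h u. h u) X = m"
   using PM.tlift_tmap[OF PH.tensor_pair_axioms H_incl left_id M.M.ab eval_K(2)[OF m] X(1)]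
    eval_K(1)[OF m] by (simp add: X(2))
  then show ?thesis using X(1) by blast
 qed
 note zl = PH.tmap_zero(1)[OF PH.tensor_pair_axioms PH.T.zero_closed]
 note zH = additive_zero[OF right_linear_additive[OF H_incl] PH.M.ab PM.M.ab]
 have "exact H H (RH M) (\<lambda>_. \<zero>\<^sub>H) (\<lambda>h. h)"
  unfolding exact_def using zH PH.M.M.zero_closed by (auto simp: image_constant_conv)
 then have ex0: "exact (tensor B H \<Sigma>) (tensor B H \<Sigma>) RM (tmap B H \<Sigma> (\<lambda>_. \<zero>\<^sub>H) (\<lambda>u. u)) (tmap B (RH M) \<Sigma> (\<lambda>h. h) (\<lambda>u. u))"
  by (rule faithfully_flat_exact[OF ff PH.M.right_module_axioms sizes(1) mods zl H_incl, THEN iffD1])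
 show "inj_on (tmap B (RH M) \<Sigma> (\<lambda>h. h) (\<lambda>u. u)) (carrier (tensor B H \<Sigma>))"
 proof (rule additive_inj_onI[OF PM.additive_tmap[OF PH.tensor_pair_axioms H_incl left_id] PH.ab PM.ab])
  fix X assume X: "X \<in> carrier (tensor B H \<Sigma>)" "tmap B (RH M) \<Sigma> (\<lambda>h. h) (\<lambda>u. u) X = \<zero>\<^sub>RM"
  then have "X \<in> tmap B H \<Sigma> (\<lambda>_. \<zero>\<^sub>H) (\<lambda>u. u) ` carrier (tensor B H \<Sigma>)" using ex0 by (simp add: exact_def)
  then show "X = \<zero>\<^bsub>tensor B H \<Sigma>\<^esub>" using PH.tmap_zero(2)[OF PH.tensor_pair_axioms] by auto
 qed
qed

end

end

text \<open>
 By faithful flatness it suffices that \<open>B \<otimes> \<Sigma> \<rightarrow> T \<otimes> \<Sigma>\<close> is surjective.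
\<close>

lemma (in galois_bicomodule) colinear_End_mult:
 assumes ff: "faithfully_flat TYPE('u) B \<Sigma>" and inf: "infinite (UNIV :: 'u set)"
  and sizes: "carrier B \<lesssim> (UNIV :: 'u set)" "carrier C \<lesssim> (UNIV :: 'u set)" "carrier \<Sigma> \<lesssim> (UNIV :: 'u set)"
  and t: "t \<in> carrier T"
 shows "\<exists>b\<in>carrier B. \<forall>u\<in>carrier \<Sigma>. t u = b \<rightharpoonup>\<^sub>\<Sigma> u"
proof -
 let ?H = "comod_Hom_mod A C \<Sigma> \<rho> \<Sigma> \<rho>"
 define l where "l b = (\<lambda>u\<in>carrier \<Sigma>. b \<rightharpoonup>\<^sub>\<Sigma> u)" for b
 interpret RB: bimodule B B "regular B" by (rule bimodule_regular[OF BA.R.ring_axioms])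
 interpret PB: tensor_pair B "regular B" \<Sigma> by (intro tensor_pair.intro RB.right_module_axioms BA.left_module_axioms)
 interpret PH: tensor_pair B ?H \<Sigma> by (rule tensor_pair_comod_Hom[OF right_comodule_axioms])
 interpret PR: tensor_pair B "RH \<Sigma>" \<Sigma> by (rule tensor_pair_RH[OF BA.right_module_axioms])
 note inc = H_incl[OF right_comodule_axioms] and sub = H_subset[OF right_comodule_axioms]
 have mem: "s \<in> carrier ?H \<longleftrightarrow> s \<in> carrier T" for s by (simp add: comod_Hom_mod_simps T_simps)
 have l: "l b \<in> carrier ?H" if "b \<in> carrier B" for b
  unfolding mem l_def by (rule TI[OF colinear_lact[OF that]])
 have ll: "right_linear B (regular B) ?H l" by (rule right_linearI[OF additiveI]; simp add: l)
   (auto simp: l_def comod_Hom_mod_simps(3,4) pointwise_add_def BA.lact_add_left BA.lact_mult BA.lact_closed intro!: restrict_ext)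
 note al = PH.additive_tmap[OF PB.tensor_pair_axioms ll left_id]
  and tl = PH.tmap_tens[OF PB.tensor_pair_axioms ll left_id]
 note z = PH.tmap_zero[OF PH.tensor_pair_axioms]
 have sH: "carrier ?H \<lesssim> (UNIV :: 'u set)" by (rule linear_maps_lepoll[OF inf BA.right_module_axioms sizes(3) sub])
 \<comment> \<open>\<open>s \<otimes> u = 1 \<otimes> s(u)\<close>, because both have the same image in \<open>Hom\<^sub>A(\<Sigma>, \<Sigma>) \<otimes> \<Sigma>\<close>\<close>
 have move: "tens B ?H \<Sigma> s u = tens B ?H \<Sigma> (l \<one>\<^sub>B) (s u)" if s: "s \<in> carrier ?H" and u: "u \<in> carrier \<Sigma>" for s u
 proof (rule inj_onD[OF counit_descent(2)[OF right_comodule_axioms ff inf sizes(2,3)]])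
  have sT: "s \<in> carrier T" using s by (simp add: mem)
  have o: "l \<one>\<^sub>B \<in> carrier ?H" by (rule l) simp
  note tt = PR.tmap_tens[OF PH.tensor_pair_axioms inc left_id]
   and KL = tlift_K_coact[OF BA.right_module_axioms]
  have "tens B (RH \<Sigma>) \<Sigma> s u = tlift (tensor B (RH \<Sigma>) \<Sigma>) (\<lambda>v c. K \<Sigma> (s v) c) (\<rho> u)"
   using sub s u by (intro KL(1)[symmetric]) auto
  also have "\<dots> = tlift (tensor B (RH \<Sigma>) \<Sigma>) (\<lambda>v c. K \<Sigma> v c) (\<rho> (s u))"
   by (rule tlift_colinear[OF BA.right_module_axioms T_colinear[OF sT] PR.ab balanced_K[OF BA.right_module_axioms] u, symmetric])
  also have "\<dots> = tlift (tensor B (RH \<Sigma>) \<Sigma>) (\<lambda>v c. K \<Sigma> (l \<one>\<^sub>B v) c) (\<rho> (s u))"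
   using sT u by (intro MC.tlift_cong[OF PR.ab balanced_K[OF BA.right_module_axioms]]) (simp_all add: l_def BA.lact_one)
  also have "\<dots> = tens B (RH \<Sigma>) \<Sigma> (l \<one>\<^sub>B) (s u)" by (rule KL(1)[OF subsetD[OF sub o] T_closed[OF sT u]])
  finally show "tmap B (RH \<Sigma>) \<Sigma> (\<lambda>h. h) (\<lambda>u. u) (tens B ?H \<Sigma> s u) = tmap B (RH \<Sigma>) \<Sigma> (\<lambda>h. h) (\<lambda>u. u) (tens B ?H \<Sigma> (l \<one>\<^sub>B) (s u))"
   unfolding tt[OF s u] tt[OF o T_closed[OF sT u]] .
  show "tens B ?H \<Sigma> s u \<in> carrier (tensor B ?H \<Sigma>)" "tens B ?H \<Sigma> (l \<one>\<^sub>B) (s u) \<in> carrier (tensor B ?H \<Sigma>)"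
   using s u o sT by simp_all
 qed
 have surj: "X \<in> tmap B ?H \<Sigma> l (\<lambda>u. u) ` carrier (tensor B (regular B) \<Sigma>)" if "X \<in> carrier (tensor B ?H \<Sigma>)" for X
  using that
 proof (induction X rule: PH.tensor_induct)
  case zero
  show ?case using additive_zero[OF al PB.ab PH.ab] by (intro image_eqI[of _ _ "\<zero>\<^bsub>tensor B (regular B) \<Sigma>\<^esub>"]) simp_all
 next
  case (tens s u)
  then have "tens B ?H \<Sigma> s u = tmap B ?H \<Sigma> l (\<lambda>u. u) (tens B (regular B) \<Sigma> \<one>\<^sub>B (s u))" "s u \<in> carrier \<Sigma>"
   using move[OF tens] tl[of "\<one>\<^sub>B" "s u"] by (simp_all add: mem)
  then show ?case by (intro image_eqI[of _ _ "tens B (regular B) \<Sigma> \<one>\<^sub>B (s u)"]) simp_all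
 next
  case (add X Y)
  then obtain X' Y' where *: "X' \<in> carrier (tensor B (regular B) \<Sigma>)" "Y' \<in> carrier (tensor B (regular B) \<Sigma>)"
   "X = tmap B ?H \<Sigma> l (\<lambda>u. u) X'" "Y = tmap B ?H \<Sigma> l (\<lambda>u. u) Y'" by blast
  then have "X \<oplus>\<^bsub>tensor B ?H \<Sigma>\<^esub> Y = tmap B ?H \<Sigma> l (\<lambda>u. u) (X' \<oplus>\<^bsub>tensor B (regular B) \<Sigma>\<^esub> Y')"
   by (simp add: additive_add[OF al])
  then show ?case by (rule image_eqI) (rule PB.T.a_closed[OF *(1,2)])
 qed
 have "exact (tensor B (regular B) \<Sigma>) (tensor B ?H \<Sigma>) (tensor B ?H \<Sigma>) (tmap B ?H \<Sigma> l (\<lambda>u. u)) (tmap B ?H \<Sigma> (\<lambda>_. \<zero>\<^bsub>?H\<^esub>) (\<lambda>u. u))"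
  unfolding exact_def using surj z(2) additive_closed[OF al] by blast
 then have "exact (regular B) ?H ?H l (\<lambda>_. \<zero>\<^bsub>?H\<^esub>)"
  by (rule faithfully_flat_exact[OF ff RB.right_module_axioms _ PH.M.right_module_axioms sH PH.M.right_module_axioms sH ll z(1)[OF PH.T.zero_closed], THEN iffD2, rotated])
   (simp add: sizes)
 then have "t \<in> l ` carrier B" using t unfolding exact_def by (simp add: mem)
 then show ?thesis by (auto simp: l_def)
qed

lemma (in fgp_pair) can_iso_imp_trace_unital:
 assumes can: "can_iso TYPE('u) A B C \<Sigma> \<rho>" and inf: "infinite (UNIV :: 'u set)"
  and sizes: "carrier A \<lesssim> (UNIV :: 'u set)" "carrier B \<lesssim> (UNIV :: 'u set)" "carrier C \<lesssim> (UNIV :: 'u set)" "carrier \<Sigma> \<lesssim> (UNIV :: 'u set)"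
 shows trace_unital
proof -
 interpret G: galois_bicomodule A B C \<Sigma> \<rho>
  using can by (intro galois_bicomodule.intro galois_bicomodule_axioms.intro fgp_bicomodule_axioms) (simp add: can_iso_def)
 have ff: "faithfully_flat TYPE('u) B \<Sigma>" using can by (simp add: can_iso_def)
 interpret Csm: right_comodule A C Csm \<sigma> by (rule right_comodule_Csm)
 have "\<one>\<^sub>Cs \<in> carrier Csm" using C.Cs_one_closed by (simp add: C.Cs_simps)
 moreover have "carrier Csm \<lesssim> (UNIV :: 'u set)" using Cs_lepoll[OF inf sizes(1)] by simp
 ultimately obtain X where "X \<in> carrier (tensor B (comod_Hom_mod A C \<Sigma> \<rho> Csm \<sigma>) \<Sigma>)" "tlift Csm (\<lambda>h u. h u) X = \<one>\<^sub>Cs"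
  using G.counit_descent(1)[OF right_comodule_Csm ff inf sizes(3)] by blast
 then show ?thesis
  by (intro trace_unital_from_counit[OF right_comodule_Csm Csm.colinear_id] G.colinear_End_mult[OF ff inf sizes(2-4)])
qed

section \<open>Frobenius corings and the Morita context\<close>

theorem proposition6p1:
  fixes A :: "('a, 'y1) ring_scheme" and B :: "('b, 'y2) ring_scheme"
    and C :: "('a, 'c, 'z1) coring_scheme"
    and \<Sigma> :: "('b, 'a, 's, 'z2) bimod_scheme"
    and \<rho> :: "'s \<Rightarrow> ('s \<times> 'c \<Rightarrow>\<^sub>0 int) set"
  assumes "ring A" and "ring B" and "coring A C" and "fgp_bicomodule A B C \<Sigma> \<rho>"
    and "infinite (UNIV :: 'u set)"
    and "carrier A \<lesssim> (UNIV :: 'u set)" and "carrier B \<lesssim> (UNIV :: 'u set)"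
    and "carrier C \<lesssim> (UNIV :: 'u set)" and "carrier \<Sigma> \<lesssim> (UNIV :: 'u set)"
  shows "(frobenius_coring TYPE('u) A C \<longrightarrow>
            (\<exists>J. bimod_iso A B (dual A \<Sigma>) (Q_AB A C \<Sigma> \<rho>) J) \<and>
            (\<exists>z \<theta>. frobenius_system A C z \<theta>) \<and>
            (\<forall>z \<theta>. frobenius_system A C z \<theta> \<longrightarrow>
              morita_isomorphic (comodule_context A C \<Sigma> \<rho>) (frobenius_context A C \<Sigma> \<rho> z \<theta>))) \<and>
         (left_fgp A C \<and>
          (can_iso TYPE('u) A B C \<Sigma> \<rho> \<or> dual_progenerator TYPE('u) A B C \<Sigma> \<rho> \<or>
           strict_comodule_context A B C \<Sigma> \<rho> \<or> inverse_equivalences TYPE('u) A B C \<Sigma> \<rho>) \<and>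
          (\<exists>J. bimod_iso A B (dual A \<Sigma>) (Q_AB A C \<Sigma> \<rho>) J)
          \<longrightarrow> frobenius_coring TYPE('u) A C)"
proof -
 interpret fgp_bicomodule A B C \<Sigma> \<rho> by fact
 have fro: "frobenius A C z \<theta>" if "frobenius_system A C z \<theta>" for z \<theta>
  using that by (intro frobenius.intro frobenius_axioms.intro C.coring_axioms)
 have fwd: "\<exists>J. bimod_iso A B D QB J" "morita_isomorphic (comodule_context A C \<Sigma> \<rho>) (frobenius_context A C \<Sigma> \<rho> z \<theta>)"
  if "frobenius_system A C z \<theta>" for z \<theta>
 proof -
  interpret F: frobenius_fgp A B C \<Sigma> \<rho> z \<theta> by (intro frobenius_fgp.intro fgp_bicomodule_axioms fro[OF that])
  show "\<exists>J. bimod_iso A B D QB J" using F.bimod_iso_J by blast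
  show "morita_isomorphic (comodule_context A C \<Sigma> \<rho>) (frobenius_context A C \<Sigma> \<rho> z \<theta>)" by (rule F.frobenius_morita)
 qed
 have sys: "\<exists>z \<theta>. frobenius_system A C z \<theta>" if "frobenius_coring TYPE('u) A C"
  using C.frobenius_coring_imp_system[OF that assms(5,6,8)] by blast
 show ?thesis
 proof (intro conjI impI allI)
  show "\<exists>z \<theta>. frobenius_system A C z \<theta>" if "frobenius_coring TYPE('u) A C" by (rule sys[OF that])
  show "\<exists>J. bimod_iso A B D QB J" if "frobenius_coring TYPE('u) A C" using sys[OF that] fwd(1) by blast
  show "morita_isomorphic (comodule_context A C \<Sigma> \<rho>) (frobenius_context A C \<Sigma> \<rho> z \<theta>)"
   if "frobenius_system A C z \<theta>" for z \<theta> by (rule fwd(2)[OF that])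
 next
  assume *: "left_fgp A C \<and>
     (can_iso TYPE('u) A B C \<Sigma> \<rho> \<or> dual_progenerator TYPE('u) A B C \<Sigma> \<rho> \<or>
      strict_comodule_context A B C \<Sigma> \<rho> \<or> inverse_equivalences TYPE('u) A B C \<Sigma> \<rho>) \<and>
     (\<exists>J. bimod_iso A B D QB J)"
  then obtain J where J: "bimod_iso A B D QB J" by blast
  interpret fgp_pair A B C \<Sigma> \<rho>
   using * by (intro fgp_pair.intro fgp_coring.intro fgp_coring_axioms.intro fgp_bicomodule_axioms C.coring_axioms) blast
  have trace_unital
   using * can_iso_imp_trace_unital[OF _ assms(5-9)] dual_progenerator_imp_trace_unital[OF _ assms(7)]
    strict_imp_trace_unital inverse_equivalences_imp_trace_unital[OF _ assms(5-7)] by blast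
  then obtain z \<theta> where "frobenius_system A C z \<theta>" using trace_unital_imp_system[OF _ J] by blast
  then show "frobenius_coring TYPE('u) A C" by (rule frobenius.frobenius_coring[OF fro])
 qed
qed

end
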